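(* Let $C$ and $C'$ be row-finite, aperiodic, cofinal higher rank graphs with finitely many vertices (identities) and no sources, such that $\mathsf{B}(C)$ and $\mathsf{B}(C')$ are countably infinite. If $\mathscr{G}(C)\cong\mathscr{G}(C')$ as discrete groups, then $K_*(C^*(C))\cong K_*(C^*(C'))$.
   Context: Categories. $\mathbb{N}=\{0,1,2,\dots\}$. A category $C$ is regarded as a set of arrows, with the set of identities (vertices) $C_o\subseteq C$; each arrow $a$ has a domain $\mathbf{d}(a)\in C_o$ and codomain $\mathbf{r}(a)\in C_o$, and $ab$ is defined exactly when $\mathbf{d}(a)=\mathbf{r}(b)$. Put $aC=\{ac : ac \text{ defined}\}$ and $XC=\bigcup_{x\in X}xC$. Elements $a,b$ are independent if $aC\cap bC=\varnothing$, otherwise dependent. A subset $X\subseteq aC$ is large in $aC$ if every $b\in aC$ is dependent on some element of $X$. Higher rank graphs. A $k$-graph ($k\ge 1$) is a countable category $C$ with a functor $d\colon C\to\mathbb{N}^k$ (the degree) such that whenever $d(a)=\mathbf{m}+\mathbf{n}$ there are unique $a_1,a_2\in C$ with $a=a_1a_2$, $d(a_1)=\mathbf{m}$, $d(a_2)=\mathbf{n}$. A higher rank graph is a $k$-graph for some $k$. It has no sources if for each $e\in C_o$ and $\mathbf{m}\in\mathbb{N}^k$ there is $x\in C$ with $\mathbf{r}(x)=e$, $d(x)=\mathbf{m}$; it is row finite if for each $e\in C_o$ and $\mathbf{m}\in\mathbb{N}^k$ the set of $x\in eC$ with $d(x)=\mathbf{m}$ is finite. $C$ is aperiodic if for all $a\neq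 b$ in $C$ with $\mathbf{d}(a)=\mathbf{d}(b)$ there is $u\in C$ (with $au,bu$ defined) such that $au$ and $bu$ are independent. $C$ is cofinal if for all $e,f\in C_o$ there is a finite large subset $X$ of $fC$ such that for every $x\in X$ there is an arrow $a$ with $\mathbf{r}(a)=e$ and $\mathbf{d}(a)=\mathbf{d}(x)$. $\mathscr{G}(C)$ and $\mathsf{B}(C)$. A right ideal of $C$ is a (possibly empty) subset $R$ with $RC\subseteq R$; it is finitely generated if $R=XC$ with $X$ finite. A bijective morphism $\theta\colon R_1\to R_2$ of right ideals is a bijection with $\mathbf{d}(\theta(r))=\mathbf{d}(r)$ and $\theta(rc)=\theta(r)c$ whenever $rc$ is defined. $\mathsf{R}(C)$ is the inverse monoid of bijective morphisms between finitely generated right ideals under composition of partial bijections (zero: the empty function). In an inverse semigroup $S$ with zero, $a\le b$ means $a=ba^{-1}a$; a non-zero idempotent $e$ is essential if $ef\ne0$ for all non-zero idempotents $f$; $S^e$ is the inverse subsemigroup of $s\in S$ with $s^{-1}s$, $ss^{-1}$ essential; $s\,\sigma\,t$ iff some $z$ satisfies $z\le s,t$. Then $\mathscr{G}(C)=\mathsf{R}(C)^e/\sigma$. The Lenz congruence $\equiv$ is: $s\equiv t$ iff for each $0<x\le s$ there is a non-zero element below both $x$ and $t$, and for each $0<y\le t$ there is a non-zero element below both $y$ and $s$; $\mathsf{B}(C)=\mathsf{R}(C)/{\equiv}$. The $C^*$-algebra. $C^*(C)$ is the universal $C^*$-algebra generated by partial isometries $s_a$ ($a\in C$) such that the $s_e$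 ($e\in C_o$) are mutually orthogonal projections, $s_as_b=s_{ab}$ when $ab$ is defined, $s_a^*s_a=s_{\mathbf{d}(a)}$, and $s_e=\sum_{a\in eC,\ d(a)=\mathbf{n}}s_as_a^*$ for all $e\in C_o$, $\mathbf{n}\in\mathbb{N}^k$. $K_*=(K_0,K_1)$ is operator $K$-theory. *)

theory Defs
  imports
    "HOL-Analysis.Analysis"
    "HOL-Algebra.Ring"
    "HOL-Library.Poly_Mapping"
begin

section \<open>Categories and higher rank graphs\<close>

text \<open>A small category is a set of arrows, the objects being identified with the identity arrows.
  The composite \<open>cmp C a b\<close> (first \<open>b\<close>, then \<open>a\<close>) is meaningful only for arrows with
  \<open>src C a = tgt C b\<close>.\<close>

record 'a arrow_cat =
  arr :: "'a set"
  ids :: "'a set"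
  src :: "'a \<Rightarrow> 'a"
  tgt :: "'a \<Rightarrow> 'a"
  cmp :: "'a \<Rightarrow> 'a \<Rightarrow> 'a"

locale arrow_category =
  fixes C :: "('a, 'm) arrow_cat_scheme"
  assumes ids_subset: "ids C \<subseteq> arr C"
    and src_in_ids: "a \<in> arr C \<Longrightarrow> src C a \<in> ids C"
    and tgt_in_ids: "a \<in> arr C \<Longrightarrow> tgt C a \<in> ids C"
    and src_id: "e \<in> ids C \<Longrightarrow> src C e = e"
    and tgt_id: "e \<in> ids C \<Longrightarrow> tgt C e = e"
    and cmp_closed: "\<lbrakk>a \<in> arr C; b \<in> arr C; src C a = tgt C b\<rbrakk> \<Longrightarrow> cmp C a b \<in> arr C"
    and src_cmp: "\<lbrakk>a \<in> arr C; b \<in> arr C; src C a = tgt C b\<rbrakk> \<Longrightarrow> src C (cmp C a b) = src C b"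
    and tgt_cmp: "\<lbrakk>a \<in> arr C; b \<in> arr C; src C a = tgt C b\<rbrakk> \<Longrightarrow> tgt C (cmp C a b) = tgt C a"
    and cmp_src: "a \<in> arr C \<Longrightarrow> cmp C a (src C a) = a"
    and cmp_tgt: "a \<in> arr C \<Longrightarrow> cmp C (tgt C a) a = a"
    and cmp_assoc: "\<lbrakk>a \<in> arr C; b \<in> arr C; c \<in> arr C; src C a = tgt C b; src C b = tgt C c\<rbrakk>
      \<Longrightarrow> cmp C (cmp C a b) c = cmp C a (cmp C b c)"

definition ray :: "('a, 'm) arrow_cat_scheme \<Rightarrow> 'a \<Rightarrow> 'a set" where
  "ray C a = {cmp C a c | c. c \<in> arr C \<and> src C a = tgt C c}"

definition independent_arrows :: "('a, 'm) arrow_cat_scheme \<Rightarrow> 'a \<Rightarrow> 'a \<Rightarrow> bool" where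
  "independent_arrows C a b \<longleftrightarrow> ray C a \<inter> ray C b = {}"

definition large_in :: "('a, 'm) arrow_cat_scheme \<Rightarrow> 'a set \<Rightarrow> 'a \<Rightarrow> bool" where
  "large_in C X a \<longleftrightarrow>
    X \<subseteq> ray C a \<and> (\<forall>b\<in>ray C a. \<exists>x\<in>X. \<not> independent_arrows C b x)"

definition aperiodic :: "('a, 'm) arrow_cat_scheme \<Rightarrow> bool" where
  "aperiodic C \<longleftrightarrow>
    (\<forall>a\<in>arr C. \<forall>b\<in>arr C. a \<noteq> b \<and> src C a = src C b \<longrightarrow>
      (\<exists>u\<in>arr C. src C a = tgt C u \<and> independent_arrows C (cmp C a u) (cmp C b u)))"

definition cofinal_cat :: "('a, 'm) arrow_cat_scheme \<Rightarrow> bool" where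
  "cofinal_cat C \<longleftrightarrow>
    (\<forall>e\<in>ids C. \<forall>f\<in>ids C. \<exists>X. finite X \<and> large_in C X f \<and>
      (\<forall>x\<in>X. \<exists>a\<in>arr C. tgt C a = e \<and> src C a = src C x))"

text \<open>\<open>\<nat>\<^sup>k\<close> is \<open>nat ^ 'k\<close>, so that \<open>k = CARD('k) \<ge> 1\<close>.\<close>

record ('a, 'k::finite) kgraph = "'a arrow_cat" +
  deg :: "'a \<Rightarrow> nat ^ 'k"

locale higher_rank_graph = arrow_category C
  for C :: "('a, 'k::finite) kgraph" +
  assumes countable_arr: "countable (arr C)"
    and deg_id: "e \<in> ids C \<Longrightarrow> deg C e = 0"
    and deg_cmp: "\<lbrakk>a \<in> arr C; b \<in> arr C; src C a = tgt C b\<rbrakk>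
      \<Longrightarrow> deg C (cmp C a b) = deg C a + deg C b"
    and unique_factorization: "\<lbrakk>a \<in> arr C; deg C a = m + n\<rbrakk>
      \<Longrightarrow> \<exists>!(a\<^sub>1, a\<^sub>2). a\<^sub>1 \<in> arr C \<and> a\<^sub>2 \<in> arr C \<and> src C a\<^sub>1 = tgt C a\<^sub>2 \<and> a = cmp C a\<^sub>1 a\<^sub>2 \<and>
            deg C a\<^sub>1 = m \<and> deg C a\<^sub>2 = n"

definition no_sources :: "('a, 'k::finite) kgraph \<Rightarrow> bool" where
  "no_sources C \<longleftrightarrow> (\<forall>e\<in>ids C. \<forall>n. \<exists>x\<in>arr C. tgt C x = e \<and> deg C x = n)"

definition row_finite :: "('a, 'k::finite) kgraph \<Rightarrow> bool" where
  "row_finite C \<longleftrightarrow> (\<forall>e\<in>ids C. \<forall>n. finite {x \<in> ray C e. deg C x = n})"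


section \<open>Inverse semigroups with zero\<close>

text \<open>The following notions are applied to inverse monoids \<open>S\<close> with zero only; there
  the generalized inverse and the zero exist and are unique.\<close>

definition pinv :: "('s, 'm) monoid_scheme \<Rightarrow> 's \<Rightarrow> 's" where
  "pinv S a = (THE b. b \<in> carrier S \<and> a \<otimes>\<^bsub>S\<^esub> b \<otimes>\<^bsub>S\<^esub> a = a \<and> b \<otimes>\<^bsub>S\<^esub> a \<otimes>\<^bsub>S\<^esub> b = b)"

definition szero :: "('s, 'm) monoid_scheme \<Rightarrow> 's" where
  "szero S = (THE z. z \<in> carrier S \<and> (\<forall>a\<in>carrier S. z \<otimes>\<^bsub>S\<^esub> a = z \<and> a \<otimes>\<^bsub>S\<^esub> z = z))"

definition nat_le :: "('s, 'm) monoid_scheme \<Rightarrow> 's \<Rightarrow> 's \<Rightarrow> bool" where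
  "nat_le S a b \<longleftrightarrow>
    a \<in> carrier S \<and> b \<in> carrier S \<and> a = b \<otimes>\<^bsub>S\<^esub> pinv S a \<otimes>\<^bsub>S\<^esub> a"

definition idempotents :: "('s, 'm) monoid_scheme \<Rightarrow> 's set" where
  "idempotents S = {e \<in> carrier S. e \<otimes>\<^bsub>S\<^esub> e = e}"

definition essential_idem :: "('s, 'm) monoid_scheme \<Rightarrow> 's \<Rightarrow> bool" where
  "essential_idem S e \<longleftrightarrow>
    e \<in> idempotents S \<and> e \<noteq> szero S \<and>
    (\<forall>f\<in>idempotents S. f \<noteq> szero S \<longrightarrow> e \<otimes>\<^bsub>S\<^esub> f \<noteq> szero S)"

definition essential_part :: "('s, 'm) monoid_scheme \<Rightarrow> ('s, 'm) monoid_scheme" where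
  "essential_part S = S\<lparr>carrier :=
    {s \<in> carrier S. essential_idem S (pinv S s \<otimes>\<^bsub>S\<^esub> s) \<and> essential_idem S (s \<otimes>\<^bsub>S\<^esub> pinv S s)}\<rparr>"

definition sigma_cong :: "('s, 'm) monoid_scheme \<Rightarrow> ('s \<times> 's) set" where
  "sigma_cong S = {(s, t). s \<in> carrier S \<and> t \<in> carrier S \<and>
    (\<exists>z\<in>carrier S. nat_le S z s \<and> nat_le S z t)}"

definition lenz_cong :: "('s, 'm) monoid_scheme \<Rightarrow> ('s \<times> 's) set" where
  "lenz_cong S = {(s, t). s \<in> carrier S \<and> t \<in> carrier S \<and>
    (\<forall>x. x \<noteq> szero S \<and> nat_le S x s \<longrightarrow>
      (\<exists>z. z \<noteq> szero S \<and> nat_le S z x \<and> nat_le S z t)) \<and>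
    (\<forall>y. y \<noteq> szero S \<and> nat_le S y t \<longrightarrow>
      (\<exists>z. z \<noteq> szero S \<and> nat_le S z y \<and> nat_le S z s))}"

text \<open>The quotient of a monoid by a congruence \<open>r\<close>; every product of representatives has the
  same class, so that the union below is a single class.\<close>

definition quot_monoid :: "('s, 'm) monoid_scheme \<Rightarrow> ('s \<times> 's) set \<Rightarrow> 's set monoid" where
  "quot_monoid S r =
    \<lparr>carrier = carrier S // r,
     mult = (\<lambda>X Y. \<Union>x\<in>X. \<Union>y\<in>Y. r `` {x \<otimes>\<^bsub>S\<^esub> y}),
     one = r `` {\<one>\<^bsub>S\<^esub>}\<rparr>"


section \<open>The group and the Boolean inverse monoid of a category\<close>

definition right_ideal :: "('a, 'm) arrow_cat_scheme \<Rightarrow> 'a set \<Rightarrow> bool" where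
  "right_ideal C R \<longleftrightarrow> R \<subseteq> arr C \<and> (\<Union>x\<in>R. ray C x) \<subseteq> R"

definition fg_right_ideal :: "('a, 'm) arrow_cat_scheme \<Rightarrow> 'a set \<Rightarrow> bool" where
  "fg_right_ideal C R \<longleftrightarrow>
    right_ideal C R \<and> (\<exists>X. finite X \<and> X \<subseteq> arr C \<and> R = (\<Union>x\<in>X. ray C x))"

text \<open>A bijective morphism \<open>\<theta> : R\<^sub>1 \<rightarrow> R\<^sub>2\<close> is encoded as the partial function with domain \<open>R\<^sub>1\<close>
  and range \<open>R\<^sub>2\<close>.\<close>

definition ideal_iso :: "('a, 'm) arrow_cat_scheme \<Rightarrow> ('a \<rightharpoonup> 'a) \<Rightarrow> bool" where
  "ideal_iso C \<theta> \<longleftrightarrow>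
    fg_right_ideal C (dom \<theta>) \<and> fg_right_ideal C (ran \<theta>) \<and> inj_on \<theta> (dom \<theta>) \<and>
    (\<forall>r s. \<theta> r = Some s \<longrightarrow>
      src C s = src C r \<and>
      (\<forall>c\<in>arr C. src C r = tgt C c \<longrightarrow> \<theta> (cmp C r c) = Some (cmp C s c)))"

definition R_monoid :: "('a, 'm) arrow_cat_scheme \<Rightarrow> ('a \<rightharpoonup> 'a) monoid" where
  "R_monoid C =
    \<lparr>carrier = {\<theta>. ideal_iso C \<theta>}, mult = (\<circ>\<^sub>m), one = (\<lambda>a. if a \<in> arr C then Some a else None)\<rparr>"

definition G_group :: "('a, 'm) arrow_cat_scheme \<Rightarrow> ('a \<rightharpoonup> 'a) set monoid" where
  "G_group C =
    quot_monoid (essential_part (R_monoid C)) (sigma_cong (essential_part (R_monoid C)))"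

definition B_monoid :: "('a, 'm) arrow_cat_scheme \<Rightarrow> ('a \<rightharpoonup> 'a) set monoid" where
  "B_monoid C = quot_monoid (R_monoid C) (lenz_cong (R_monoid C))"


section \<open>The universal $C^*$-algebra of a higher rank graph\<close>

record 'x cstar_alg = "'x ring" +
  scale :: "complex \<Rightarrow> 'x \<Rightarrow> 'x"
  star :: "'x \<Rightarrow> 'x"
  cnorm :: "'x \<Rightarrow> real"

text \<open>Words in the letters \<open>s\<^sub>a\<close> (encoded as \<open>(a, False)\<close>) and \<open>s\<^sub>a\<^sup>*\<close> (encoded as \<open>(a, True)\<close>).
  With concatenation as (additive) monoid structure, the convolution product of \<open>\<Rightarrow>\<^sub>0\<close> makes
  \<open>'a star_word \<Rightarrow>\<^sub>0 complex\<close> the free complex unital *-algebra.\<close>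

datatype 'a star_word = Star_Word (letters: "('a \<times> bool) list")

instantiation star_word :: (type) monoid_add
begin

definition zero_star_word :: "'a star_word" where
  "0 = Star_Word []"

definition plus_star_word :: "'a star_word \<Rightarrow> 'a star_word \<Rightarrow> 'a star_word" where
  "u + v = Star_Word (letters u @ letters v)"

instance
  by standard (simp_all add: zero_star_word_def plus_star_word_def)

end

type_synonym 'a star_poly = "'a star_word \<Rightarrow>\<^sub>0 complex"

definition word_star :: "'a star_word \<Rightarrow> 'a star_word" where
  "word_star w = Star_Word (rev (map (\<lambda>(a, b). (a, \<not> b)) (letters w)))"

definition poly_star :: "'a star_poly \<Rightarrow> 'a star_poly" where
  "poly_star f =
    (\<Sum>w\<in>Poly_Mapping.keys f. Poly_Mapping.single (word_star w) (cnj (Poly_Mapping.lookup f w)))"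

definition poly_scale :: "complex \<Rightarrow> 'a star_poly \<Rightarrow> 'a star_poly" where
  "poly_scale c f = Poly_Mapping.single 0 c * f"

definition gen :: "'a \<Rightarrow> 'a star_poly" where
  "gen a = Poly_Mapping.single (Star_Word [(a, False)]) 1"

text \<open>The free non-unital *-algebra on the arrows: the empty word is excluded.\<close>

definition star_polys :: "('a, 'm) arrow_cat_scheme \<Rightarrow> 'a star_poly set" where
  "star_polys C =
    {f. \<forall>w\<in>Poly_Mapping.keys f. letters w \<noteq> [] \<and> fst ` set (letters w) \<subseteq> arr C}"

text \<open>The sums in the last family of relators are finite for row-finite graphs, the only ones
  considered here.\<close>

definition graph_relators :: "('a, 'k::finite) kgraph \<Rightarrow> 'a star_poly set" where
  "graph_relators C =
    {gen a * poly_star (gen a) * gen a - gen a | a. a \<in> arr C} \<union>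
    {gen e * gen e - gen e | e. e \<in> ids C} \<union>
    {poly_star (gen e) - gen e | e. e \<in> ids C} \<union>
    {gen e * gen f | e f. e \<in> ids C \<and> f \<in> ids C \<and> e \<noteq> f} \<union>
    {gen a * gen b - gen (cmp C a b) | a b. a \<in> arr C \<and> b \<in> arr C \<and> src C a = tgt C b} \<union>
    {poly_star (gen a) * gen a - gen (src C a) | a. a \<in> arr C} \<union>
    {gen e - (\<Sum>a\<in>{a \<in> ray C e. deg C a = n}. gen a * poly_star (gen a)) | e n. e \<in> ids C}"

definition cstar_seminorm :: "('a, 'm) arrow_cat_scheme \<Rightarrow> ('a star_poly \<Rightarrow> real) \<Rightarrow> bool" where
  "cstar_seminorm C p \<longleftrightarrow>
    (\<forall>x\<in>star_polys C. 0 \<le> p x \<and> p (poly_star x * x) = (p x)\<^sup>2 \<and> (\<forall>c. p (poly_scale c x) = cmod c * p x)) \<and>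
    (\<forall>x\<in>star_polys C. \<forall>y\<in>star_polys C. p (x + y) \<le> p x + p y \<and> p (x * y) \<le> p x * p y)"

text \<open>The $C^*$-seminorms that vanish on the relators are exactly the functions \<open>x \<mapsto> \<parallel>\<pi> x\<parallel>\<close> for
  \<open>\<pi>\<close> a *-homomorphism to a $C^*$-algebra under which the generators satisfy the relations.
  They are bounded pointwise (every partial isometry has norm at most 1), and the separated
  completion of the free *-algebra in the largest of them is the universal $C^*$-algebra.\<close>

definition univ_norm :: "('a, 'k::finite) kgraph \<Rightarrow> 'a star_poly \<Rightarrow> real" where
  "univ_norm C x =
    (SUP p \<in> {p. cstar_seminorm C p \<and> (\<forall>r\<in>graph_relators C. p r = 0)}. p x)"

definition cauchy_seqs :: "('a, 'k::finite) kgraph \<Rightarrow> (nat \<Rightarrow> 'a star_poly) set" where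
  "cauchy_seqs C = {f. (\<forall>n. f n \<in> star_polys C) \<and>
    (\<forall>\<epsilon>>0. \<exists>N. \<forall>m\<ge>N. \<forall>n\<ge>N. univ_norm C (f m - f n) < \<epsilon>)}"

definition null_rel :: "('a, 'k::finite) kgraph \<Rightarrow> ((nat \<Rightarrow> 'a star_poly) \<times> (nat \<Rightarrow> 'a star_poly)) set" where
  "null_rel C = {(f, g). f \<in> cauchy_seqs C \<and> g \<in> cauchy_seqs C \<and>
    (\<lambda>n. univ_norm C (f n - g n)) \<longlonglongrightarrow> 0}"

text \<open>The unit \<open>\<Sum>\<^sub>e s\<^sub>e\<close> is meaningful only if there are finitely many identities, which is the case
  in which the algebra is unital.\<close>

definition graph_algebra :: "('a, 'k::finite) kgraph \<Rightarrow> (nat \<Rightarrow> 'a star_poly) set cstar_alg" where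
  "graph_algebra C =
    \<lparr>carrier = cauchy_seqs C // null_rel C,
     mult = (\<lambda>X Y. \<Union>f\<in>X. \<Union>g\<in>Y. null_rel C `` {\<lambda>n. f n * g n}),
     one = null_rel C `` {\<lambda>n. \<Sum>e\<in>ids C. gen e},
     zero = null_rel C `` {\<lambda>n. 0},
     add = (\<lambda>X Y. \<Union>f\<in>X. \<Union>g\<in>Y. null_rel C `` {\<lambda>n. f n + g n}),
     scale = (\<lambda>c X. \<Union>f\<in>X. null_rel C `` {\<lambda>n. poly_scale c (f n)}),
     star = (\<lambda>X. \<Union>f\<in>X. null_rel C `` {\<lambda>n. poly_star (f n)}),
     cnorm = (\<lambda>X. lim (\<lambda>n. univ_norm C ((SOME f. f \<in> X) n)))\<rparr>"


section \<open>Operator K-theory of unital $C^*$-algebras\<close>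

text \<open>A rectangular matrix over \<open>A\<close> is a function of two indices (counted from 0) which is padded
  with \<open>\<zero>\<close> outside its format. An element of \<open>\<Union>\<^sub>n M\<^sub>n(A)\<close> (disjoint union) is a pair of the size
  and the matrix; the empty matrix of size 0 is allowed and serves as the neutral element for
  the block sum.\<close>

type_synonym 'x mtx = "nat \<Rightarrow> nat \<Rightarrow> 'x"

definition mtx_carrier :: "('x, 'm) cstar_alg_scheme \<Rightarrow> nat \<Rightarrow> nat \<Rightarrow> 'x mtx set" where
  "mtx_carrier A m n =
    {M. (\<forall>i j. i < m \<and> j < n \<longrightarrow> M i j \<in> carrier A) \<and> (\<forall>i j. \<not> (i < m \<and> j < n) \<longrightarrow> M i j = \<zero>\<^bsub>A\<^esub>)}"

text \<open>The product of matrices with inner dimension \<open>n\<close>.\<close>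

definition mtx_mult :: "('x, 'm) cstar_alg_scheme \<Rightarrow> nat \<Rightarrow> 'x mtx \<Rightarrow> 'x mtx \<Rightarrow> 'x mtx" where
  "mtx_mult A n M N = (\<lambda>i j. \<Oplus>\<^bsub>A\<^esub>k\<in>{..<n}. M i k \<otimes>\<^bsub>A\<^esub> N k j)"

definition mtx_star :: "('x, 'm) cstar_alg_scheme \<Rightarrow> 'x mtx \<Rightarrow> 'x mtx" where
  "mtx_star A M = (\<lambda>i j. star A (M j i))"

definition mtx_one :: "('x, 'm) cstar_alg_scheme \<Rightarrow> nat \<Rightarrow> 'x mtx" where
  "mtx_one A n = (\<lambda>i j. if i < n \<and> i = j then \<one>\<^bsub>A\<^esub> else \<zero>\<^bsub>A\<^esub>)"

fun block_sum :: "('x, 'm) cstar_alg_scheme \<Rightarrow> nat \<times> 'x mtx \<Rightarrow> nat \<times> 'x mtx \<Rightarrow> nat \<times> 'x mtx" where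
  "block_sum A (m, M) (n, N) =
    (m + n, \<lambda>i j. if i < m \<and> j < m then M i j
                  else if m \<le> i \<and> m \<le> j then N (i - m) (j - m)
                  else \<zero>\<^bsub>A\<^esub>)"

definition mtx_projections :: "('x, 'm) cstar_alg_scheme \<Rightarrow> (nat \<times> 'x mtx) set" where
  "mtx_projections A = {(n, p). p \<in> mtx_carrier A n n \<and> mtx_mult A n p p = p \<and> mtx_star A p = p}"

text \<open>Murray--von Neumann equivalence, by a rectangular partial isometry.\<close>

fun mvn_equiv :: "('x, 'm) cstar_alg_scheme \<Rightarrow> nat \<times> 'x mtx \<Rightarrow> nat \<times> 'x mtx \<Rightarrow> bool" where
  "mvn_equiv A (m, p) (n, q) \<longleftrightarrow>
    (\<exists>v\<in>mtx_carrier A n m. mtx_mult A n (mtx_star A v) v = p \<and> mtx_mult A m v (mtx_star A v) = q)"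

text \<open>\<open>K\<^sub>0(A)\<close> is the Grothendieck group of the monoid of classes of projections; the pair \<open>(p, q)\<close>
  stands for \<open>[p] - [q]\<close>.\<close>

definition K0_pairs :: "('x, 'm) cstar_alg_scheme \<Rightarrow> ((nat \<times> 'x mtx) \<times> (nat \<times> 'x mtx)) monoid" where
  "K0_pairs A =
    \<lparr>carrier = mtx_projections A \<times> mtx_projections A,
     mult = (\<lambda>(p, q) (p', q'). (block_sum A p p', block_sum A q q')),
     one = ((0, \<lambda>i j. \<zero>\<^bsub>A\<^esub>), (0, \<lambda>i j. \<zero>\<^bsub>A\<^esub>))\<rparr>"

definition K0_rel ::
  "('x, 'm) cstar_alg_scheme \<Rightarrow>
    (((nat \<times> 'x mtx) \<times> (nat \<times> 'x mtx)) \<times> ((nat \<times> 'x mtx) \<times> (nat \<times> 'x mtx))) set" where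
  "K0_rel A = {((p, q), (p', q')).
    {p, q, p', q'} \<subseteq> mtx_projections A \<and>
    (\<exists>r\<in>mtx_projections A.
      mvn_equiv A (block_sum A (block_sum A p q') r) (block_sum A (block_sum A p' q) r))}"

definition K0 :: "('x, 'm) cstar_alg_scheme \<Rightarrow> ((nat \<times> 'x mtx) \<times> (nat \<times> 'x mtx)) set monoid" where
  "K0 A = quot_monoid (K0_pairs A) (K0_rel A)"

definition mtx_unitaries :: "('x, 'm) cstar_alg_scheme \<Rightarrow> (nat \<times> 'x mtx) set" where
  "mtx_unitaries A = {(n, u). u \<in> mtx_carrier A n n \<and>
    mtx_mult A n (mtx_star A u) u = mtx_one A n \<and> mtx_mult A n u (mtx_star A u) = mtx_one A n}"

text \<open>Continuity of paths of matrices of a fixed size is expressed entrywise, which amounts to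
  continuity in the $C^*$-norm of \<open>M\<^sub>n(A)\<close>.\<close>

definition mtx_path_continuous :: "('x, 'm) cstar_alg_scheme \<Rightarrow> (real \<Rightarrow> 'x mtx) \<Rightarrow> bool" where
  "mtx_path_continuous A \<gamma> \<longleftrightarrow>
    (\<forall>i j. \<forall>t\<in>{0..1}. ((\<lambda>s. cnorm A (\<gamma> s i j \<ominus>\<^bsub>A\<^esub> \<gamma> t i j)) \<longlongrightarrow> 0) (at t within {0..1}))"

definition unitary_homotopic :: "('x, 'm) cstar_alg_scheme \<Rightarrow> nat \<times> 'x mtx \<Rightarrow> nat \<times> 'x mtx \<Rightarrow> bool" where
  "unitary_homotopic A u v \<longleftrightarrow>
    (\<exists>n \<gamma>. (\<forall>t\<in>{0..1}. (n, \<gamma> t) \<in> mtx_unitaries A) \<and> mtx_path_continuous A \<gamma> \<and>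
      u = (n, \<gamma> 0) \<and> v = (n, \<gamma> 1))"

text \<open>\<open>K\<^sub>1(A)\<close> consists of the homotopy classes of unitary matrices, where \<open>u\<close> is identified with
  \<open>u \<oplus> 1\<^sub>k\<close>.\<close>

definition unitary_monoid :: "('x, 'm) cstar_alg_scheme \<Rightarrow> (nat \<times> 'x mtx) monoid" where
  "unitary_monoid A =
    \<lparr>carrier = mtx_unitaries A, mult = block_sum A, one = (0, \<lambda>i j. \<zero>\<^bsub>A\<^esub>)\<rparr>"

definition K1_rel :: "('x, 'm) cstar_alg_scheme \<Rightarrow> ((nat \<times> 'x mtx) \<times> (nat \<times> 'x mtx)) set" where
  "K1_rel A = {(u, v). u \<in> mtx_unitaries A \<and> v \<in> mtx_unitaries A \<and>
    (\<exists>k l. unitary_homotopic A (block_sum A u (k, mtx_one A k)) (block_sum A v (l, mtx_one A l)))}"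

definition K1 :: "('x, 'm) cstar_alg_scheme \<Rightarrow> (nat \<times> 'x mtx) set monoid" where
  "K1 A = quot_monoid (unitary_monoid A) (K1_rel A)"

end

theory Submission
  imports Defs
begin

text \<open>Both \<open>G_group C\<close> and \<open>graph_algebra C\<close> are governed by the space \<open>X\<close> of infinite paths of \<open>C\<close>
  and the partial homeomorphisms \<open>b y \<mapsto> a y\<close> of \<open>X\<close>, for arrows \<open>a\<close>, \<open>b\<close> with the same source. The
  proof recovers \<open>X\<close> with these maps from the group, and then the algebra from \<open>X\<close>.

  \<^emph>\<open>From the graph to paths.\<close> For a row-finite graph with finitely many vertices and no sources, \<open>X\<close>
  is compact, and the cylinders (the paths with a given initial segment) are a base of clopen sets.
  The full group consists of the homeomorphisms of \<open>X\<close> which are of the form \<open>b y \<mapsto> a y\<close> near each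
  path. If \<open>C\<close> is aperiodic, then \<open>a\<close> is determined by \<open>b\<close> and the map, so that essential bijective
  morphisms of right ideals modulo \<open>\<sigma>\<close> are the same as elements of the full group (\<open>G_group_iso\<close>).
  The class of a morphism in \<open>B_monoid C\<close> depends only on the induced partial map of \<open>X\<close>, so that
  \<open>X\<close> is infinite if \<open>B_monoid C\<close> is (\<open>infinite_B_infinite_paths\<close>). If \<open>C\<close> is cofinal as well, then
  every non-empty clopen set contains a path with the same tail as any given one, no path is isolated,
  and the full group has many elements supported in any given clopen set.

  \<^emph>\<open>From the group to paths.\<close> This is the setting of Rubin's reconstruction theorem. Inclusion of the
  supports of two elements can be expressed by equations in the group (\<open>supp_subset_iff\<close>), and every
  clopen set is a support. Hence an isomorphism of full groups induces an isomorphism of the algebras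
  of clopen sets compatible with the actions (\<open>spatial_realization\<close>). By Stone duality it comes from
  a homeomorphism \<open>\<phi>\<close>, which conjugates the full groups; since every local map agrees near each path
  with an element of the full group (\<open>bisection_extends\<close>), \<open>\<phi>\<close> also conjugates the local maps
  (\<open>group_iso_path_conjugacy\<close>).

  \<^emph>\<open>From paths to the algebra.\<close> An injective local map \<open>h\<close> on a clopen set is given by finitely many
  pairs \<open>(a, b)\<close> as \<open>b y \<mapsto> a y\<close>, and \<open>\<Sum> s\<^sub>a s\<^sub>b\<^sup>*\<close> depends only on \<open>h\<close>, up to elements of norm zero.
  Composition, inversion and disjoint union of local maps become product, adjoint and sum. Therefore
  sending \<open>s\<^sub>a\<close> to the operator of the conjugate by \<open>\<phi>\<close> of \<open>y \<mapsto> a y\<close> defines a *-homomorphism of free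
  *-algebras under which the relators have norm zero. It is contractive for the universal norms, and
  the homomorphism obtained from \<open>\<phi>\<^sup>-\<^sup>1\<close> is its inverse up to norm zero, so that it is isometric
  (\<open>hom_universal_iso\<close>). It extends to an isomorphism of the completions, which induces isomorphisms
  on K-theory.

  The analytic ingredient is the relation \<open>s\<^sub>b\<^sup>* s\<^sub>c = 0\<close> for different arrows \<open>b\<close>, \<open>c\<close> of the same degree:
  projections whose sum is a projection are orthogonal. It is deduced for an arbitrary $C^*$-seminorm
  from the $C^*$-identity alone, through the extremality of projections in the unit ball
  (\<open>unit_extreme\<close>).\<close>

section \<open>Reconstructing an algebra of sets from a group of permutations\<close>

definition fixes_outside :: "'p set \<Rightarrow> ('p \<Rightarrow> 'p) \<Rightarrow> bool" where
  "fixes_outside a g \<longleftrightarrow> (\<forall>x. x \<notin> a \<longrightarrow> g x = x)"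

lemma fixes_outside_mono: "fixes_outside a g \<Longrightarrow> a \<subseteq> b \<Longrightarrow> fixes_outside b g"
  unfolding fixes_outside_def by blast

lemma fixes_outside_maps:
  assumes "fixes_outside a g" "inj g"
  shows "g x \<in> a \<longleftrightarrow> x \<in> a"
  using assms unfolding fixes_outside_def by (metis injD)

lemma fixes_outside_commute:
  assumes "fixes_outside a g" "fixes_outside b h" "inj g" "inj h" "a \<inter> b = {}"
  shows "g \<circ> h = h \<circ> g"
proof
  fix x
  consider "x \<in> a" | "x \<in> b" | "x \<notin> a" "x \<notin> b" by blast
  then show "(g \<circ> h) x = (h \<circ> g) x"
  proof cases
    case 1
    then have "g x \<in> a" using fixes_outside_maps assms(1,3) by metis
    then have "x \<notin> b" "g x \<notin> b" using 1 assms(5) by auto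
    then show ?thesis using assms(2) unfolding fixes_outside_def by simp
  next
    case 2
    then have "h x \<in> b" using fixes_outside_maps assms(2,4) by metis
    then have "x \<notin> a" "h x \<notin> a" using 2 assms(5) by auto
    then show ?thesis using assms(1) unfolding fixes_outside_def by simp
  next
    case 3
    then show ?thesis using assms(1,2) unfolding fixes_outside_def by simp
  qed
qed

text \<open>Rubin's algebraic disjointness: every \<open>h\<close> that does not commute with \<open>f\<close> admits \<open>f1\<close>, \<open>f2\<close> commuting
  with \<open>g\<close> such that \<open>k = [f1, [f2, h]]\<close> is not trivial and commutes with \<open>g\<close>. The commutators
  \<open>w = [f2, h]\<close> and \<open>k\<close> are characterized by equations between products, which group isomorphisms
  visibly preserve.\<close>

definition alg_disjoint :: "('p \<Rightarrow> 'p) set \<Rightarrow> ('p \<Rightarrow> 'p) \<Rightarrow> ('p \<Rightarrow> 'p) \<Rightarrow> bool" where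
  "alg_disjoint G g f \<longleftrightarrow> (\<forall>h\<in>G. f \<circ> h \<noteq> h \<circ> f \<longrightarrow>
    (\<exists>f1\<in>G. \<exists>f2\<in>G. \<exists>w\<in>G. \<exists>k\<in>G. f1 \<circ> g = g \<circ> f1 \<and> f2 \<circ> g = g \<circ> f2 \<and> k \<circ> g = g \<circ> k \<and>
      w \<circ> h \<circ> f2 = f2 \<circ> h \<and> k \<circ> w \<circ> f1 = f1 \<circ> w \<and> k \<noteq> id))"

text \<open>By the last clause \<open>g\<close> moves points in every non-empty part of \<open>s\<close>, so that \<open>s\<close> is the least member of
  \<open>A\<close> outside which \<open>g\<close> is the identity.\<close>

definition is_support :: "'p set set \<Rightarrow> ('p \<Rightarrow> 'p) \<Rightarrow> 'p set \<Rightarrow> bool" where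
  "is_support A g s \<longleftrightarrow> s \<in> A \<and> fixes_outside s g \<and> (\<forall>b\<in>A. b \<noteq> {} \<and> b \<subseteq> s \<longrightarrow> (\<exists>x\<in>b. g x \<noteq> x))"

text \<open>The model is a full group acting on the clopen sets of a compact space. The exponent 12 is the
  least common multiple of 1, 2, 3, 4: a point that \<open>g ^^ 12\<close> moves is also moved by \<open>g\<close>, \<open>g ^^ 2\<close>,
  \<open>g ^^ 3\<close> and \<open>g ^^ 4\<close>, as the counting of orbit points in \<open>alg_disjoint_moves\<close> demands.\<close>

locale rubin_action =
  fixes X :: "'p set" and A :: "'p set set" and G :: "('p \<Rightarrow> 'p) set"
  assumes A_subset: "a \<in> A \<Longrightarrow> a \<subseteq> X"
    and A_inter: "a \<in> A \<Longrightarrow> b \<in> A \<Longrightarrow> a \<inter> b \<in> A"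
    and A_diff: "a \<in> A \<Longrightarrow> b \<in> A \<Longrightarrow> a - b \<in> A"
    and A_separates: "x \<in> X \<Longrightarrow> y \<in> X \<Longrightarrow> x \<noteq> y \<Longrightarrow> \<exists>a\<in>A. x \<in> a \<and> y \<notin> a"
    and G_bij: "g \<in> G \<Longrightarrow> bij g"
    and G_maps: "g \<in> G \<Longrightarrow> x \<in> X \<Longrightarrow> g x \<in> X"
    and G_id: "id \<in> G"
    and G_comp: "g \<in> G \<Longrightarrow> h \<in> G \<Longrightarrow> g \<circ> h \<in> G"
    and G_inv: "g \<in> G \<Longrightarrow> inv_into UNIV g \<in> G"
    and G_image: "g \<in> G \<Longrightarrow> a \<in> A \<Longrightarrow> g ` a \<in> A"
    and G_support: "g \<in> G \<Longrightarrow> \<exists>s. is_support A g s"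
    and G_rich: "a \<in> A \<Longrightarrow> a \<noteq> {} \<Longrightarrow> \<exists>g\<in>G. fixes_outside a g \<and> g ^^ 12 \<noteq> id"
    and G_full: "a \<in> A \<Longrightarrow> \<exists>g\<in>G. is_support A g a"
begin

lemma G_inj: "g \<in> G \<Longrightarrow> inj g"
  using G_bij bij_is_inj by blast

lemma G_power: "g \<in> G \<Longrightarrow> g ^^ n \<in> G"
  by (induction n) (simp_all add: G_id[unfolded id_def] G_id G_comp)

lemma G_inv_apply: "g \<in> G \<Longrightarrow> inv_into UNIV g (g x) = x" "g \<in> G \<Longrightarrow> g (inv_into UNIV g x) = x"
  using G_bij by (simp_all add: bij_is_inj bij_is_surj surj_f_inv_f)

definition supp :: "('p \<Rightarrow> 'p) \<Rightarrow> 'p set" where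
  "supp g = (THE s. is_support A g s)"

lemma support_least:
  assumes "is_support A g s" "fixes_outside b g" "b \<in> A"
  shows "s \<subseteq> b"
proof (rule ccontr)
  assume "\<not> s \<subseteq> b"
  moreover have "s - b \<in> A" using assms A_diff unfolding is_support_def by simp
  ultimately obtain x where "x \<in> s - b" "g x \<noteq> x"
    using assms(1) unfolding is_support_def by (metis Diff_eq_empty_iff Diff_subset)
  then show False using assms(2) unfolding fixes_outside_def by blast
qed

lemma supp_eq: "is_support A g s \<Longrightarrow> supp g = s"
  unfolding supp_def
proof (rule the_equality)
  fix t assume "is_support A g s" "is_support A g t"
  then show "t = s" using support_least[of g s t] support_least[of g t s] unfolding is_support_def by simp
qed

lemma supp_is_support: "g \<in> G \<Longrightarrow> is_support A g (supp g)"
  using G_support supp_eq by metis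

lemma suppD:
  assumes "g \<in> G"
  shows "supp g \<in> A" "fixes_outside (supp g) g" "b \<in> A \<Longrightarrow> b \<noteq> {} \<Longrightarrow> b \<subseteq> supp g \<Longrightarrow> \<exists>x\<in>b. g x \<noteq> x"
  using supp_is_support[OF assms] unfolding is_support_def by auto

text \<open>Take \<open>u\<close> in \<open>A\<close> that contains \<open>x\<close> but not \<open>g x\<close>, and cut away the points that \<open>g\<close> maps into \<open>u\<close>.\<close>

lemma displace:
  assumes "g \<in> G" "x \<in> X" "g x \<noteq> x"
  obtains a where "a \<in> A" "x \<in> a" "g ` a \<inter> a = {}"
proof -
  obtain u where u: "u \<in> A" "x \<in> u" "g x \<notin> u" using A_separates G_maps assms by metis
  let ?a = "u - inv_into UNIV g ` u"
  have "?a \<in> A" using u A_diff G_image G_inv assms(1) by blast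
  moreover have "x \<notin> inv_into UNIV g ` u"
  proof
    assume "x \<in> inv_into UNIV g ` u"
    then obtain v where "v \<in> u" "x = inv_into UNIV g v" by blast
    then show False using u G_inv_apply(2)[OF assms(1)] by metis
  qed
  moreover have "g ` ?a \<inter> ?a = {}"
  proof -
    have "y \<in> inv_into UNIV g ` u" if "g y \<in> u" for y
      using that G_inv_apply(1)[OF assms(1), of y] by (metis imageI)
    then show ?thesis by blast
  qed
  ultimately show ?thesis using that u by blast
qed

lemma nontrivial_inside:
  assumes "a \<in> A" "a \<noteq> {}"
  obtains g x where "g \<in> G" "fixes_outside a g" "x \<in> a" "g x \<noteq> x"
proof -
  obtain g where g: "g \<in> G" "fixes_outside a g" "g ^^ 12 \<noteq> id" using G_rich assms by blast
  have "g \<noteq> id" using g(3) by (metis id_funpow)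
  then obtain x where "g x \<noteq> x" by (metis eq_id_iff)
  moreover from this have "x \<in> a" using g unfolding fixes_outside_def by blast
  ultimately show ?thesis using that g by blast
qed

lemma not_commute:
  assumes "u \<inter> h ` u = {}" "fixes_outside u g" "z \<in> u" "g z \<noteq> z" "inj h"
  shows "h (g z) \<noteq> g (h z)"
proof -
  have "g (h z) = h z" using assms unfolding fixes_outside_def by blast
  then show ?thesis using assms(4,5) injD by metis
qed

text \<open>If \<open>h\<close> does not commute with \<open>f\<close>, it moves a point of the support of \<open>f\<close>, hence displaces some \<open>a\<close>
  inside this support. Choose \<open>f1\<close>, \<open>f2\<close> supported in \<open>a\<close> that do not commute. Then \<open>[f2, h]\<close> is the
  product of \<open>f2\<close> and a map \<open>d\<close> supported in \<open>h ` a\<close>, which commutes with \<open>f1\<close>; so \<open>[f1, [f2, h]]\<close> is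
  \<open>[f1, f2]\<close>, supported in \<open>a\<close> and therefore commuting with \<open>g\<close>.\<close>

lemma disjoint_alg_disjoint:
  assumes g: "g \<in> G" "fixes_outside b g" and f: "f \<in> G" and disj: "b \<inter> supp f = {}"
  shows "alg_disjoint G g f"
  unfolding alg_disjoint_def
proof (intro ballI impI)
  fix h assume h: "h \<in> G" "f \<circ> h \<noteq> h \<circ> f"
  note fs = suppD[OF f]
  have "\<exists>x\<in>supp f. h x \<noteq> x"
  proof (rule ccontr)
    assume "\<not> (\<exists>x\<in>supp f. h x \<noteq> x)"
    then have "fixes_outside (- supp f) h" unfolding fixes_outside_def by blast
    then show False using fixes_outside_commute[OF fs(2), of "- supp f" h] h G_inj f by blast
  qed
  then obtain x where x: "x \<in> supp f" "h x \<noteq> x" by blast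
  obtain a0 where a0: "a0 \<in> A" "x \<in> a0" "h ` a0 \<inter> a0 = {}"
    using displace[OF h(1)] x A_subset fs(1) by blast
  define a where "a = a0 \<inter> supp f"
  have a: "a \<in> A" "x \<in> a" "h ` a \<inter> a = {}" "a \<subseteq> supp f"
    unfolding a_def using A_inter a0 x fs(1) by blast+
  obtain f1 y where f1: "f1 \<in> G" "fixes_outside a f1" "y \<in> a" "f1 y \<noteq> y"
    using nontrivial_inside[of a] a by blast
  obtain c0 where c0: "c0 \<in> A" "y \<in> c0" "f1 ` c0 \<inter> c0 = {}"
    using displace[OF f1(1) _ f1(4)] f1(3) A_subset a by blast
  define c where "c = c0 \<inter> a"
  have c: "c \<in> A" "y \<in> c" "c \<inter> f1 ` c = {}" "c \<subseteq> a" unfolding c_def using A_inter a c0 f1 by blast+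
  obtain f2 z where f2: "f2 \<in> G" "fixes_outside c f2" "z \<in> c" "f2 z \<noteq> z"
    using nontrivial_inside[of c] c by blast
  have f2a: "fixes_outside a f2" using f2 c fixes_outside_mono by blast
  let ?i = "inv_into UNIV"
  \<comment> \<open>\<open>w = [f2, h]\<close>, and \<open>k = [f1, f2]\<close> turns out to be \<open>[f1, w]\<close>.\<close>
  define d where "d = h \<circ> ?i f2 \<circ> ?i h"
  define w where "w = f2 \<circ> d"
  define k where "k = f1 \<circ> f2 \<circ> ?i f1 \<circ> ?i f2"
  have G: "d \<in> G" "w \<in> G" "k \<in> G" unfolding d_def w_def k_def using G_comp G_inv h f1 f2 by auto
  have d_out: "fixes_outside (h ` a) d"
    unfolding fixes_outside_def d_def
  proof (intro allI impI)
    fix x assume "x \<notin> h ` a"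
    then have "?i h x \<notin> a" using G_inv_apply(2)[OF h(1), of x] by (metis imageI)
    then have "f2 (?i h x) = ?i h x" using f2a unfolding fixes_outside_def by blast
    then have "?i f2 (?i h x) = ?i h x" using G_inv_apply(1)[OF f2(1)] by metis
    then show "(h \<circ> ?i f2 \<circ> ?i h) x = x" using G_inv_apply(2)[OF h(1)] by simp
  qed
  have "f1 \<circ> d = d \<circ> f1"
    by (rule fixes_outside_commute[OF f1(2) d_out]) (use a G G_inj f1 in auto)
  then have f1d: "d (f1 x) = f1 (d x)" for x by (metis comp_apply)
  have comm: "p \<circ> g = g \<circ> p" if "p \<in> G" "fixes_outside a p" for p
    by (rule fixes_outside_commute[OF that(2) g(2)]) (use that g a disj G_inj in auto)
  have "w \<circ> h \<circ> f2 = f2 \<circ> h"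
    unfolding w_def d_def by (simp add: fun_eq_iff G_inv_apply[OF h(1)] G_inv_apply[OF f2(1)])
  moreover have "k \<circ> w \<circ> f1 = f1 \<circ> w"
    unfolding w_def k_def by (simp add: fun_eq_iff G_inv_apply[OF f1(1)] G_inv_apply[OF f2(1)] f1d)
  moreover have "k \<noteq> id"
  proof
    assume "k = id"
    then have "k (f2 (f1 z)) = f2 (f1 z)" by simp
    then have "f1 (f2 z) = f2 (f1 z)"
      unfolding k_def by (simp add: G_inv_apply[OF f1(1)] G_inv_apply[OF f2(1)])
    then show False using not_commute[OF c(3) f2(2-4) G_inj[OF f1(1)]] by simp
  qed
  moreover have "f1 \<circ> g = g \<circ> f1" "f2 \<circ> g = g \<circ> f2" using comm f1 f2 f2a by auto
  moreover have "k \<circ> g = g \<circ> k"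
  proof (rule comm[OF G(3)])
    have "?i p x = x" if "p \<in> G" "fixes_outside a p" "x \<notin> a" for p x
      using that G_inv_apply(1)[OF that(1), of x] unfolding fixes_outside_def by simp
    then show "fixes_outside a k"
      unfolding k_def using f1 f2 f2a unfolding fixes_outside_def by simp
  qed
  ultimately show "\<exists>f1\<in>G. \<exists>f2\<in>G. \<exists>w\<in>G. \<exists>k\<in>G. f1 \<circ> g = g \<circ> f1 \<and> f2 \<circ> g = g \<circ> f2 \<and>
      k \<circ> g = g \<circ> k \<and> w \<circ> h \<circ> f2 = f2 \<circ> h \<and> k \<circ> w \<circ> f1 = f1 \<circ> w \<and> k \<noteq> id"
    using f1 f2 G by blast
qed

lemma power_fixed_multiple:
  fixes g :: "'p \<Rightarrow> 'p"
  assumes "(g ^^ m) x = x"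
  shows "(g ^^ (n * m)) x = x"
  using assms by (induction n) (simp_all add: funpow_add)

text \<open>Suppose that \<open>g ^^ 12\<close> moves \<open>x\<close> as well. Choose \<open>u\<close> around \<open>x\<close> that is displaced by \<open>f\<close> and by
  \<open>g, \<dots>, g ^^ 4\<close>, and \<open>h\<close> supported in \<open>u\<close> that does not commute with \<open>f\<close>. The commutator \<open>k\<close>
  provided by algebraic disjointness is supported in the union of the four sets \<open>p ` u\<close>, for
  \<open>p \<in> {id, f1, f2, f1 \<circ> f2}\<close>. If \<open>k\<close> moves \<open>y\<close>, it moves the five points \<open>y, g y, \<dots>, (g ^^ 4) y\<close>,
  because it commutes with \<open>g\<close>. Two of them lie in the same \<open>p ` u\<close>; as \<open>p\<close> commutes with \<open>g\<close>, some
  \<open>g ^^ m\<close> with \<open>1 \<le> m \<le> 4\<close> maps a point of \<open>u\<close> into \<open>u\<close>.\<close>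

lemma alg_disjoint_moves:
  assumes g: "g \<in> G" and f: "f \<in> G" and ad: "alg_disjoint G g f"
    and x: "x \<in> X" "f x \<noteq> x"
  shows "(g ^^ 12) x = x"
proof (rule ccontr)
  assume g12: "(g ^^ 12) x \<noteq> x"
  have nofix: "(g ^^ m) x \<noteq> x" if m: "m \<in> {1..4}" for m
  proof
    assume *: "(g ^^ m) x = x"
    have "m = 1 \<or> m = 2 \<or> m = 3 \<or> m = 4" using m by auto
    then have "12 = (12 div m) * m" by auto
    then show False using power_fixed_multiple[OF *, of "12 div m"] g12 by simp
  qed
  obtain a where a: "a \<in> A" "x \<in> a" "f ` a \<inter> a = {}" using displace[OF f x] .
  have "\<exists>b. b \<in> A \<and> x \<in> b \<and> (g ^^ m) ` b \<inter> b = {}" if m: "m \<in> {1..4}" for m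
    using displace[OF G_power[OF g] x(1) nofix[OF m]] by metis
  then obtain b where b: "\<And>m. m \<in> {1..4} \<Longrightarrow> b m \<in> A \<and> x \<in> b m \<and> (g ^^ m) ` b m \<inter> b m = {}"
    by metis
  define u where "u = a \<inter> (b 1 \<inter> (b 2 \<inter> (b 3 \<inter> b 4)))"
  have u: "u \<in> A" "x \<in> u" unfolding u_def using a b by (intro A_inter | simp)+
  have uf: "u \<inter> f ` u = {}" using a unfolding u_def by blast
  have ug: "(g ^^ m) v \<notin> u" if m: "m \<in> {1..4}" "v \<in> u" for m v
  proof -
    have "m = 1 \<or> m = 2 \<or> m = 3 \<or> m = 4" using m by auto
    then have "u \<subseteq> b m" unfolding u_def by blast
    then show ?thesis using b[OF m(1)] m(2) by blast
  qed
  obtain h z where h: "h \<in> G" "fixes_outside u h" "z \<in> u" "h z \<noteq> z" using nontrivial_inside[of u] u by blast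
  have fh: "f \<circ> h \<noteq> h \<circ> f" using not_commute[OF uf h(2-4) G_inj[OF f]] by (metis comp_apply)
  then obtain f1 f2 w k where k: "f1 \<in> G" "f2 \<in> G" "w \<in> G" "k \<in> G" "f1 \<circ> g = g \<circ> f1" "f2 \<circ> g = g \<circ> f2"
    "k \<circ> g = g \<circ> k" "w \<circ> h \<circ> f2 = f2 \<circ> h" "k \<circ> w \<circ> f1 = f1 \<circ> w" "k \<noteq> id"
    using ad[unfolded alg_disjoint_def, rule_format, OF h(1) fh] by (elim bexE conjE) (rule that)
  \<comment> \<open>\<open>[f2, h]\<close> is the product of a conjugate of \<open>h\<close> by \<open>f2\<close> and the inverse of \<open>h\<close>.\<close>
  have w_out: "w y = y" if "y \<notin> u \<union> f2 ` u" for y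
  proof -
    obtain v where v: "y = f2 v" using G_bij[OF k(2)] by (meson bij_pointE)
    then have "v \<notin> u" using that by blast
    then have "h v = v" "h y = y" using h(2) that unfolding fixes_outside_def by auto
    then show ?thesis using fun_cong[OF k(8), of v] v by simp
  qed
  have k_out: "k y = y" if "y \<notin> u \<union> f2 ` u \<union> f1 ` (u \<union> f2 ` u)" for y
  proof -
    obtain v where v: "y = f1 v" using G_bij[OF k(1)] by (meson bij_pointE)
    then have "v \<notin> u \<union> f2 ` u" using that by blast
    then have "w v = v" "w y = y" using w_out that by auto
    then show ?thesis using fun_cong[OF k(9), of v] v by simp
  qed
  let ?P = "{id, f1, f2, f1 \<circ> f2}"
  have P_comm: "p ((g ^^ m) v) = (g ^^ m) (p v)" if "p \<in> ?P" for p m v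
  proof -
    have c: "f1 (g v) = g (f1 v)" "f2 (g v) = g (f2 v)" for v
      using k(5,6) by (metis comp_apply)+
    have "p (g v) = g (p v)" for v using that c by auto
    then show ?thesis by (induction m) simp_all
  qed
  have k_comm: "k ((g ^^ m) v) = (g ^^ m) (k v)" for m v
    using k(7) by (induction m) (simp_all, metis comp_apply)
  obtain y where y: "k y \<noteq> y" using k(10) by (metis eq_id_iff)
  have "\<exists>p\<in>?P. (g ^^ j) y \<in> p ` u" for j
  proof -
    have "k ((g ^^ j) y) \<noteq> (g ^^ j) y" using y k_comm G_inj[OF G_power[OF g, of j]] by (metis injD)
    then have "(g ^^ j) y \<in> u \<union> f2 ` u \<union> f1 ` (u \<union> f2 ` u)" using k_out by blast
    then show ?thesis by (auto simp: image_comp image_Un)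
  qed
  then obtain p where p: "\<And>j. p j \<in> ?P" "\<And>j. (g ^^ j) y \<in> p j ` u" by metis
  have "\<not> inj_on p {0..4::nat}"
  proof
    assume "inj_on p {0..4::nat}"
    then have "card {0..4::nat} \<le> card ?P" by (rule card_inj_on_le) (use p in auto)
    also have "card ?P \<le> 4"
      using card_length[of "[id, f1, f2, f1 \<circ> f2]"] by simp
    finally show False by simp
  qed
  then obtain i j where ij: "i < j" "j \<le> 4" "p i = p j"
    unfolding inj_on_def by (metis atLeastAtMost_iff linorder_neqE_nat)
  obtain v v' where v: "v \<in> u" "(g ^^ i) y = p i v" "v' \<in> u" "(g ^^ j) y = p i v'"
    using p(2)[of i] p(2)[of j] ij(3) by auto
  have "(g ^^ j) y = (g ^^ (j - i)) ((g ^^ i) y)" using ij funpow_add[of "j - i" i g] by simp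
  then have "p i v' = p i ((g ^^ (j - i)) v)" using v P_comm[OF p(1)] by simp
  moreover have "inj (p i)" using p(1)[of i] k(1,2) G_inj G_comp by auto
  ultimately have "v' = (g ^^ (j - i)) v" by (metis injD)
  moreover have "j - i \<in> {1..4}" using ij by auto
  ultimately show False using ug v by blast
qed

lemma alg_disjoint_supports:
  assumes g: "g \<in> G" and f: "f \<in> G" and ad: "alg_disjoint G g f"
  shows "supp (g ^^ 12) \<inter> supp f = {}"
proof (rule ccontr)
  note gs = suppD[OF G_power[OF g, of 12]] and fs = suppD[OF f]
  let ?b = "supp (g ^^ 12) \<inter> supp f"
  assume "?b \<noteq> {}"
  then obtain x where x: "x \<in> ?b" "f x \<noteq> x" using fs(3)[OF A_inter[OF gs(1) fs(1)]] by blast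
  obtain a where a: "a \<in> A" "x \<in> a" "f ` a \<inter> a = {}"
    using displace[OF f _ x(2)] x A_subset fs by blast
  have "a \<inter> ?b \<in> A" "a \<inter> ?b \<noteq> {}" "a \<inter> ?b \<subseteq> supp (g ^^ 12)"
    using A_inter[OF a(1) A_inter[OF gs(1) fs(1)]] a x by auto
  then obtain y where y: "y \<in> a \<inter> ?b" "(g ^^ 12) y \<noteq> y" using gs(3) by blast
  then have "f y \<noteq> y" "y \<in> X" using a A_subset by auto
  then show False using alg_disjoint_moves[OF g f ad] y by blast
qed

text \<open>The inclusion of supports becomes a property of the abstract group: \<open>supp h \<subseteq> supp f\<close> iff \<open>h\<close>
  centralizes the twelfth powers of the elements algebraically disjoint from \<open>f\<close>. If \<open>h\<close> moves points
  outside \<open>supp f\<close>, it displaces a set there, which carries some \<open>g\<close> whose twelfth power is not trivial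
  and hence does not commute with \<open>h\<close>.\<close>

lemma supp_subset_iff:
  assumes h: "h \<in> G" and f: "f \<in> G"
  shows "supp h \<subseteq> supp f \<longleftrightarrow> (\<forall>g\<in>G. alg_disjoint G g f \<longrightarrow> h \<circ> (g ^^ 12) = (g ^^ 12) \<circ> h)"
proof
  assume "supp h \<subseteq> supp f"
  then show "\<forall>g\<in>G. alg_disjoint G g f \<longrightarrow> h \<circ> (g ^^ 12) = (g ^^ 12) \<circ> h"
  proof (intro ballI impI)
    fix g assume g: "g \<in> G" "alg_disjoint G g f"
    have "supp h \<inter> supp (g ^^ 12) = {}"
      using alg_disjoint_supports[OF g(1) f g(2)] \<open>supp h \<subseteq> supp f\<close> by blast
    then show "h \<circ> (g ^^ 12) = (g ^^ 12) \<circ> h"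
      using fixes_outside_commute suppD(2) G_inj h G_power[OF g(1)] by metis
  qed
next
  assume R: "\<forall>g\<in>G. alg_disjoint G g f \<longrightarrow> h \<circ> (g ^^ 12) = (g ^^ 12) \<circ> h"
  show "supp h \<subseteq> supp f"
  proof (rule ccontr)
    note hs = suppD[OF h] and fs = suppD[OF f]
    assume "\<not> supp h \<subseteq> supp f"
    then obtain x where x: "x \<in> supp h - supp f" "h x \<noteq> x"
      using hs(3)[OF A_diff[OF hs(1) fs(1)]] by blast
    obtain a where a: "a \<in> A" "x \<in> a" "h ` a \<inter> a = {}"
      using displace[OF h _ x(2)] x A_subset hs by blast
    let ?u = "a \<inter> (supp h - supp f)"
    have "?u \<in> A" "?u \<noteq> {}" using A_inter[OF a(1) A_diff[OF hs(1) fs(1)]] a(2) x by auto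
    then obtain g where g: "g \<in> G" "fixes_outside ?u g" "g ^^ 12 \<noteq> id" using G_rich by blast
    have "alg_disjoint G g f" by (rule disjoint_alg_disjoint[OF g(1,2) f]) blast
    then have hg: "h \<circ> (g ^^ 12) = (g ^^ 12) \<circ> h" using R g by blast
    have out: "fixes_outside ?u (g ^^ m)" for m
      using g(2) unfolding fixes_outside_def by (induction m) auto
    obtain z where z: "(g ^^ 12) z \<noteq> z" using g(3) by (metis eq_id_iff)
    then have "z \<in> ?u" using out unfolding fixes_outside_def by blast
    moreover have disj: "?u \<inter> h ` ?u = {}" using a(3) by blast
    ultimately have "h ((g ^^ 12) z) \<noteq> (g ^^ 12) (h z)"
      by (intro not_commute[OF disj out _ z G_inj[OF h]])
    then show False using fun_cong[OF hg, of z] by simp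
  qed
qed

lemma supp_conjugate:
  assumes "g \<in> G" "f \<in> G"
  shows "supp (g \<circ> f \<circ> inv_into UNIV g) = g ` supp f"
proof (rule supp_eq)
  note fs = suppD[OF assms(2)] and gi = G_inv_apply[OF assms(1)]
  show "is_support A (g \<circ> f \<circ> inv_into UNIV g) (g ` supp f)"
    unfolding is_support_def
  proof (intro conjI ballI impI)
    show "g ` supp f \<in> A" using G_image assms fs by blast
    show "fixes_outside (g ` supp f) (g \<circ> f \<circ> inv_into UNIV g)"
      unfolding fixes_outside_def
    proof (intro allI impI)
      fix x assume "x \<notin> g ` supp f"
      then have "inv_into UNIV g x \<notin> supp f" using gi(2)[of x] by (metis imageI)
      then show "(g \<circ> f \<circ> inv_into UNIV g) x = x" using fs(2) gi unfolding fixes_outside_def by simp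
    qed
    fix b assume b: "b \<in> A" "b \<noteq> {} \<and> b \<subseteq> g ` supp f"
    let ?c = "inv_into UNIV g ` b"
    have "?c \<in> A" "?c \<noteq> {}" "?c \<subseteq> supp f" using G_image[OF G_inv[OF assms(1)]] b gi by auto
    then obtain x where x: "x \<in> ?c" "f x \<noteq> x" using fs(3) by blast
    then obtain y where y: "y \<in> b" "x = inv_into UNIV g y" by blast
    then have "(g \<circ> f \<circ> inv_into UNIV g) y \<noteq> y" using x gi by (metis comp_apply)
    then show "\<exists>x\<in>b. (g \<circ> f \<circ> inv_into UNIV g) x \<noteq> x" using y by blast
  qed
qed

end

locale rubin_iso = rubin_action X A G + T: rubin_action X' A' G'
  for X :: "'p set" and A G and X' :: "'q set" and A' G' +
  fixes \<alpha> :: "('p \<Rightarrow> 'p) \<Rightarrow> ('q \<Rightarrow> 'q)"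
  assumes \<alpha>_bij: "bij_betw \<alpha> G G'"
    and \<alpha>_comp: "g \<in> G \<Longrightarrow> h \<in> G \<Longrightarrow> \<alpha> (g \<circ> h) = \<alpha> g \<circ> \<alpha> h"
begin

lemma \<alpha>_in: "g \<in> G \<Longrightarrow> \<alpha> g \<in> G'"
  using \<alpha>_bij bij_betwE by blast

lemma \<alpha>_eq: "g \<in> G \<Longrightarrow> h \<in> G \<Longrightarrow> \<alpha> g = \<alpha> h \<longleftrightarrow> g = h"
  using \<alpha>_bij by (metis bij_betw_def inj_onD)

lemma \<alpha>_surj: "h \<in> G' \<Longrightarrow> \<exists>g\<in>G. h = \<alpha> g"
  using \<alpha>_bij by (metis bij_betw_def imageE)

lemma \<alpha>_id: "\<alpha> id = id"
proof -
  have "\<alpha> id \<circ> \<alpha> id = \<alpha> id" using \<alpha>_comp[OF G_id G_id] by simp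
  then have "\<alpha> id (\<alpha> id x) = \<alpha> id x" for x by (metis comp_apply)
  then show ?thesis using injD[OF T.G_inj[OF \<alpha>_in[OF G_id]]] by (simp add: fun_eq_iff)
qed

lemma \<alpha>_inv:
  assumes "g \<in> G"
  shows "\<alpha> (inv_into UNIV g) = inv_into UNIV (\<alpha> g)"
proof
  fix x
  have "g \<circ> inv_into UNIV g = id" using G_inv_apply[OF assms] by (simp add: fun_eq_iff)
  then have "\<alpha> g \<circ> \<alpha> (inv_into UNIV g) = id" using \<alpha>_comp[OF assms G_inv[OF assms]] \<alpha>_id by simp
  then have "\<alpha> g (\<alpha> (inv_into UNIV g) x) = x" by (metis comp_apply id_apply)
  then show "\<alpha> (inv_into UNIV g) x = inv_into UNIV (\<alpha> g) x"
    using T.G_inv_apply(1)[OF \<alpha>_in[OF assms]] by metis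
qed

lemma \<alpha>_power: "g \<in> G \<Longrightarrow> \<alpha> (g ^^ n) = \<alpha> g ^^ n"
  by (induction n) (simp_all add: \<alpha>_id[unfolded id_def] \<alpha>_id \<alpha>_comp G_power)

lemma \<alpha>_comp_eq:
  "g \<in> G \<Longrightarrow> h \<in> G \<Longrightarrow> p \<in> G \<Longrightarrow> q \<in> G \<Longrightarrow> \<alpha> g \<circ> \<alpha> h = \<alpha> p \<circ> \<alpha> q \<longleftrightarrow> g \<circ> h = p \<circ> q"
  using \<alpha>_comp \<alpha>_eq G_comp by metis

lemma \<alpha>_alg_disjoint:
  assumes "g \<in> G" "f \<in> G" "alg_disjoint G g f"
  shows "alg_disjoint G' (\<alpha> g) (\<alpha> f)"
  unfolding alg_disjoint_def
proof (intro ballI impI)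
  fix h' assume h': "h' \<in> G'" "\<alpha> f \<circ> h' \<noteq> h' \<circ> \<alpha> f"
  obtain h where h: "h \<in> G" "h' = \<alpha> h" using \<alpha>_surj h' by blast
  then have fh: "f \<circ> h \<noteq> h \<circ> f" using h'(2) \<alpha>_comp_eq assms by metis
  obtain f1 f2 w k where k: "f1 \<in> G" "f2 \<in> G" "w \<in> G" "k \<in> G" "f1 \<circ> g = g \<circ> f1" "f2 \<circ> g = g \<circ> f2"
    "k \<circ> g = g \<circ> k" "w \<circ> h \<circ> f2 = f2 \<circ> h" "k \<circ> w \<circ> f1 = f1 \<circ> w" "k \<noteq> id"
    using assms(3)[unfolded alg_disjoint_def, rule_format, OF h(1) fh] by (elim bexE conjE) (rule that)
  have "\<alpha> k \<noteq> id" using k \<alpha>_eq[OF _ G_id] \<alpha>_id by metis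
  moreover have "\<alpha> w \<circ> h' \<circ> \<alpha> f2 = \<alpha> f2 \<circ> h'" "\<alpha> k \<circ> \<alpha> w \<circ> \<alpha> f1 = \<alpha> f1 \<circ> \<alpha> w"
    using k h \<alpha>_comp G_comp by metis+
  moreover have "\<alpha> f1 \<circ> \<alpha> g = \<alpha> g \<circ> \<alpha> f1" "\<alpha> f2 \<circ> \<alpha> g = \<alpha> g \<circ> \<alpha> f2" "\<alpha> k \<circ> \<alpha> g = \<alpha> g \<circ> \<alpha> k"
    using k assms(1) \<alpha>_comp_eq by auto
  ultimately show "\<exists>f1\<in>G'. \<exists>f2\<in>G'. \<exists>w\<in>G'. \<exists>k\<in>G'. f1 \<circ> \<alpha> g = \<alpha> g \<circ> f1 \<and> f2 \<circ> \<alpha> g = \<alpha> g \<circ> f2 \<and>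
      k \<circ> \<alpha> g = \<alpha> g \<circ> k \<and> w \<circ> h' \<circ> f2 = f2 \<circ> h' \<and> k \<circ> w \<circ> f1 = f1 \<circ> w \<and> k \<noteq> id"
    using \<alpha>_in k(1-4) by blast
qed

text \<open>The right side of \<open>supp_subset_iff\<close> is stated in terms of the group only. One implication suffices
  here, since the other one is this lemma for the inverse isomorphism.\<close>

lemma \<alpha>_supp_mono:
  assumes "g \<in> G" "f \<in> G" "T.supp (\<alpha> g) \<subseteq> T.supp (\<alpha> f)"
  shows "supp g \<subseteq> supp f"
  unfolding supp_subset_iff[OF assms(1,2)]
proof (intro ballI impI)
  fix q assume q: "q \<in> G" "alg_disjoint G q f"
  then have "\<alpha> g \<circ> (\<alpha> q ^^ 12) = (\<alpha> q ^^ 12) \<circ> \<alpha> g"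
    using assms(3) \<alpha>_alg_disjoint assms(1,2)
    unfolding T.supp_subset_iff[OF \<alpha>_in[OF assms(1)] \<alpha>_in[OF assms(2)]] using \<alpha>_in by blast
  then have "\<alpha> g \<circ> \<alpha> (q ^^ 12) = \<alpha> (q ^^ 12) \<circ> \<alpha> g" using \<alpha>_power q by simp
  then show "g \<circ> q ^^ 12 = q ^^ 12 \<circ> g" using \<alpha>_comp_eq assms q G_power by blast
qed

lemma inverse_iso: "rubin_iso X' A' G' X A G (inv_into G \<alpha>)"
proof (unfold_locales)
  show "bij_betw (inv_into G \<alpha>) G' G" using \<alpha>_bij by (rule bij_betw_inv_into)
  show "inv_into G \<alpha> (g \<circ> h) = inv_into G \<alpha> g \<circ> inv_into G \<alpha> h" if gh': "g \<in> G'" "h \<in> G'" for g h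
  proof -
    obtain g0 h0 where gh: "g0 \<in> G" "g = \<alpha> g0" "h0 \<in> G" "h = \<alpha> h0"
      using \<alpha>_surj[OF gh'(1)] \<alpha>_surj[OF gh'(2)] by blast
    moreover from this have "g \<circ> h = \<alpha> (g0 \<circ> h0)" using \<alpha>_comp by simp
    ultimately show ?thesis using G_comp \<alpha>_bij by (simp add: bij_betw_inv_into_left)
  qed
qed

lemma \<alpha>_supp_iff:
  assumes "g \<in> G" "f \<in> G"
  shows "T.supp (\<alpha> g) \<subseteq> T.supp (\<alpha> f) \<longleftrightarrow> supp g \<subseteq> supp f"
proof
  interpret I: rubin_iso X' A' G' X A G "inv_into G \<alpha>" by (rule inverse_iso)
  assume "supp g \<subseteq> supp f"
  moreover have "inv_into G \<alpha> (\<alpha> g) = g" "inv_into G \<alpha> (\<alpha> f) = f"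
    using \<alpha>_bij assms by (simp_all add: bij_betw_inv_into_left)
  ultimately show "T.supp (\<alpha> g) \<subseteq> T.supp (\<alpha> f)"
    using I.\<alpha>_supp_mono[OF \<alpha>_in[OF assms(1)] \<alpha>_in[OF assms(2)]] by simp
qed (rule \<alpha>_supp_mono[OF assms])

text \<open>Every member of \<open>A\<close> is a support, and \<open>\<theta>\<close> sends \<open>supp g\<close> to the support of \<open>\<alpha> g\<close>. It is equivariant
  because conjugation of \<open>f\<close> by \<open>g\<close> moves the support of \<open>f\<close> by \<open>g\<close>.\<close>

theorem spatial_realization:
  obtains \<theta> where "bij_betw \<theta> A A'" "\<And>a b. a \<in> A \<Longrightarrow> b \<in> A \<Longrightarrow> \<theta> a \<subseteq> \<theta> b \<longleftrightarrow> a \<subseteq> b"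
    "\<And>g a. g \<in> G \<Longrightarrow> a \<in> A \<Longrightarrow> \<theta> (g ` a) = \<alpha> g ` \<theta> a"
proof -
  obtain el where el: "\<And>a. a \<in> A \<Longrightarrow> el a \<in> G \<and> supp (el a) = a" using G_full supp_eq by metis
  define \<theta> where "\<theta> a = T.supp (\<alpha> (el a))" for a
  have \<theta>_supp: "\<theta> (supp g) = T.supp (\<alpha> g)" if "g \<in> G" for g
  proof -
    have "el (supp g) \<in> G" "supp (el (supp g)) = supp g" using el suppD(1)[OF that] by auto
    then show ?thesis unfolding \<theta>_def using \<alpha>_supp_iff that by (metis order_refl subset_antisym)
  qed
  have iff: "\<theta> a \<subseteq> \<theta> b \<longleftrightarrow> a \<subseteq> b" if "a \<in> A" "b \<in> A" for a b
    unfolding \<theta>_def using \<alpha>_supp_iff el that by metis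
  have "bij_betw \<theta> A A'"
    unfolding bij_betw_def
  proof
    show "inj_on \<theta> A" by (rule inj_onI) (metis iff order_refl subset_antisym)
    show "\<theta> ` A = A'"
    proof
      show "\<theta> ` A \<subseteq> A'" unfolding \<theta>_def using T.suppD(1) \<alpha>_in el by blast
      show "A' \<subseteq> \<theta> ` A"
      proof
        fix a' assume "a' \<in> A'"
        then obtain h where "h \<in> G'" "T.supp h = a'" using T.G_full T.supp_eq by metis
        then obtain g where "g \<in> G" "T.supp (\<alpha> g) = a'" using \<alpha>_surj by blast
        then show "a' \<in> \<theta> ` A" using \<theta>_supp suppD(1) by blast
      qed
    qed
  qed
  moreover have "\<theta> (g ` a) = \<alpha> g ` \<theta> a" if "g \<in> G" "a \<in> A" for g a
  proof -
    note e = el[OF that(2)]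
    have "g ` a = supp (g \<circ> el a \<circ> inv_into UNIV g)" using supp_conjugate that e by simp
    then have "\<theta> (g ` a) = T.supp (\<alpha> (g \<circ> el a \<circ> inv_into UNIV g))"
      using \<theta>_supp G_comp G_inv that e by simp
    also have "\<dots> = T.supp (\<alpha> g \<circ> \<alpha> (el a) \<circ> inv_into UNIV (\<alpha> g))"
      using \<alpha>_comp \<alpha>_inv G_comp G_inv that e by simp
    also have "\<dots> = \<alpha> g ` \<theta> a" unfolding \<theta>_def using T.supp_conjugate \<alpha>_in that e by simp
    finally show ?thesis .
  qed
  ultimately show ?thesis using that iff by blast
qed

end

section \<open>Infinite paths in a higher rank graph\<close>

context higher_rank_graph
begin

definition composable :: "'a \<Rightarrow> 'a \<Rightarrow> bool" where
  "composable a b \<longleftrightarrow> a \<in> arr C \<and> b \<in> arr C \<and> src C a = tgt C b"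

definition prefix :: "'a \<Rightarrow> 'a \<Rightarrow> bool" (infix \<open>\<preceq>\<close> 50) where
  "b \<preceq> a \<longleftrightarrow> (\<exists>c. composable b c \<and> a = cmp C b c)"

lemma composableD:
  assumes "composable a b"
  shows "a \<in> arr C" "b \<in> arr C" "src C a = tgt C b" "cmp C a b \<in> arr C"
    "src C (cmp C a b) = src C b" "tgt C (cmp C a b) = tgt C a"
    "deg C (cmp C a b) = deg C a + deg C b"
  using assms unfolding composable_def
  by (simp_all add: cmp_closed src_cmp tgt_cmp deg_cmp)

lemma composable_assoc:
  assumes "composable a b" "composable b c"
  shows "composable (cmp C a b) c" "composable a (cmp C b c)"
    "cmp C (cmp C a b) c = cmp C a (cmp C b c)"
  using assms composableD[OF assms(1)] composableD[OF assms(2)]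
  unfolding composable_def by (simp_all add: cmp_assoc)

lemma composable_assoc_left_iff:
  assumes "composable a b"
  shows "composable (cmp C a b) c \<longleftrightarrow> composable b c"
  using assms composableD[OF assms] unfolding composable_def by auto

lemma composable_src: "a \<in> arr C \<Longrightarrow> composable a (src C a)"
  unfolding composable_def using src_in_ids ids_subset tgt_id by auto

lemma composable_tgt: "a \<in> arr C \<Longrightarrow> composable (tgt C a) a"
  unfolding composable_def using tgt_in_ids ids_subset src_id by auto

lemma ray_prefix_iff: "a \<in> arr C \<Longrightarrow> x \<in> ray C a \<longleftrightarrow> a \<preceq> x"
  unfolding ray_def prefix_def composable_def by auto

lemma prefixD:
  assumes "b \<preceq> a"
  shows "b \<in> arr C" "a \<in> arr C" "tgt C b = tgt C a"
  using assms composableD unfolding prefix_def by (metis)+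

lemma prefix_refl: "a \<in> arr C \<Longrightarrow> a \<preceq> a"
  unfolding prefix_def using composable_src cmp_src by metis

lemma prefix_cmp: "composable a b \<Longrightarrow> a \<preceq> cmp C a b"
  unfolding prefix_def by blast

lemma prefix_trans: "a \<preceq> b \<Longrightarrow> b \<preceq> c \<Longrightarrow> a \<preceq> c"
  unfolding prefix_def by (metis composable_assoc(2,3) composable_assoc_left_iff)

lemma prefix_cmp_mono: "composable a b \<Longrightarrow> b \<preceq> c \<Longrightarrow> cmp C a b \<preceq> cmp C a c"
  unfolding prefix_def by (metis composable_assoc(1,3))

lemma tgt_prefix: "a \<in> arr C \<Longrightarrow> tgt C a \<preceq> a"
  unfolding prefix_def using composable_tgt cmp_tgt by metis

lemma factorization_unique:
  assumes "composable a b" "composable a' b'" "cmp C a b = cmp C a' b'" "deg C a = deg C a'"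
  shows "a = a'" "b = b'"
proof -
  have d: "deg C b = deg C b'"
    using composableD(7)[OF assms(1)] composableD(7)[OF assms(2)] assms(3,4) by simp
  define P where "P = (\<lambda>(a\<^sub>1, a\<^sub>2). a\<^sub>1 \<in> arr C \<and> a\<^sub>2 \<in> arr C \<and> src C a\<^sub>1 = tgt C a\<^sub>2 \<and>
      cmp C a b = cmp C a\<^sub>1 a\<^sub>2 \<and> deg C a\<^sub>1 = deg C a \<and> deg C a\<^sub>2 = deg C b)"
  have "\<exists>!p. P p"
    unfolding P_def by (rule unique_factorization) (use composableD[OF assms(1)] in auto)
  moreover have "P (a, b)" "P (a', b')"
    unfolding P_def using assms d by (auto simp: composable_def)
  ultimately have "(a, b) = (a', b')" by blast
  then show "a = a'" "b = b'" by auto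
qed

lemma factorization_exists:
  assumes "a \<in> arr C" "deg C a = m + n"
  obtains b c where "composable b c" "a = cmp C b c" "deg C b = m" "deg C c = n"
  using unique_factorization[OF assms] unfolding composable_def by auto

lemma left_cancel: "composable a b \<Longrightarrow> composable a b' \<Longrightarrow> cmp C a b = cmp C a b' \<Longrightarrow> b = b'"
  using factorization_unique by blast

lemma right_cancel: "composable a b \<Longrightarrow> composable a' b \<Longrightarrow> cmp C a b = cmp C a' b \<Longrightarrow> a = a'"
  using factorization_unique(1) composableD(7) by (metis add_right_cancel)

lemma degree_zero_id:
  assumes "a \<in> arr C" "deg C a = 0"
  shows "tgt C a = a" "a \<in> ids C"
proof -
  have "deg C (tgt C a) = 0" using assms deg_id tgt_in_ids by auto
  then show "tgt C a = a"
    using factorization_unique(1)[OF composable_tgt composable_src, of a a] assms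
    by (simp add: cmp_src cmp_tgt)
  then show "a \<in> ids C" using tgt_in_ids assms(1) by metis
qed

lemma prefix_unique: "b \<preceq> a \<Longrightarrow> b' \<preceq> a \<Longrightarrow> deg C b = deg C b' \<Longrightarrow> b = b'"
  unfolding prefix_def using factorization_unique(1) by metis

lemma prefix_of_degree:
  assumes "a \<in> arr C" "deg C a = m + n"
  obtains b where "b \<preceq> a" "deg C b = m"
  using factorization_exists[OF assms] unfolding prefix_def by metis

text \<open>Factorize \<open>c\<close> at the degree of \<open>b\<close>: by unique factorization of \<open>a\<close> the first factor is \<open>b\<close>.\<close>

lemma prefix_compare:
  assumes "b \<preceq> a" "c \<preceq> a" "deg C c = deg C b + n"
  shows "b \<preceq> c"
proof -
  obtain b' where "b' \<preceq> c" "deg C b' = deg C b"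
    using prefix_of_degree[OF prefixD(1)[OF assms(2)] assms(3)] .
  with prefix_unique[OF assms(1)] prefix_trans[OF _ assms(2)] show ?thesis by metis
qed

lemma prefix_left_cancel:
  assumes "composable a b" "composable a c" "cmp C a b \<preceq> cmp C a c"
  shows "b \<preceq> c"
proof -
  obtain w where w: "composable (cmp C a b) w" "cmp C a c = cmp C (cmp C a b) w"
    using assms(3) unfolding prefix_def by auto
  then have bw: "composable b w" using composable_assoc_left_iff assms(1) by blast
  then have "c = cmp C b w"
    using left_cancel[OF assms(2)] composable_assoc[OF assms(1) bw] w by metis
  with bw show ?thesis unfolding prefix_def by blast
qed

lemma common_extension_dependent:
  assumes "a \<in> arr C" "b \<in> arr C"
  shows "\<not> independent_arrows C a b \<longleftrightarrow> (\<exists>c. a \<preceq> c \<and> b \<preceq> c)"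
  unfolding independent_arrows_def using ray_prefix_iff assms by blast

text \<open>An infinite path is encoded as the set of its finite initial segments, one of each degree. It
  amounts to a degree preserving functor to \<open>C\<close> from the category of pairs \<open>m \<le> n\<close> in \<open>\<nat>\<^sup>k\<close>.\<close>

definition paths :: "'a set set" where
  "paths = {x. x \<subseteq> arr C \<and> (\<forall>n. \<exists>!a. a \<in> x \<and> deg C a = n) \<and> (\<forall>a\<in>x. \<forall>b. b \<preceq> a \<longrightarrow> b \<in> x)}"

definition cyl :: "'a \<Rightarrow> 'a set set" where
  "cyl a = {x \<in> paths. a \<in> x}"

text \<open>The path \<open>a y\<close>, obtained by putting \<open>a\<close> in front of \<open>y\<close>.\<close>

definition shift :: "'a \<Rightarrow> 'a set \<Rightarrow> 'a set" where
  "shift a y = {b. \<exists>c\<in>y. composable a c \<and> b \<preceq> cmp C a c}"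

lemma path_prefix_closed: "x \<in> paths \<Longrightarrow> a \<in> x \<Longrightarrow> b \<preceq> a \<Longrightarrow> b \<in> x"
  unfolding paths_def by blast

lemma path_arr: "x \<in> paths \<Longrightarrow> a \<in> x \<Longrightarrow> a \<in> arr C"
  unfolding paths_def by blast

lemma path_degree_ex: "x \<in> paths \<Longrightarrow> \<exists>a\<in>x. deg C a = n"
  unfolding paths_def by blast

lemma path_degree_unique: "x \<in> paths \<Longrightarrow> a \<in> x \<Longrightarrow> b \<in> x \<Longrightarrow> deg C a = deg C b \<Longrightarrow> a = b"
  unfolding paths_def by blast

lemma path_directed:
  assumes "x \<in> paths" "a \<in> x" "b \<in> x"
  obtains c where "c \<in> x" "a \<preceq> c" "b \<preceq> c"
proof -
  obtain c where c: "c \<in> x" "deg C c = deg C a + deg C b" using path_degree_ex[OF assms(1)] by blast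
  have ca: "c \<in> arr C" using c path_arr assms by auto
  obtain a' where a': "a' \<preceq> c" "deg C a' = deg C a" using prefix_of_degree[OF ca c(2)] .
  obtain b' where b': "b' \<preceq> c" "deg C b' = deg C b"
    using prefix_of_degree[OF ca, of "deg C b" "deg C a"] c(2) by (metis add.commute)
  have "a' = a" "b' = b"
    using path_degree_unique[OF assms(1)] path_prefix_closed[OF assms(1) c(1)] a' b' assms by auto
  with a' b' c that show ?thesis by auto
qed

lemma path_tgt:
  assumes "x \<in> paths" "a \<in> x"
  shows "tgt C a \<in> x"
  using path_prefix_closed[OF assms tgt_prefix] path_arr[OF assms] by blast

lemma path_tgt_eq: "x \<in> paths \<Longrightarrow> a \<in> x \<Longrightarrow> b \<in> x \<Longrightarrow> tgt C a = tgt C b"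
  by (metis path_directed prefixD(3))

lemma cylD: "x \<in> cyl a \<Longrightarrow> x \<in> paths" "x \<in> cyl a \<Longrightarrow> a \<in> x" "x \<in> cyl a \<Longrightarrow> a \<in> arr C"
  using path_arr by (auto simp: cyl_def)

lemma cyl_mono: "a \<preceq> b \<Longrightarrow> cyl b \<subseteq> cyl a"
  unfolding cyl_def using path_prefix_closed by blast

lemma path_composable:
  assumes "y \<in> cyl (src C a)" "a \<in> arr C" "c \<in> y"
  shows "composable a c"
  unfolding composable_def
  using assms path_tgt_eq[of y "src C a" c] cylD[OF assms(1)] path_arr[of y c] src_in_ids tgt_id
  by auto

text \<open>A directed set of arrows of unbounded degree that is closed under prefixes is a path: it has an
  element of each given degree by cutting a longer one, and only one because two of them are prefixes
  of a common arrow.\<close>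

lemma path_of_degrees:
  assumes sub: "x \<subseteq> arr C" and ex: "\<And>n. \<exists>a\<in>x. \<exists>k. deg C a = n + k"
    and dir: "\<And>a b. a \<in> x \<Longrightarrow> b \<in> x \<Longrightarrow> \<exists>c. a \<preceq> c \<and> b \<preceq> c"
    and down: "\<And>a b. a \<in> x \<Longrightarrow> b \<preceq> a \<Longrightarrow> b \<in> x"
  shows "x \<in> paths"
proof -
  have "\<exists>!a. a \<in> x \<and> deg C a = n" for n
  proof -
    obtain a k where a: "a \<in> x" "deg C a = n + k" using ex by blast
    then obtain b where "b \<preceq> a" "deg C b = n"
      using prefix_of_degree[of a n k] sub by blast
    then have "b \<in> x \<and> deg C b = n" using down[OF a(1)] by blast
    then show ?thesis
    proof (rule ex1I)
      fix c assume c: "c \<in> x \<and> deg C c = n"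
      then obtain d where "b \<preceq> d" "c \<preceq> d" using dir \<open>b \<in> x \<and> deg C b = n\<close> by blast
      then show "c = b" using prefix_unique c \<open>b \<in> x \<and> deg C b = n\<close> by metis
    qed
  qed
  moreover have "\<forall>a\<in>x. \<forall>b. b \<preceq> a \<longrightarrow> b \<in> x" using down by simp
  ultimately show ?thesis unfolding paths_def using sub by simp
qed

lemma shift_path:
  assumes "y \<in> cyl (src C a)" "a \<in> arr C"
  shows "shift a y \<in> paths"
proof (rule path_of_degrees)
  note y = cylD(1,2)[OF assms(1)]
  note cmpa = path_composable[OF assms]
  show "shift a y \<subseteq> arr C" unfolding shift_def using prefixD by blast
  show "\<exists>b\<in>shift a y. \<exists>k. deg C b = n + k" for n
  proof -
    obtain c where c: "c \<in> y" "deg C c = n" using path_degree_ex y by blast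
    then have "cmp C a c \<in> shift a y"
      unfolding shift_def using c(1) cmpa[OF c(1)] prefix_refl[OF composableD(4)[OF cmpa[OF c(1)]]] by blast
    moreover have "deg C (cmp C a c) = n + deg C a"
      using composableD(7)[OF cmpa[OF c(1)]] c by (simp add: add.commute)
    ultimately show ?thesis by blast
  qed
  show "\<exists>d. b \<preceq> d \<and> b' \<preceq> d" if bb: "b \<in> shift a y" "b' \<in> shift a y" for b b'
  proof -
    obtain c c' where c: "c \<in> y" "c' \<in> y" "b \<preceq> cmp C a c" "b' \<preceq> cmp C a c'"
      using bb unfolding shift_def by blast
    obtain e where "e \<in> y" "c \<preceq> e" "c' \<preceq> e" using path_directed[OF y(1) c(1,2)] .
    then have "b \<preceq> cmp C a e" "b' \<preceq> cmp C a e"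
      using c prefix_trans[OF _ prefix_cmp_mono[OF cmpa]] by auto
    then show ?thesis by blast
  qed
  show "b' \<in> shift a y" if b: "b \<in> shift a y" "b' \<preceq> b" for b b'
  proof -
    obtain c where "c \<in> y" "composable a c" "b \<preceq> cmp C a c" using b(1) unfolding shift_def by blast
    moreover from this have "b' \<preceq> cmp C a c" using prefix_trans[OF b(2)] by blast
    ultimately show ?thesis unfolding shift_def by blast
  qed
qed

lemma cmp_mem_shift:
  assumes "y \<in> cyl (src C a)" "a \<in> arr C" "composable a c"
  shows "cmp C a c \<in> shift a y \<longleftrightarrow> c \<in> y"
proof
  assume "cmp C a c \<in> shift a y"
  then obtain d where d: "d \<in> y" "composable a d" "cmp C a c \<preceq> cmp C a d"
    unfolding shift_def by blast
  show "c \<in> y"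
    by (rule path_prefix_closed[OF cylD(1)[OF assms(1)] d(1) prefix_left_cancel[OF assms(3) d(2,3)]])
next
  assume "c \<in> y"
  then show "cmp C a c \<in> shift a y"
    unfolding shift_def using assms(3) prefix_refl[OF composableD(4)[OF assms(3)]] by blast
qed

lemma shift_in_cyl:
  assumes "y \<in> cyl (src C a)" "a \<in> arr C"
  shows "shift a y \<in> cyl a"
  using shift_path[OF assms] cmp_mem_shift[OF assms composable_src[OF assms(2)]] cylD(2)[OF assms(1)]
    cmp_src[OF assms(2)]
  by (simp add: cyl_def)

lemma path_determined:
  assumes "x \<in> paths" "y \<in> paths" "\<And>a. a \<in> x \<Longrightarrow> \<exists>b\<in>y. a \<preceq> b"
  shows "x = y"
proof
  show sub: "x \<subseteq> y"
  proof
    fix a assume "a \<in> x"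
    then obtain b where "b \<in> y" "a \<preceq> b" using assms(3) by blast
    then show "a \<in> y" using path_prefix_closed[OF assms(2)] by blast
  qed
  show "y \<subseteq> x"
  proof
    fix b assume b: "b \<in> y"
    obtain a where a: "a \<in> x" "deg C a = deg C b" using path_degree_ex[OF assms(1)] by blast
    then have "a = b" using path_degree_unique[OF assms(2) _ b] sub by blast
    with a show "b \<in> x" by simp
  qed
qed

lemma path_subset_eq:
  assumes "x \<in> paths" "y \<in> paths" "x \<subseteq> y"
  shows "x = y"
proof (rule path_determined[OF assms(1,2)])
  fix a assume "a \<in> x"
  then show "\<exists>b\<in>y. a \<preceq> b" using prefix_refl path_arr[OF assms(1)] assms(3) by blast
qed

lemma shift_inj:
  assumes "y \<in> cyl (src C a)" "y' \<in> cyl (src C a)" "a \<in> arr C" "shift a y = shift a y'"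
  shows "y = y'"
proof (rule path_subset_eq[OF cylD(1)[OF assms(1)] cylD(1)[OF assms(2)]], rule subsetI)
  fix c assume "c \<in> y"
  moreover from this have "composable a c" using path_composable[OF assms(1,3)] by blast
  ultimately show "c \<in> y'"
    using cmp_mem_shift[OF assms(1,3)] cmp_mem_shift[OF assms(2,3)] assms(4) by blast
qed

text \<open>Deleting the initial segment \<open>a\<close> of \<open>x\<close>: the remainder consists of the \<open>c\<close> such that \<open>a c\<close> is in \<open>x\<close>.\<close>

lemma cyl_shift:
  assumes "x \<in> cyl a"
  obtains y where "y \<in> cyl (src C a)" "x = shift a y"
proof
  note x = cylD[OF assms]
  let ?y = "{c. composable a c \<and> cmp C a c \<in> x}"
  have ext: "\<exists>c\<in>?y. b \<preceq> cmp C a c" if b: "b \<in> x" for b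
  proof -
    obtain d where d: "d \<in> x" "a \<preceq> d" "b \<preceq> d" using path_directed[OF x(1,2) b] .
    then show ?thesis unfolding prefix_def by blast
  qed
  have "?y \<in> paths"
  proof (rule path_of_degrees)
    show "?y \<subseteq> arr C" using composableD by blast
    show "\<exists>c\<in>?y. \<exists>k. deg C c = n + k" for n
    proof -
      obtain b where b: "b \<in> x" "deg C b = deg C a + n" using path_degree_ex x(1) by blast
      then obtain a' c where "composable a' c" "b = cmp C a' c" "deg C a' = deg C a" "deg C c = n"
        using factorization_exists path_arr[OF x(1)] by metis
      moreover have "a' = a"
        using path_degree_unique[OF x(1) _ x(2)] path_prefix_closed[OF x(1) b(1)] calculation prefix_cmp
        by blast
      ultimately show ?thesis using b by (metis (mono_tags, lifting) add.right_neutral mem_Collect_eq)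
    qed
    show "\<exists>e. c \<preceq> e \<and> d \<preceq> e" if cd: "c \<in> ?y" "d \<in> ?y" for c d
    proof -
      obtain e where e: "e \<in> x" "cmp C a c \<preceq> e" "cmp C a d \<preceq> e"
        using path_directed[OF x(1), of "cmp C a c" "cmp C a d"] cd by auto
      have "a \<preceq> e" using prefix_trans[OF prefix_cmp e(2)] cd by simp
      then obtain f where f: "composable a f" "e = cmp C a f" unfolding prefix_def by blast
      then have "c \<preceq> f" "d \<preceq> f" using prefix_left_cancel[OF _ f(1)] cd e by auto
      then show ?thesis by blast
    qed
    show "d \<in> ?y" if "c \<in> ?y" "d \<preceq> c" for c d
    proof -
      have "composable a d" using that prefixD[OF that(2)] unfolding composable_def by auto
      then show ?thesis using that prefix_cmp_mono path_prefix_closed[OF x(1)] by blast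
    qed
  qed
  then show y: "?y \<in> cyl (src C a)" using x composable_src[OF x(3)] by (simp add: cyl_def cmp_src)
  show "x = shift a ?y"
  proof (rule path_determined[OF x(1) shift_path[OF y x(3)]])
    fix b assume "b \<in> x"
    then obtain c where "c \<in> ?y" "b \<preceq> cmp C a c" using ext by blast
    then show "\<exists>d\<in>shift a ?y. b \<preceq> d" using cmp_mem_shift[OF y x(3)] by auto
  qed
qed

lemma cyl_eq_shift: "a \<in> arr C \<Longrightarrow> cyl a = shift a ` cyl (src C a)"
  using shift_in_cyl cyl_shift by (metis (no_types, lifting) image_eqI image_subsetI subsetI subset_antisym)

lemma shift_cmp:
  assumes "composable a b" "y \<in> cyl (src C b)"
  shows "shift b y \<in> cyl (src C a)" "shift a (shift b y) = shift (cmp C a b) y"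
proof -
  note ab = composableD[OF assms(1)]
  have s: "shift b y \<in> cyl b" using shift_in_cyl assms ab by blast
  then have "src C a \<in> shift b y" using path_tgt cylD ab(3) by metis
  then show s': "shift b y \<in> cyl (src C a)" using s unfolding cyl_def by blast
  have y': "y \<in> cyl (src C (cmp C a b))" using assms(2) ab by simp
  show "shift a (shift b y) = shift (cmp C a b) y"
  proof (rule sym, rule path_determined[OF shift_path[OF y' ab(4)] shift_path[OF s' ab(1)]])
    fix d assume "d \<in> shift (cmp C a b) y"
    then obtain c where c: "c \<in> y" "composable (cmp C a b) c" "d \<preceq> cmp C (cmp C a b) c"
      unfolding shift_def by blast
    have bc: "composable b c" using c composable_assoc_left_iff assms by blast
    have "cmp C b c \<in> shift b y" using cmp_mem_shift[OF assms(2) ab(2) bc] c by blast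
    then have "cmp C a (cmp C b c) \<in> shift a (shift b y)"
      using cmp_mem_shift[OF s' ab(1)] composable_assoc(2)[OF assms(1) bc] by blast
    with c show "\<exists>b\<in>shift a (shift b y). d \<preceq> b" using composable_assoc(3)[OF assms(1) bc] by auto
  qed
qed

lemma shift_id:
  assumes "e \<in> ids C" "y \<in> cyl e"
  shows "shift e y = y"
proof -
  have e: "e \<in> arr C" "src C e = e" using assms ids_subset src_id by auto
  show ?thesis
  proof (rule sym, rule path_subset_eq)
    show "y \<in> paths" "shift e y \<in> paths" using assms cylD shift_path e by auto
    show "y \<subseteq> shift e y"
    proof
      fix c assume c: "c \<in> y"
      have ec: "composable e c" using path_composable c e assms by simp
      then have "cmp C e c = c" unfolding composable_def using cmp_tgt e by auto
      then show "c \<in> shift e y" using cmp_mem_shift[OF _ e(1) ec] assms e c by simp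
    qed
  qed
qed

lemma cyl_disjoint_degree: "deg C a = deg C b \<Longrightarrow> a \<noteq> b \<Longrightarrow> cyl a \<inter> cyl b = {}"
  unfolding cyl_def using path_degree_unique by blast

lemma path_of_sequence:
  assumes "\<And>i. b i \<preceq> b (Suc i)" "\<And>n. \<exists>i k. deg C (b i) = n + k"
  shows "{c. \<exists>i. c \<preceq> b i} \<in> paths" (is "?x \<in> _")
proof (rule path_of_degrees)
  have mono: "b i \<preceq> b (i + j)" for i j
  proof (induction j)
    case 0
    show ?case using prefix_refl prefixD(1)[OF assms(1)] by simp
  next
    case (Suc j)
    then show ?case using prefix_trans[OF Suc assms(1)] by simp
  qed
  have mono': "b j \<preceq> b (i + j)" for i j using mono[of j i] by (simp add: add.commute)
  show "?x \<subseteq> arr C" using prefixD by blast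
  show "\<exists>a\<in>?x. \<exists>k. deg C a = n + k" for n
  proof -
    obtain i k where "deg C (b i) = n + k" using assms(2) by blast
    moreover have "b i \<preceq> b i" using prefix_refl prefixD(1)[OF assms(1)] by blast
    ultimately show ?thesis by blast
  qed
  show "\<exists>c. a \<preceq> c \<and> a' \<preceq> c" if aa: "a \<in> ?x" "a' \<in> ?x" for a a'
  proof -
    obtain i j where "a \<preceq> b i" "a' \<preceq> b j" using aa by blast
    then have "a \<preceq> b (i + j)" "a' \<preceq> b (i + j)" using prefix_trans[OF _ mono] prefix_trans[OF _ mono'] by auto
    then show ?thesis by blast
  qed
  show "a' \<in> ?x" if aa: "a \<in> ?x" "a' \<preceq> a" for a a'
  proof -
    obtain i where "a \<preceq> b i" using aa by blast
    then show ?thesis using prefix_trans[OF aa(2)] by blast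
  qed
qed

end

section \<open>Clopen sets, local maps and the full group\<close>

locale finite_graph = higher_rank_graph C for C :: "('a, 'k::finite) kgraph" +
  assumes row_finite: "row_finite C" and no_sources: "no_sources C" and finite_ids: "finite (ids C)"
begin

text \<open>The degrees \<open>(N, \<dots>, N)\<close> are cofinal in \<open>\<nat>\<^sup>k\<close>, so that paths can be built along a sequence.\<close>

definition diag :: "nat \<Rightarrow> nat ^ 'k" where
  "diag N = (\<chi> i. N)"

lemma diag_simps: "diag 0 = 0" "diag (M + N) = diag M + diag N"
  unfolding diag_def by (simp_all add: vec_eq_iff)

lemma diag_dominates: "\<exists>N k. diag N = m + k"
proof -
  have "m $ i \<le> (\<Sum>j\<in>UNIV. m $ j)" for i by (rule member_le_sum) auto
  then have "diag (\<Sum>j\<in>UNIV. m $ j) = m + (\<chi> i. (\<Sum>j\<in>UNIV. m $ j) - m $ i)"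
    unfolding diag_def by (simp add: vec_eq_iff)
  then show ?thesis by blast
qed

lemma finite_level: "finite {a \<in> arr C. deg C a = n}"
proof -
  have "{a \<in> arr C. deg C a = n} \<subseteq> (\<Union>e\<in>ids C. {x \<in> ray C e. deg C x = n})"
    using tgt_in_ids ids_subset ray_prefix_iff[of "tgt C _"] tgt_prefix by blast
  then show ?thesis
    using finite_ids row_finite unfolding row_finite_def by (meson finite_UN finite_subset)
qed

lemma extension_exists:
  assumes "a \<in> arr C"
  obtains c where "composable a c" "deg C c = n"
proof -
  have "\<exists>x\<in>arr C. tgt C x = src C a \<and> deg C x = n"
    using no_sources src_in_ids assms unfolding no_sources_def by blast
  then show ?thesis using that assms unfolding composable_def by metis
qed

text \<open>In the absence of sources \<open>a\<close> has a sequence of extensions of unbounded degree.\<close>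

lemma cyl_nonempty:
  assumes "a \<in> arr C"
  shows "cyl a \<noteq> {}"
proof -
  obtain b where b: "\<And>i. b i \<in> arr C \<and> (\<exists>k. deg C (b i) = diag i + k)" "b 0 = a"
      "\<And>i. b i \<preceq> b (Suc i)"
  proof -
    have step: "\<exists>c'. (c' \<in> arr C \<and> (\<exists>k. deg C c' = diag (Suc i) + k)) \<and> c \<preceq> c'"
      if c: "c \<in> arr C \<and> (\<exists>k. deg C c = diag i + k)" for c i
    proof -
      obtain k where k: "deg C c = diag i + k" using c by blast
      obtain d where d: "composable c d" "deg C d = diag 1" using extension_exists c by blast
      have "deg C (cmp C c d) = diag (Suc i) + k"
        using composableD(7)[OF d(1)] d k diag_simps(2)[of i 1] by (simp add: ac_simps)
      then show ?thesis using composableD(4)[OF d(1)] prefix_cmp[OF d(1)] by blast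
    qed
    have "\<exists>f. \<forall>i. (f i \<in> arr C \<and> (\<exists>k. deg C (f i) = diag i + k) \<and> (i = 0 \<longrightarrow> f i = a)) \<and> f i \<preceq> f (Suc i)"
    proof (rule dependent_nat_choice)
      show "\<exists>x. x \<in> arr C \<and> (\<exists>k. deg C x = diag 0 + k) \<and> ((0::nat) = 0 \<longrightarrow> x = a)"
        using assms by (simp add: diag_simps)
      show "\<exists>y. (y \<in> arr C \<and> (\<exists>k. deg C y = diag (Suc n) + k) \<and> (Suc n = 0 \<longrightarrow> y = a)) \<and> x \<preceq> y"
        if "x \<in> arr C \<and> (\<exists>k. deg C x = diag n + k) \<and> (n = 0 \<longrightarrow> x = a)" for x n
        using step[of x n] that by auto
    qed
    then obtain f where "\<And>i. (f i \<in> arr C \<and> (\<exists>k. deg C (f i) = diag i + k) \<and> (i = 0 \<longrightarrow> f i = a)) \<and> f i \<preceq> f (Suc i)"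
      by blast
    then show ?thesis using that[of f] by blast
  qed
  have "{c. \<exists>i. c \<preceq> b i} \<in> paths"
  proof (rule path_of_sequence)
    show "\<And>i. b i \<preceq> b (Suc i)" using b(3) .
    show "\<exists>i k. deg C (b i) = n + k" for n
    proof -
      obtain N k where "diag N = n + k" using diag_dominates by blast
      moreover obtain l where "deg C (b N) = diag N + l" using b(1) by blast
      ultimately have "deg C (b N) = n + (k + l)" by (simp add: ac_simps)
      then show ?thesis by blast
    qed
  qed
  moreover have "a \<preceq> b 0" using b(2) prefix_refl assms by simp
  ultimately show ?thesis unfolding cyl_def by blast
qed

text \<open>Koenig's lemma, the form in which compactness of the path space enters: a property that passes to
  extensions and is met by some initial segment of every path holds at a fixed degree. Otherwise
  call an arrow bad if it has arbitrarily long extensions without the property. Since there are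
  finitely many arrows of each degree, every bad arrow has a bad extension that is one step longer,
  and bad arrows generate a path without the property.\<close>

lemma path_compactness:
  assumes ex: "\<And>x. x \<in> paths \<Longrightarrow> \<exists>b\<in>x. Q b"
    and her: "\<And>b c. Q b \<Longrightarrow> b \<preceq> c \<Longrightarrow> Q c"
  obtains n where "\<And>b. b \<in> arr C \<Longrightarrow> deg C b = n \<Longrightarrow> Q b"
proof (rule ccontr)
  assume "\<not> thesis"
  then have neg: "\<exists>b\<in>arr C. deg C b = n \<and> \<not> Q b" for n using that by blast
  define bad where "bad b \<longleftrightarrow> (\<forall>N. \<exists>c. b \<preceq> c \<and> deg C c = deg C b + diag N \<and> \<not> Q c)" for b
  have step: "\<exists>b\<in>S. bad b"
    if S: "finite S" "\<And>b. b \<in> S \<Longrightarrow> deg C b = d"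
      "\<And>N. \<exists>c. (\<exists>b\<in>S. b \<preceq> c) \<and> deg C c = d + diag N \<and> \<not> Q c" for S d
  proof (rule ccontr)
    assume "\<not> (\<exists>b\<in>S. bad b)"
    then have "\<forall>b\<in>S. \<exists>N. \<forall>c. b \<preceq> c \<and> deg C c = deg C b + diag N \<longrightarrow> Q c"
      unfolding bad_def by blast
    then obtain N where N: "\<And>b c. b \<in> S \<Longrightarrow> b \<preceq> c \<Longrightarrow> deg C c = deg C b + diag (N b) \<Longrightarrow> Q c"
      by metis
    obtain b c where c: "b \<in> S" "b \<preceq> c" "deg C c = d + diag (\<Sum>b\<in>S. N b)" "\<not> Q c"
      using S(3) by blast
    have "N b \<le> (\<Sum>b\<in>S. N b)" by (rule member_le_sum) (use c S in auto)
    then obtain M where "(\<Sum>b\<in>S. N b) = N b + M" using le_Suc_ex by blast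
    then have dc: "deg C c = (d + diag (N b)) + diag M" using c(3) diag_simps(2) by (simp add: ac_simps)
    obtain c' where c': "c' \<preceq> c" "deg C c' = d + diag (N b)"
      using prefix_of_degree[OF prefixD(2)[OF c(2)] dc] .
    then have "b \<preceq> c'" using prefix_compare[OF c(2) c'(1)] S(2)[OF c(1)] by simp
    then have "Q c'" using N[OF c(1)] c' S(2)[OF c(1)] by simp
    then show False using her c' c by blast
  qed
  have "\<exists>e\<in>ids C. bad e"
  proof (rule step[OF finite_ids])
    show "\<And>b. b \<in> ids C \<Longrightarrow> deg C b = 0" by (rule deg_id)
    show "\<exists>c. (\<exists>b\<in>ids C. b \<preceq> c) \<and> deg C c = 0 + diag N \<and> \<not> Q c" for N
    proof -
      obtain c where "c \<in> arr C" "deg C c = diag N" "\<not> Q c" using neg by blast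
      moreover from this have "tgt C c \<in> ids C" "tgt C c \<preceq> c" using tgt_in_ids tgt_prefix by auto
      ultimately show ?thesis by auto
    qed
  qed
  then obtain e where e: "e \<in> ids C" "bad e" by blast
  have next_bad: "\<exists>b'. (bad b' \<and> deg C b' = diag (Suc i)) \<and> b \<preceq> b'" if b: "bad b" "deg C b = diag i" for b i
  proof -
    let ?S = "{b'. b \<preceq> b' \<and> deg C b' = deg C b + diag 1}"
    have "\<exists>b'\<in>?S. bad b'"
    proof (rule step)
      have "?S \<subseteq> {a \<in> arr C. deg C a = deg C b + diag 1}" using prefixD(2) by blast
      then show "finite ?S" using finite_level finite_subset by blast
      show "\<And>b'. b' \<in> ?S \<Longrightarrow> deg C b' = deg C b + diag 1" by simp
      show "\<exists>c. (\<exists>b'\<in>?S. b' \<preceq> c) \<and> deg C c = deg C b + diag 1 + diag N \<and> \<not> Q c" for N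
      proof -
        obtain c where c: "b \<preceq> c" "deg C c = deg C b + diag (1 + N)" "\<not> Q c"
          using b(1) unfolding bad_def by blast
        then have dc: "deg C c = (deg C b + diag 1) + diag N" using diag_simps(2)[of 1 N] by (simp only: add.assoc)
        obtain c' where c': "c' \<preceq> c" "deg C c' = deg C b + diag 1"
          using prefix_of_degree[OF prefixD(2)[OF c(1)] dc] .
        then have "b \<preceq> c'" using prefix_compare[OF c(1) c'(1)] by simp
        then show ?thesis using c c' dc by blast
      qed
    qed
    then show ?thesis using b diag_simps(2)[of i 1] by auto
  qed
  have "\<exists>f. \<forall>i. (bad (f i) \<and> deg C (f i) = diag i) \<and> f i \<preceq> f (Suc i)"
    by (rule dependent_nat_choice) (use e deg_id next_bad in \<open>auto simp: diag_simps\<close>)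
  then obtain f where f: "\<And>i. bad (f i)" "\<And>i. deg C (f i) = diag i" "\<And>i. f i \<preceq> f (Suc i)" by blast
  have "{c. \<exists>i. c \<preceq> f i} \<in> paths"
    by (rule path_of_sequence) (use f diag_dominates in metis)+
  then obtain b i where b: "b \<preceq> f i" "Q b" using ex by blast
  then have "Q (f i)" using her by blast
  moreover obtain c where "f i \<preceq> c" "\<not> Q c" using f(1) unfolding bad_def by blast
  ultimately show False using her by blast
qed

text \<open>By compactness, the clopen sets of paths are those for which membership is decided by the initial
  segment of some fixed degree. This description serves as the definition.\<close>

definition clopen :: "'a set set \<Rightarrow> bool" where
  "clopen U \<longleftrightarrow> U \<subseteq> paths \<and> (\<exists>n. \<forall>b\<in>arr C. deg C b = n \<longrightarrow> cyl b \<subseteq> U \<or> cyl b \<inter> U = {})"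

lemma clopen_subset: "clopen U \<Longrightarrow> U \<subseteq> paths"
  unfolding clopen_def by blast

lemma cyl_subset: "cyl a \<subseteq> paths"
  unfolding cyl_def by blast

lemma path_in_cyl: "x \<in> paths \<Longrightarrow> \<exists>b\<in>arr C. deg C b = n \<and> x \<in> cyl b"
  unfolding cyl_def using path_degree_ex path_arr by blast

lemma clopen_level_up:
  assumes "\<forall>b\<in>arr C. deg C b = n \<longrightarrow> cyl b \<subseteq> U \<or> cyl b \<inter> U = {}" "b \<in> arr C" "deg C b = n + k"
  shows "cyl b \<subseteq> U \<or> cyl b \<inter> U = {}"
proof -
  obtain c where "c \<preceq> b" "deg C c = n" using prefix_of_degree[OF assms(2,3)] .
  then show ?thesis using assms(1) prefixD(1) cyl_mono by blast
qed

lemma clopen_local: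
  assumes "U \<subseteq> paths"
    and "\<And>x. x \<in> U \<Longrightarrow> \<exists>b\<in>x. cyl b \<subseteq> U"
    and "\<And>x. x \<in> paths \<Longrightarrow> x \<notin> U \<Longrightarrow> \<exists>b\<in>x. cyl b \<inter> U = {}"
  shows "clopen U"
proof -
  obtain n where "\<And>b. b \<in> arr C \<Longrightarrow> deg C b = n \<Longrightarrow> cyl b \<subseteq> U \<or> cyl b \<inter> U = {}"
    by (rule path_compactness[of "\<lambda>b. cyl b \<subseteq> U \<or> cyl b \<inter> U = {}"])
      (use assms cyl_mono in \<open>blast+\<close>)
  then show ?thesis unfolding clopen_def using assms(1) by blast
qed

lemma clopen_nbhd:
  assumes "clopen U" "x \<in> U"
  obtains b k where "x \<in> cyl b" "cyl b \<subseteq> U" "deg C b = n + k"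
proof -
  obtain m where m: "\<forall>b\<in>arr C. deg C b = m \<longrightarrow> cyl b \<subseteq> U \<or> cyl b \<inter> U = {}"
    using assms unfolding clopen_def by blast
  obtain b where b: "b \<in> arr C" "deg C b = m + n" "x \<in> cyl b"
    using path_in_cyl assms clopen_subset by blast
  have "deg C b = n + m" using b by (simp add: add.commute)
  then show ?thesis using clopen_level_up[OF m b(1,2)] b that assms(2) by blast
qed

lemma clopen_compl: "clopen U \<Longrightarrow> clopen (paths - U)"
  unfolding clopen_def using cyl_subset by blast

lemma clopen_inter:
  assumes "clopen U" "clopen V"
  shows "clopen (U \<inter> V)"
proof (rule clopen_local)
  show "U \<inter> V \<subseteq> paths" using assms clopen_subset by blast
next
  fix x assume x: "x \<in> U \<inter> V"
  obtain b k where b: "x \<in> cyl b" "cyl b \<subseteq> U" "deg C b = 0 + k" using clopen_nbhd assms(1) x by blast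
  obtain c l where c: "x \<in> cyl c" "cyl c \<subseteq> V" "deg C c = 0 + l" using clopen_nbhd assms(2) x by blast
  obtain d where "d \<in> x" "b \<preceq> d" "c \<preceq> d" using path_directed cylD b c by metis
  then show "\<exists>b\<in>x. cyl b \<subseteq> U \<inter> V" using cyl_mono b c by blast
next
  fix x assume x: "x \<in> paths" "x \<notin> U \<inter> V"
  then consider "x \<in> paths - U" | "x \<in> paths - V" by blast
  then show "\<exists>b\<in>x. cyl b \<inter> (U \<inter> V) = {}"
  proof cases
    case 1
    obtain b k where "x \<in> cyl b" "cyl b \<subseteq> paths - U" "deg C b = 0 + k"
      using clopen_nbhd[OF clopen_compl[OF assms(1)] 1] .
    then show ?thesis using cylD(2) by blast
  next
    case 2
    obtain b k where "x \<in> cyl b" "cyl b \<subseteq> paths - V" "deg C b = 0 + k"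
      using clopen_nbhd[OF clopen_compl[OF assms(2)] 2] .
    then show ?thesis using cylD(2) by blast
  qed
qed

lemma clopen_paths: "clopen paths"
  unfolding clopen_def using cyl_subset by blast

lemma clopen_diff: "clopen U \<Longrightarrow> clopen V \<Longrightarrow> clopen (U - V)"
  using clopen_inter[OF _ clopen_compl[of V], of U] clopen_subset[of U]
  by (simp add: Diff_eq Int_assoc[symmetric] inf.absorb1)

lemma clopen_union:
  assumes "clopen U" "clopen V"
  shows "clopen (U \<union> V)"
proof -
  have "U \<union> V = paths - ((paths - U) \<inter> (paths - V))" using clopen_subset assms by blast
  then show ?thesis using assms clopen_compl clopen_inter by simp
qed

lemma clopen_empty: "clopen {}"
  unfolding clopen_def by blast

lemma clopen_UN: "finite I \<Longrightarrow> (\<And>i. i \<in> I \<Longrightarrow> clopen (U i)) \<Longrightarrow> clopen (\<Union>i\<in>I. U i)"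
  by (induction I rule: finite_induct) (auto intro: clopen_empty clopen_union)

lemma clopen_cyl: "clopen (cyl a)"
  unfolding clopen_def using cyl_subset cyl_disjoint_degree by blast

lemma paths_separated:
  assumes "x \<in> paths" "y \<in> paths" "x \<noteq> y"
  obtains a where "x \<in> cyl a" "y \<notin> cyl a"
proof -
  have "\<not> x \<subseteq> y" using path_subset_eq assms by blast
  then show ?thesis using that assms unfolding cyl_def by blast
qed

text \<open>\<open>h\<close> is the basic map \<open>b y \<mapsto> a y\<close> on the cylinder of \<open>b\<close>.\<close>

definition acts :: "('a set \<Rightarrow> 'a set) \<Rightarrow> 'a \<Rightarrow> 'a \<Rightarrow> bool" where
  "acts h a b \<longleftrightarrow> a \<in> arr C \<and> b \<in> arr C \<and> src C a = src C b \<and>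
    (\<forall>y\<in>cyl (src C b). h (shift b y) = shift a y)"

lemma actsD:
  assumes "acts h a b"
  shows "a \<in> arr C" "b \<in> arr C" "src C a = src C b"
    "y \<in> cyl (src C b) \<Longrightarrow> h (shift b y) = shift a y"
  using assms unfolding acts_def by auto

lemma acts_image:
  assumes "acts h a b"
  shows "h ` cyl b = cyl a"
  using actsD[OF assms] cyl_eq_shift[of a] cyl_eq_shift[of b] by (simp add: image_image)

lemma acts_inj:
  assumes "acts h a b"
  shows "inj_on h (cyl b)"
proof (rule inj_onI)
  note ab = actsD[OF assms]
  fix x x' assume x: "x \<in> cyl b" "x' \<in> cyl b" "h x = h x'"
  obtain y y' where y: "y \<in> cyl (src C b)" "x = shift b y" "y' \<in> cyl (src C b)" "x' = shift b y'"
    using cyl_shift[OF x(1)] cyl_shift[OF x(2)] by metis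
  then have "shift a y = shift a y'" using ab(4) x(3) by metis
  then have "y = y'" using shift_inj[of y a y'] y ab by simp
  then show "x = x'" using y by simp
qed

lemma acts_cong:
  assumes "acts h a b" "\<And>x. x \<in> cyl b \<Longrightarrow> h x = g x"
  shows "acts g a b"
  using assms shift_in_cyl unfolding acts_def by metis

lemma acts_ext:
  assumes "acts h a b" "composable b c"
  shows "composable a c" "acts h (cmp C a c) (cmp C b c)"
proof -
  note ab = actsD[OF assms(1)] and bc = composableD[OF assms(2)]
  show ac: "composable a c" using ab bc unfolding composable_def by simp
  show "acts h (cmp C a c) (cmp C b c)"
    unfolding acts_def
  proof (intro conjI ballI)
    show "cmp C a c \<in> arr C" "cmp C b c \<in> arr C" "src C (cmp C a c) = src C (cmp C b c)"
      using composableD[OF ac] bc by auto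
    fix y assume "y \<in> cyl (src C (cmp C b c))"
    then have y: "y \<in> cyl (src C c)" using bc by simp
    show "h (shift (cmp C b c) y) = shift (cmp C a c) y"
      using shift_cmp[OF assms(2) y] shift_cmp[OF ac y] ab by metis
  qed
qed

lemma acts_comp:
  assumes "acts h a b" "acts g c a"
  shows "acts (g \<circ> h) c b"
  using assms unfolding acts_def by auto

lemma acts_inverse:
  assumes "acts h a b" "\<And>x. x \<in> cyl b \<Longrightarrow> g (h x) = x"
  shows "acts g b a"
  using assms shift_in_cyl unfolding acts_def by metis

lemma acts_id: "a \<in> arr C \<Longrightarrow> acts (\<lambda>x. x) a a"
  unfolding acts_def by simp

lemma acts_shift:
  assumes "a \<in> arr C"
  shows "acts (shift a) a (src C a)"
  unfolding acts_def using assms src_in_ids ids_subset src_id shift_id by auto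

lemma acts_shrink:
  assumes "acts h a b" "x \<in> cyl b" "clopen U" "x \<in> U"
  obtains a' b' k l where "acts h a' b'" "x \<in> cyl b'" "cyl b' \<subseteq> U" "deg C b' = n + k" "deg C a' = n + l"
proof -
  obtain c k where c: "x \<in> cyl c" "cyl c \<subseteq> U" "deg C c = (deg C b + n) + k"
    using clopen_nbhd[OF assms(3,4)] .
  have "b \<preceq> c"
  proof -
    obtain d where "b \<preceq> d" "c \<preceq> d" using path_directed[of x b c] cylD c assms(2) by metis
    then show ?thesis using prefix_compare[of b d c] c(3) by (metis add.assoc)
  qed
  then obtain w where w: "composable b w" "c = cmp C b w" unfolding prefix_def by blast
  note e = acts_ext[OF assms(1) w(1)]
  have "deg C b + deg C w = deg C b + (n + k)"
    using composableD(7)[OF w(1)] w(2) c(3) by (simp only: add.assoc)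
  then have dw: "deg C w = n + k" by (simp only: add_left_cancel)
  have "deg C (cmp C b w) = n + (k + deg C b)" "deg C (cmp C a w) = n + (k + deg C a)"
    using composableD(7)[OF w(1)] composableD(7)[OF e(1)] dw by (simp_all add: ac_simps)
  then show ?thesis using that[OF e(2)] c w by blast
qed

text \<open>These are the compact open bisections of the path groupoid: injective maps on a clopen set which
  have the form \<open>b y \<mapsto> a y\<close> near each path.\<close>

definition bisection :: "'a set set \<Rightarrow> ('a set \<Rightarrow> 'a set) \<Rightarrow> bool" where
  "bisection U h \<longleftrightarrow> clopen U \<and> inj_on h U \<and> (\<forall>x\<in>U. \<exists>a b. acts h a b \<and> x \<in> cyl b)"

lemma bisectionD:
  assumes "bisection U h"
  shows "clopen U" "inj_on h U" "x \<in> U \<Longrightarrow> \<exists>a b. acts h a b \<and> x \<in> cyl b"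
  using assms unfolding bisection_def by auto

lemma bisection_nbhd:
  assumes "bisection U h" "clopen V" "x \<in> U" "x \<in> V"
  obtains a b k l where "acts h a b" "x \<in> cyl b" "cyl b \<subseteq> U \<inter> V" "deg C b = n + k" "deg C a = n + l"
proof -
  obtain a b where ab: "acts h a b" "x \<in> cyl b" using bisectionD(3)[OF assms(1,3)] by blast
  obtain a' b' k l where "acts h a' b'" "x \<in> cyl b'" "cyl b' \<subseteq> U \<inter> V" "deg C b' = n + k" "deg C a' = n + l"
    by (rule acts_shrink[OF ab clopen_inter[OF bisectionD(1)[OF assms(1)] assms(2)]]) (use assms in auto)
  then show ?thesis by (rule that)
qed

lemma bisection_local:
  assumes "clopen U" "inj_on h U"
    "\<And>x. x \<in> U \<Longrightarrow> \<exists>g a b V. acts g a b \<and> x \<in> cyl b \<and> clopen V \<and> x \<in> V \<and> (\<forall>y\<in>V. h y = g y)"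
  shows "bisection U h"
  unfolding bisection_def
proof (intro conjI ballI)
  fix x assume "x \<in> U"
  then obtain g a b V where *: "acts g a b" "x \<in> cyl b" "clopen V" "x \<in> V" "\<forall>y\<in>V. h y = g y"
    using assms(3) by metis
  obtain a' b' k l where **: "acts g a' b'" "x \<in> cyl b'" "cyl b' \<subseteq> V"
    "deg C b' = 0 + k" "deg C a' = 0 + l" using acts_shrink[OF *(1-4)] .
  have "acts h a' b'" by (rule acts_cong[OF **(1)]) (use * ** in auto)
  then show "\<exists>a b. acts h a b \<and> x \<in> cyl b" using ** by blast
qed (use assms in auto)

lemma bisection_cong:
  assumes "bisection U h" "\<And>x. x \<in> U \<Longrightarrow> h x = g x"
  shows "bisection U g"
proof (rule bisection_local)
  show "clopen U" using bisectionD(1)[OF assms(1)] .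
  show "inj_on g U" using bisectionD(2)[OF assms(1)] assms(2) inj_on_cong by blast
  show "\<exists>h a b V. acts h a b \<and> x \<in> cyl b \<and> clopen V \<and> x \<in> V \<and> (\<forall>y\<in>V. g y = h y)" if "x \<in> U" for x
    using bisectionD(3)[OF assms(1) that] bisectionD(1)[OF assms(1)] assms(2) that by metis
qed

lemma bisection_subset: "bisection U h \<Longrightarrow> clopen V \<Longrightarrow> V \<subseteq> U \<Longrightarrow> bisection V h"
  unfolding bisection_def using inj_on_subset by blast

lemma bisection_union:
  assumes "bisection U h" "bisection V h" "inj_on h (U \<union> V)"
  shows "bisection (U \<union> V) h"
  using assms clopen_union unfolding bisection_def by blast

text \<open>By compactness the arrows \<open>b\<close> that give the local forms can be taken of one and the same degree.\<close>

lemma bisection_level: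
  assumes "bisection U h"
  obtains n where "\<forall>b\<in>arr C. deg C b = n \<longrightarrow> cyl b \<inter> U = {} \<or> cyl b \<subseteq> U \<and> (\<exists>a. acts h a b)"
proof (rule path_compactness[of "\<lambda>b. cyl b \<inter> U = {} \<or> cyl b \<subseteq> U \<and> (\<exists>a. acts h a b)"])
  fix x assume x: "x \<in> paths"
  show "\<exists>b\<in>x. cyl b \<inter> U = {} \<or> cyl b \<subseteq> U \<and> (\<exists>a. acts h a b)"
  proof (cases "x \<in> U")
    case True
    obtain a b k l where "acts h a b" "x \<in> cyl b" "cyl b \<subseteq> U \<inter> paths" "deg C b = 0 + k" "deg C a = 0 + l"
      using bisection_nbhd[OF assms clopen_paths True x] .
    then show ?thesis using cylD(2) by blast
  next
    case False
    then have x': "x \<in> paths - U" using x by blast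
    obtain b k where "x \<in> cyl b" "cyl b \<subseteq> paths - U" "deg C b = 0 + k"
      using clopen_nbhd[OF clopen_compl[OF bisectionD(1)[OF assms]] x'] .
    then show ?thesis using cylD(2) by blast
  qed
next
  fix b c assume b: "cyl b \<inter> U = {} \<or> cyl b \<subseteq> U \<and> (\<exists>a. acts h a b)" "b \<preceq> c"
  then show "cyl c \<inter> U = {} \<or> cyl c \<subseteq> U \<and> (\<exists>a. acts h a c)"
    using cyl_mono[OF b(2)] acts_ext(2) unfolding prefix_def by blast
next
  fix n assume "\<And>b. b \<in> arr C \<Longrightarrow> deg C b = n \<Longrightarrow> cyl b \<inter> U = {} \<or> cyl b \<subseteq> U \<and> (\<exists>a. acts h a b)"
  then show thesis by (intro that) blast
qed

lemma bisection_clopen_image: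
  assumes "bisection U h"
  shows "clopen (h ` U)"
proof -
  obtain n where n: "\<forall>b\<in>arr C. deg C b = n \<longrightarrow> cyl b \<inter> U = {} \<or> cyl b \<subseteq> U \<and> (\<exists>a. acts h a b)"
    using bisection_level[OF assms] .
  let ?B = "{b \<in> arr C. deg C b = n} \<inter> {b. cyl b \<subseteq> U \<and> (\<exists>a. acts h a b)}"
  have "U = (\<Union>b\<in>?B. cyl b)"
  proof
    show "U \<subseteq> (\<Union>b\<in>?B. cyl b)"
    proof
      fix x assume x: "x \<in> U"
      then obtain b where b: "b \<in> arr C" "deg C b = n" "x \<in> cyl b"
        using path_in_cyl clopen_subset[OF bisectionD(1)[OF assms]] by blast
      then have "\<not> cyl b \<inter> U = {}" using x by blast
      then have "cyl b \<subseteq> U \<and> (\<exists>a. acts h a b)" using n[rule_format, OF b(1,2)] by simp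
      then show "x \<in> (\<Union>b\<in>?B. cyl b)" by (intro UN_I[of b]) (use b in simp_all)
    qed
  qed blast
  then have img: "h ` U = (\<Union>b\<in>?B. h ` cyl b)" by blast
  have "clopen (h ` cyl b)" if "b \<in> ?B" for b
    using that acts_image clopen_cyl by auto
  moreover have "finite ?B" using finite_level by blast
  ultimately show ?thesis unfolding img by (intro clopen_UN)
qed

lemma bisection_preimage:
  assumes "bisection U h" "clopen V"
  shows "clopen {x \<in> U. h x \<in> V}"
proof (rule clopen_local)
  have U: "clopen U" using bisectionD(1)[OF assms(1)] .
  then show "{x \<in> U. h x \<in> V} \<subseteq> paths" using clopen_subset by blast
  have nb: "\<exists>b\<in>x. cyl b \<subseteq> {x \<in> U. h x \<in> W}" if W: "clopen W" "x \<in> U" "h x \<in> W" for x W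
  proof -
    obtain a b where ab: "acts h a b" "x \<in> cyl b" using bisectionD(3)[OF assms(1) W(2)] by blast
    obtain y where y: "y \<in> cyl (src C b)" "x = shift b y" using cyl_shift[OF ab(2)] .
    have hx: "h x \<in> cyl a" using acts_image[OF ab(1)] ab(2) by blast
    obtain a' k where a': "h x \<in> cyl a'" "cyl a' \<subseteq> W" "deg C a' = deg C a + k"
      using clopen_nbhd[OF W(1,3)] .
    obtain d where "a \<preceq> d" "a' \<preceq> d" using path_directed[of "h x" a a'] cylD a' hx by metis
    then have "a \<preceq> a'" using prefix_compare[of a d a'] a'(3) by blast
    then obtain w where w: "composable a w" "a' = cmp C a w" unfolding prefix_def by blast
    have bw: "composable b w" using w actsD[OF ab(1)] unfolding composable_def by simp
    have e: "acts h a' (cmp C b w)" using acts_ext(2)[OF ab(1) bw] w by simp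
    have "shift a y \<in> cyl a'" using a'(1) y actsD(4)[OF ab(1)] by metis
    then have "w \<in> y"
      using cmp_mem_shift[OF _ _ w(1), of y] y actsD[OF ab(1)] w(2) cylD(2) by metis
    then have "x \<in> cyl (cmp C b w)"
      using cmp_mem_shift[OF y(1) actsD(2)[OF ab(1)] bw] y(2) ab(2) unfolding cyl_def by simp
    moreover have "\<forall>z\<in>cyl (cmp C b w). h z \<in> W" using acts_image[OF e] a' by blast
    moreover obtain c l where "x \<in> cyl c" "cyl c \<subseteq> cyl (cmp C b w) \<inter> U" "deg C c = 0 + l"
      using clopen_nbhd[OF clopen_inter[OF clopen_cyl U], of x "cmp C b w"] calculation(1) W(2) by blast
    ultimately show ?thesis using cylD(2) by blast
  qed
  show "\<exists>b\<in>x. cyl b \<subseteq> {x \<in> U. h x \<in> V}" if "x \<in> {x \<in> U. h x \<in> V}" for x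
    using nb assms(2) that by blast
  show "\<exists>b\<in>x. cyl b \<inter> {x \<in> U. h x \<in> V} = {}" if x: "x \<in> paths" "x \<notin> {x \<in> U. h x \<in> V}" for x
  proof (cases "x \<in> U")
    case True
    have "h x \<in> paths" using clopen_subset[OF bisection_clopen_image[OF assms(1)]] True by blast
    then have "h x \<in> paths - V" using x True by blast
    then show ?thesis using nb[OF clopen_compl[OF assms(2)] True] by blast
  next
    case False
    then have "x \<in> paths - U" using x by blast
    then obtain b k where "x \<in> cyl b" "cyl b \<subseteq> paths - U" "deg C b = 0 + k"
      using clopen_nbhd[OF clopen_compl[OF U]] by metis
    then show ?thesis using cylD(2) by blast
  qed
qed

lemma bisection_comp:
  assumes "bisection U h" "bisection V g"
  shows "bisection {x \<in> U. h x \<in> V} (g \<circ> h)"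
proof (rule bisection_local)
  show "clopen {x \<in> U. h x \<in> V}" using bisection_preimage assms bisectionD(1) by blast
  show "inj_on (g \<circ> h) {x \<in> U. h x \<in> V}"
    using bisectionD(2)[OF assms(1)] bisectionD(2)[OF assms(2)] by (auto simp: inj_on_def)
  fix x assume x: "x \<in> {x \<in> U. h x \<in> V}"
  obtain c a' where c: "acts g c a'" "h x \<in> cyl a'" using bisectionD(3)[OF assms(2)] x by blast
  have cl: "clopen {x \<in> U. h x \<in> cyl a'}" using bisection_preimage[OF assms(1) clopen_cyl] .
  obtain a b k l where ab: "acts h a b" "x \<in> cyl b" "cyl b \<subseteq> U \<inter> {x \<in> U. h x \<in> cyl a'}"
    "deg C b = deg C a' + k" "deg C a = deg C a' + l"
    by (rule bisection_nbhd[OF assms(1) cl, of x]) (use x c in auto)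
  have "h x \<in> cyl a" using acts_image[OF ab(1)] ab(2) by blast
  then obtain d where "a' \<preceq> d" "a \<preceq> d" using path_directed[of "h x" a' a] cylD c by metis
  then have "a' \<preceq> a" using prefix_compare[of a' d a] ab(5) by blast
  then obtain w where "composable a' w" "a = cmp C a' w" unfolding prefix_def by blast
  then have "acts g (cmp C c w) a" using acts_ext(2)[OF c(1)] by simp
  then have "acts (g \<circ> h) (cmp C c w) b" using acts_comp[OF ab(1)] by blast
  then show "\<exists>f a b V. acts f a b \<and> x \<in> cyl b \<and> clopen V \<and> x \<in> V \<and> (\<forall>y\<in>V. (g \<circ> h) y = f y)"
    using ab(2) clopen_cyl by blast
qed

lemma bisection_inverse:
  assumes "bisection U h"
  shows "bisection (h ` U) (inv_into U h)"
proof (rule bisection_local)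
  show "clopen (h ` U)" using bisection_clopen_image[OF assms] .
  show "inj_on (inv_into U h) (h ` U)" by (rule inj_on_inv_into) simp
  fix y assume "y \<in> h ` U"
  then obtain x where x: "x \<in> U" "y = h x" by blast
  then have xp: "x \<in> paths" using clopen_subset[OF bisectionD(1)[OF assms]] by blast
  obtain a b k l where ab: "acts h a b" "x \<in> cyl b" "cyl b \<subseteq> U \<inter> paths" "deg C b = 0 + k" "deg C a = 0 + l"
    using bisection_nbhd[OF assms clopen_paths x(1) xp] .
  have "acts (inv_into U h) b a"
    by (rule acts_inverse[OF ab(1)]) (use ab(3) inv_into_f_f[OF bisectionD(2)[OF assms]] in auto)
  moreover have "y \<in> cyl a" using acts_image[OF ab(1)] ab(2) x by blast
  ultimately show "\<exists>g a b V. acts g a b \<and> y \<in> cyl b \<and> clopen V \<and> y \<in> V \<and> (\<forall>z\<in>V. inv_into U h z = g z)"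
    using clopen_cyl by blast
qed

lemma bisection_id:
  assumes "clopen U"
  shows "bisection U (\<lambda>x. x)"
  unfolding bisection_def
proof (intro conjI ballI)
  fix x assume "x \<in> U"
  then obtain b where "b \<in> arr C" "x \<in> cyl b" using path_in_cyl clopen_subset[OF assms] by blast
  then show "\<exists>a b. acts (\<lambda>x. x) a b \<and> x \<in> cyl b" using acts_id by blast
qed (use assms in auto)

lemma bisection_shift:
  assumes "a \<in> arr C"
  shows "bisection (cyl (src C a)) (shift a)"
  unfolding bisection_def using clopen_cyl acts_shift[OF assms] acts_inj by blast

text \<open>The homeomorphisms are extended by the identity outside the path space, so that they become
  permutations of a type and form a group under \<open>(\<circ>)\<close>.\<close>

definition full_group :: "('a set \<Rightarrow> 'a set) set" where
  "full_group = {h. bij h \<and> (\<forall>x. x \<notin> paths \<longrightarrow> h x = x) \<and> bisection paths h}"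

lemma full_groupD:
  assumes "h \<in> full_group"
  shows "bij h" "x \<notin> paths \<Longrightarrow> h x = x" "bisection paths h"
  using assms unfolding full_group_def by auto

lemma full_group_paths:
  assumes "h \<in> full_group"
  shows "h x \<in> paths \<longleftrightarrow> x \<in> paths" "h ` paths = paths"
proof -
  have 1: "h ` paths \<subseteq> paths"
    using clopen_subset[OF bisection_clopen_image[OF full_groupD(3)[OF assms]]] .
  have 2: "h x \<notin> paths" if "x \<notin> paths" for x using full_groupD(2)[OF assms that] that by simp
  show "h x \<in> paths \<longleftrightarrow> x \<in> paths" using 1 2 by blast
  have "paths \<subseteq> h ` paths"
  proof
    fix y assume "y \<in> paths"
    moreover obtain x where "y = h x" using full_groupD(1)[OF assms] by (meson bij_pointE)
    ultimately show "y \<in> h ` paths" using 2 by blast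
  qed
  then show "h ` paths = paths" using 1 by blast
qed

lemma full_group_id: "id \<in> full_group"
  unfolding full_group_def using bisection_id[OF clopen_paths] bij_id by (simp add: id_def)

lemma full_group_comp:
  assumes "g \<in> full_group" "h \<in> full_group"
  shows "g \<circ> h \<in> full_group"
proof -
  have "bisection {x \<in> paths. h x \<in> paths} (g \<circ> h)"
    by (rule bisection_comp[OF full_groupD(3)[OF assms(2)] full_groupD(3)[OF assms(1)]])
  moreover have "{x \<in> paths. h x \<in> paths} = paths" using full_group_paths(1)[OF assms(2)] by blast
  ultimately show ?thesis
    unfolding full_group_def using full_groupD[OF assms(1)] full_groupD[OF assms(2)] bij_comp by auto
qed

lemma full_group_inv:
  assumes "h \<in> full_group"
  shows "inv_into UNIV h \<in> full_group"
proof -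
  note b = full_groupD(1)[OF assms]
  have "bisection paths (inv_into paths h)"
    using bisection_inverse[OF full_groupD(3)[OF assms]] full_group_paths(2)[OF assms] by simp
  then have "bisection paths (inv_into UNIV h)"
  proof (rule bisection_cong)
    fix x assume "x \<in> paths"
    then obtain y where "y \<in> paths" "x = h y" using full_group_paths(2)[OF assms] by blast
    then show "inv_into paths h x = inv_into UNIV h x"
      using inv_into_f_f[OF bisectionD(2)[OF full_groupD(3)[OF assms]]] inv_f_f[OF bij_is_inj[OF b]] by simp
  qed
  moreover have "inv_into UNIV h x = x" if "x \<notin> paths" for x
    using full_groupD(2)[OF assms that] bij_is_inj[OF b] by (metis inv_f_f)
  ultimately show ?thesis unfolding full_group_def using bij_imp_bij_inv[OF b] by blast
qed

lemma full_group_clopen: "h \<in> full_group \<Longrightarrow> clopen U \<Longrightarrow> clopen (h ` U)"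
  using bisection_clopen_image bisection_subset full_groupD(3) clopen_subset by blast

end

section \<open>Aperiodicity and cofinality in terms of paths\<close>

context finite_graph
begin

lemma nbhd_extension:
  assumes "x \<in> cyl b" "x \<in> cyl c" "deg C c = deg C b + k"
  obtains w where "composable b w" "c = cmp C b w"
proof -
  obtain d where "b \<preceq> d" "c \<preceq> d" using path_directed[of x b c] cylD assms(1,2) by metis
  then have "b \<preceq> c" using prefix_compare[of b d c] assms(3) by blast
  then show ?thesis using that unfolding prefix_def by blast
qed

lemma cyl_disjoint_iff:
  assumes "a \<in> arr C" "b \<in> arr C"
  shows "cyl a \<inter> cyl b = {} \<longleftrightarrow> independent_arrows C a b"
proof
  assume *: "cyl a \<inter> cyl b = {}"
  show "independent_arrows C a b"
  proof (rule ccontr)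
    assume "\<not> independent_arrows C a b"
    then obtain c where c: "a \<preceq> c" "b \<preceq> c" using common_extension_dependent assms by blast
    then have "cyl c \<noteq> {}" using cyl_nonempty prefixD(2) by blast
    then show False using cyl_mono[OF c(1)] cyl_mono[OF c(2)] * by blast
  qed
next
  assume *: "independent_arrows C a b"
  show "cyl a \<inter> cyl b = {}"
  proof (rule ccontr)
    assume "cyl a \<inter> cyl b \<noteq> {}"
    then obtain x where x: "x \<in> cyl a" "x \<in> cyl b" by blast
    obtain c where "a \<preceq> c" "b \<preceq> c" using path_directed[OF cylD(1,2)[OF x(1)] cylD(2)[OF x(2)]] .
    then show False using common_extension_dependent[OF assms] * by blast
  qed
qed

text \<open>Given a path through \<open>f\<close>, take an initial segment \<open>b\<close> whose degree dominates those of the finitely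
  many elements of \<open>X\<close>. It has a common extension with some \<open>x\<close> in \<open>X\<close>; then \<open>x\<close> is a prefix of \<open>b\<close>.\<close>

lemma large_cover:
  assumes "finite X" "large_in C X f" "f \<in> ids C"
  shows "cyl f \<subseteq> (\<Union>x\<in>X. cyl x)"
proof
  fix y assume y: "y \<in> cyl f"
  have fa: "f \<in> arr C" using assms(3) ids_subset by blast
  obtain b where b: "b \<in> y" "deg C b = (\<Sum>x\<in>X. deg C x)" using path_degree_ex cylD(1)[OF y] by blast
  obtain w where "composable f w" "b = cmp C f w"
    by (rule nbhd_extension[of y f b "deg C b"])
      (use y b cylD(1)[OF y] deg_id[OF assms(3)] in \<open>auto simp: cyl_def\<close>)
  then have "b \<in> ray C f" using ray_prefix_iff[OF fa] prefix_cmp by blast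
  then obtain x where x: "x \<in> X" "\<not> independent_arrows C b x"
    using assms(2) unfolding large_in_def by blast
  have xa: "x \<in> arr C"
    using assms(2) x(1) ray_prefix_iff[OF fa] prefixD(2) unfolding large_in_def by blast
  obtain c where c: "b \<preceq> c" "x \<preceq> c"
    using x(2) common_extension_dependent xa path_arr[OF cylD(1)[OF y] b(1)] by blast
  have "deg C b = deg C x + (\<Sum>x\<in>X - {x}. deg C x)" using b(2) x(1) assms(1) by (simp add: sum.remove)
  then have "x \<preceq> b" using prefix_compare[OF c(2,1)] by blast
  then have "y \<in> cyl x" using path_prefix_closed[OF cylD(1)[OF y] b(1)] cylD(1)[OF y] by (simp add: cyl_def)
  then show "y \<in> (\<Union>x\<in>X. cyl x)" using x(1) by blast
qed

text \<open>The map \<open>b y \<mapsto> a y\<close>.\<close>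

definition transfer :: "'a \<Rightarrow> 'a \<Rightarrow> 'a set \<Rightarrow> 'a set" where
  "transfer a b x = shift a (inv_into (cyl (src C b)) (shift b) x)"

lemma acts_transfer:
  assumes "a \<in> arr C" "b \<in> arr C" "src C a = src C b"
  shows "acts (transfer a b) a b"
proof -
  have "inj_on (shift b) (cyl (src C b))"
    by (rule inj_onI) (use shift_inj assms(2) in blast)
  then show ?thesis unfolding acts_def transfer_def using assms by simp
qed

lemma bisection_acts: "acts h a b \<Longrightarrow> bisection (cyl b) h"
  unfolding bisection_def using clopen_cyl acts_inj by blast

definition extend_id :: "'a set set \<Rightarrow> ('a set \<Rightarrow> 'a set) \<Rightarrow> 'a set \<Rightarrow> 'a set" where
  "extend_id W h x = (if x \<in> W then h x else x)"

lemma full_group_extend: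
  assumes "bisection W h" "h ` W = W"
  shows "extend_id W h \<in> full_group"
proof -
  let ?h = "extend_id W h"
  have W: "clopen W" "inj_on h W" using bisectionD[OF assms(1)] by auto
  have mem: "?h x \<in> W \<longleftrightarrow> x \<in> W" for x unfolding extend_id_def using assms(2) by auto
  have inj: "inj ?h"
  proof (rule injI)
    fix x y assume *: "?h x = ?h y"
    then have "x \<in> W \<longleftrightarrow> y \<in> W" using mem by metis
    then show "x = y" using * W(2) unfolding extend_id_def by (auto simp: inj_on_def split: if_splits)
  qed
  moreover have "surj ?h"
    unfolding surj_def
  proof
    fix y show "\<exists>x. y = ?h x"
    proof (cases "y \<in> W")
      case True
      then obtain x where "x \<in> W" "y = h x" using assms(2) by blast
      then show ?thesis unfolding extend_id_def by auto
    next
      case False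
      then show ?thesis unfolding extend_id_def by auto
    qed
  qed
  ultimately have "bij ?h" by (rule bijI)
  moreover have "?h x = x" if "x \<notin> paths" for x
    using clopen_subset[OF W(1)] that unfolding extend_id_def by auto
  moreover have "bisection paths ?h"
  proof -
    have "bisection W ?h" by (rule bisection_cong[OF assms(1)]) (simp add: extend_id_def)
    moreover have "bisection (paths - W) ?h"
      by (rule bisection_cong[OF bisection_id[OF clopen_compl[OF W(1)]]]) (simp add: extend_id_def)
    ultimately have "bisection (W \<union> (paths - W)) ?h"
      by (rule bisection_union) (use inj inj_on_subset in blast)
    moreover have "W \<union> (paths - W) = paths" using clopen_subset[OF W(1)] by blast
    ultimately show ?thesis by simp
  qed
  ultimately show ?thesis unfolding full_group_def by blast
qed

text \<open>For disjoint \<open>V\<close> and \<open>f ` V\<close>, the involution that exchanges them by means of \<open>f\<close>.\<close>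

definition swap_map :: "'a set set \<Rightarrow> ('a set \<Rightarrow> 'a set) \<Rightarrow> 'a set \<Rightarrow> 'a set" where
  "swap_map V f x = (if x \<in> V then f x else if x \<in> f ` V then inv_into V f x else x)"

lemma swap_map_apply:
  assumes "inj_on f V" "V \<inter> f ` V = {}"
  shows "x \<in> V \<Longrightarrow> swap_map V f x = f x" "x \<in> V \<Longrightarrow> swap_map V f (f x) = x"
    "x \<notin> V \<Longrightarrow> x \<notin> f ` V \<Longrightarrow> swap_map V f x = x"
  using assms unfolding swap_map_def by auto

lemma swap_map_full_group:
  assumes "bisection V f" "V \<inter> f ` V = {}"
  shows "swap_map V f \<in> full_group"
proof -
  note V = bisectionD(1,2)[OF assms(1)]
  note ap = swap_map_apply[OF V(2) assms(2)]
  let ?W = "V \<union> f ` V" and ?s = "swap_map V f"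
  have involutive: "?s (?s x) = x" for x
  proof (cases "x \<in> V \<union> f ` V")
    case True
    then show ?thesis using ap(1,2) by auto
  qed (use ap(3) in auto)
  then have inj: "inj ?s" by (metis injI)
  have "bisection V ?s" by (rule bisection_cong[OF assms(1)]) (simp add: swap_map_def)
  moreover have "bisection (f ` V) ?s"
    by (rule bisection_cong[OF bisection_inverse[OF assms(1)]]) (use assms(2) in \<open>auto simp: swap_map_def\<close>)
  ultimately have "bisection ?W ?s" by (rule bisection_union) (use inj inj_on_subset in blast)
  moreover have "?s ` ?W = ?W"
  proof -
    have 1: "?s ` V = f ` V" using ap(1) by auto
    have "?s ` f ` V = V" using ap(2) by (auto simp: image_image)
    then show ?thesis using 1 by (simp add: image_Un Un_commute)
  qed
  ultimately have "extend_id ?W ?s \<in> full_group" by (rule full_group_extend)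
  moreover have "extend_id ?W ?s = ?s" unfolding extend_id_def using ap(3) by (auto simp: fun_eq_iff)
  ultimately show ?thesis by simp
qed

end

locale aperiodic_graph = finite_graph C for C :: "('a, 'k::finite) kgraph" +
  assumes aperiodic: "aperiodic C"
begin

text \<open>The dynamical content of aperiodicity: if \<open>a u\<close> and \<open>c u\<close> are independent, then the images \<open>a u y\<close>
  and \<open>c u y\<close> of \<open>b u y\<close> lie in disjoint cylinders.\<close>

lemma acts_moves:
  assumes "acts h a b" "acts g c b" "a \<noteq> c"
  obtains y where "y \<in> cyl b" "h y \<noteq> g y"
proof -
  note h = actsD[OF assms(1)] and g = actsD[OF assms(2)]
  obtain u where u: "u \<in> arr C" "src C a = tgt C u" "independent_arrows C (cmp C a u) (cmp C c u)"
    using aperiodic h g assms(3) unfolding aperiodic_def by metis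
  have cu: "composable a u" "composable b u" "composable c u"
    using u h g unfolding composable_def by auto
  obtain y where y: "y \<in> cyl (cmp C b u)" using cyl_nonempty composableD(4)[OF cu(2)] by blast
  have "h y \<in> cyl (cmp C a u)" "g y \<in> cyl (cmp C c u)"
    using acts_image[OF acts_ext(2)[OF assms(1) cu(2)]] acts_image[OF acts_ext(2)[OF assms(2) cu(2)]] y
    by blast+
  then have "h y \<noteq> g y" using cyl_disjoint_iff[OF composableD(4)[OF cu(1)] composableD(4)[OF cu(3)]] u(3) by auto
  moreover have "y \<in> cyl b" using y cyl_mono[OF prefix_cmp[OF cu(2)]] by blast
  ultimately show ?thesis using that by blast
qed

lemma acts_unique: "acts h a b \<Longrightarrow> acts h c b \<Longrightarrow> a = c"
  using acts_moves by metis

text \<open>At a degree where \<open>h\<close> acts by arrows, the support is the union of the cylinders of those \<open>b\<close> that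
  are not fixed; by aperiodicity \<open>h\<close> moves points in every non-empty clopen part of such a cylinder.\<close>

lemma full_group_support:
  assumes "h \<in> full_group"
  shows "\<exists>s. is_support {U. clopen U} h s"
proof -
  obtain n where n: "\<forall>b\<in>arr C. deg C b = n \<longrightarrow> cyl b \<inter> paths = {} \<or> cyl b \<subseteq> paths \<and> (\<exists>a. acts h a b)"
    using bisection_level[OF full_groupD(3)[OF assms]] .
  have ex: "\<exists>a. acts h a b" if "b \<in> arr C" "deg C b = n" for b
    using n that cyl_nonempty cyl_subset by blast
  let ?B = "{b \<in> arr C. deg C b = n} \<inter> {b. \<not> acts h b b}"
  let ?s = "\<Union>b\<in>?B. cyl b"
  have "is_support {U. clopen U} h ?s"
    unfolding is_support_def fixes_outside_def
  proof (intro conjI allI impI ballI)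
    have "finite ?B" using finite_level by blast
    then have "clopen ?s" by (rule clopen_UN) (rule clopen_cyl)
    then show "?s \<in> {U. clopen U}" by simp
    show "h x = x" if x: "x \<notin> ?s" for x
    proof (cases "x \<in> paths")
      case True
      then obtain b where b: "b \<in> arr C" "deg C b = n" "x \<in> cyl b" using path_in_cyl by blast
      then have "acts h b b" using x by blast
      moreover obtain y where "y \<in> cyl (src C b)" "x = shift b y" using cyl_shift[OF b(3)] .
      ultimately show ?thesis using actsD(4) by metis
    qed (use full_groupD(2)[OF assms] in blast)
    fix U assume U: "U \<in> {U. clopen U}" "U \<noteq> {} \<and> U \<subseteq> ?s"
    then obtain x b where x: "x \<in> U" "x \<in> cyl b" "b \<in> arr C" "deg C b = n" "\<not> acts h b b" by blast
    obtain a where a: "acts h a b" using ex x by blast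
    obtain c k where c: "x \<in> cyl c" "cyl c \<subseteq> U" "deg C c = deg C b + k" using clopen_nbhd U x by blast
    obtain w where w: "composable b w" "c = cmp C b w" using nbhd_extension[OF x(2) c(1,3)] .
    note e = acts_ext[OF a w(1)]
    have "cmp C a w \<noteq> cmp C b w" using right_cancel[OF e(1) w(1)] a x(5) by blast
    then obtain y where "y \<in> cyl (cmp C b w)" "h y \<noteq> (\<lambda>x. x) y"
      using acts_moves[OF e(2) acts_id[OF composableD(4)[OF w(1)]]] by blast
    then show "\<exists>x\<in>U. h x \<noteq> x" using c(2) w(2) by blast
  qed
  then show ?thesis by blast
qed

end

text \<open>Cofinality says that the local maps act minimally on the path space; as the space is infinite, it
  follows that no path is isolated (\<open>infinite_cyl\<close>).\<close>

locale minimal_graph = aperiodic_graph C for C :: "('a, 'k::finite) kgraph" +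
  assumes cofinal: "cofinal_cat C" and infinite_paths: "infinite paths"
begin

text \<open>A cylinder has as many paths as there are paths that start at the source of its arrow. Hence by
  cofinality one finite cylinder would make all cylinders finite, and with them the path space.\<close>

lemma infinite_cyl:
  assumes "a \<in> arr C"
  shows "infinite (cyl a)"
proof
  assume fin: "finite (cyl a)"
  define e where "e = src C a"
  have e: "e \<in> ids C" unfolding e_def using src_in_ids assms by blast
  have fin_src: "finite (cyl (src C c))" if "finite (cyl c)" "c \<in> arr C" for c
  proof (rule finite_imageD)
    show "finite (shift c ` cyl (src C c))" using that cyl_eq_shift by simp
    show "inj_on (shift c) (cyl (src C c))" by (rule inj_onI) (use shift_inj that in blast)
  qed
  have fe: "finite (cyl e)" unfolding e_def using fin_src[OF fin assms] .
  have "finite (cyl f)" if f: "f \<in> ids C" for f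
  proof -
    obtain X where X: "finite X" "large_in C X f" "\<And>x. x \<in> X \<Longrightarrow> \<exists>c\<in>arr C. tgt C c = e \<and> src C c = src C x"
      using cofinal e f unfolding cofinal_cat_def by metis
    have "finite (cyl x)" if x: "x \<in> X" for x
    proof -
      obtain c where c: "c \<in> arr C" "tgt C c = e" "src C c = src C x" using X(3)[OF x] by blast
      have "cyl c \<subseteq> cyl e" using cyl_mono[OF tgt_prefix[OF c(1)]] c(2) by simp
      then have "finite (cyl (src C x))" using fin_src[OF _ c(1)] fe finite_subset c(3) by metis
      moreover have "x \<in> arr C \<or> cyl x = {}" using cylD(3) by blast
      ultimately show ?thesis using cyl_eq_shift by (metis finite.emptyI finite_imageI)
    qed
    then show ?thesis using large_cover[OF X(1,2) f] X(1) finite_subset by (metis finite_UN_I)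
  qed
  moreover have "paths \<subseteq> (\<Union>f\<in>ids C. cyl f)" using path_in_cyl[of _ 0] degree_zero_id by blast
  ultimately show False using infinite_paths finite_ids finite_subset by (metis finite_UN_I)
qed

lemma infinite_clopen:
  assumes "clopen U" "x \<in> U"
  shows "infinite U"
proof -
  obtain b k where "x \<in> cyl b" "cyl b \<subseteq> U" "deg C b = 0 + k" using clopen_nbhd[OF assms] .
  then show ?thesis using infinite_cyl cylD(3) finite_subset by metis
qed

text \<open>Minimality: some path in \<open>U\<close> has the same tail as \<open>x\<close>.\<close>

lemma orbit_dense:
  assumes "x \<in> paths" "clopen U" "U \<noteq> {}"
  obtains a b where "acts (transfer a b) a b" "x \<in> cyl b" "cyl a \<subseteq> U"
proof -
  obtain z where "z \<in> U" using assms by blast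
  then obtain d k where "z \<in> cyl d" "cyl d \<subseteq> U" "deg C d = 0 + k" using clopen_nbhd assms(2) by blast
  then have d: "cyl d \<subseteq> U" "d \<in> arr C" using cylD(3) by auto
  obtain f where f: "f \<in> arr C" "deg C f = 0" "x \<in> cyl f" using path_in_cyl assms(1) by blast
  have fi: "f \<in> ids C" using degree_zero_id f by blast
  obtain X where X: "finite X" "large_in C X f" "\<And>y. y \<in> X \<Longrightarrow> \<exists>c\<in>arr C. tgt C c = src C d \<and> src C c = src C y"
    using cofinal fi src_in_ids[OF d(2)] unfolding cofinal_cat_def by metis
  obtain y where y: "y \<in> X" "x \<in> cyl y" using large_cover[OF X(1,2) fi] f(3) by blast
  obtain c where c: "c \<in> arr C" "tgt C c = src C d" "src C c = src C y" using X(3)[OF y(1)] by blast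
  have dc: "composable d c" unfolding composable_def using c d by simp
  have "acts (transfer (cmp C d c) y) (cmp C d c) y"
    by (rule acts_transfer) (use composableD[OF dc] c y cylD(3) in auto)
  moreover have "cyl (cmp C d c) \<subseteq> U" using cyl_mono[OF prefix_cmp[OF dc]] d by blast
  ultimately show ?thesis using that y(2) by blast
qed

text \<open>Since \<open>x\<close> is not isolated, \<open>W\<close> has a part away from \<open>x\<close>, which a local map reaches from near \<open>x\<close>.\<close>

lemma move_inside:
  assumes "clopen W" "x \<in> W"
  obtains V f where "bisection V f" "x \<in> V" "V \<subseteq> W" "f ` V \<subseteq> W" "V \<inter> f ` V = {}"
proof -
  have xp: "x \<in> paths" using assms clopen_subset by blast
  have "infinite W" using infinite_clopen assms by blast
  then have "\<exists>y\<in>W. y \<noteq> x" by (metis finite.emptyI finite_insert finite_subset insertI1 insert_subset subsetI)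
  then obtain y where y: "y \<in> W" "y \<noteq> x" by blast
  then have yp: "y \<in> paths" using assms clopen_subset by blast
  obtain c where c: "y \<in> cyl c" "x \<notin> cyl c" using paths_separated[OF yp xp y(2)] .
  have cl: "clopen (W \<inter> cyl c)" using clopen_inter[OF assms(1) clopen_cyl] .
  obtain a b where ab: "acts (transfer a b) a b" "x \<in> cyl b" "cyl a \<subseteq> W \<inter> cyl c"
    using orbit_dense[OF xp cl] y c by blast
  let ?V = "(W \<inter> cyl b) - cyl a"
  have "clopen ?V" using clopen_diff clopen_inter assms(1) clopen_cyl by blast
  then have "bisection ?V (transfer a b)" using bisection_subset[OF bisection_acts[OF ab(1)]] by blast
  moreover have "transfer a b ` ?V \<subseteq> cyl a" using acts_image[OF ab(1)] by blast
  ultimately show ?thesis using that[of ?V "transfer a b"] ab(2,3) c(2) assms(2) by blast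
qed

text \<open>Moving \<open>x\<close> inside smaller and smaller neighbourhoods yields \<open>V\<close> with disjoint copies
  \<open>f1 ` V, \<dots>, f4 ` V\<close> inside \<open>U\<close>. The product of the four involutions that exchange \<open>V\<close> with its copies
  permutes the five sets cyclically, and 5 does not divide 12.\<close>

lemma full_group_rich:
  assumes "clopen U" "U \<noteq> {}"
  shows "\<exists>g\<in>full_group. fixes_outside U g \<and> g ^^ 12 \<noteq> id"
proof -
  obtain x where x: "x \<in> U" using assms by blast
  obtain V1 f1 where 1: "bisection V1 f1" "x \<in> V1" "V1 \<subseteq> U" "f1 ` V1 \<subseteq> U" "V1 \<inter> f1 ` V1 = {}"
    using move_inside[OF assms(1) x] .
  obtain V2 f2 where 2: "bisection V2 f2" "x \<in> V2" "V2 \<subseteq> V1" "f2 ` V2 \<subseteq> V1" "V2 \<inter> f2 ` V2 = {}"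
    using move_inside[OF bisectionD(1)[OF 1(1)] 1(2)] .
  obtain V3 f3 where 3: "bisection V3 f3" "x \<in> V3" "V3 \<subseteq> V2" "f3 ` V3 \<subseteq> V2" "V3 \<inter> f3 ` V3 = {}"
    using move_inside[OF bisectionD(1)[OF 2(1)] 2(2)] .
  obtain V f4 where 4: "bisection V f4" "x \<in> V" "V \<subseteq> V3" "f4 ` V \<subseteq> V3" "V \<inter> f4 ` V = {}"
    using move_inside[OF bisectionD(1)[OF 3(1)] 3(2)] .
  note V = bisectionD(1)[OF 4(1)]
  have b: "bisection V f1" "bisection V f2" "bisection V f3"
    using bisection_subset[OF 1(1) V] bisection_subset[OF 2(1) V] bisection_subset[OF 3(1) V]
      2(3) 3(3) 4(3) by auto
  have sub: "V \<subseteq> V1" "V \<subseteq> V2" "V \<subseteq> V3" using 2(3) 3(3) 4(3) by auto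
  have e1: "V1 \<inter> f1 ` V = {}" using 1(5) sub(1) by blast
  have e2: "V2 \<inter> f2 ` V = {}" using 2(5) sub(2) by blast
  have e3: "V3 \<inter> f3 ` V = {}" using 3(5) sub(3) by blast
  have i2: "f2 ` V \<subseteq> V1" using 2(4) sub(2) by blast
  have i3: "f3 ` V \<subseteq> V2" "f3 ` V \<subseteq> V1" using 3(4) 2(3) sub(3) by blast+
  have i4: "f4 ` V \<subseteq> V3" "f4 ` V \<subseteq> V2" "f4 ` V \<subseteq> V1" using 4(4) 3(3) 2(3) by auto
  have d: "V \<inter> f1 ` V = {}" "V \<inter> f2 ` V = {}" "V \<inter> f3 ` V = {}"
    using e1 e2 e3 sub by auto
  note s = swap_map_apply[OF bisectionD(2)[OF b(1)] d(1)] swap_map_apply[OF bisectionD(2)[OF b(2)] d(2)]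
    swap_map_apply[OF bisectionD(2)[OF b(3)] d(3)] swap_map_apply[OF bisectionD(2)[OF 4(1)] 4(5)]
  let ?s1 = "swap_map V f1" and ?s2 = "swap_map V f2" and ?s3 = "swap_map V f3" and ?s4 = "swap_map V f4"
  define g where "g = ?s1 \<circ> ?s2 \<circ> ?s3 \<circ> ?s4"
  have "g \<in> full_group" unfolding g_def
    using swap_map_full_group[OF b(1) d(1)] swap_map_full_group[OF b(2) d(2)]
      swap_map_full_group[OF b(3) d(3)] swap_map_full_group[OF 4(1,5)] full_group_comp by blast
  moreover have "fixes_outside U g"
    unfolding fixes_outside_def
  proof (intro allI impI)
    fix y assume y: "y \<notin> U"
    have "V \<subseteq> U" "f1 ` V \<subseteq> U" "f2 ` V \<subseteq> U" "f3 ` V \<subseteq> U" "f4 ` V \<subseteq> U"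
      using 1(3,4) sub(1) i2 i3 i4 by auto
    then have "y \<notin> V" "y \<notin> f1 ` V" "y \<notin> f2 ` V" "y \<notin> f3 ` V" "y \<notin> f4 ` V" using y by auto
    then show "g y = y" unfolding g_def using s by simp
  qed
  moreover have "(g ^^ 12) x \<noteq> x"
  proof -
    have inV: "f4 x \<in> f4 ` V" "f3 x \<in> f3 ` V" "f2 x \<in> f2 ` V" "f1 x \<in> f1 ` V" using 4(2) by auto
    have m: "f4 x \<in> V3" "f4 x \<in> V2" "f4 x \<in> V1" "f3 x \<in> V2" "f3 x \<in> V1" "f2 x \<in> V1"
      using inV i2 i3 i4 by auto
    have n4: "f4 x \<notin> f3 ` V" "f4 x \<notin> f2 ` V" "f4 x \<notin> f1 ` V" "f4 x \<notin> V"
      using m(1) e3 apply blast using m(2) e2 apply blast using m(3) e1 apply blast using inV(1) 4(5) by blast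
    have n3: "f3 x \<notin> f4 ` V" "f3 x \<notin> f2 ` V" "f3 x \<notin> f1 ` V" "f3 x \<notin> V"
      using inV(2) i4(1) e3 apply blast using m(4) e2 apply blast using m(5) e1 apply blast using inV(2) d(3) by blast
    have n2: "f2 x \<notin> f4 ` V" "f2 x \<notin> f3 ` V" "f2 x \<notin> f1 ` V" "f2 x \<notin> V"
      using inV(3) i4(2) e2 apply blast using inV(3) i3(1) e2 apply blast using m(6) e1 apply blast using inV(3) d(2) by blast
    have n1: "f1 x \<notin> f4 ` V" "f1 x \<notin> f3 ` V" "f1 x \<notin> f2 ` V" "f1 x \<notin> V"
      using inV(4) i4(3) e1 apply blast using inV(4) i3(2) e1 apply blast using inV(4) i2 e1 apply blast using inV(4) d(1) by blast
    \<comment> \<open>The orbit of \<open>x\<close> is a 5-cycle, and \<open>12 = 2\<close> modulo 5.\<close>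
    have g: "g x = f4 x" "g (f4 x) = f3 x" "g (f3 x) = f2 x" "g (f2 x) = f1 x" "g (f1 x) = x"
      unfolding g_def using s 4(2) n1 n2 n3 n4 by simp_all
    have "(g ^^ 12) x = f3 x" by (simp add: eval_nat_numeral g)
    then show ?thesis using n3 4(2) by auto
  qed
  ultimately show ?thesis by (metis id_apply)
qed

text \<open>By compactness \<open>U\<close> is covered by finitely many cylinders, each displaced inside \<open>U\<close> by some local
  map. The element \<open>g\<close> is built up one cylinder at a time: if \<open>V\<close> is the part of the cylinder outside
  the support \<open>S\<close> reached so far, multiplying with the involution that exchanges \<open>V\<close> and \<open>f ` V\<close>
  enlarges the support to \<open>S \<union> V \<union> f ` V\<close>.\<close>

lemma full_group_full:
  assumes "clopen U"
  shows "\<exists>g\<in>full_group. is_support {U. clopen U} g U"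
proof -
  define Q where "Q b \<longleftrightarrow> cyl b \<inter> U = {} \<or>
    (\<exists>f. bisection (cyl b) f \<and> cyl b \<subseteq> U \<and> f ` cyl b \<subseteq> U \<and> cyl b \<inter> f ` cyl b = {})" for b
  obtain n where n: "\<forall>b\<in>arr C. deg C b = n \<longrightarrow> Q b"
  proof (rule path_compactness[of Q])
    fix x assume x: "x \<in> paths"
    show "\<exists>b\<in>x. Q b"
    proof (cases "x \<in> U")
      case True
      obtain V f where V: "bisection V f" "x \<in> V" "V \<subseteq> U" "f ` V \<subseteq> U" "V \<inter> f ` V = {}"
        using move_inside[OF assms True] .
      obtain b k where b: "x \<in> cyl b" "cyl b \<subseteq> V" "deg C b = 0 + k" using clopen_nbhd[OF bisectionD(1)[OF V(1)] V(2)] .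
      have "bisection (cyl b) f" using bisection_subset[OF V(1) clopen_cyl b(2)] .
      moreover have "cyl b \<subseteq> U" "f ` cyl b \<subseteq> U" "cyl b \<inter> f ` cyl b = {}" using V b by blast+
      ultimately have "Q b" unfolding Q_def by blast
      then show ?thesis using cylD(2)[OF b(1)] by blast
    next
      case False
      then have "x \<in> paths - U" using x by blast
      then obtain b k where b: "x \<in> cyl b" "cyl b \<subseteq> paths - U" "deg C b = 0 + k"
        using clopen_nbhd[OF clopen_compl[OF assms]] by metis
      then have "Q b" unfolding Q_def by blast
      then show ?thesis using cylD(2)[OF b(1)] by blast
    qed
  next
    fix b c assume b: "Q b" "b \<preceq> c"
    note m = cyl_mono[OF b(2)]
    show "Q c"
    proof (cases "cyl b \<inter> U = {}")
      case True
      then show ?thesis unfolding Q_def using m by blast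
    next
      case False
      then obtain f where f: "bisection (cyl b) f" "cyl b \<subseteq> U" "f ` cyl b \<subseteq> U" "cyl b \<inter> f ` cyl b = {}"
        using b(1) unfolding Q_def by blast
      have "bisection (cyl c) f" using bisection_subset[OF f(1) clopen_cyl m] .
      moreover have "cyl c \<subseteq> U" "f ` cyl c \<subseteq> U" "cyl c \<inter> f ` cyl c = {}" using f m by blast+
      ultimately show ?thesis unfolding Q_def by blast
    qed
  next
    fix n assume "\<And>b. b \<in> arr C \<Longrightarrow> deg C b = n \<Longrightarrow> Q b"
    then show thesis by (intro that) blast
  qed
  define B where "B = {b \<in> arr C. deg C b = n} \<inter> {b. cyl b \<inter> U \<noteq> {}}"
  have B: "finite B" unfolding B_def using finite_level by blast
  have cover: "U \<subseteq> (\<Union>b\<in>B. cyl b)"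
  proof
    fix x assume x: "x \<in> U"
    then obtain b where "b \<in> arr C" "deg C b = n" "x \<in> cyl b" using path_in_cyl clopen_subset[OF assms] by blast
    then show "x \<in> (\<Union>b\<in>B. cyl b)" unfolding B_def using x by blast
  qed
  have "\<exists>g\<in>full_group. \<exists>S. is_support {U. clopen U} g S \<and> (\<Union>b\<in>B'. cyl b) \<subseteq> S \<and> S \<subseteq> U"
    if "finite B'" "B' \<subseteq> B" for B'
    using that
  proof (induction B' rule: finite_induct)
    case empty
    have "is_support {U. clopen U} id {}"
      unfolding is_support_def fixes_outside_def using clopen_empty by simp
    then show ?case using full_group_id by blast
  next
    case (insert b B')
    then obtain g S where g: "g \<in> full_group" "is_support {U. clopen U} g S" "(\<Union>b\<in>B'. cyl b) \<subseteq> S" "S \<subseteq> U"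
      by auto
    have "Q b" "cyl b \<inter> U \<noteq> {}" using insert.prems n unfolding B_def by auto
    then obtain f where f: "bisection (cyl b) f" "cyl b \<subseteq> U" "f ` cyl b \<subseteq> U" "cyl b \<inter> f ` cyl b = {}"
      unfolding Q_def by blast
    have S: "clopen S" "fixes_outside S g" "\<And>b. clopen b \<Longrightarrow> b \<noteq> {} \<Longrightarrow> b \<subseteq> S \<Longrightarrow> \<exists>x\<in>b. g x \<noteq> x"
      using g(2) unfolding is_support_def by auto
    have gS: "g x \<in> S \<longleftrightarrow> x \<in> S" for x
      using fixes_outside_maps[OF S(2)] full_groupD(1)[OF g(1)] bij_is_inj by blast
    have gout: "g x = x" if "x \<notin> S" for x using S(2) that unfolding fixes_outside_def by blast
    define V where "V = cyl b - S"
    have V: "clopen V" unfolding V_def using clopen_diff[OF clopen_cyl S(1)] .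
    have bV: "bisection V f" using bisection_subset[OF f(1) V] unfolding V_def by blast
    have dV: "V \<inter> f ` V = {}" using f(4) unfolding V_def by blast
    note sw = swap_map_apply[OF bisectionD(2)[OF bV] dV]
    let ?h = "g \<circ> swap_map V f" and ?S = "S \<union> V \<union> f ` V"
    have h: "?h \<in> full_group" using full_group_comp g(1) swap_map_full_group[OF bV dV] by blast
    have moved1: "?h x \<noteq> x" if x: "x \<in> V" for x
    proof (cases "f x \<in> S")
      case True
      then have "g (f x) \<in> S" using gS by blast
      then show ?thesis using sw(1)[OF x] x unfolding V_def by auto
    next
      case False
      then have "?h x = f x" using sw(1)[OF x] gout by simp
      then show ?thesis using dV x by (metis IntI empty_iff imageI)
    qed
    have moved2: "?h x \<noteq> x" if x: "x \<in> f ` V" for x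
    proof -
      obtain y where y: "y \<in> V" "x = f y" using x by blast
      then have "?h x = y" using sw(2)[OF y(1)] gout unfolding V_def by auto
      then show ?thesis using dV y x by blast
    qed
    have "is_support {U. clopen U} ?h ?S"
      unfolding is_support_def fixes_outside_def
    proof (intro conjI allI impI ballI)
      show "?S \<in> {U. clopen U}" using clopen_union S(1) V bisection_clopen_image[OF bV] by blast
      show "?h x = x" if "x \<notin> ?S" for x using that sw(3) gout by auto
      fix c assume c: "c \<in> {U. clopen U}" "c \<noteq> {} \<and> c \<subseteq> ?S"
      show "\<exists>x\<in>c. ?h x \<noteq> x"
      proof (cases "c \<inter> (V \<union> f ` V) = {}")
        case True
        then have "c \<subseteq> S" using c(2) by blast
        then obtain x where x: "x \<in> c" "g x \<noteq> x" using S(3)[of c] c by auto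
        then have "x \<notin> V" "x \<notin> f ` V" using True by auto
        then have "?h x \<noteq> x" using sw(3) x(2) by simp
        then show ?thesis using x(1) by blast
      next
        case False
        then show ?thesis using moved1 moved2 by blast
      qed
    qed
    moreover have "(\<Union>b\<in>insert b B'. cyl b) \<subseteq> ?S" using g(3) unfolding V_def by blast
    moreover have "?S \<subseteq> U" using g(4) f(2,3) unfolding V_def by blast
    ultimately show ?case using h by blast
  qed
  from this[OF B order_refl]
  obtain g S where g: "g \<in> full_group" "is_support {U. clopen U} g S" "(\<Union>b\<in>B. cyl b) \<subseteq> S" "S \<subseteq> U"
    by blast
  then have "S = U" using cover by blast
  then show ?thesis using g by blast
qed

text \<open>A point that is moved has a neighbourhood \<open>V\<close> that is displaced, and the involution that exchanges
  \<open>V\<close> and its image agrees with the given map on \<open>V\<close>.\<close>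

lemma bisection_extends_moving:
  assumes "bisection U T" "x \<in> U" "T x \<noteq> x"
  obtains V g where "clopen V" "x \<in> V" "V \<subseteq> U" "g \<in> full_group" "\<And>y. y \<in> V \<Longrightarrow> g y = T y"
proof -
  have xp: "x \<in> paths" "T x \<in> paths"
    using assms(2) clopen_subset[OF bisectionD(1)[OF assms(1)]] clopen_subset[OF bisection_clopen_image[OF assms(1)]] by auto
  obtain a where a: "x \<in> cyl a" "T x \<notin> cyl a" using paths_separated xp assms(3) by metis
  let ?V = "{y \<in> U. T y \<in> paths - cyl a} \<inter> cyl a"
  have V: "clopen ?V"
    using clopen_inter[OF bisection_preimage[OF assms(1) clopen_compl[OF clopen_cyl]] clopen_cyl] .
  then have bV: "bisection ?V T" using bisection_subset[OF assms(1)] by blast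
  have d: "?V \<inter> T ` ?V = {}" by blast
  show ?thesis
  proof (rule that)
    show "clopen ?V" by (rule V)
    show "x \<in> ?V" "?V \<subseteq> U" using assms a xp by auto
    show "swap_map ?V T \<in> full_group" by (rule swap_map_full_group[OF bV d])
    show "\<And>y. y \<in> ?V \<Longrightarrow> swap_map ?V T y = T y" by (rule swap_map_apply(1)[OF bisectionD(2)[OF bV] d])
  qed
qed

text \<open>Every bisection agrees near each path with an element of the full group. At a fixed point, it is
  written as the product of two local maps that move the relevant points: some \<open>f\<close> and \<open>T \<circ> f\<^sup>-\<^sup>1\<close>.\<close>

lemma bisection_extends:
  assumes "bisection U T" "x \<in> U"
  obtains V g where "clopen V" "x \<in> V" "V \<subseteq> U" "g \<in> full_group" "\<And>y. y \<in> V \<Longrightarrow> g y = T y"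
proof (cases "T x = x")
  case False
  show ?thesis using bisection_extends_moving[OF assms False] that by blast
next
  case True
  obtain V0 f where f: "bisection V0 f" "x \<in> V0" "V0 \<subseteq> U" "f ` V0 \<subseteq> U" "V0 \<inter> f ` V0 = {}"
    using move_inside[OF bisectionD(1)[OF assms(1)] assms(2)] .
  have fx: "f x \<noteq> x" using f(2,5) by (metis IntI empty_iff imageI)
  note finv = inv_into_f_f[OF bisectionD(2)[OF f(1)]]
  let ?W = "{y \<in> f ` V0. inv_into V0 f y \<in> U}"
  have bW: "bisection ?W (T \<circ> inv_into V0 f)"
    by (rule bisection_comp[OF bisection_inverse[OF f(1)] assms(1)])
  have fxW: "f x \<in> ?W" using f(2,3) finv by auto
  have "(T \<circ> inv_into V0 f) (f x) \<noteq> f x" using True fx finv[OF f(2)] by simp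
  then obtain V1 g1 where 1: "clopen V1" "f x \<in> V1" "V1 \<subseteq> ?W" "g1 \<in> full_group"
      "\<And>y. y \<in> V1 \<Longrightarrow> g1 y = (T \<circ> inv_into V0 f) y"
    using bisection_extends_moving[OF bW fxW] by blast
  obtain V2 g2 where 2: "clopen V2" "x \<in> V2" "V2 \<subseteq> V0" "g2 \<in> full_group" "\<And>y. y \<in> V2 \<Longrightarrow> g2 y = f y"
    using bisection_extends_moving[OF f(1,2) fx] by blast
  show ?thesis
  proof (rule that)
    show "clopen {y \<in> V2. f y \<in> V1}" by (rule bisection_preimage[OF bisection_subset[OF f(1) 2(1,3)] 1(1)])
    show "x \<in> {y \<in> V2. f y \<in> V1}" "{y \<in> V2. f y \<in> V1} \<subseteq> U" using 1(2) 2(2,3) f(3) by auto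
    show "g1 \<circ> g2 \<in> full_group" using full_group_comp 1(4) 2(4) by blast
    show "(g1 \<circ> g2) y = T y" if "y \<in> {y \<in> V2. f y \<in> V1}" for y
      using that 1(5)[of "f y"] 2(3,5) finv[of y] by auto
  qed
qed

end

section \<open>The inverse monoid of bijective morphisms of right ideals\<close>

lemma map_comp_Some_iff: "(f \<circ>\<^sub>m g) x = Some z \<longleftrightarrow> (\<exists>y. g x = Some y \<and> f y = Some z)"
  unfolding map_comp_def by (cases "g x") auto

definition map_inverse :: "('a \<rightharpoonup> 'b) \<Rightarrow> ('b \<rightharpoonup> 'a)" where
  "map_inverse f y = (if y \<in> ran f then Some (SOME x. f x = Some y) else None)"

lemma map_inverse_iff:
  assumes "inj_on f (dom f)"
  shows "map_inverse f y = Some x \<longleftrightarrow> f x = Some y"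
proof
  assume "f x = Some y"
  moreover from this have "(SOME x. f x = Some y) = x"
    using assms by (intro some_equality) (auto simp: inj_on_def dom_def)
  ultimately show "map_inverse f y = Some x" unfolding map_inverse_def by (auto simp: ran_def)
next
  assume "map_inverse f y = Some x"
  then have "x = (SOME x. f x = Some y)" "\<exists>x. f x = Some y"
    unfolding map_inverse_def by (auto simp: ran_def split: if_splits)
  then show "f x = Some y" using someI_ex[of "\<lambda>x. f x = Some y"] by simp
qed

definition id_map :: "'a set \<Rightarrow> ('a \<rightharpoonup> 'a)" where
  "id_map R = (\<lambda>a. if a \<in> R then Some a else None)"

lemma id_map_iff: "id_map R a = Some b \<longleftrightarrow> a \<in> R \<and> a = b"
  unfolding id_map_def by auto

lemma dom_id_map: "dom (id_map R) = R" "ran (id_map R) = R"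
  unfolding id_map_def by (auto simp: dom_def ran_def)

lemma map_eqI: "(\<And>x y. f x = Some y \<longleftrightarrow> g x = Some y) \<Longrightarrow> f = g"
  by (rule ext) (metis not_None_eq)

lemma map_inj_iff: "inj_on f (dom f) \<longleftrightarrow> (\<forall>x x' y. f x = Some y \<and> f x' = Some y \<longrightarrow> x = x')"
  by (auto simp: inj_on_def dom_def)

context finite_graph
begin

lemma fg_right_ideal_iff:
  "fg_right_ideal C R \<longleftrightarrow> (\<exists>F. finite F \<and> F \<subseteq> arr C \<and> R = {x. \<exists>a\<in>F. a \<preceq> x})"
proof
  assume "fg_right_ideal C R"
  then obtain F where F: "finite F" "F \<subseteq> arr C" "R = (\<Union>x\<in>F. ray C x)"
    unfolding fg_right_ideal_def by blast
  then have "R = {x. \<exists>a\<in>F. a \<preceq> x}" using ray_prefix_iff by blast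
  then show "\<exists>F. finite F \<and> F \<subseteq> arr C \<and> R = {x. \<exists>a\<in>F. a \<preceq> x}" using F by blast
next
  assume "\<exists>F. finite F \<and> F \<subseteq> arr C \<and> R = {x. \<exists>a\<in>F. a \<preceq> x}"
  then obtain F where F: "finite F" "F \<subseteq> arr C" "R = {x. \<exists>a\<in>F. a \<preceq> x}" by blast
  have R: "R = (\<Union>x\<in>F. ray C x)" using F ray_prefix_iff by blast
  have sub: "R \<subseteq> arr C" using F(3) prefixD(2) by blast
  moreover have "(\<Union>x\<in>R. ray C x) \<subseteq> R"
  proof
    fix y assume "y \<in> (\<Union>x\<in>R. ray C x)"
    then obtain x where x: "x \<in> R" "x \<preceq> y" using ray_prefix_iff sub by blast
    then obtain a where "a \<in> F" "a \<preceq> x" using F(3) by blast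
    then show "y \<in> R" using F(3) prefix_trans[OF _ x(2)] by blast
  qed
  ultimately show "fg_right_ideal C R" unfolding fg_right_ideal_def right_ideal_def using F(1,2) R by blast
qed

lemma fg_right_idealD:
  assumes "fg_right_ideal C R"
  shows "R \<subseteq> arr C" "x \<in> R \<Longrightarrow> x \<preceq> y \<Longrightarrow> y \<in> R"
proof -
  obtain F where F: "R = {x. \<exists>a\<in>F. a \<preceq> x}" using assms unfolding fg_right_ideal_iff by blast
  show "R \<subseteq> arr C" using F prefixD(2) by blast
  show "y \<in> R" if xy: "x \<in> R" "x \<preceq> y"
  proof -
    obtain a where "a \<in> F" "a \<preceq> x" using F xy(1) by blast
    then show ?thesis using F prefix_trans[OF _ xy(2)] by blast
  qed
qed

lemma fg_ray: "a \<in> arr C \<Longrightarrow> fg_right_ideal C {x. a \<preceq> x}"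
  unfolding fg_right_ideal_iff by (rule exI[of _ "{a}"]) auto

lemma fg_empty: "fg_right_ideal C {}"
  unfolding fg_right_ideal_iff by (rule exI[of _ "{}"]) auto

lemma fg_level: "fg_right_ideal C {x \<in> arr C. \<exists>k. deg C x = n + k}"
proof -
  have "{x \<in> arr C. \<exists>k. deg C x = n + k} = {x. \<exists>a\<in>{a \<in> arr C. deg C a = n}. a \<preceq> x}" (is "?L = ?R")
  proof
    show "?L \<subseteq> ?R"
    proof
      fix x assume "x \<in> ?L"
      then obtain k where k: "x \<in> arr C" "deg C x = n + k" by blast
      obtain a where "a \<preceq> x" "deg C a = n" using prefix_of_degree[OF k] .
      then show "x \<in> ?R" using prefixD(1) by blast
    qed
    show "?R \<subseteq> ?L"
    proof
      fix x assume "x \<in> ?R"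
      then obtain a c where "deg C a = n" "composable a c" "x = cmp C a c" unfolding prefix_def by blast
      then show "x \<in> ?L" using composableD(4,7) by auto
    qed
  qed
  then show ?thesis
    unfolding fg_right_ideal_iff by (intro exI[of _ "{a \<in> arr C. deg C a = n}"]) (simp add: finite_level)
qed

lemma fg_UN:
  assumes "finite I" "\<And>i. i \<in> I \<Longrightarrow> fg_right_ideal C (R i)"
  shows "fg_right_ideal C (\<Union>i\<in>I. R i)"
proof -
  have "\<forall>i\<in>I. \<exists>F. finite F \<and> F \<subseteq> arr C \<and> R i = {x. \<exists>a\<in>F. a \<preceq> x}"
    using assms(2) unfolding fg_right_ideal_iff by blast
  then obtain F where F: "\<forall>i\<in>I. finite (F i) \<and> F i \<subseteq> arr C \<and> R i = {x. \<exists>a\<in>F i. a \<preceq> x}" by metis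
  show ?thesis unfolding fg_right_ideal_iff
  proof (intro exI[of _ "\<Union>i\<in>I. F i"] conjI)
    show "finite (\<Union>i\<in>I. F i)" "(\<Union>i\<in>I. F i) \<subseteq> arr C" using F assms(1) by auto
    have "(\<Union>i\<in>I. R i) = (\<Union>i\<in>I. {x. \<exists>a\<in>F i. a \<preceq> x})" using F by simp
    then show "(\<Union>i\<in>I. R i) = {x. \<exists>a\<in>\<Union>i\<in>I. F i. a \<preceq> x}" by blast
  qed
qed

text \<open>The common extensions of \<open>a\<close> and \<open>b\<close> are generated by those whose degree is the supremum of the
  degrees of \<open>a\<close> and \<open>b\<close>; there are finitely many of these.\<close>

lemma fg_inter_ray:
  assumes "a \<in> arr C" "b \<in> arr C"
  shows "fg_right_ideal C ({x. a \<preceq> x} \<inter> {x. b \<preceq> x})"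
proof -
  define m where "m = (\<chi> i. max (deg C a $ i) (deg C b $ i))"
  have m: "m = deg C a + (\<chi> i. m $ i - deg C a $ i)" "m = deg C b + (\<chi> i. m $ i - deg C b $ i)"
    unfolding m_def by (simp_all add: vec_eq_iff)
  let ?F = "{c \<in> arr C. deg C c = m} \<inter> {c. a \<preceq> c \<and> b \<preceq> c}"
  have "finite ?F" using finite_level by blast
  moreover have "{x. a \<preceq> x} \<inter> {x. b \<preceq> x} = {x. \<exists>c\<in>?F. c \<preceq> x}"
  proof
    show "{x. a \<preceq> x} \<inter> {x. b \<preceq> x} \<subseteq> {x. \<exists>c\<in>?F. c \<preceq> x}"
    proof
      fix x assume "x \<in> {x. a \<preceq> x} \<inter> {x. b \<preceq> x}"
      then have x: "a \<preceq> x" "b \<preceq> x" by auto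
      obtain k l where "deg C x = deg C a + k" "deg C x = deg C b + l"
        using x composableD(7) unfolding prefix_def by metis
      then have "deg C a $ i \<le> deg C x $ i" "deg C b $ i \<le> deg C x $ i" for i
        by (metis le_add1 vector_add_component)+
      then have "deg C x = m + (\<chi> i. deg C x $ i - m $ i)"
        unfolding m_def by (simp add: vec_eq_iff)
      then obtain c where c: "c \<preceq> x" "deg C c = m"
        using prefix_of_degree[OF prefixD(2)[OF x(1)]] by blast
      have "a \<preceq> c" "b \<preceq> c" using prefix_compare[OF x(1) c(1)] prefix_compare[OF x(2) c(1)] c(2) m by metis+
      then show "x \<in> {x. \<exists>c\<in>?F. c \<preceq> x}" using c prefixD(1) by blast
    qed
    show "{x. \<exists>c\<in>?F. c \<preceq> x} \<subseteq> {x. a \<preceq> x} \<inter> {x. b \<preceq> x}"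
    proof
      fix x assume "x \<in> {x. \<exists>c\<in>?F. c \<preceq> x}"
      then obtain c where "a \<preceq> c" "b \<preceq> c" "c \<preceq> x" by blast
      then show "x \<in> {x. a \<preceq> x} \<inter> {x. b \<preceq> x}" using prefix_trans[of _ c x] by simp
    qed
  qed
  moreover have "?F \<subseteq> arr C" by blast
  ultimately show ?thesis unfolding fg_right_ideal_iff by (intro exI[of _ ?F] conjI)
qed

lemma fg_inter:
  assumes "fg_right_ideal C R" "fg_right_ideal C S"
  shows "fg_right_ideal C (R \<inter> S)"
proof -
  obtain F where F: "finite F" "F \<subseteq> arr C" "R = {x. \<exists>a\<in>F. a \<preceq> x}" using assms(1) unfolding fg_right_ideal_iff by blast
  obtain H where H: "finite H" "H \<subseteq> arr C" "S = {x. \<exists>a\<in>H. a \<preceq> x}" using assms(2) unfolding fg_right_ideal_iff by blast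
  have "R \<inter> S = (\<Union>(a, b)\<in>F \<times> H. {x. a \<preceq> x} \<inter> {x. b \<preceq> x})" using F(3) H(3) by auto
  moreover have "fg_right_ideal C (\<Union>(a, b)\<in>F \<times> H. {x. a \<preceq> x} \<inter> {x. b \<preceq> x})"
    by (rule fg_UN) (use F H fg_inter_ray in auto)
  ultimately show ?thesis by simp
qed

definition equivariant :: "('a \<rightharpoonup> 'a) \<Rightarrow> bool" where
  "equivariant f \<longleftrightarrow> dom f \<subseteq> arr C \<and> (\<forall>r s. f r = Some s \<longrightarrow> s \<in> arr C \<and> src C s = src C r \<and>
    (\<forall>c. composable r c \<longrightarrow> f (cmp C r c) = Some (cmp C s c)))"

lemma equivariantD:
  assumes "equivariant f" "f r = Some s"
  shows "r \<in> arr C" "s \<in> arr C" "src C s = src C r" "composable r c \<Longrightarrow> f (cmp C r c) = Some (cmp C s c)"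
    "composable r c \<longleftrightarrow> composable s c"
  using assms unfolding equivariant_def composable_def by auto

lemma ideal_iso_iff:
  "ideal_iso C f \<longleftrightarrow> fg_right_ideal C (dom f) \<and> fg_right_ideal C (ran f) \<and> inj_on f (dom f) \<and> equivariant f"
proof
  assume *: "ideal_iso C f"
  then have fg: "fg_right_ideal C (dom f)" "fg_right_ideal C (ran f)" "inj_on f (dom f)"
    unfolding ideal_iso_def by auto
  have "s \<in> arr C" if "f r = Some s" for r s
    using fg_right_idealD(1)[OF fg(2)] that by (auto simp: ran_def)
  then have "equivariant f"
    unfolding equivariant_def using * fg_right_idealD(1)[OF fg(1)]
    unfolding ideal_iso_def composable_def by blast
  then show "fg_right_ideal C (dom f) \<and> fg_right_ideal C (ran f) \<and> inj_on f (dom f) \<and> equivariant f"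
    using fg by blast
next
  assume *: "fg_right_ideal C (dom f) \<and> fg_right_ideal C (ran f) \<and> inj_on f (dom f) \<and> equivariant f"
  then show "ideal_iso C f"
    unfolding ideal_iso_def equivariant_def composable_def by (auto simp: dom_def)
qed

lemma fg_image:
  assumes "equivariant f" "fg_right_ideal C R" "R \<subseteq> dom f"
  shows "fg_right_ideal C {s. \<exists>r\<in>R. f r = Some s}"
proof -
  obtain F where F: "finite F" "F \<subseteq> arr C" "R = {x. \<exists>a\<in>F. a \<preceq> x}" using assms(2) unfolding fg_right_ideal_iff by blast
  have FR: "F \<subseteq> R" using F prefix_refl by blast
  let ?H = "(\<lambda>a. the (f a)) ` F"
  have fF: "f a = Some (the (f a))" if "a \<in> F" for a using FR assms(3) that by auto
  have "{s. \<exists>r\<in>R. f r = Some s} = {x. \<exists>a\<in>?H. a \<preceq> x}"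
  proof
    show "{s. \<exists>r\<in>R. f r = Some s} \<subseteq> {x. \<exists>a\<in>?H. a \<preceq> x}"
    proof
      fix s assume "s \<in> {s. \<exists>r\<in>R. f r = Some s}"
      then obtain r where r: "r \<in> R" "f r = Some s" by blast
      then obtain a c where a: "a \<in> F" "composable a c" "r = cmp C a c" using F(3) unfolding prefix_def by blast
      then have "s = cmp C (the (f a)) c" "composable (the (f a)) c"
        using equivariantD(4,5)[OF assms(1) fF] r(2) by auto
      then show "s \<in> {x. \<exists>a\<in>?H. a \<preceq> x}" using prefix_cmp a(1) by blast
    qed
    show "{x. \<exists>a\<in>?H. a \<preceq> x} \<subseteq> {s. \<exists>r\<in>R. f r = Some s}"
    proof
      fix x assume "x \<in> {x. \<exists>a\<in>?H. a \<preceq> x}"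
      then obtain a c where a: "a \<in> F" "composable (the (f a)) c" "x = cmp C (the (f a)) c"
        unfolding prefix_def by blast
      then have "composable a c" using equivariantD(5)[OF assms(1) fF] by blast
      then have "f (cmp C a c) = Some x" "cmp C a c \<in> R"
        using equivariantD(4)[OF assms(1) fF[OF a(1)]] a(1,3) prefix_cmp F(3) by auto
      then show "x \<in> {s. \<exists>r\<in>R. f r = Some s}" by blast
    qed
  qed
  moreover have "?H \<subseteq> arr C" using equivariantD(2)[OF assms(1) fF] by blast
  ultimately show ?thesis unfolding fg_right_ideal_iff using F(1) by (intro exI[of _ ?H]) simp
qed

lemma ideal_isoD:
  assumes "ideal_iso C f"
  shows "fg_right_ideal C (dom f)" "fg_right_ideal C (ran f)" "inj_on f (dom f)" "equivariant f"
  using assms ideal_iso_iff by auto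

lemma ideal_iso_id: "fg_right_ideal C R \<Longrightarrow> ideal_iso C (id_map R)"
  unfolding ideal_iso_iff equivariant_def dom_id_map id_map_iff
  using fg_right_idealD prefix_cmp by (auto simp: inj_on_def id_map_def)

lemma ideal_iso_inverse:
  assumes "ideal_iso C f"
  shows "ideal_iso C (map_inverse f)"
proof -
  note f = ideal_isoD[OF assms] and inv = map_inverse_iff[OF ideal_isoD(3)[OF assms]]
  have "dom (map_inverse f) = ran f" "ran (map_inverse f) = dom f"
    using inv by (auto simp: dom_def ran_def)
  moreover have "inj_on (map_inverse f) (dom (map_inverse f))"
    unfolding map_inj_iff inv by auto
  moreover have "equivariant (map_inverse f)"
    unfolding equivariant_def inv
  proof (intro conjI allI impI)
    show "dom (map_inverse f) \<subseteq> arr C" using calculation(1) fg_right_idealD(1)[OF f(2)] by simp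
    fix r s assume sr: "f s = Some r"
    show "s \<in> arr C" "src C s = src C r" using equivariantD[OF f(4) sr] by auto
    fix c assume "composable r c"
    then show "f (cmp C s c) = Some (cmp C r c)" using equivariantD[OF f(4) sr] by blast
  qed
  ultimately show ?thesis unfolding ideal_iso_iff using f by simp
qed

lemma ideal_iso_comp:
  assumes "ideal_iso C f" "ideal_iso C g"
  shows "ideal_iso C (f \<circ>\<^sub>m g)"
proof -
  note f = ideal_isoD[OF assms(1)] and g = ideal_isoD[OF assms(2)]
  note gi = ideal_isoD[OF ideal_iso_inverse[OF assms(2)]]
  note inv = map_inverse_iff[OF g(3)]
  let ?I = "dom f \<inter> ran g"
  have I: "fg_right_ideal C ?I" using fg_inter f g by blast
  have "dom (f \<circ>\<^sub>m g) = {r. \<exists>s\<in>?I. map_inverse g s = Some r}"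
    unfolding inv by (auto simp: dom_def ran_def map_comp_Some_iff)
  moreover have "fg_right_ideal C {r. \<exists>s\<in>?I. map_inverse g s = Some r}"
  proof (rule fg_image[OF gi(4) I])
    show "?I \<subseteq> dom (map_inverse g)" using inv by (auto simp: dom_def ran_def)
  qed
  moreover have "ran (f \<circ>\<^sub>m g) = {t. \<exists>s\<in>?I. f s = Some t}"
    by (auto simp: dom_def ran_def map_comp_Some_iff)
  moreover have "fg_right_ideal C {t. \<exists>s\<in>?I. f s = Some t}" by (rule fg_image[OF f(4) I]) blast
  moreover have "inj_on (f \<circ>\<^sub>m g) (dom (f \<circ>\<^sub>m g))"
    using f(3) g(3) unfolding map_inj_iff map_comp_Some_iff by metis
  moreover have "equivariant (f \<circ>\<^sub>m g)"
    unfolding equivariant_def map_comp_Some_iff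
  proof (intro conjI allI impI)
    show "dom (f \<circ>\<^sub>m g) \<subseteq> arr C" using equivariantD(1)[OF g(4)] by (auto simp: dom_def map_comp_Some_iff)
    fix r t assume "\<exists>s. g r = Some s \<and> f s = Some t"
    then obtain s where s: "g r = Some s" "f s = Some t" by blast
    show "t \<in> arr C" "src C t = src C r" using equivariantD[OF g(4) s(1)] equivariantD[OF f(4) s(2)] by auto
    fix c assume "composable r c"
    then show "\<exists>y. g (cmp C r c) = Some y \<and> f y = Some (cmp C t c)"
      using equivariantD[OF g(4) s(1)] equivariantD[OF f(4) s(2)] by blast
  qed
  ultimately show ?thesis unfolding ideal_iso_iff by simp
qed

lemma R_monoid_simps:
  "f \<in> carrier (R_monoid C) \<longleftrightarrow> ideal_iso C f" "mult (R_monoid C) = (\<circ>\<^sub>m)"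
  unfolding R_monoid_def by auto

lemma map_inverse_comp:
  assumes "inj_on f (dom f)"
  shows "map_inverse f \<circ>\<^sub>m f = id_map (dom f)" "f \<circ>\<^sub>m map_inverse f = id_map (ran f)"
proof -
  have inj: "x = x'" if "f x = Some y" "f x' = Some y" for x x' y
    using assms that unfolding map_inj_iff by blast
  show "map_inverse f \<circ>\<^sub>m f = id_map (dom f)"
    by (rule map_eqI) (auto simp: map_comp_Some_iff id_map_iff map_inverse_iff[OF assms] dest: inj)
  show "f \<circ>\<^sub>m map_inverse f = id_map (ran f)"
    by (rule map_eqI) (auto simp: map_comp_Some_iff id_map_iff map_inverse_iff[OF assms] ran_def)
qed

lemma map_generalized_inverse:
  assumes "inj_on f (dom f)" "inj_on g (dom g)" "f \<circ>\<^sub>m g \<circ>\<^sub>m f = f" "g \<circ>\<^sub>m f \<circ>\<^sub>m g = g"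
  shows "g = map_inverse f"
proof (rule map_eqI)
  fix x y
  have "g x = Some y \<longleftrightarrow> f y = Some x"
  proof
    assume *: "g x = Some y"
    then have "(g \<circ>\<^sub>m f \<circ>\<^sub>m g) x = Some y" using assms(4) by simp
    then obtain z where "f y = Some z" "g z = Some y" using * by (auto simp: map_comp_Some_iff)
    then show "f y = Some x" using assms(2) * unfolding map_inj_iff by metis
  next
    assume *: "f y = Some x"
    then have "(f \<circ>\<^sub>m g \<circ>\<^sub>m f) y = Some x" using assms(3) by simp
    then obtain z where "g x = Some z" "f z = Some x" using * by (auto simp: map_comp_Some_iff)
    then show "g x = Some y" using assms(1) * unfolding map_inj_iff by metis
  qed
  then show "g x = Some y \<longleftrightarrow> map_inverse f x = Some y" using map_inverse_iff[OF assms(1)] by simp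
qed

text \<open>The submonoid \<open>S\<close> is either the whole monoid or its essential part.\<close>

lemma pinv_sub_monoid:
  assumes "ideal_iso C f" "f \<in> carrier S" "map_inverse f \<in> carrier S" "mult S = (\<circ>\<^sub>m)"
    "\<And>g. g \<in> carrier S \<Longrightarrow> ideal_iso C g"
  shows "pinv S f = map_inverse f"
  unfolding pinv_def assms(4)
proof (rule the_equality)
  note inj = ideal_isoD(3)[OF assms(1)]
  have "f \<circ>\<^sub>m map_inverse f \<circ>\<^sub>m f = f"
    by (rule map_eqI) (auto simp: map_inverse_comp[OF inj] map_comp_Some_iff id_map_iff ran_def)
  moreover have "map_inverse f \<circ>\<^sub>m f \<circ>\<^sub>m map_inverse f = map_inverse f"
    by (rule map_eqI)
      (auto simp: map_inverse_comp[OF inj] map_comp_Some_iff id_map_iff map_inverse_iff[OF inj])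
  ultimately show "map_inverse f \<in> carrier S \<and> f \<circ>\<^sub>m map_inverse f \<circ>\<^sub>m f = f \<and>
      map_inverse f \<circ>\<^sub>m f \<circ>\<^sub>m map_inverse f = map_inverse f"
    using assms(3) by blast
next
  fix g assume g: "g \<in> carrier S \<and> f \<circ>\<^sub>m g \<circ>\<^sub>m f = f \<and> g \<circ>\<^sub>m f \<circ>\<^sub>m g = g"
  show "g = map_inverse f"
    by (rule map_generalized_inverse[OF ideal_isoD(3)[OF assms(1)] ideal_isoD(3)[OF assms(5)]])
      (use g in auto)
qed

lemma pinv_R: "ideal_iso C f \<Longrightarrow> pinv (R_monoid C) f = map_inverse f"
  by (rule pinv_sub_monoid) (auto simp: R_monoid_simps ideal_iso_inverse)

lemma map_le_iff_restrict:
  assumes "inj_on z (dom z)"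
  shows "z = s \<circ>\<^sub>m map_inverse z \<circ>\<^sub>m z \<longleftrightarrow> z \<subseteq>\<^sub>m s"
proof -
  have "s \<circ>\<^sub>m map_inverse z \<circ>\<^sub>m z = s \<circ>\<^sub>m id_map (dom z)"
    by (rule map_eqI) (auto simp: map_comp_Some_iff map_inverse_iff[OF assms] id_map_iff dom_def,
      use assms in \<open>auto simp: map_inj_iff\<close>)
  moreover have "z = s \<circ>\<^sub>m id_map (dom z) \<longleftrightarrow> z \<subseteq>\<^sub>m s"
  proof
    assume *: "z = s \<circ>\<^sub>m id_map (dom z)"
    have "z a = s a" if "a \<in> dom z" for a
      using fun_cong[OF *, of a] that by (simp add: map_comp_def id_map_def)
    then show "z \<subseteq>\<^sub>m s" unfolding map_le_def by blast
  next
    assume *: "z \<subseteq>\<^sub>m s"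
    show "z = s \<circ>\<^sub>m id_map (dom z)"
    proof
      fix a show "z a = (s \<circ>\<^sub>m id_map (dom z)) a"
        using * unfolding map_le_def by (cases "a \<in> dom z") (auto simp: map_comp_def id_map_def)
    qed
  qed
  ultimately show ?thesis by simp
qed

lemma nat_le_R: "nat_le (R_monoid C) z s \<longleftrightarrow> ideal_iso C z \<and> ideal_iso C s \<and> z \<subseteq>\<^sub>m s"
  unfolding nat_le_def R_monoid_simps
  using pinv_R map_le_iff_restrict ideal_isoD(3) by metis

lemma szero_R: "szero (R_monoid C) = Map.empty"
  unfolding szero_def R_monoid_simps
proof (rule the_equality)
  have "(id_map {} :: 'a \<rightharpoonup> 'a) = Map.empty" unfolding id_map_def by simp
  then have e: "ideal_iso C Map.empty" using ideal_iso_id[OF fg_empty] by simp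
  then show "ideal_iso C Map.empty \<and> (\<forall>a\<in>carrier (R_monoid C). Map.empty \<circ>\<^sub>m a = Map.empty \<and> a \<circ>\<^sub>m Map.empty = Map.empty)"
    by (auto intro!: map_eqI simp: map_comp_Some_iff)
  fix z assume "ideal_iso C z \<and> (\<forall>a\<in>carrier (R_monoid C). z \<circ>\<^sub>m a = z \<and> a \<circ>\<^sub>m z = z)"
  then have "z \<circ>\<^sub>m Map.empty = z" using e R_monoid_simps(1) by blast
  then show "z = Map.empty" by (metis map_comp_empty(1))
qed

lemma idempotents_R: "e \<in> idempotents (R_monoid C) \<longleftrightarrow> (\<exists>R. fg_right_ideal C R \<and> e = id_map R)"
proof
  assume "e \<in> idempotents (R_monoid C)"
  then have e: "ideal_iso C e" "e \<circ>\<^sub>m e = e" unfolding idempotents_def R_monoid_simps(2) using R_monoid_simps(1) by auto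
  have diag_e: "x = y" if *: "e x = Some y" for x y
    proof -
      have "(e \<circ>\<^sub>m e) x = Some y" using e(2) * by simp
      then have "e y = Some y" using * by (auto simp: map_comp_Some_iff)
      then show ?thesis using * ideal_isoD(3)[OF e(1)] unfolding map_inj_iff by metis
    qed
  have "e = id_map (dom e)"
    by (rule map_eqI) (auto simp: id_map_iff dest: diag_e)
  then show "\<exists>R. fg_right_ideal C R \<and> e = id_map R" using ideal_isoD(1)[OF e(1)] by blast
next
  assume "\<exists>R. fg_right_ideal C R \<and> e = id_map R"
  then obtain R where R: "fg_right_ideal C R" "e = id_map R" by blast
  have "e \<circ>\<^sub>m e = e" unfolding R(2) by (rule map_eqI) (auto simp: map_comp_Some_iff id_map_iff)
  then show "e \<in> idempotents (R_monoid C)"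
    unfolding idempotents_def R_monoid_simps(2) using ideal_iso_id[OF R(1)] R(2) R_monoid_simps(1) by simp
qed

text \<open>The ideals that every path enters; their identity maps are the essential idempotents.\<close>

definition dense_set :: "'a set \<Rightarrow> bool" where
  "dense_set D \<longleftrightarrow> (\<forall>x\<in>paths. \<exists>r\<in>x. r \<in> D)"

text \<open>If a path does not enter \<open>R\<close>, then a segment of it that dominates the degrees of the generators of
  \<open>R\<close> has no extension in \<open>R\<close>, and generates an ideal disjoint from \<open>R\<close>. Conversely, a path that enters
  some ideal also enters a dense \<open>R\<close>, and its segments finally lie in both.\<close>

lemma essential_R:
  assumes "fg_right_ideal C R" "paths \<noteq> {}"
  shows "essential_idem (R_monoid C) (id_map R) \<longleftrightarrow> dense_set R"
proof
  assume *: "essential_idem (R_monoid C) (id_map R)"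
  obtain F where F: "finite F" "F \<subseteq> arr C" "R = {x. \<exists>a\<in>F. a \<preceq> x}" using assms(1) unfolding fg_right_ideal_iff by blast
  show "dense_set R" unfolding dense_set_def
  proof (rule ballI, rule ccontr)
    fix x assume x: "x \<in> paths" "\<not> (\<exists>r\<in>x. r \<in> R)"
    obtain b where b: "b \<in> x" "deg C b = (\<Sum>a\<in>F. deg C a)" using path_degree_ex x(1) by blast
    have ba: "b \<in> arr C" using path_arr x(1) b(1) by blast
    have "R \<inter> {c. b \<preceq> c} = {}"
    proof (rule ccontr)
      assume "R \<inter> {c. b \<preceq> c} \<noteq> {}"
      then obtain a c where ac: "a \<in> F" "a \<preceq> c" "b \<preceq> c" using F(3) by blast
      have "deg C b = deg C a + (\<Sum>a\<in>F - {a}. deg C a)" using b(2) F(1) ac(1) by (simp add: sum.remove)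
      then have "a \<preceq> b" using prefix_compare[OF ac(2,3)] by blast
      then have "b \<in> R" using F(3) ac(1) by blast
      then show False using x(2) b(1) by blast
    qed
    then have "id_map R \<circ>\<^sub>m id_map {c. b \<preceq> c} = szero (R_monoid C)"
      unfolding szero_R by (intro map_eqI) (auto simp: map_comp_Some_iff id_map_iff)
    moreover have "id_map {c. b \<preceq> c} \<in> idempotents (R_monoid C)" unfolding idempotents_R using fg_ray[OF ba] by blast
    moreover have "id_map {c. b \<preceq> c} \<noteq> szero (R_monoid C)"
    proof -
      have "id_map {c. b \<preceq> c} b = Some b" by (simp add: id_map_iff prefix_refl[OF ba])
      then show ?thesis unfolding szero_R by auto
    qed
    moreover have "\<forall>f\<in>idempotents (R_monoid C). f \<noteq> szero (R_monoid C) \<longrightarrow>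
        id_map R \<circ>\<^sub>m f \<noteq> szero (R_monoid C)"
      using * unfolding essential_idem_def R_monoid_simps(2) by blast
    ultimately show False by blast
  qed
next
  assume d: "dense_set R"
  have "\<exists>r. r \<in> R" using d assms(2) unfolding dense_set_def by blast
  then have "id_map R \<noteq> szero (R_monoid C)" unfolding szero_R using id_map_iff by (metis option.distinct(1))
  moreover have "id_map R \<circ>\<^sub>m f \<noteq> szero (R_monoid C)"
    if f: "f \<in> idempotents (R_monoid C)" "f \<noteq> szero (R_monoid C)" for f
  proof -
    obtain S where S: "fg_right_ideal C S" "f = id_map S" using f(1) unfolding idempotents_R by blast
    have "S \<noteq> {}" using f(2) S(2) unfolding szero_R id_map_def by auto
    then obtain s where s: "s \<in> S" by blast
    then have "s \<in> arr C" using fg_right_idealD(1)[OF S(1)] by blast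
    then obtain x where x: "x \<in> cyl s" using cyl_nonempty by blast
    then obtain r where r: "r \<in> x" "r \<in> R" using d cylD(1) unfolding dense_set_def by blast
    obtain c where c: "c \<in> x" "s \<preceq> c" "r \<preceq> c" using path_directed[OF cylD(1,2)[OF x] r(1)] .
    have "c \<in> S" "c \<in> R" using fg_right_idealD(2)[OF S(1) s c(2)] fg_right_idealD(2)[OF assms(1) r(2) c(3)] by auto
    then have "(id_map R \<circ>\<^sub>m f) c = Some c" unfolding S(2) by (auto simp: map_comp_Some_iff id_map_iff)
    then show ?thesis unfolding szero_R by auto
  qed
  moreover have "id_map R \<in> idempotents (R_monoid C)" unfolding idempotents_R using assms(1) by blast
  ultimately show "essential_idem (R_monoid C) (id_map R)"
    unfolding essential_idem_def R_monoid_simps(2) by blast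
qed

end

section \<open>The group and the Boolean inverse monoid act on paths\<close>

context finite_graph
begin

text \<open>The partial map \<open>r y \<mapsto> f(r) y\<close> of the path space induced by \<open>f\<close>, extended by the identity.\<close>

definition path_map :: "('a \<rightharpoonup> 'a) \<Rightarrow> 'a set \<Rightarrow> 'a set" where
  "path_map f x = (if x \<in> paths \<and> (\<exists>r\<in>x. r \<in> dom f)
    then {b. \<exists>r\<in>x. \<exists>s. f r = Some s \<and> b \<preceq> s} else x)"

lemma path_map_acts:
  assumes "equivariant f" "f r = Some s"
  shows "acts (path_map f) s r"
  unfolding acts_def
proof (intro conjI ballI)
  note rs = equivariantD[OF assms]
  show "s \<in> arr C" "r \<in> arr C" "src C s = src C r" using rs by auto
  fix y assume y: "y \<in> cyl (src C r)"
  then have y': "y \<in> cyl (src C s)" using rs(3) by simp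
  note x = shift_in_cyl[OF y rs(1)]
  let ?x = "shift r y"
  have "path_map f ?x = {b. \<exists>r\<in>?x. \<exists>s. f r = Some s \<and> b \<preceq> s}"
    unfolding path_map_def using cylD(1,2)[OF x] assms(2) by auto
  also have "\<dots> = shift s y"
  proof
    show "shift s y \<subseteq> {b. \<exists>r\<in>?x. \<exists>s. f r = Some s \<and> b \<preceq> s}"
    proof
      fix b assume "b \<in> shift s y"
      then obtain c where c: "c \<in> y" "composable s c" "b \<preceq> cmp C s c" unfolding shift_def by blast
      then have rc: "composable r c" using rs(5) by blast
      then have "cmp C r c \<in> ?x" using cmp_mem_shift[OF y rs(1)] c(1) by blast
      then show "b \<in> {b. \<exists>r\<in>?x. \<exists>s. f r = Some s \<and> b \<preceq> s}" using rs(4)[OF rc] c(3) by blast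
    qed
    show "{b. \<exists>r\<in>?x. \<exists>s. f r = Some s \<and> b \<preceq> s} \<subseteq> shift s y"
    proof
      fix b assume "b \<in> {b. \<exists>r\<in>?x. \<exists>s. f r = Some s \<and> b \<preceq> s}"
      then obtain r' s' where r': "r' \<in> ?x" "f r' = Some s'" "b \<preceq> s'" by blast
      obtain d where d: "d \<in> ?x" "r \<preceq> d" "r' \<preceq> d" using path_directed[OF cylD(1,2)[OF x] r'(1)] .
      obtain c where c: "composable r c" "d = cmp C r c" using d(2) unfolding prefix_def by blast
      obtain c' where c': "composable r' c'" "d = cmp C r' c'" using d(3) unfolding prefix_def by blast
      have "cmp C s c = cmp C s' c'"
        using rs(4)[OF c(1)] equivariantD(4)[OF assms(1) r'(2) c'(1)] c(2) c'(2) by simp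
      moreover have "composable s' c'" using equivariantD(5)[OF assms(1) r'(2)] c'(1) by blast
      ultimately have "b \<preceq> cmp C s c" using prefix_trans[OF r'(3)] prefix_cmp by metis
      moreover have "c \<in> y" using cmp_mem_shift[OF y rs(1) c(1)] d(1) c(2) by simp
      moreover have "composable s c" using rs(5) c(1) by blast
      ultimately show "b \<in> shift s y" unfolding shift_def by blast
    qed
  qed
  finally show "path_map f ?x = shift s y" .
qed

lemma path_map_out: "x \<notin> paths \<Longrightarrow> path_map f x = x"
  unfolding path_map_def by simp

definition essential_iso :: "('a \<rightharpoonup> 'a) \<Rightarrow> bool" where
  "essential_iso f \<longleftrightarrow> ideal_iso C f \<and> dense_set (dom f) \<and> dense_set (ran f)"

lemma essential_isoD:
  assumes "essential_iso f"
  shows "ideal_iso C f" "dense_set (dom f)" "dense_set (ran f)" "equivariant f"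
    "fg_right_ideal C (dom f)" "fg_right_ideal C (ran f)" "inj_on f (dom f)"
  using assms ideal_isoD unfolding essential_iso_def by auto

lemma dense_dom_nbhd:
  assumes "dense_set (dom f)" "x \<in> paths"
  obtains r s where "f r = Some s" "x \<in> cyl r"
  using assms unfolding dense_set_def cyl_def by auto

lemma essential_part_carrier:
  assumes "paths \<noteq> {}"
  shows "f \<in> carrier (essential_part (R_monoid C)) \<longleftrightarrow> essential_iso f"
proof -
  have "f \<in> carrier (R_monoid C) \<and> essential_idem (R_monoid C) (pinv (R_monoid C) f \<otimes>\<^bsub>R_monoid C\<^esub> f) \<and>
      essential_idem (R_monoid C) (f \<otimes>\<^bsub>R_monoid C\<^esub> pinv (R_monoid C) f) \<longleftrightarrow> essential_iso f"
  proof (cases "ideal_iso C f")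
    case True
    note f = ideal_isoD[OF True]
    show ?thesis
      unfolding R_monoid_simps pinv_R[OF True] map_inverse_comp[OF f(3)] essential_R[OF f(1) assms]
        essential_R[OF f(2) assms] essential_iso_def using True by simp
  qed (simp add: R_monoid_simps essential_iso_def)
  then show ?thesis unfolding essential_part_def by simp
qed

lemma essential_part_mult: "mult (essential_part (R_monoid C)) = (\<circ>\<^sub>m)"
  unfolding essential_part_def by (simp add: R_monoid_simps)

lemma map_inverse_dom_ran:
  assumes "inj_on f (dom f)"
  shows "dom (map_inverse f) = ran f" "ran (map_inverse f) = dom f"
  using map_inverse_iff[OF assms] by (auto simp: dom_def ran_def)

lemma essential_inverse: "essential_iso f \<Longrightarrow> essential_iso (map_inverse f)"
  unfolding essential_iso_def using ideal_iso_inverse map_inverse_dom_ran ideal_isoD(3) by metis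

lemma path_map_inverse:
  assumes "essential_iso f" "x \<in> paths"
  shows "path_map (map_inverse f) (path_map f x) = x" "path_map f x \<in> paths"
proof -
  note f = essential_isoD[OF assms(1)]
  obtain r s where rs: "f r = Some s" "x \<in> cyl r" using dense_dom_nbhd[OF f(2) assms(2)] .
  note a = path_map_acts[OF f(4) rs(1)]
  have "map_inverse f s = Some r" using map_inverse_iff[OF f(7)] rs(1) by simp
  then have b: "acts (path_map (map_inverse f)) r s"
    using path_map_acts essential_isoD(4)[OF essential_inverse[OF assms(1)]] by blast
  obtain y where "y \<in> cyl (src C r)" "x = shift r y" using cyl_shift[OF rs(2)] .
  then show "path_map (map_inverse f) (path_map f x) = x" using actsD(3,4)[OF a] actsD(4)[OF b] by metis
  show "path_map f x \<in> paths" using acts_image[OF a] rs(2) cyl_subset by blast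
qed

lemma map_inverse_inverse: "inj_on f (dom f) \<Longrightarrow> map_inverse (map_inverse f) = f"
proof (rule map_eqI)
  assume inj: "inj_on f (dom f)"
  have "inj_on (map_inverse f) (dom (map_inverse f))"
    unfolding map_inj_iff map_inverse_iff[OF inj] by auto
  then show "map_inverse (map_inverse f) x = Some y \<longleftrightarrow> f x = Some y" for x y
    using map_inverse_iff inj by metis
qed

lemma path_map_full_group:
  assumes "essential_iso f"
  shows "path_map f \<in> full_group"
proof -
  note f = essential_isoD[OF assms]
  have 1: "path_map (map_inverse f) (path_map f x) = x" for x
    using path_map_inverse(1)[OF assms] path_map_out by (cases "x \<in> paths") auto
  have 2: "path_map f (path_map (map_inverse f) x) = x" for x
    using path_map_inverse(1)[OF essential_inverse[OF assms]] path_map_out map_inverse_inverse[OF f(7)]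
    by (cases "x \<in> paths") auto
  have bij: "bij (path_map f)"
    by (rule o_bij[of "path_map (map_inverse f)"]) (use 1 2 in \<open>auto simp: fun_eq_iff\<close>)
  moreover have "bisection paths (path_map f)"
    unfolding bisection_def
  proof (intro conjI ballI)
    show "inj_on (path_map f) paths" using bij bij_is_inj inj_on_subset by blast
    fix x assume "x \<in> paths"
    then obtain r s where "f r = Some s" "x \<in> cyl r" using dense_dom_nbhd[OF f(2)] by blast
    then show "\<exists>a b. acts (path_map f) a b \<and> x \<in> cyl b" using path_map_acts[OF f(4)] by blast
  qed (rule clopen_paths)
  ultimately show ?thesis unfolding full_group_def using path_map_out by blast
qed

lemma dense_comp:
  assumes "essential_iso f" "essential_iso g"
  shows "dense_set (dom (f \<circ>\<^sub>m g))"
  unfolding dense_set_def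
proof
  note f = essential_isoD[OF assms(1)] and g = essential_isoD[OF assms(2)]
  fix x assume x: "x \<in> paths"
  obtain r s where rs: "g r = Some s" "x \<in> cyl r" using dense_dom_nbhd[OF g(2) x] .
  note a = path_map_acts[OF g(4) rs(1)] and e = equivariantD[OF g(4) rs(1)]
  obtain y where y: "y \<in> cyl (src C r)" "x = shift r y" using cyl_shift[OF rs(2)] .
  have y': "y \<in> cyl (src C s)" using y(1) e(3) by simp
  have sy: "shift s y \<in> cyl s" using shift_in_cyl[OF y' e(2)] .
  obtain s' t where st: "f s' = Some t" "shift s y \<in> cyl s'" using dense_dom_nbhd[OF f(2) cylD(1)[OF sy]] .
  obtain d where d: "d \<in> shift s y" "s \<preceq> d" "s' \<preceq> d" using path_directed[OF cylD(1,2)[OF sy] cylD(2)[OF st(2)]] .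
  obtain c where c: "composable s c" "d = cmp C s c" using d(2) unfolding prefix_def by blast
  have "d \<in> dom f" using fg_right_idealD(2)[OF f(5) _ d(3)] st(1) by blast
  then obtain u where "f d = Some u" by blast
  moreover have rc: "composable r c" using e(5) c(1) by blast
  moreover have "g (cmp C r c) = Some d" using e(4)[OF rc] c(2) by simp
  moreover have "c \<in> y" using cmp_mem_shift[OF y' e(2) c(1)] d(1) c(2) by simp
  then have "cmp C r c \<in> x" using cmp_mem_shift[OF y(1) e(1) rc] y(2) by simp
  ultimately have "(f \<circ>\<^sub>m g) (cmp C r c) = Some u" "cmp C r c \<in> x" by (auto simp: map_comp_Some_iff)
  then show "\<exists>r\<in>x. r \<in> dom (f \<circ>\<^sub>m g)" by blast
qed

lemma essential_comp:
  assumes "essential_iso f" "essential_iso g"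
  shows "essential_iso (f \<circ>\<^sub>m g)"
proof -
  note f = essential_isoD[OF assms(1)] and g = essential_isoD[OF assms(2)]
  note c = ideal_iso_comp[OF f(1) g(1)]
  have "map_inverse (f \<circ>\<^sub>m g) = map_inverse g \<circ>\<^sub>m map_inverse f"
    by (rule map_eqI)
      (auto simp: map_inverse_iff[OF ideal_isoD(3)[OF c]] map_comp_Some_iff map_inverse_iff[OF f(7)] map_inverse_iff[OF g(7)])
  then have "dense_set (ran (f \<circ>\<^sub>m g))"
    using dense_comp[OF essential_inverse[OF assms(2)] essential_inverse[OF assms(1)]]
      map_inverse_dom_ran(1)[OF ideal_isoD(3)[OF c]] by simp
  then show ?thesis unfolding essential_iso_def using c dense_comp[OF assms] by blast
qed

lemma path_map_comp:
  assumes "essential_iso f" "essential_iso g"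
  shows "path_map (f \<circ>\<^sub>m g) = path_map f \<circ> path_map g"
proof
  note f = essential_isoD[OF assms(1)] and g = essential_isoD[OF assms(2)]
  note fg = essential_isoD[OF essential_comp[OF assms]]
  fix x
  show "path_map (f \<circ>\<^sub>m g) x = (path_map f \<circ> path_map g) x"
  proof (cases "x \<in> paths")
    case True
    obtain r t where rt: "(f \<circ>\<^sub>m g) r = Some t" "x \<in> cyl r" using dense_dom_nbhd[OF fg(2) True] .
    then obtain s where s: "g r = Some s" "f s = Some t" by (auto simp: map_comp_Some_iff)
    obtain y where y: "y \<in> cyl (src C r)" "x = shift r y" using cyl_shift[OF rt(2)] .
    show ?thesis
      using actsD(4)[OF path_map_acts[OF fg(4) rt(1)] y(1)] actsD(4)[OF path_map_acts[OF g(4) s(1)] y(1)]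
        actsD(4)[OF path_map_acts[OF f(4) s(2)]] y equivariantD(3)[OF g(4) s(1)] by simp
  qed (simp add: path_map_out)
qed

lemma nat_le_essential:
  assumes "paths \<noteq> {}"
  shows "nat_le (essential_part (R_monoid C)) z s \<longleftrightarrow> essential_iso z \<and> essential_iso s \<and> z \<subseteq>\<^sub>m s"
proof -
  have "pinv (essential_part (R_monoid C)) f = map_inverse f" if "essential_iso f" for f
    by (rule pinv_sub_monoid)
      (use that essential_inverse essential_isoD(1) in \<open>auto simp: essential_part_carrier[OF assms] essential_part_mult\<close>)
  then show ?thesis
    unfolding nat_le_def essential_part_carrier[OF assms] essential_part_mult
    using map_le_iff_restrict essential_isoD(7) by metis
qed

lemma essential_id: "fg_right_ideal C R \<Longrightarrow> dense_set R \<Longrightarrow> essential_iso (id_map R)"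
  unfolding essential_iso_def dom_id_map using ideal_iso_id by blast

definition full_group_monoid :: "('a set \<Rightarrow> 'a set) monoid" where
  "full_group_monoid = \<lparr>carrier = full_group, mult = (\<circ>), one = id\<rparr>"

end

context aperiodic_graph
begin

text \<open>If \<open>f\<close> and \<open>g\<close> have a common restriction with dense domain, they induce the same map. Conversely, if
  they induce the same map, then by aperiodicity they agree on the intersection of their domains, and
  this intersection is dense.\<close>

lemma sigma_iff:
  assumes "paths \<noteq> {}"
  shows "(f, g) \<in> sigma_cong (essential_part (R_monoid C)) \<longleftrightarrow>
    essential_iso f \<and> essential_iso g \<and> path_map f = path_map g"
proof
  assume "(f, g) \<in> sigma_cong (essential_part (R_monoid C))"
  then obtain z where z: "essential_iso f" "essential_iso g" "essential_iso z" "z \<subseteq>\<^sub>m f" "z \<subseteq>\<^sub>m g"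
    unfolding sigma_cong_def nat_le_essential[OF assms] essential_part_carrier[OF assms] by auto
  have "path_map f x = path_map g x" for x
  proof (cases "x \<in> paths")
    case True
    obtain r s where rs: "z r = Some s" "x \<in> cyl r" using dense_dom_nbhd[OF essential_isoD(2)[OF z(3)] True] .
    then have "f r = Some s" "g r = Some s" using z(4,5) unfolding map_le_def by (metis domI)+
    then have "acts (path_map f) s r" "acts (path_map g) s r"
      using path_map_acts essential_isoD(4) z(1,2) by blast+
    moreover obtain y where "y \<in> cyl (src C r)" "x = shift r y" using cyl_shift[OF rs(2)] .
    ultimately show ?thesis using actsD(4) by metis
  qed (simp add: path_map_out)
  then show "essential_iso f \<and> essential_iso g \<and> path_map f = path_map g" using z by blast
next
  assume *: "essential_iso f \<and> essential_iso g \<and> path_map f = path_map g"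
  note f = essential_isoD[OF conjunct1[OF *]]
  have g0: "essential_iso g" using * by blast
  note g = essential_isoD[OF g0]
  \<comment> \<open>The restriction of \<open>f\<close> to \<open>dom g\<close> is a common lower bound.\<close>
  let ?z = "f \<circ>\<^sub>m id_map (dom g)"
  have z: "essential_iso ?z" using essential_comp essential_id g(2,5) * by blast
  have z_iff: "?z r = Some s \<longleftrightarrow> f r = Some s \<and> r \<in> dom g" for r s
    by (auto simp: map_comp_Some_iff id_map_iff)
  have fg: "g r = Some s" if rs: "f r = Some s" "r \<in> dom g" for r s
  proof -
    obtain t where t: "g r = Some t" using rs(2) by blast
    have "acts (path_map f) s r" "acts (path_map f) t r"
      using path_map_acts[OF f(4) rs(1)] path_map_acts[OF g(4) t] * by auto
    then show ?thesis using acts_unique t by metis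
  qed
  have "?z \<subseteq>\<^sub>m f" "?z \<subseteq>\<^sub>m g" unfolding map_le_def using z_iff fg by (metis domD)+
  then show "(f, g) \<in> sigma_cong (essential_part (R_monoid C))"
    unfolding sigma_cong_def nat_le_essential[OF assms] using * z essential_part_carrier[OF assms] by auto
qed

text \<open>From some degree on, every arrow \<open>r\<close> acts under \<open>h\<close> as \<open>r y \<mapsto> s y\<close>, and \<open>s\<close> is unique by
  aperiodicity. The required morphism is \<open>r \<mapsto> s\<close>.\<close>

lemma path_map_surj:
  assumes h: "h \<in> full_group"
  obtains f where "essential_iso f" "path_map f = h"
proof -
  obtain n where n: "\<forall>b\<in>arr C. deg C b = n \<longrightarrow> cyl b \<inter> paths = {} \<or> cyl b \<subseteq> paths \<and> (\<exists>a. acts h a b)"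
    using bisection_level[OF full_groupD(3)[OF h]] .
  let ?D = "{r \<in> arr C. \<exists>k. deg C r = n + k}"
  define f where "f r = (if r \<in> ?D then Some (THE s. acts h s r) else None)" for r
  have ex: "\<exists>s. acts h s r" if r: "r \<in> ?D" for r
  proof -
    obtain k where "deg C r = n + k" using r by blast
    then obtain b c where b: "composable b c" "r = cmp C b c" "deg C b = n"
      using factorization_exists r by (metis (no_types, lifting) mem_Collect_eq)
    then have "b \<in> arr C" using composableD(1) by blast
    then obtain a where "acts h a b" using n b(3) cyl_nonempty cyl_subset by blast
    then show ?thesis using acts_ext(2)[OF _ b(1)] b(2) by blast
  qed
  have f_iff: "f r = Some s \<longleftrightarrow> r \<in> ?D \<and> acts h s r" for r s
  proof (cases "r \<in> ?D")
    case True
    then obtain t where t: "acts h t r" using ex by blast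
    then have "(THE s. acts h s r) = t" using acts_unique by blast
    then show ?thesis unfolding f_def using True t acts_unique by auto
  qed (auto simp: f_def)
  have dom: "dom f = ?D" using f_iff ex by (auto simp: dom_def)
  have eq: "equivariant f"
    unfolding equivariant_def f_iff
  proof (intro conjI allI impI)
    show "dom f \<subseteq> arr C" using dom by blast
    fix r s assume rs: "r \<in> ?D \<and> acts h s r"
    then show "s \<in> arr C" "src C s = src C r" using actsD by blast+
    fix c assume c: "composable r c"
    obtain k where "deg C r = n + k" using rs by blast
    then have "deg C (cmp C r c) = n + (k + deg C c)" using composableD(7)[OF c] by (simp add: ac_simps)
    then show "cmp C r c \<in> ?D" using composableD(4)[OF c] by blast
    show "acts h (cmp C s c) (cmp C r c)" using acts_ext(2)[OF _ c] rs by blast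
  qed
  have inj: "inj_on f (dom f)"
    unfolding map_inj_iff f_iff
  proof (intro allI impI, elim conjE)
    fix r r' s assume a: "acts h s r" "acts h s r'"
    let ?i = "inv_into UNIV h"
    have i: "?i (h x) = x" for x using full_groupD(1)[OF h] by (simp add: bij_is_inj)
    have "acts ?i r s" "acts ?i r' s" using acts_inverse[OF a(1)] acts_inverse[OF a(2)] i by blast+
    then show "r = r'" using acts_unique by blast
  qed
  have fgD: "fg_right_ideal C (dom f)" unfolding dom by (rule fg_level)
  moreover have "ran f = {s. \<exists>r\<in>dom f. f r = Some s}" by (auto simp: ran_def)
  then have "fg_right_ideal C (ran f)" using fg_image[OF eq fgD order_refl] by simp
  ultimately have iso: "ideal_iso C f" unfolding ideal_iso_iff using inj eq by blast
  have nb: "\<exists>r s. f r = Some s \<and> x \<in> cyl r" if "x \<in> paths" for x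
  proof -
    obtain b where b: "b \<in> arr C" "deg C b = n" "x \<in> cyl b" using path_in_cyl \<open>x \<in> paths\<close> by blast
    then have "b \<in> ?D" by (auto intro: exI[of _ 0])
    then show ?thesis using f_iff ex b(3) by blast
  qed
  have dd: "dense_set (dom f)"
    unfolding dense_set_def using nb cylD(2) by blast
  have ph: "path_map f x = h x" if x: "x \<in> paths" for x
  proof -
    obtain r s where rs: "f r = Some s" "x \<in> cyl r" using nb[OF x] by blast
    obtain y where "y \<in> cyl (src C r)" "x = shift r y" using cyl_shift[OF rs(2)] .
    then show ?thesis using actsD(4)[OF path_map_acts[OF eq rs(1)]] actsD(4)[of h s r] rs(1) f_iff by metis
  qed
  have "dense_set (ran f)"
    unfolding dense_set_def
  proof
    fix x assume "x \<in> paths"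
    then have "x \<in> h ` paths" by (simp add: full_group_paths(2)[OF h])
    then obtain y where y: "y \<in> paths" "h y = x" by auto
    obtain r s where rs: "f r = Some s" "y \<in> cyl r" using nb[OF y(1)] by blast
    then have "acts h s r" using f_iff by simp
    then have "x \<in> cyl s" using acts_image[of h s r] rs(2) y(2) by auto
    then show "\<exists>r\<in>x. r \<in> ran f" using cylD(2) rs(1) by (metis ranI)
  qed
  then have "essential_iso f" unfolding essential_iso_def using iso dd by blast
  moreover have "path_map f = h"
  proof
    fix x show "path_map f x = h x"
      using ph path_map_out full_groupD(2)[OF h] by (cases "x \<in> paths") auto
  qed
  ultimately show ?thesis using that by blast
qed

text \<open>The map induced on paths is a surjective homomorphism whose fibres are the classes of \<open>\<sigma>\<close>.\<close>

theorem G_group_iso: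
  assumes "paths \<noteq> {}"
  shows "full_group_monoid \<cong> G_group C"
proof -
  let ?E = "essential_part (R_monoid C)"
  let ?r = "sigma_cong ?E"
  define F where "F h = {f. essential_iso f \<and> path_map f = h}" for h
  have cls: "?r `` {f} = F (path_map f)" if "essential_iso f" for f
    unfolding F_def Image_def using sigma_iff[OF assms] that by auto
  have ne: "\<exists>f. f \<in> F h" if "h \<in> full_group" for h
    using path_map_surj[OF that] unfolding F_def by blast
  have carrier: "carrier (G_group C) = F ` full_group"
  proof
    show "carrier (G_group C) \<subseteq> F ` full_group"
      unfolding G_group_def quot_monoid_def quotient_def
      using cls path_map_full_group by (auto simp: essential_part_carrier[OF assms])
    show "F ` full_group \<subseteq> carrier (G_group C)"
    proof
      fix X assume "X \<in> F ` full_group"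
      then obtain h where h: "h \<in> full_group" "X = F h" by blast
      obtain f where f: "essential_iso f" "path_map f = h" using path_map_surj[OF h(1)] .
      then have "X = ?r `` {f}" using cls h by simp
      then show "X \<in> carrier (G_group C)"
        unfolding G_group_def quot_monoid_def using f(1) by (auto simp: essential_part_carrier[OF assms] intro!: quotientI)
    qed
  qed
  have "F \<in> hom full_group_monoid (G_group C)"
  proof (rule homI)
    show "F h \<in> carrier (G_group C)" if "h \<in> carrier full_group_monoid" for h
      using that carrier unfolding full_group_monoid_def by auto
    fix g h assume "g \<in> carrier full_group_monoid" "h \<in> carrier full_group_monoid"
    then have gh: "g \<in> full_group" "h \<in> full_group" unfolding full_group_monoid_def by auto
    have "?r `` {x \<circ>\<^sub>m y} = F (g \<circ> h)" if "x \<in> F g" "y \<in> F h" for x y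
      using that cls[OF essential_comp] path_map_comp unfolding F_def by auto
    then have "(\<Union>x\<in>F g. \<Union>y\<in>F h. ?r `` {x \<circ>\<^sub>m y}) = F (g \<circ> h)"
      using ne[OF gh(1)] ne[OF gh(2)] by auto
    then show "F (g \<otimes>\<^bsub>full_group_monoid\<^esub> h) = F g \<otimes>\<^bsub>G_group C\<^esub> F h"
      unfolding full_group_monoid_def G_group_def quot_monoid_def by (simp add: essential_part_mult)
  qed
  moreover have "bij_betw F (carrier full_group_monoid) (carrier (G_group C))"
    unfolding bij_betw_def full_group_monoid_def carrier
  proof
    show "inj_on F (carrier \<lparr>carrier = full_group, mult = (\<circ>), one = id\<rparr>)"
    proof (rule inj_onI)
      fix g h assume *: "g \<in> carrier \<lparr>carrier = full_group, mult = (\<circ>), one = id\<rparr>" "F g = F h"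
      then have "g \<in> full_group" by simp
      then obtain f where "f \<in> F g" using ne by blast
      then show "g = h" using *(2) unfolding F_def by auto
    qed
  qed simp
  ultimately have "F \<in> iso full_group_monoid (G_group C)" unfolding iso_def by blast
  then show ?thesis unfolding is_iso_def by blast
qed

text \<open>The graph of the induced partial map, which unlike \<open>path_map\<close> remembers where the map is defined.\<close>

definition path_graph :: "('a \<rightharpoonup> 'a) \<Rightarrow> ('a set \<times> 'a set) set" where
  "path_graph f = {(x, path_map f x) | x. x \<in> paths \<and> (\<exists>r\<in>x. r \<in> dom f)}"

text \<open>The ideals on which \<open>x\<close> and \<open>g\<close> are defined meet, because a path that enters the first one enters the
  second one too. Restrict \<open>x\<close> to the extensions of an arrow in both: by aperiodicity it agrees with
  \<open>g\<close> there.\<close>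

lemma path_graph_lenz:
  assumes f: "ideal_iso C f" and g: "ideal_iso C g" and eq: "path_graph f = path_graph g"
    and x: "ideal_iso C x" "x \<subseteq>\<^sub>m f" "x \<noteq> Map.empty"
  shows "\<exists>z. z \<noteq> Map.empty \<and> ideal_iso C z \<and> z \<subseteq>\<^sub>m x \<and> z \<subseteq>\<^sub>m g"
proof -
  note fD = ideal_isoD[OF f] and gD = ideal_isoD[OF g] and xD = ideal_isoD[OF x(1)]
  have same: "path_map f p = path_map g p \<and> (\<exists>r\<in>p. r \<in> dom g)" if "p \<in> cyl r" "r \<in> dom f" for p r
  proof -
    have "\<exists>r\<in>p. r \<in> dom f" using cylD(2)[OF that(1)] that(2) by (rule bexI[rotated])
    then have "(p, path_map f p) \<in> path_graph f"
      using cylD(1)[OF that(1)] unfolding path_graph_def by simp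
    then have "(p, path_map f p) \<in> path_graph g" by (simp only: eq)
    then show ?thesis unfolding path_graph_def by simp
  qed
  obtain r where r: "r \<in> dom x" using x(3) by (metis dom_eq_empty_conv ex_in_conv)
  then have ra: "r \<in> arr C" using fg_right_idealD(1)[OF xD(1)] by blast
  obtain p where p: "p \<in> cyl r" using cyl_nonempty[OF ra] by blast
  have rf: "r \<in> dom f" using r x(2) by (metis domIff map_le_def)
  then obtain r' where r': "r' \<in> p" "r' \<in> dom g" using same[OF p] by blast
  obtain d where d: "d \<in> p" "r \<preceq> d" "r' \<preceq> d" using path_directed[OF cylD(1,2)[OF p] r'(1)] .
  have da: "d \<in> arr C" using prefixD(2)[OF d(2)] .
  let ?z = "x \<circ>\<^sub>m id_map {e. d \<preceq> e}"
  have z_iff: "?z e = Some s \<longleftrightarrow> d \<preceq> e \<and> x e = Some s" for e s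
    by (auto simp: map_comp_Some_iff id_map_iff)
  have "ideal_iso C ?z" using ideal_iso_comp x(1) ideal_iso_id fg_ray[OF da] by blast
  moreover have "?z \<subseteq>\<^sub>m x" unfolding map_le_def using z_iff by (metis domD)
  moreover have "?z \<subseteq>\<^sub>m g"
    unfolding map_le_def
  proof
    fix e assume "e \<in> dom ?z"
    then obtain s where s: "?z e = Some s" by blast
    then have e: "d \<preceq> e" "x e = Some s" using z_iff by auto
    have fe: "f e = Some s" using e(2) x(2) unfolding map_le_def by (metis domI)
    have "e \<in> dom g" using fg_right_idealD(2)[OF gD(1) r'(2) prefix_trans[OF d(3) e(1)]] .
    then obtain t where t: "g e = Some t" by blast
    have "acts (path_map g) s e"
    proof (rule acts_cong[OF path_map_acts[OF fD(4) fe]])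
      show "\<And>q. q \<in> cyl e \<Longrightarrow> path_map f q = path_map g q" using same fe by blast
    qed
    then have "s = t" using acts_unique path_map_acts[OF gD(4) t] by blast
    then show "?z e = g e" using s t by simp
  qed
  moreover have "?z \<noteq> Map.empty"
  proof -
    have "d \<in> dom x" using fg_right_idealD(2)[OF xD(1) r d(2)] .
    then obtain s where "x d = Some s" by blast
    then have "?z d = Some s" using z_iff prefix_refl[OF da] by blast
    then show ?thesis by auto
  qed
  ultimately show ?thesis by blast
qed

lemma lenz_iff:
  "(f, g) \<in> lenz_cong (R_monoid C) \<longleftrightarrow> ideal_iso C f \<and> ideal_iso C g \<and>
    (\<forall>x. ideal_iso C x \<and> x \<subseteq>\<^sub>m f \<and> x \<noteq> Map.empty \<longrightarrow> (\<exists>z. z \<noteq> Map.empty \<and> ideal_iso C z \<and> z \<subseteq>\<^sub>m x \<and> z \<subseteq>\<^sub>m g)) \<and>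
    (\<forall>x. ideal_iso C x \<and> x \<subseteq>\<^sub>m g \<and> x \<noteq> Map.empty \<longrightarrow> (\<exists>z. z \<noteq> Map.empty \<and> ideal_iso C z \<and> z \<subseteq>\<^sub>m x \<and> z \<subseteq>\<^sub>m f))"
proof -
  have "(\<exists>z. z \<noteq> Map.empty \<and> (ideal_iso C z \<and> ideal_iso C x \<and> z \<subseteq>\<^sub>m x) \<and> ideal_iso C z \<and> ideal_iso C h \<and> z \<subseteq>\<^sub>m h)
      \<longleftrightarrow> (\<exists>z. z \<noteq> Map.empty \<and> ideal_iso C z \<and> z \<subseteq>\<^sub>m x \<and> z \<subseteq>\<^sub>m h)"
    if "ideal_iso C x" "ideal_iso C h" for x h
    using that by auto
  then show ?thesis
    unfolding lenz_cong_def nat_le_R szero_R R_monoid_simps(1) mem_Collect_eq prod.case by (smt (verit))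
qed

lemma path_graph_lenz_cong:
  assumes "ideal_iso C f" "ideal_iso C g" "path_graph f = path_graph g"
  shows "(f, g) \<in> lenz_cong (R_monoid C)"
  unfolding lenz_iff
  using assms(1,2) path_graph_lenz[OF assms] path_graph_lenz[OF assms(2,1) assms(3)[symmetric]] by simp

lemma lenz_trans: "trans (lenz_cong (R_monoid C))"
proof (rule transI)
  have step: "\<exists>z. z \<noteq> Map.empty \<and> ideal_iso C z \<and> z \<subseteq>\<^sub>m x \<and> z \<subseteq>\<^sub>m h"
    if fg: "\<forall>x. ideal_iso C x \<and> x \<subseteq>\<^sub>m f \<and> x \<noteq> Map.empty \<longrightarrow> (\<exists>z. z \<noteq> Map.empty \<and> ideal_iso C z \<and> z \<subseteq>\<^sub>m x \<and> z \<subseteq>\<^sub>m g)"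
      and gh: "\<forall>x. ideal_iso C x \<and> x \<subseteq>\<^sub>m g \<and> x \<noteq> Map.empty \<longrightarrow> (\<exists>z. z \<noteq> Map.empty \<and> ideal_iso C z \<and> z \<subseteq>\<^sub>m x \<and> z \<subseteq>\<^sub>m h)"
      and x: "ideal_iso C x \<and> x \<subseteq>\<^sub>m f \<and> x \<noteq> Map.empty" for f g h x
  proof -
    obtain z where z: "z \<noteq> Map.empty" "ideal_iso C z" "z \<subseteq>\<^sub>m x" "z \<subseteq>\<^sub>m g" using fg x by blast
    then obtain w where "w \<noteq> Map.empty" "ideal_iso C w" "w \<subseteq>\<^sub>m z" "w \<subseteq>\<^sub>m h" using gh by blast
    then show ?thesis using map_le_trans[OF _ z(3)] by blast
  qed
  fix f g h assume 1: "(f, g) \<in> lenz_cong (R_monoid C)" and 2: "(g, h) \<in> lenz_cong (R_monoid C)"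
  show "(f, h) \<in> lenz_cong (R_monoid C)"
    unfolding lenz_iff using 1[unfolded lenz_iff] 2[unfolded lenz_iff] step[of f g h] step[of h g f] by blast
qed

text \<open>A Lenz class is determined by the induced partial map of the path space, and a finite space has
  finitely many partial maps.\<close>

lemma infinite_B_infinite_paths:
  assumes "infinite (carrier (B_monoid C))"
  shows "infinite paths"
proof
  assume fin: "finite paths"
  let ?r = "lenz_cong (R_monoid C)" and ?R = "carrier (R_monoid C)"
  have cls: "?r `` {f} = ?r `` {g}" if "f \<in> ?R" "g \<in> ?R" "path_graph f = path_graph g" for f g
  proof -
    have "(f, g) \<in> ?r" "(g, f) \<in> ?r" using path_graph_lenz_cong that R_monoid_simps(1) by auto
    then show ?thesis using lenz_trans unfolding trans_def by blast
  qed
  define pick where "pick G = (SOME f. f \<in> ?R \<and> path_graph f = G)" for G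
  have "carrier (B_monoid C) \<subseteq> (\<lambda>G. ?r `` {pick G}) ` (path_graph ` ?R)"
  proof
    fix X assume "X \<in> carrier (B_monoid C)"
    then obtain f where f: "f \<in> ?R" "X = ?r `` {f}"
      unfolding B_monoid_def quot_monoid_def by (auto elim: quotientE)
    have "pick (path_graph f) \<in> ?R \<and> path_graph (pick (path_graph f)) = path_graph f"
      unfolding pick_def by (rule someI[of _ f]) (use f in blast)
    then have "X = ?r `` {pick (path_graph f)}" using cls f by metis
    then show "X \<in> (\<lambda>G. ?r `` {pick G}) ` (path_graph ` ?R)" using f(1) by blast
  qed
  moreover have "path_graph ` ?R \<subseteq> Pow (paths \<times> (\<Union>x\<in>paths. range (\<lambda>f. path_map f x) \<inter> paths))"
  proof -
    have "path_map f x \<in> paths" if f: "f \<in> ?R" and x: "x \<in> paths" "\<exists>r\<in>x. r \<in> dom f" for f x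
    proof -
      obtain r s where rs: "r \<in> x" "f r = Some s" using x by blast
      have "acts (path_map f) s r" using path_map_acts ideal_isoD(4) f R_monoid_simps(1) rs(2) by blast
      then show ?thesis using acts_image[of "path_map f" s r] x(1) rs(1) cyl_subset unfolding cyl_def by blast
    qed
    then show ?thesis unfolding path_graph_def by blast
  qed
  then have "path_graph ` ?R \<subseteq> Pow (paths \<times> paths)" by blast
  then have "finite (path_graph ` ?R)" using fin finite_subset by (metis finite_Pow_iff finite_SigmaI)
  ultimately show False using assms finite_subset by (metis finite_imageI)
qed

end

section \<open>From a group isomorphism to a homeomorphism of path spaces\<close>

context minimal_graph
begin

lemma rubin_action_full_group: "rubin_action paths {U. clopen U} full_group"
proof
  show "a \<subseteq> paths" if "a \<in> {U. clopen U}" for a using that clopen_subset by blast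
  show "a \<inter> b \<in> {U. clopen U}" "a - b \<in> {U. clopen U}"
    if "a \<in> {U. clopen U}" "b \<in> {U. clopen U}" for a b
    using that clopen_inter clopen_diff by auto
  show "\<exists>a\<in>{U. clopen U}. x \<in> a \<and> y \<notin> a" if xy: "x \<in> paths" "y \<in> paths" "x \<noteq> y" for x y
    using paths_separated[OF xy] clopen_cyl by (metis mem_Collect_eq)
  show "bij g" if "g \<in> full_group" for g using full_groupD(1)[OF that] .
  show "g x \<in> paths" if "g \<in> full_group" "x \<in> paths" for g x using full_group_paths(1) that by simp
  show "id \<in> full_group" by (rule full_group_id)
  show "g \<circ> h \<in> full_group" if "g \<in> full_group" "h \<in> full_group" for g h using full_group_comp that .
  show "inv_into UNIV g \<in> full_group" if "g \<in> full_group" for g using full_group_inv that .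
  show "g ` a \<in> {U. clopen U}" if "g \<in> full_group" "a \<in> {U. clopen U}" for g a
    using full_group_clopen that by simp
  show "\<exists>s. is_support {U. clopen U} g s" if "g \<in> full_group" for g using full_group_support that .
  show "\<exists>g\<in>full_group. fixes_outside a g \<and> g ^^ 12 \<noteq> id" if "a \<in> {U. clopen U}" "a \<noteq> {}" for a
    using full_group_rich that by simp
  show "\<exists>g\<in>full_group. is_support {U. clopen U} g a" if "a \<in> {U. clopen U}" for a
    using full_group_full that by simp
qed

end

locale clopen_order_iso = S: finite_graph C + T: finite_graph C'
  for C :: "('a, 'k::finite) kgraph" and C' :: "('b, 'l::finite) kgraph" +
  fixes \<eta> :: "'b set set \<Rightarrow> 'a set set"
  assumes \<eta>_bij: "bij_betw \<eta> {V. T.clopen V} {U. S.clopen U}"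
    and \<eta>_mono: "T.clopen V \<Longrightarrow> T.clopen W \<Longrightarrow> \<eta> V \<subseteq> \<eta> W \<longleftrightarrow> V \<subseteq> W"
begin

lemma \<eta>_clopen: "T.clopen V \<Longrightarrow> S.clopen (\<eta> V)"
  using \<eta>_bij bij_betwE by blast

lemma \<eta>_surj:
  assumes "S.clopen U"
  obtains V where "T.clopen V" "\<eta> V = U"
  using \<eta>_bij assms unfolding bij_betw_def by (metis imageE mem_Collect_eq)

lemma \<eta>_empty: "\<eta> {} = {}"
proof -
  obtain V where "T.clopen V" "\<eta> V = {}" using \<eta>_surj[OF S.clopen_empty] .
  then show ?thesis using \<eta>_mono[OF T.clopen_empty] by blast
qed

lemma \<eta>_paths: "\<eta> T.paths = S.paths"
proof -
  obtain V where V: "T.clopen V" "\<eta> V = S.paths" using \<eta>_surj[OF S.clopen_paths] .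
  then have "S.paths \<subseteq> \<eta> T.paths" using \<eta>_mono[OF V(1) T.clopen_paths] T.clopen_subset by blast
  then show ?thesis using S.clopen_subset[OF \<eta>_clopen[OF T.clopen_paths]] by blast
qed

lemma \<eta>_disjoint:
  assumes "T.clopen V" "T.clopen W" "V \<inter> W = {}"
  shows "\<eta> V \<inter> \<eta> W = {}"
proof -
  have "S.clopen (\<eta> V \<inter> \<eta> W)" using S.clopen_inter \<eta>_clopen assms by blast
  then obtain X where X: "T.clopen X" "\<eta> X = \<eta> V \<inter> \<eta> W" using \<eta>_surj by metis
  then have "\<eta> X \<subseteq> \<eta> V" "\<eta> X \<subseteq> \<eta> W" by auto
  then have "X \<subseteq> V" "X \<subseteq> W" using \<eta>_mono X(1) assms by auto
  then have "X = {}" using assms(3) by blast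
  then show ?thesis using X(2) \<eta>_empty by simp
qed

text \<open>Stone duality: the path whose clopen neighbourhoods are the \<open>V\<close> with \<open>x \<in> \<eta> V\<close>, given by the arrows
  whose cylinders are among these.\<close>

definition point_map :: "'a set \<Rightarrow> 'b set" where
  "point_map x = {b \<in> arr C'. x \<in> \<eta> (T.cyl b)}"

lemma point_map_path:
  assumes "x \<in> S.paths"
  shows "point_map x \<in> T.paths"
  unfolding T.paths_def
proof (intro CollectI conjI allI ballI impI)
  show "point_map x \<subseteq> arr C'" unfolding point_map_def by blast
  show "\<exists>!b. b \<in> point_map x \<and> deg C' b = n" for n
  proof -
    let ?B = "{b \<in> arr C'. deg C' b = n}"
    let ?U = "\<Union>b\<in>?B. \<eta> (T.cyl b)"
    have clU: "S.clopen ?U" by (rule S.clopen_UN[OF T.finite_level]) (rule \<eta>_clopen[OF T.clopen_cyl])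
    obtain V where V: "T.clopen V" "\<eta> V = ?U" using \<eta>_surj[OF clU] .
    have bV: "T.cyl b \<subseteq> V" if "b \<in> ?B" for b
      using \<eta>_mono[OF T.clopen_cyl V(1), of b] V(2) that by blast
    have "T.paths \<subseteq> V"
    proof
      fix y assume "y \<in> T.paths"
      then obtain b where "b \<in> ?B" "y \<in> T.cyl b" using T.path_in_cyl[of y n] by auto
      then show "y \<in> V" using bV by blast
    qed
    then have "S.paths \<subseteq> ?U" using \<eta>_mono[OF T.clopen_paths V(1)] \<eta>_paths V(2) by simp
    then obtain b where b: "b \<in> ?B" "x \<in> \<eta> (T.cyl b)" using assms by blast
    show ?thesis
    proof (rule ex1I)
      show "b \<in> point_map x \<and> deg C' b = n" unfolding point_map_def using b by simp
      fix c assume c: "c \<in> point_map x \<and> deg C' c = n"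
      show "c = b"
      proof (rule ccontr)
        assume "c \<noteq> b"
        then have "T.cyl c \<inter> T.cyl b = {}" using T.cyl_disjoint_degree c b(1) by simp
        then have "\<eta> (T.cyl c) \<inter> \<eta> (T.cyl b) = {}" using \<eta>_disjoint T.clopen_cyl by blast
        then show False using b(2) c unfolding point_map_def by blast
      qed
    qed
  qed
  fix a b assume a: "a \<in> point_map x" "T.prefix b a"
  have "\<eta> (T.cyl a) \<subseteq> \<eta> (T.cyl b)" using \<eta>_mono T.clopen_cyl T.cyl_mono[OF a(2)] by blast
  then show "b \<in> point_map x" using a T.prefixD(1)[OF a(2)] unfolding point_map_def by blast
qed

lemma point_map_clopen:
  assumes "x \<in> S.paths" "T.clopen V"
  shows "point_map x \<in> V \<longleftrightarrow> x \<in> \<eta> V"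
proof -
  note p = point_map_path[OF assms(1)]
  obtain n where n: "\<forall>b\<in>arr C'. deg C' b = n \<longrightarrow> T.cyl b \<subseteq> V \<or> T.cyl b \<inter> V = {}"
    using assms(2) unfolding T.clopen_def by blast
  obtain b where b: "b \<in> arr C'" "deg C' b = n" "point_map x \<in> T.cyl b" using T.path_in_cyl[OF p] by blast
  then have x: "x \<in> \<eta> (T.cyl b)" using T.cylD(2) unfolding point_map_def by blast
  consider "T.cyl b \<subseteq> V" | "T.cyl b \<inter> V = {}" using n b by blast
  then show ?thesis
  proof cases
    case 1
    then have "\<eta> (T.cyl b) \<subseteq> \<eta> V" using \<eta>_mono T.clopen_cyl assms(2) by blast
    then show ?thesis using 1 b(3) x by blast
  next
    case 2
    then have "\<eta> (T.cyl b) \<inter> \<eta> V = {}" using \<eta>_disjoint T.clopen_cyl assms(2) by blast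
    then show ?thesis using 2 b(3) x by blast
  qed
qed

end

text \<open>Conjugation by \<open>\<phi>\<close> carries bisections to bisections, so that \<open>\<phi>\<close> induces an isomorphism of path
  groupoids once the same is known for its inverse \<open>\<psi>\<close>.\<close>

definition path_conjugacy ::
  "('a, 'k::finite) kgraph \<Rightarrow> ('b, 'l::finite) kgraph \<Rightarrow> ('a set \<Rightarrow> 'b set) \<Rightarrow> ('b set \<Rightarrow> 'a set) \<Rightarrow> bool" where
  "path_conjugacy C C' \<phi> \<psi> \<longleftrightarrow>
    (\<forall>x\<in>higher_rank_graph.paths C. \<phi> x \<in> higher_rank_graph.paths C' \<and> \<psi> (\<phi> x) = x) \<and>
    (\<forall>U T. finite_graph.bisection C U T \<longrightarrow> finite_graph.bisection C' (\<phi> ` U) (\<phi> \<circ> T \<circ> \<psi>))"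

text \<open>Conjugates of bisections can be recognized locally, and there bisections agree with elements of the
  full group.\<close>

lemma path_conjugacyI:
  fixes C :: "('a, 'k::finite) kgraph" and C' :: "('b, 'l::finite) kgraph"
  assumes "minimal_graph C" "minimal_graph C'"
    and inv: "\<And>x. x \<in> higher_rank_graph.paths C \<Longrightarrow> \<phi> x \<in> higher_rank_graph.paths C' \<and> \<psi> (\<phi> x) = x"
    and cl: "\<And>U. finite_graph.clopen C U \<Longrightarrow> finite_graph.clopen C' (\<phi> ` U)"
    and eq: "\<And>g. g \<in> finite_graph.full_group C \<Longrightarrow>
      \<exists>g'\<in>finite_graph.full_group C'. \<forall>x\<in>higher_rank_graph.paths C. \<phi> (g x) = g' (\<phi> x)"
  shows "path_conjugacy C C' \<phi> \<psi>"
proof -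
  interpret S: minimal_graph C by fact
  interpret T: minimal_graph C' by fact
  have inj: "x = y" if "\<phi> x = \<phi> y" "x \<in> S.paths" "y \<in> S.paths" for x y
    using inv that by metis
  have "T.bisection (\<phi> ` U) (\<phi> \<circ> F \<circ> \<psi>)" if F: "S.bisection U F" for U F
  proof (rule T.bisection_local)
    have U: "S.clopen U" "U \<subseteq> S.paths" "F ` U \<subseteq> S.paths" "inj_on F U"
      using S.bisectionD[OF F] S.clopen_subset S.bisection_clopen_image[OF F] by auto
    have \<psi>: "\<psi> (\<phi> x) = x" if "x \<in> U" for x using inv U(2) that by blast
    show "T.clopen (\<phi> ` U)" using cl U(1) .
    show "inj_on (\<phi> \<circ> F \<circ> \<psi>) (\<phi> ` U)"
    proof (rule inj_onI)
      fix y y' assume y: "y \<in> \<phi> ` U" "y' \<in> \<phi> ` U" "(\<phi> \<circ> F \<circ> \<psi>) y = (\<phi> \<circ> F \<circ> \<psi>) y'"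
      then obtain x x' where x: "x \<in> U" "y = \<phi> x" "x' \<in> U" "y' = \<phi> x'" by blast
      then have "\<phi> (F x) = \<phi> (F x')" using y(3) \<psi> by simp
      then have "F x = F x'" using inj U(3) x by blast
      then have "x = x'" using inj_onD[OF U(4)] x by blast
      then show "y = y'" using x by simp
    qed
    fix y assume "y \<in> \<phi> ` U"
    then obtain x where x: "x \<in> U" "y = \<phi> x" by blast
    obtain V g where V: "S.clopen V" "x \<in> V" "V \<subseteq> U" "g \<in> S.full_group" "\<And>z. z \<in> V \<Longrightarrow> g z = F z"
      using S.bisection_extends[OF F x(1)] by metis
    obtain g' where g': "g' \<in> T.full_group" "\<forall>x\<in>S.paths. \<phi> (g x) = g' (\<phi> x)" using eq[OF V(4)] by blast
    have yp: "y \<in> T.paths" using inv x U(2) by blast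
    obtain a b where "T.acts g' a b" "y \<in> T.cyl b" using T.bisectionD(3)[OF T.full_groupD(3)[OF g'(1)] yp] by blast
    moreover have "(\<phi> \<circ> F \<circ> \<psi>) z = g' z" if zV: "z \<in> \<phi> ` V" for z
    proof -
      obtain w where w: "w \<in> V" "z = \<phi> w" using zV by (rule imageE)
      then have "w \<in> U" "w \<in> S.paths" using V(3) U(2) by auto
      then show ?thesis using \<psi> w V(5)[OF w(1)] g'(2) by (metis comp_apply)
    qed
    ultimately show "\<exists>g a b V. T.acts g a b \<and> y \<in> T.cyl b \<and> T.clopen V \<and> y \<in> V \<and> (\<forall>z\<in>V. (\<phi> \<circ> F \<circ> \<psi>) z = g z)"
      using cl[OF V(1)] V(2) x(2) by blast
  qed
  then show ?thesis unfolding path_conjugacy_def using inv by blast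
qed

text \<open>The equivariant isomorphism of the algebras of clopen sets is induced by a homeomorphism, and
  equivariance says that the homeomorphism conjugates \<open>g\<close> to \<open>\<alpha> g\<close>.\<close>

theorem group_iso_path_conjugacy:
  fixes C :: "('a, 'k::finite) kgraph" and C' :: "('b, 'l::finite) kgraph"
  assumes "minimal_graph C" "minimal_graph C'"
    and iso: "finite_graph.full_group_monoid C \<cong> finite_graph.full_group_monoid C'"
  obtains \<phi> \<psi> where "path_conjugacy C C' \<phi> \<psi>" "path_conjugacy C' C \<psi> \<phi>"
proof -
  interpret S: minimal_graph C by fact
  interpret T: minimal_graph C' by fact
  obtain \<alpha> where "\<alpha> \<in> iso S.full_group_monoid T.full_group_monoid" using iso unfolding is_iso_def by blast
  then have \<alpha>: "bij_betw \<alpha> S.full_group T.full_group"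
    "\<And>g h. g \<in> S.full_group \<Longrightarrow> h \<in> S.full_group \<Longrightarrow> \<alpha> (g \<circ> h) = \<alpha> g \<circ> \<alpha> h"
    unfolding iso_def hom_def S.full_group_monoid_def T.full_group_monoid_def by auto
  interpret R: rubin_iso S.paths "{U. S.clopen U}" S.full_group T.paths "{U. T.clopen U}" T.full_group \<alpha>
    by (intro rubin_iso.intro rubin_iso_axioms.intro S.rubin_action_full_group T.rubin_action_full_group \<alpha>)
  obtain \<theta> where \<theta>: "bij_betw \<theta> {U. S.clopen U} {U. T.clopen U}"
    "\<And>a b. a \<in> {U. S.clopen U} \<Longrightarrow> b \<in> {U. S.clopen U} \<Longrightarrow> \<theta> a \<subseteq> \<theta> b \<longleftrightarrow> a \<subseteq> b"
    "\<And>g a. g \<in> S.full_group \<Longrightarrow> a \<in> {U. S.clopen U} \<Longrightarrow> \<theta> (g ` a) = \<alpha> g ` \<theta> a"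
    using R.spatial_realization by metis
  define \<eta> where "\<eta> = inv_into {U. S.clopen U} \<theta>"
  have \<eta>\<theta>: "\<eta> (\<theta> U) = U" if "S.clopen U" for U
    unfolding \<eta>_def using bij_betw_inv_into_left[OF \<theta>(1)] that by simp
  have \<theta>\<eta>: "\<theta> (\<eta> V) = V" if "T.clopen V" for V
    unfolding \<eta>_def using bij_betw_inv_into_right[OF \<theta>(1)] that by simp
  have \<eta>_bij: "bij_betw \<eta> {V. T.clopen V} {U. S.clopen U}"
    unfolding \<eta>_def by (rule bij_betw_inv_into[OF \<theta>(1)])
  then have \<eta>_cl: "S.clopen (\<eta> V)" if "T.clopen V" for V using that bij_betwE by blast
  have \<theta>_cl: "T.clopen (\<theta> U)" if "S.clopen U" for U using that \<theta>(1) bij_betwE by blast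
  interpret E: clopen_order_iso C C' \<eta>
  proof
    show "bij_betw \<eta> {V. T.clopen V} {U. S.clopen U}" by (rule \<eta>_bij)
    show "\<eta> V \<subseteq> \<eta> W \<longleftrightarrow> V \<subseteq> W" if "T.clopen V" "T.clopen W" for V W
      using \<theta>(2)[of "\<eta> V" "\<eta> W"] \<theta>\<eta> \<eta>_cl that by simp
  qed
  interpret F: clopen_order_iso C' C \<theta>
    by unfold_locales (use \<theta> in auto)
  define \<phi> where "\<phi> = E.point_map"
  define \<psi> where "\<psi> = F.point_map"
  have \<phi>: "\<phi> x \<in> T.paths" "T.clopen V \<Longrightarrow> \<phi> x \<in> V \<longleftrightarrow> x \<in> \<eta> V" if "x \<in> S.paths" for x V
    unfolding \<phi>_def using E.point_map_path E.point_map_clopen that by auto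
  have \<psi>: "\<psi> y \<in> S.paths" "S.clopen U \<Longrightarrow> \<psi> y \<in> U \<longleftrightarrow> y \<in> \<theta> U" if "y \<in> T.paths" for y U
    unfolding \<psi>_def using F.point_map_path F.point_map_clopen that by auto
  have \<psi>\<phi>: "\<psi> (\<phi> x) = x" if x: "x \<in> S.paths" for x
  proof (rule S.path_subset_eq[OF \<psi>(1)[OF \<phi>(1)[OF x]] x], rule subsetI)
    fix b assume "b \<in> \<psi> (\<phi> x)"
    then have "\<psi> (\<phi> x) \<in> S.cyl b" using \<psi>(1)[OF \<phi>(1)[OF x]] unfolding S.cyl_def by blast
    then have "\<phi> x \<in> \<theta> (S.cyl b)" using \<psi>(2)[OF \<phi>(1)[OF x] S.clopen_cyl] by blast
    then have "x \<in> \<eta> (\<theta> (S.cyl b))" using \<phi>(2)[OF x \<theta>_cl[OF S.clopen_cyl]] by blast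
    then show "b \<in> x" using \<eta>\<theta>[OF S.clopen_cyl] S.cylD(2) by simp
  qed
  have \<phi>\<psi>: "\<phi> (\<psi> y) = y" if y: "y \<in> T.paths" for y
  proof (rule T.path_subset_eq[OF \<phi>(1)[OF \<psi>(1)[OF y]] y], rule subsetI)
    fix b assume "b \<in> \<phi> (\<psi> y)"
    then have "\<phi> (\<psi> y) \<in> T.cyl b" using \<phi>(1)[OF \<psi>(1)[OF y]] unfolding T.cyl_def by blast
    then have "\<psi> y \<in> \<eta> (T.cyl b)" using \<phi>(2)[OF \<psi>(1)[OF y] T.clopen_cyl] by blast
    then have "y \<in> \<theta> (\<eta> (T.cyl b))" using \<psi>(2)[OF y \<eta>_cl[OF T.clopen_cyl]] by blast
    then show "b \<in> y" using \<theta>\<eta>[OF T.clopen_cyl] T.cylD(2) by simp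
  qed
  have \<phi>_img: "\<phi> ` U = \<theta> U" if U: "S.clopen U" for U
  proof
    show "\<phi> ` U \<subseteq> \<theta> U"
    proof
      fix y assume "y \<in> \<phi> ` U"
      then obtain x where x: "x \<in> U" "y = \<phi> x" by (rule imageE)
      moreover have "x \<in> S.paths" using x(1) S.clopen_subset[OF U] by blast
      ultimately show "y \<in> \<theta> U" using \<phi>(2) \<theta>_cl[OF U] \<eta>\<theta>[OF U] by simp
    qed
    show "\<theta> U \<subseteq> \<phi> ` U"
    proof
      fix y assume y: "y \<in> \<theta> U"
      then have yp: "y \<in> T.paths" using T.clopen_subset[OF \<theta>_cl[OF U]] by blast
      then have "\<psi> y \<in> U" using \<psi>(2)[OF yp U] y by blast
      then show "y \<in> \<phi> ` U" using \<phi>\<psi>[OF yp] by (metis imageI)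
    qed
  qed
  have \<psi>_img: "\<psi> ` V = \<eta> V" if V: "T.clopen V" for V
  proof -
    have "V = \<phi> ` \<eta> V" using \<phi>_img[OF \<eta>_cl[OF V]] \<theta>\<eta>[OF V] by simp
    moreover have "\<psi> ` \<phi> ` \<eta> V = \<eta> V"
      using \<psi>\<phi> S.clopen_subset[OF \<eta>_cl[OF V]] by (force simp: image_image)
    ultimately show ?thesis by simp
  qed
  have equi: "\<phi> (g x) = \<alpha> g (\<phi> x)" if g: "g \<in> S.full_group" and x: "x \<in> S.paths" for g x
  proof (rule ccontr)
    assume ne: "\<phi> (g x) \<noteq> \<alpha> g (\<phi> x)"
    have gx: "g x \<in> S.paths" using S.full_group_paths(1)[OF g] x by blast
    have \<alpha>g: "\<alpha> g \<in> T.full_group" using R.\<alpha>_in[OF g] .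
    have "\<alpha> g (\<phi> x) \<in> T.paths" using T.full_group_paths(1)[OF \<alpha>g] \<phi>(1)[OF x] by blast
    then obtain b where b: "\<phi> (g x) \<in> T.cyl b" "\<alpha> g (\<phi> x) \<notin> T.cyl b"
      using T.paths_separated[OF \<phi>(1)[OF gx] _ ne] by metis
    define a where "a = inv_into UNIV g ` \<eta> (T.cyl b)"
    have a: "S.clopen a" unfolding a_def
      using S.full_group_clopen S.full_group_inv[OF g] \<eta>_cl T.clopen_cyl by blast
    have "g ` a = \<eta> (T.cyl b)"
      unfolding a_def using S.full_groupD(1)[OF g] by (simp add: bij_is_surj image_f_inv_f)
    then have \<theta>a: "\<alpha> g ` \<theta> a = T.cyl b"
      using \<theta>(3)[OF g, of a] a \<theta>\<eta>[OF T.clopen_cyl, of b] by simp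
    have "g x \<in> g ` a" using \<phi>(2)[OF gx T.clopen_cyl] b(1) \<open>g ` a = \<eta> (T.cyl b)\<close> by simp
    then have "x \<in> a" using S.full_groupD(1)[OF g] by (metis bij_is_inj inj_image_mem_iff)
    then have "\<phi> x \<in> \<theta> a" using \<phi>_img[OF a] by blast
    then show False using \<theta>a b(2) by blast
  qed
  have "path_conjugacy C C' \<phi> \<psi>"
  proof (rule path_conjugacyI[OF assms(1,2)])
    show "\<phi> x \<in> T.paths \<and> \<psi> (\<phi> x) = x" if "x \<in> S.paths" for x using \<phi>(1) \<psi>\<phi> that by simp
    show "T.clopen (\<phi> ` U)" if "S.clopen U" for U using \<phi>_img \<theta>_cl that by simp
    show "\<exists>g'\<in>T.full_group. \<forall>x\<in>S.paths. \<phi> (g x) = g' (\<phi> x)" if "g \<in> S.full_group" for g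
      using equi[OF that] R.\<alpha>_in[OF that] by blast
  qed
  moreover have "path_conjugacy C' C \<psi> \<phi>"
  proof (rule path_conjugacyI[OF assms(2,1)])
    show "\<psi> y \<in> S.paths \<and> \<phi> (\<psi> y) = y" if "y \<in> T.paths" for y using \<psi>(1) \<phi>\<psi> that by simp
    show "S.clopen (\<psi> ` V)" if "T.clopen V" for V using \<psi>_img \<eta>_cl that by simp
    show "\<exists>g\<in>S.full_group. \<forall>y\<in>T.paths. \<psi> (h y) = g (\<psi> y)" if h: "h \<in> T.full_group" for h
    proof -
      obtain g where g: "g \<in> S.full_group" "h = \<alpha> g" using R.\<alpha>_surj[OF h] by blast
      have "\<psi> (h y) = g (\<psi> y)" if y: "y \<in> T.paths" for y
      proof -
        have gp: "g (\<psi> y) \<in> S.paths" using S.full_group_paths(1)[OF g(1)] \<psi>(1)[OF y] by blast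
        have "h y = \<phi> (g (\<psi> y))" using equi[OF g(1) \<psi>(1)[OF y]] g(2) \<phi>\<psi>[OF y] by simp
        then show ?thesis using \<psi>\<phi>[OF gp] by simp
      qed
      then show ?thesis using g(1) by blast
    qed
  qed
  ultimately show ?thesis by (rule that)
qed

section \<open>The free *-algebra\<close>

abbreviation "plookup \<equiv> Poly_Mapping.lookup"
abbreviation "psingle \<equiv> Poly_Mapping.single"
abbreviation "pkeys \<equiv> Poly_Mapping.keys"

lemma star_word_add: "letters (u + v) = letters u @ letters v" "letters 0 = []"
  by (simp_all add: plus_star_word_def zero_star_word_def)

lemma word_star_simps:
  "word_star (word_star w) = w" "word_star (u + v) = word_star v + word_star u" "word_star 0 = 0"
  "fst ` set (letters (word_star w)) = fst ` set (letters w)" "letters (word_star w) = [] \<longleftrightarrow> letters w = []"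
  by (auto simp: word_star_def plus_star_word_def zero_star_word_def rev_map comp_def case_prod_unfold image_image
      intro: star_word.expand)

lemma word_star_eq: "word_star u = w \<longleftrightarrow> u = word_star w"
  using word_star_simps(1) by metis

lemma poly_decompose:
  fixes f :: "'a \<Rightarrow>\<^sub>0 'b::comm_monoid_add"
  shows "f = (\<Sum>w\<in>pkeys f. psingle w (plookup f w))"
  by (rule poly_mapping_eqI)
    (auto simp: lookup_sum lookup_single when_def sum.delta' in_keys_iff)

lemma poly_induct [case_names zero single add]:
  fixes f :: "'a \<Rightarrow>\<^sub>0 'b::comm_monoid_add"
  assumes "P 0" "\<And>w c. P (psingle w c)" "\<And>f g. P f \<Longrightarrow> P g \<Longrightarrow> P (f + g)"
  shows "P f"
proof -
  have "P (\<Sum>w\<in>A. psingle w (plookup f w))" if "finite A" for A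
    using that by (induction A rule: finite_induct) (simp_all add: assms)
  then show ?thesis using poly_decompose[of f] finite_keys by metis
qed

lemma lookup_poly_star: "plookup (poly_star f) w = cnj (plookup f (word_star w))"
  by (auto simp: poly_star_def lookup_sum lookup_single when_def word_star_eq sum.delta' in_keys_iff)

lemma poly_star_simps:
  "poly_star 0 = 0" "poly_star (f + g) = poly_star f + poly_star g" "poly_star (- f) = - poly_star f"
  "poly_star (f - g) = poly_star f - poly_star g" "poly_star (poly_star f) = f"
  "poly_star (psingle w c) = psingle (word_star w) (cnj c)"
  by (rule poly_mapping_eqI; simp add: lookup_poly_star lookup_add lookup_minus word_star_simps lookup_single when_def;
      metis word_star_eq complex_cnj_zero)+

lemma poly_star_sum: "poly_star (\<Sum>i\<in>I. f i) = (\<Sum>i\<in>I. poly_star (f i))"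
  by (induction I rule: infinite_finite_induct) (simp_all add: poly_star_simps)

lemma poly_star_mult: "poly_star (f * g) = poly_star g * poly_star f"
proof (induction f rule: poly_induct)
  case (single u a)
  show ?case
  proof (induction g rule: poly_induct)
    case (single v b)
    show ?case by (simp add: mult_single poly_star_simps word_star_simps mult.commute)
  qed (simp_all add: poly_star_simps algebra_simps)
qed (simp_all add: poly_star_simps algebra_simps)

lemma lookup_poly_scale: "plookup (poly_scale c f) w = c * plookup f w"
proof -
  have "poly_scale c f = Poly_Mapping.map ((*) c) f"
    unfolding poly_scale_def by (rule mult_map_scale_conv_mult[symmetric])
  then show ?thesis by (simp add: map.rep_eq when_def)
qed

lemma poly_scale_simps:
  "poly_scale c (f + g) = poly_scale c f + poly_scale c g" "poly_scale c (f - g) = poly_scale c f - poly_scale c g"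
  "poly_scale (c + d) f = poly_scale c f + poly_scale d f"
  "poly_scale c (poly_scale d f) = poly_scale (c * d) f" "poly_scale 1 f = f" "poly_scale 0 f = 0"
  "poly_scale c 0 = 0" "poly_scale (- 1) f = - f"
  by (rule poly_mapping_eqI; simp add: lookup_poly_scale lookup_add lookup_minus algebra_simps)+

lemma poly_scale_mult: "poly_scale c f * g = poly_scale c (f * g)" "f * poly_scale c g = poly_scale c (f * g)"
proof -
  show "poly_scale c f * g = poly_scale c (f * g)" unfolding poly_scale_def by (simp add: mult.assoc)
  have "f * psingle 0 c = psingle 0 c * f"
    by (induction f rule: poly_induct) (simp_all add: mult_single algebra_simps)
  then have "f * psingle 0 c * g = psingle 0 c * f * g" by simp
  then show "f * poly_scale c g = poly_scale c (f * g)" unfolding poly_scale_def by (simp add: mult.assoc)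
qed

lemma poly_star_scale: "poly_star (poly_scale c f) = poly_scale (cnj c) (poly_star f)"
  by (rule poly_mapping_eqI) (simp add: lookup_poly_star lookup_poly_scale)

lemma single_scale: "psingle w c = poly_scale c (psingle w 1)"
  by (simp add: poly_scale_def mult_single)

lemma star_polysI: "(\<And>w. plookup f w \<noteq> 0 \<Longrightarrow> letters w \<noteq> [] \<and> fst ` set (letters w) \<subseteq> arr C) \<Longrightarrow> f \<in> star_polys C"
  unfolding star_polys_def by (simp add: in_keys_iff)

lemma star_polysD: "f \<in> star_polys C \<Longrightarrow> plookup f w \<noteq> 0 \<Longrightarrow> letters w \<noteq> [] \<and> fst ` set (letters w) \<subseteq> arr C"
  unfolding star_polys_def by (simp add: in_keys_iff)

lemma star_polys_closed:
  "0 \<in> star_polys C" "a \<in> arr C \<Longrightarrow> gen a \<in> star_polys C"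
  "f \<in> star_polys C \<Longrightarrow> g \<in> star_polys C \<Longrightarrow> f + g \<in> star_polys C"
  "f \<in> star_polys C \<Longrightarrow> g \<in> star_polys C \<Longrightarrow> f - g \<in> star_polys C"
  "f \<in> star_polys C \<Longrightarrow> - f \<in> star_polys C"
  "f \<in> star_polys C \<Longrightarrow> poly_scale c f \<in> star_polys C"
  "f \<in> star_polys C \<Longrightarrow> poly_star f \<in> star_polys C"
  "f \<in> star_polys C \<Longrightarrow> g \<in> star_polys C \<Longrightarrow> f * g \<in> star_polys C"
proof -
  show "0 \<in> star_polys C" by (rule star_polysI) simp
  show "gen a \<in> star_polys C" if "a \<in> arr C"
    by (rule star_polysI) (use that in \<open>auto simp: gen_def lookup_single when_def split: if_splits\<close>)
  show "f + g \<in> star_polys C" if fg: "f \<in> star_polys C" "g \<in> star_polys C"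
  proof (rule star_polysI)
    fix w assume "plookup (f + g) w \<noteq> 0"
    then have "plookup f w \<noteq> 0 \<or> plookup g w \<noteq> 0" by (auto simp: lookup_add)
    then show "letters w \<noteq> [] \<and> fst ` set (letters w) \<subseteq> arr C" using star_polysD fg by blast
  qed
  show "f - g \<in> star_polys C" if fg: "f \<in> star_polys C" "g \<in> star_polys C"
  proof (rule star_polysI)
    fix w assume "plookup (f - g) w \<noteq> 0"
    then have "plookup f w \<noteq> 0 \<or> plookup g w \<noteq> 0" by (auto simp: lookup_minus)
    then show "letters w \<noteq> [] \<and> fst ` set (letters w) \<subseteq> arr C" using star_polysD fg by blast
  qed
  show "- f \<in> star_polys C" if f: "f \<in> star_polys C"
    by (rule star_polysI) (use star_polysD[OF f] in simp)
  show "poly_scale c f \<in> star_polys C" if f: "f \<in> star_polys C"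
    by (rule star_polysI) (use star_polysD[OF f] in \<open>simp add: lookup_poly_scale\<close>)
  show "poly_star f \<in> star_polys C" if f: "f \<in> star_polys C"
  proof (rule star_polysI)
    fix w assume "plookup (poly_star f) w \<noteq> 0"
    then have "plookup f (word_star w) \<noteq> 0" by (simp add: lookup_poly_star)
    then show "letters w \<noteq> [] \<and> fst ` set (letters w) \<subseteq> arr C"
      using star_polysD[OF f, of "word_star w"] by (simp add: word_star_simps(4,5))
  qed
  show "f * g \<in> star_polys C" if fg: "f \<in> star_polys C" "g \<in> star_polys C"
  proof (rule star_polysI)
    fix w assume "plookup (f * g) w \<noteq> 0"
    then have "w \<in> pkeys (f * g)" by (simp add: in_keys_iff)
    then obtain u v where "w = u + v" "u \<in> pkeys f" "v \<in> pkeys g" using keys_mult by blast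
    then show "letters w \<noteq> [] \<and> fst ` set (letters w) \<subseteq> arr C"
      using star_polysD[OF fg(1), of u] star_polysD[OF fg(2), of v] by (auto simp: star_word_add in_keys_iff)
  qed
qed

lemma star_polys_sum: "(\<And>i. i \<in> I \<Longrightarrow> f i \<in> star_polys C) \<Longrightarrow> (\<Sum>i\<in>I. f i) \<in> star_polys C"
  by (induction I rule: infinite_finite_induct) (simp_all add: star_polys_closed)

lemma star_polys_induct [consumes 1, case_names gen star mult add scale zero]:
  assumes f: "f \<in> star_polys C"
    and gen: "\<And>a. a \<in> arr C \<Longrightarrow> P (gen a)" and star: "\<And>a. a \<in> arr C \<Longrightarrow> P (poly_star (gen a))"
    and mult: "\<And>f g. f \<in> star_polys C \<Longrightarrow> g \<in> star_polys C \<Longrightarrow> P f \<Longrightarrow> P g \<Longrightarrow> P (f * g)"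
    and add: "\<And>f g. f \<in> star_polys C \<Longrightarrow> g \<in> star_polys C \<Longrightarrow> P f \<Longrightarrow> P g \<Longrightarrow> P (f + g)"
    and scale: "\<And>c f. f \<in> star_polys C \<Longrightarrow> P f \<Longrightarrow> P (poly_scale c f)"
    and zero: "P 0"
  shows "P f"
proof -
  have letter: "P (psingle (Star_Word [l]) 1) \<and> psingle (Star_Word [l]) 1 \<in> star_polys C" if l: "fst l \<in> arr C" for l
  proof (cases l)
    case (Pair a b)
    have "psingle (Star_Word [(a, True)]) 1 = poly_star (gen a)"
      by (simp add: gen_def poly_star_simps word_star_def)
    moreover have "gen a = psingle (Star_Word [(a, False)]) 1" by (simp add: gen_def)
    moreover have "a \<in> arr C" using l Pair by simp
    ultimately show ?thesis
      using gen[of a] star[of a] star_polys_closed(2)[of a C] star_polys_closed(7)[of "gen a" C] Pair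
      by (cases b) auto
  qed
  have word: "P (psingle (Star_Word ls) 1) \<and> psingle (Star_Word ls) 1 \<in> star_polys C"
    if "ls \<noteq> []" "fst ` set ls \<subseteq> arr C" for ls
    using that
  proof (induction ls rule: list_nonempty_induct)
    case (single l)
    then show ?case using letter by simp
  next
    case (cons l ls)
    have "psingle (Star_Word (l # ls)) (1 :: complex) = psingle (Star_Word [l]) 1 * psingle (Star_Word ls) 1"
      by (simp add: mult_single plus_star_word_def)
    moreover have "P (psingle (Star_Word [l]) 1) \<and> psingle (Star_Word [l]) 1 \<in> star_polys C"
      using letter[of l] cons.prems by simp
    moreover have "P (psingle (Star_Word ls) 1) \<and> psingle (Star_Word ls) 1 \<in> star_polys C"
      using cons.IH cons.prems by simp
    ultimately show ?case using mult star_polys_closed(8) by metis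
  qed
  have "P (\<Sum>w\<in>A. psingle w (plookup f w)) \<and> (\<Sum>w\<in>A. psingle w (plookup f w)) \<in> star_polys C"
    if "finite A" "A \<subseteq> pkeys f" for A
    using that
  proof (induction A rule: finite_induct)
    case (insert w A)
    have "letters w \<noteq> [] \<and> fst ` set (letters w) \<subseteq> arr C" using star_polysD[OF f, of w] insert.prems by (simp add: in_keys_iff)
    then have "P (psingle w 1) \<and> psingle w 1 \<in> star_polys C" using word[of "letters w"] by simp
    then have "P (psingle w (plookup f w)) \<and> psingle w (plookup f w) \<in> star_polys C"
      using scale star_polys_closed(6) single_scale by metis
    then show ?case using insert add star_polys_closed(3) by auto
  qed (simp add: zero star_polys_closed)
  then show ?thesis using poly_decompose[of f] finite_keys order_refl by metis
qed

section \<open>$C^*$-seminorms and orthogonality\<close>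

lemma poly_sum_const: "(\<Sum>i\<in>I. f) = poly_scale (of_nat (card I)) f"
  by (induction I rule: infinite_finite_induct) (simp_all add: poly_scale_simps algebra_simps)

locale star_seminorm =
  fixes C :: "('a, 'm) arrow_cat_scheme" and p :: "'a star_poly \<Rightarrow> real"
  assumes cstar: "cstar_seminorm C p"
begin

lemmas closed = star_polys_closed[where C = C]
lemmas closed_sum = star_polys_sum[where C = C]

lemma p_nonneg: "x \<in> star_polys C \<Longrightarrow> 0 \<le> p x"
  and p_square: "x \<in> star_polys C \<Longrightarrow> p (poly_star x * x) = (p x)\<^sup>2"
  and p_scale: "x \<in> star_polys C \<Longrightarrow> p (poly_scale c x) = cmod c * p x"
  and p_add: "x \<in> star_polys C \<Longrightarrow> y \<in> star_polys C \<Longrightarrow> p (x + y) \<le> p x + p y"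
  and p_mult: "x \<in> star_polys C \<Longrightarrow> y \<in> star_polys C \<Longrightarrow> p (x * y) \<le> p x * p y"
  using cstar unfolding cstar_seminorm_def by auto

lemma p_zero: "p 0 = 0"
  using p_scale[OF closed(1), of 0] by (simp add: poly_scale_simps)

lemma p_uminus: "x \<in> star_polys C \<Longrightarrow> p (- x) = p x"
  using p_scale[of x "- 1"] by (simp add: poly_scale_simps)

lemma p_diff: "x \<in> star_polys C \<Longrightarrow> y \<in> star_polys C \<Longrightarrow> p (x - y) \<le> p x + p y"
  using p_add[of x "- y"] p_uminus[of y] closed(5)[of y] by simp

lemma p_diff_commute: "x \<in> star_polys C \<Longrightarrow> y \<in> star_polys C \<Longrightarrow> p (x - y) = p (y - x)"
  using p_uminus[OF closed(4), of x y] by simp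

lemma p_star:
  assumes "x \<in> star_polys C"
  shows "p (poly_star x) = p x"
proof -
  have le: "p y \<le> p (poly_star y)" if y: "y \<in> star_polys C" for y
  proof (cases "p y = 0")
    case False
    have "p y * p y \<le> p (poly_star y) * p y"
      using p_square[OF y] p_mult[OF closed(7)[OF y] y] by (simp add: power2_eq_square)
    then show ?thesis using False p_nonneg[OF y] by simp
  qed (use p_nonneg[OF closed(7)[OF y]] in simp)
  show ?thesis using le[OF assms] le[OF closed(7)[OF assms]] by (simp add: poly_star_simps)
qed

lemma p_sum: "(\<And>i. i \<in> I \<Longrightarrow> f i \<in> star_polys C) \<Longrightarrow> p (\<Sum>i\<in>I. f i) \<le> (\<Sum>i\<in>I. p (f i))"
proof (induction I rule: infinite_finite_induct)
  case (insert i I)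
  have "p (f i + (\<Sum>i\<in>I. f i)) \<le> p (f i) + p (\<Sum>i\<in>I. f i)"
    by (intro p_add closed_sum) (use insert.prems in auto)
  moreover have "p (\<Sum>i\<in>I. f i) \<le> (\<Sum>i\<in>I. p (f i))" using insert by blast
  ultimately show ?case using insert.hyps by simp
qed (simp_all add: p_zero)

text \<open>Equality in the quotient by the elements of seminorm zero. The calculations below take place in
  this quotient, which satisfies the $C^*$-identity.\<close>

definition eqv :: "'a star_poly \<Rightarrow> 'a star_poly \<Rightarrow> bool" (infix \<open>\<doteq>\<close> 50) where
  "x \<doteq> y \<longleftrightarrow> x \<in> star_polys C \<and> y \<in> star_polys C \<and> p (x - y) = 0"

lemma eqvD: "x \<doteq> y \<Longrightarrow> x \<in> star_polys C" "x \<doteq> y \<Longrightarrow> y \<in> star_polys C"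
  unfolding eqv_def by auto

lemma eqv_refl: "x \<in> star_polys C \<Longrightarrow> x \<doteq> x"
  unfolding eqv_def by (simp add: p_zero)

lemma eqv_sym: "x \<doteq> y \<Longrightarrow> y \<doteq> x"
  unfolding eqv_def using p_diff_commute by metis

lemma p_zero_le: "x \<in> star_polys C \<Longrightarrow> p x \<le> 0 \<Longrightarrow> p x = 0"
  using p_nonneg by (metis order_antisym)

lemma eqv_trans [trans]:
  assumes "x \<doteq> y" "y \<doteq> z"
  shows "x \<doteq> z"
proof -
  have *: "x \<in> star_polys C" "y \<in> star_polys C" "z \<in> star_polys C" using assms eqvD by auto
  have "p ((x - y) + (y - z)) \<le> p (x - y) + p (y - z)" by (intro p_add closed *)
  then have "p (x - z) \<le> 0" using assms unfolding eqv_def by simp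
  then show ?thesis unfolding eqv_def using * p_zero_le closed(4) by blast
qed

lemma eqv_p:
  assumes "x \<doteq> y"
  shows "p x = p y"
proof -
  have *: "x \<in> star_polys C" "y \<in> star_polys C" using assms eqvD by auto
  have "p (x - y + y) \<le> p (x - y) + p y" "p (y - x + x) \<le> p (y - x) + p x"
    by (intro p_add closed *)+
  then show ?thesis using assms eqv_sym[OF assms] unfolding eqv_def by simp
qed

lemma eqv_zero_iff: "x \<doteq> 0 \<longleftrightarrow> x \<in> star_polys C \<and> p x = 0"
  unfolding eqv_def using closed(1) by auto

lemma eqv_add:
  assumes "x \<doteq> x'" "y \<doteq> y'"
  shows "x + y \<doteq> x' + y'"
proof -
  note * = eqvD[OF assms(1)] eqvD[OF assms(2)]
  have "p ((x - x') + (y - y')) \<le> p (x - x') + p (y - y')" by (intro p_add closed *)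
  then have "p ((x + y) - (x' + y')) \<le> 0" using assms unfolding eqv_def by (simp add: algebra_simps)
  then show ?thesis unfolding eqv_def using * p_zero_le closed(3,4) by metis
qed

lemma eqv_scale: "x \<doteq> y \<Longrightarrow> poly_scale c x \<doteq> poly_scale c y"
  unfolding eqv_def using p_scale[OF closed(4), of x y c] closed(6)
  by (simp add: poly_scale_simps)

lemma eqv_uminus: "x \<doteq> y \<Longrightarrow> - x \<doteq> - y"
  using eqv_scale[of x y "- 1"] by (simp add: poly_scale_simps)

lemma eqv_diff: "x \<doteq> x' \<Longrightarrow> y \<doteq> y' \<Longrightarrow> x - y \<doteq> x' - y'"
  using eqv_add[OF _ eqv_uminus, of x x' y y'] by simp

lemma eqv_star: "x \<doteq> y \<Longrightarrow> poly_star x \<doteq> poly_star y"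
  unfolding eqv_def using p_star[OF closed(4), of x y] closed(7)
  by (simp add: poly_star_simps)

lemma eqv_mult:
  assumes "x \<doteq> x'" "y \<doteq> y'"
  shows "x * y \<doteq> x' * y'"
proof -
  note * = eqvD[OF assms(1)] eqvD[OF assms(2)]
  have "x * y - x' * y' = (x - x') * y + x' * (y - y')" by (simp add: algebra_simps)
  then have "p (x * y - x' * y') \<le> p ((x - x') * y) + p (x' * (y - y'))"
    using p_add[of "(x - x') * y" "x' * (y - y')"] * closed by metis
  also have "\<dots> \<le> p (x - x') * p y + p x' * p (y - y')"
    by (intro add_mono p_mult closed *)
  also have "\<dots> = 0" using assms unfolding eqv_def by simp
  finally show ?thesis unfolding eqv_def using * p_zero_le closed(4,8) by metis
qed

lemma eqv_sum: "(\<And>i. i \<in> I \<Longrightarrow> f i \<doteq> g i) \<Longrightarrow> (\<Sum>i\<in>I. f i) \<doteq> (\<Sum>i\<in>I. g i)"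
  by (induction I rule: infinite_finite_induct) (simp_all add: eqv_refl closed eqv_add)

lemma eqv_sum_zero: "(\<And>i. i \<in> I \<Longrightarrow> f i \<doteq> 0) \<Longrightarrow> (\<Sum>i\<in>I. f i) \<doteq> 0"
  using eqv_sum[of I f "\<lambda>_. 0"] by simp

lemma p_projection_le_1:
  assumes "q * q \<doteq> q" "poly_star q \<doteq> q"
  shows "p q \<le> 1"
proof -
  have q: "q \<in> star_polys C" using eqvD(2)[OF assms(1)] .
  have "poly_star q * q \<doteq> q" using eqv_trans[OF eqv_mult[OF assms(2) eqv_refl[OF q]] assms(1)] .
  then have "(p q)\<^sup>2 = p q" using p_square[OF q] eqv_p by metis
  then have "p q * (p q - 1) = 0" by (simp add: power2_eq_square algebra_simps)
  then show ?thesis by auto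
qed

text \<open>A projection \<open>q\<close> is an extreme point among the self-adjoint elements of the unit ball of its corner.
  Put \<open>u z = q + z x\<close>. The squares of \<open>u z\<close> and \<open>u (\<i> z)\<close> have opposite quadratic terms, and their mean is
  \<open>u ((1 + \<i>) z)\<close>. So if \<open>u z\<close> and \<open>u (\<i> z)\<close> are in the unit ball, \<open>u ((1 + \<i>) z)\<close> is in it too. At first
  this applies to \<open>z = 1, \<i>, - 1, - \<i>\<close>, for \<open>z = \<plusminus>\<i>\<close> by the $C^*$-identity because
  \<open>(u \<i>)\<^sup>* u \<i> = q + x\<^sup>2\<close> is the mean of \<open>(u 1)\<^sup>2\<close> and \<open>(u (- 1))\<^sup>2\<close>. By iteration \<open>u ((1 + \<i>) ^ n)\<close> is in the
  unit ball for all \<open>n\<close>, which bounds \<open>(sqrt 2) ^ n * p x\<close>.\<close>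

lemma unit_extreme:
  assumes qq: "q * q \<doteq> q" and qs: "poly_star q \<doteq> q" and qx: "q * x \<doteq> x" and xq: "x * q \<doteq> x"
    and xs: "poly_star x \<doteq> x" and plus: "p (q + x) \<le> 1" and minus: "p (q - x) \<le> 1"
  shows "p x = 0"
proof -
  have q: "q \<in> star_polys C" and x: "x \<in> star_polys C" using eqvD(2) qq qx by auto
  note cl = closed q x
  define u where "u z = q + poly_scale z x" for z
  have u: "u z \<in> star_polys C" for z unfolding u_def by (intro cl)
  have uu: "u z * u w \<doteq> q + poly_scale (z + w) x + poly_scale (z * w) (x * x)" for z w
  proof -
    have "u z * u w = q * q + poly_scale w (q * x) + (poly_scale z (x * q) + poly_scale (z * w) (x * x))"
      unfolding u_def by (simp add: algebra_simps poly_scale_mult poly_scale_simps)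
    also have "\<dots> \<doteq> q + poly_scale w x + (poly_scale z x + poly_scale (z * w) (x * x))"
      by (intro eqv_add eqv_scale qq qx xq eqv_refl cl)
    also have "\<dots> = q + poly_scale (z + w) x + poly_scale (z * w) (x * x)"
      by (simp add: poly_scale_simps algebra_simps)
    finally show ?thesis .
  qed
  have half: "p y \<le> 1" if y: "y \<doteq> poly_scale (1/2) (a * a') + poly_scale (1/2) (b * b')"
    and ab: "a \<in> star_polys C" "a' \<in> star_polys C" "b \<in> star_polys C" "b' \<in> star_polys C"
    and le: "p a \<le> 1" "p a' \<le> 1" "p b \<le> 1" "p b' \<le> 1" for y a b a' b'
  proof -
    have "p y = p (poly_scale (1/2) (a * a') + poly_scale (1/2) (b * b'))" by (rule eqv_p[OF y])
    also have "\<dots> \<le> p (poly_scale (1/2) (a * a')) + p (poly_scale (1/2) (b * b'))"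
      by (intro p_add closed ab)
    also have "\<dots> = (1/2) * p (a * a') + (1/2) * p (b * b')"
      using p_scale[of "a * a'" "1/2"] p_scale[of "b * b'" "1/2"] closed(8) ab by (simp add: norm_divide)
    also have "\<dots> \<le> (1/2) * (p a * p a') + (1/2) * (p b * p b')"
      using p_mult[OF ab(1,2)] p_mult[OF ab(3,4)] by simp
    also have "\<dots> \<le> (1/2) * 1 + (1/2) * 1"
      using mult_le_one[OF le(1) p_nonneg[OF ab(2)] le(2)] mult_le_one[OF le(3) p_nonneg[OF ab(4)] le(4)] by linarith
    finally show ?thesis by simp
  qed
  have step: "p (u ((1 + \<i>) * z)) \<le> 1" if z: "p (u z) \<le> 1" "p (u (\<i> * z)) \<le> 1" for z
  proof (rule half[OF _ u u u u z(1) z(1) z(2) z(2)])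
    have "u ((1 + \<i>) * z) = poly_scale (1/2) (q + poly_scale (z + z) x + poly_scale (z * z) (x * x)) +
        poly_scale (1/2) (q + poly_scale (\<i> * z + \<i> * z) x + poly_scale ((\<i> * z) * (\<i> * z)) (x * x))"
      unfolding u_def
      by (rule poly_mapping_eqI) (simp add: lookup_add lookup_poly_scale algebra_simps)
    also have "\<dots> \<doteq> poly_scale (1/2) (u z * u z) + poly_scale (1/2) (u (\<i> * z) * u (\<i> * z))"
      by (intro eqv_add eqv_scale eqv_sym[OF uu])
    finally show "u ((1 + \<i>) * z) \<doteq> poly_scale (1/2) (u z * u z) + poly_scale (1/2) (u (\<i> * z) * u (\<i> * z))" .
  qed
  have u1: "p (u 1) \<le> 1" "p (u (- 1)) \<le> 1"
    using plus minus unfolding u_def by (simp_all add: poly_scale_simps)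
  have sq: "p (q + x * x) \<le> 1"
  proof (rule half[OF _ u u u u u1(1) u1(1) u1(2) u1(2)])
    have "q + x * x = poly_scale (1/2) (q + poly_scale (1 + 1) x + poly_scale (1 * 1) (x * x)) +
        poly_scale (1/2) (q + poly_scale (- 1 + - 1) x + poly_scale ((- 1) * (- 1)) (x * x))"
      by (rule poly_mapping_eqI) (simp add: lookup_add lookup_poly_scale algebra_simps)
    also have "\<dots> \<doteq> poly_scale (1/2) (u 1 * u 1) + poly_scale (1/2) (u (- 1) * u (- 1))"
      by (intro eqv_add eqv_scale eqv_sym[OF uu])
    finally show "q + x * x \<doteq> poly_scale (1/2) (u 1 * u 1) + poly_scale (1/2) (u (- 1) * u (- 1))" .
  qed
  have imag: "p (u z) \<le> 1" if z: "z = \<i> \<or> z = - \<i>" for z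
  proof -
    have "poly_star (u z) = poly_star q + poly_scale (cnj z) (poly_star x)"
      unfolding u_def by (simp add: poly_star_simps poly_star_scale)
    also have "\<dots> \<doteq> u (cnj z)" unfolding u_def by (intro eqv_add eqv_scale qs xs)
    finally have "poly_star (u z) * u z \<doteq> u (cnj z) * u z" by (intro eqv_mult eqv_refl u)
    also have "\<dots> \<doteq> q + poly_scale (cnj z + z) x + poly_scale (cnj z * z) (x * x)" by (rule uu)
    also have "\<dots> = q + x * x"
    proof -
      have "cnj z + z = 0" "cnj z * z = 1" using z by auto
      then show ?thesis by (simp only: poly_scale_simps add_0_right)
    qed
    finally have "(p (u z))\<^sup>2 = p (q + x * x)" using p_square[OF u] eqv_p by metis
    then have "(p (u z))\<^sup>2 \<le> 1\<^sup>2" using sq by simp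
    then show ?thesis by (rule power2_le_imp_le) simp
  qed
  have base: "p (u (\<i> ^ k)) \<le> 1" for k
  proof -
    have "\<i> ^ k \<in> {1, \<i>, - 1, - \<i>}" by (induction k) auto
    then show ?thesis using u1 imag by auto
  qed
  have all: "p (u (\<i> ^ k * (1 + \<i>) ^ n)) \<le> 1" for k n
  proof (induction n arbitrary: k)
    case (Suc n)
    have "p (u ((1 + \<i>) * (\<i> ^ k * (1 + \<i>) ^ n))) \<le> 1"
      by (rule step) (use Suc[of k] Suc[of "Suc k"] in \<open>simp_all add: mult.assoc\<close>)
    then show ?case by (simp add: ac_simps)
  qed (use base in simp)
  have bound: "(sqrt 2) ^ n * p x \<le> 1 + p q" for n
  proof -
    have "poly_scale ((1 + \<i>) ^ n) x = u ((1 + \<i>) ^ n) - q" unfolding u_def by simp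
    then have "cmod ((1 + \<i>) ^ n) * p x \<le> p (u ((1 + \<i>) ^ n)) + p q"
      using p_scale[OF x, of "(1 + \<i>) ^ n"] p_diff[OF u q] by metis
    moreover have "cmod (1 + \<i>) = sqrt 2" by (simp add: cmod_def)
    ultimately show ?thesis using all[of 0 n] by (simp add: norm_power)
  qed
  show ?thesis
  proof (rule ccontr)
    assume "p x \<noteq> 0"
    then have px: "p x > 0" using p_nonneg[OF x] by simp
    obtain n where "(1 + p q) / p x < (sqrt 2) ^ n" using real_arch_pow[of "sqrt 2"] by auto
    then show False using bound[of n] px by (simp add: field_simps)
  qed
qed

end

locale graph_seminorm = finite_graph C + star_seminorm C p
  for C :: "('a, 'k::finite) kgraph" and p :: "'a star_poly \<Rightarrow> real" +
  assumes relators: "r \<in> graph_relators C \<Longrightarrow> p r = 0"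
begin

lemma gen_closed: "a \<in> arr C \<Longrightarrow> gen a \<in> star_polys C" "a \<in> arr C \<Longrightarrow> poly_star (gen a) \<in> star_polys C"
  using closed by auto

lemma ids_arr: "e \<in> ids C \<Longrightarrow> e \<in> arr C"
  using ids_subset by blast

lemma gen_partial_isometry: "a \<in> arr C \<Longrightarrow> gen a * poly_star (gen a) * gen a \<doteq> gen a"
  unfolding eqv_def using gen_closed closed(8)
  by (auto intro!: relators simp: graph_relators_def)

lemma gen_idem: "e \<in> ids C \<Longrightarrow> gen e * gen e \<doteq> gen e"
  unfolding eqv_def using gen_closed closed(8) ids_arr
  by (auto intro!: relators simp: graph_relators_def)

lemma gen_selfadjoint: "e \<in> ids C \<Longrightarrow> poly_star (gen e) \<doteq> gen e"
  unfolding eqv_def using gen_closed ids_arr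
  by (auto intro!: relators simp: graph_relators_def)

lemma gen_orthogonal: "e \<in> ids C \<Longrightarrow> f \<in> ids C \<Longrightarrow> e \<noteq> f \<Longrightarrow> gen e * gen f \<doteq> 0"
  unfolding eqv_zero_iff using gen_closed closed(8) ids_arr
  by (auto intro!: relators simp: graph_relators_def)

lemma gen_cmp:
  assumes "composable a b"
  shows "gen a * gen b \<doteq> gen (cmp C a b)"
proof -
  note ab = composableD[OF assms]
  have "gen a * gen b - gen (cmp C a b) \<in> graph_relators C"
    unfolding graph_relators_def using ab by blast
  then show ?thesis unfolding eqv_def using relators gen_closed(1)[OF ab(1)] gen_closed(1)[OF ab(2)]
    gen_closed(1)[OF ab(4)] closed(8) by blast
qed

lemma gen_source:
  assumes "a \<in> arr C"
  shows "poly_star (gen a) * gen a \<doteq> gen (src C a)"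
proof -
  have "poly_star (gen a) * gen a - gen (src C a) \<in> graph_relators C"
    unfolding graph_relators_def using assms by blast
  then show ?thesis unfolding eqv_def using relators gen_closed assms
    closed(8) src_in_ids ids_arr by blast
qed

lemma ray_level:
  assumes "e \<in> ids C"
  shows "{a \<in> ray C e. deg C a = n} = {a \<in> arr C. tgt C a = e \<and> deg C a = n}"
proof -
  have ea: "e \<in> arr C" using ids_arr assms .
  have "a \<in> ray C e \<longleftrightarrow> a \<in> arr C \<and> tgt C a = e" for a
    unfolding ray_prefix_iff[OF ea] using prefixD[of e a] tgt_prefix[of a] tgt_id[OF assms] by auto
  then show ?thesis by blast
qed

lemma gen_level_sum:
  assumes "e \<in> ids C"
  shows "gen e \<doteq> (\<Sum>a\<in>{a \<in> arr C. tgt C a = e \<and> deg C a = n}. gen a * poly_star (gen a))"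
proof -
  let ?S = "\<Sum>a\<in>{a \<in> arr C. tgt C a = e \<and> deg C a = n}. gen a * poly_star (gen a)"
  have "gen e - (\<Sum>a\<in>{a \<in> ray C e. deg C a = n}. gen a * poly_star (gen a)) \<in> graph_relators C"
    unfolding graph_relators_def using assms by blast
  then have "p (gen e - ?S) = 0" using relators ray_level[OF assms] by simp
  moreover have "?S \<in> star_polys C" by (rule closed_sum) (use gen_closed closed(8) in auto)
  ultimately show ?thesis unfolding eqv_def using gen_closed ids_arr assms by blast
qed

lemma gen_tgt: "a \<in> arr C \<Longrightarrow> gen (tgt C a) * gen a \<doteq> gen a"
  using gen_cmp[OF composable_tgt] cmp_tgt by metis

lemma gen_src: "a \<in> arr C \<Longrightarrow> gen a * gen (src C a) \<doteq> gen a"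
  using gen_cmp[OF composable_src] cmp_src by metis

lemma star_gen_tgt:
  assumes "a \<in> arr C"
  shows "poly_star (gen a) * gen (tgt C a) \<doteq> poly_star (gen a)"
proof -
  have "poly_star (gen a) * gen (tgt C a) \<doteq> poly_star (gen a) * poly_star (gen (tgt C a))"
    by (intro eqv_mult eqv_refl gen_closed eqv_sym[OF gen_selfadjoint] tgt_in_ids assms)
  also have "\<dots> = poly_star (gen (tgt C a) * gen a)" by (simp add: poly_star_mult)
  also have "\<dots> \<doteq> poly_star (gen a)" by (intro eqv_star gen_tgt assms)
  finally show ?thesis .
qed

definition range_proj :: "'a \<Rightarrow> 'a star_poly" where
  "range_proj a = gen a * poly_star (gen a)"

lemma range_proj:
  assumes "a \<in> arr C"
  shows "range_proj a \<in> star_polys C" "range_proj a * range_proj a \<doteq> range_proj a"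
    "poly_star (range_proj a) = range_proj a" "gen (tgt C a) * range_proj a \<doteq> range_proj a"
    "range_proj a * gen (tgt C a) \<doteq> range_proj a" "p (range_proj a) \<le> 1"
proof -
  note g = gen_closed[OF assms]
  show cl: "range_proj a \<in> star_polys C" unfolding range_proj_def by (intro closed(8) g)
  have "range_proj a * range_proj a = (gen a * poly_star (gen a) * gen a) * poly_star (gen a)"
    unfolding range_proj_def by (simp add: mult.assoc)
  also have "\<dots> \<doteq> range_proj a" unfolding range_proj_def by (intro eqv_mult eqv_refl gen_partial_isometry assms g)
  finally show id: "range_proj a * range_proj a \<doteq> range_proj a" .
  show sa: "poly_star (range_proj a) = range_proj a"
    unfolding range_proj_def by (simp add: poly_star_mult poly_star_simps)
  show "gen (tgt C a) * range_proj a \<doteq> range_proj a"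
    unfolding range_proj_def mult.assoc[symmetric] by (intro eqv_mult eqv_refl g gen_tgt assms)
  show "range_proj a * gen (tgt C a) \<doteq> range_proj a"
    unfolding range_proj_def mult.assoc by (intro eqv_mult eqv_refl g star_gen_tgt assms)
  show "p (range_proj a) \<le> 1" by (rule p_projection_le_1[OF id]) (use sa cl eqv_refl in simp)
qed

text \<open>Let \<open>q\<close> be the range projection of \<open>b\<close>. The projection \<open>s\<^sub>e\<close> of the vertex \<open>e = tgt C b\<close> is the sum of the
  range projections \<open>r\<^sub>a\<close> of the arrows \<open>a\<close> with the same codomain and degree as \<open>b\<close>. The elements \<open>h a = q r\<^sub>a q\<close> for \<open>a \<noteq> b\<close> sum to zero, and each
  \<open>q - h a = q (s\<^sub>e - r\<^sub>a) q\<close> is in the unit ball. So both \<open>q - x\<close> and \<open>q + x\<close> are in the unit ball for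
  \<open>x = h c / N\<close>, where \<open>N\<close> is the number of \<open>a \<noteq> b\<close>: the latter because \<open>- h c\<close> is the sum of the other
  \<open>h a\<close>. Now \<open>unit_extreme\<close> gives \<open>h c = 0\<close>, and \<open>h c\<close> is the square of \<open>r\<^sub>c q\<close> in the sense of the
  $C^*$-identity.\<close>

lemma range_proj_orthogonal:
  assumes b: "b \<in> arr C" and c: "c \<in> arr C" and d: "deg C b = deg C c" and t: "tgt C b = tgt C c" and ne: "b \<noteq> c"
  shows "range_proj c * range_proj b \<doteq> 0"
proof -
  define e where "e = tgt C b"
  define q where "q = range_proj b"
  define L where "L = {a \<in> arr C. tgt C a = e \<and> deg C a = deg C b}"
  define h where "h a = q * range_proj a * q" for a
  have e: "e \<in> ids C" unfolding e_def using tgt_in_ids b by blast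
  have L: "finite L" "b \<in> L" "c \<in> L - {b}"
    unfolding L_def using finite_level[of "deg C b"] b c d t ne by (auto simp: e_def intro: rev_finite_subset)
  have Larr: "a \<in> arr C" "tgt C a = e" if "a \<in> L" for a using that unfolding L_def by auto
  have q: "q \<in> star_polys C" "q * q \<doteq> q" "poly_star q = q" "gen e * q \<doteq> q" "q * gen e \<doteq> q" "p q \<le> 1"
    unfolding q_def e_def using range_proj[OF b] by auto
  have ge: "gen e \<in> star_polys C" using gen_closed ids_arr e by blast
  have hc: "h a \<in> star_polys C" if "a \<in> L" for a
    unfolding h_def by (intro closed(8) q range_proj(1) Larr that)
  have hs: "poly_star (h a) = h a" if "a \<in> L" for a
    unfolding h_def using q(3) range_proj(3)[OF Larr(1)[OF that]] by (simp add: poly_star_mult mult.assoc)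
  have qh: "q * h a \<doteq> h a" "h a * q \<doteq> h a" if "a \<in> L" for a
  proof -
    note r = range_proj(1)[OF Larr(1)[OF that]]
    have "q * h a = q * q * (range_proj a * q)" unfolding h_def by (simp add: mult.assoc)
    also have "\<dots> \<doteq> q * (range_proj a * q)" by (intro eqv_mult eqv_refl closed(8) q r)
    finally show "q * h a \<doteq> h a" unfolding h_def by (simp add: mult.assoc)
    have "h a * q = q * range_proj a * (q * q)" unfolding h_def by (simp add: mult.assoc)
    also have "\<dots> \<doteq> h a" unfolding h_def by (intro eqv_mult eqv_refl closed(8) q r)
    finally show "h a * q \<doteq> h a" .
  qed
  have qmh: "p (q - h a) \<le> 1" if a: "a \<in> L" for a
  proof -
    note r = range_proj[OF Larr(1)[OF a]]
    let ?m = "gen e - range_proj a"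
    have m: "?m \<in> star_polys C" by (intro closed(4) ge r)
    have er: "gen e * range_proj a \<doteq> range_proj a" "range_proj a * gen e \<doteq> range_proj a"
      using r(4,5) Larr(2)[OF a] by auto
    have "?m * ?m = (gen e * gen e - gen e * range_proj a) - (range_proj a * gen e - range_proj a * range_proj a)"
      by (simp add: algebra_simps)
    also have "\<dots> \<doteq> (gen e - range_proj a) - (range_proj a - range_proj a)"
      by (intro eqv_diff gen_idem e er r(2))
    finally have mm: "?m * ?m \<doteq> ?m" by simp
    have "poly_star ?m = poly_star (gen e) - range_proj a" using r(3) by (simp add: poly_star_simps)
    also have "\<dots> \<doteq> ?m" by (intro eqv_diff gen_selfadjoint e eqv_refl r)
    finally have pm: "p ?m \<le> 1" using p_projection_le_1[OF mm] by blast
    have "q * ?m * q = q * gen e * q - h a" unfolding h_def by (simp add: algebra_simps)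
    also have "\<dots> \<doteq> q * q - h a" by (intro eqv_diff eqv_mult eqv_refl q hc a)
    also have "\<dots> \<doteq> q - h a" by (intro eqv_diff eqv_refl q hc a)
    finally have "p (q - h a) = p (q * ?m * q)" using eqv_p by metis
    also have "\<dots> \<le> p (q * ?m) * p q" by (intro p_mult closed(8) q m)
    also have "\<dots> \<le> (p q * p ?m) * p q" by (intro mult_right_mono p_mult p_nonneg q m)
    also have "\<dots> \<le> 1"
      using q(6) pm p_nonneg[OF q(1)] p_nonneg[OF m] by (simp add: mult_le_one)
    finally show ?thesis .
  qed
  let ?R = "L - {b}"
  have hb: "h b \<doteq> q"
  proof -
    have "h b = q * q * q" unfolding h_def q_def by simp
    also have "\<dots> \<doteq> q * q" by (intro eqv_mult eqv_refl q)
    also have "\<dots> \<doteq> q" by (rule q)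
    finally show ?thesis .
  qed
  have sum0: "(\<Sum>a\<in>?R. h a) \<doteq> 0"
  proof -
    have "(\<Sum>a\<in>L. h a) = q * (\<Sum>a\<in>L. range_proj a) * q"
      unfolding h_def by (simp add: sum_distrib_left sum_distrib_right)
    also have "\<dots> \<doteq> q * gen e * q"
      unfolding range_proj_def L_def by (intro eqv_mult eqv_refl q eqv_sym[OF gen_level_sum] e)
    also have "\<dots> \<doteq> q * q" by (intro eqv_mult eqv_refl q)
    also have "\<dots> \<doteq> q" by (rule q)
    finally have "(\<Sum>a\<in>L. h a) - h b \<doteq> q - q" by (intro eqv_diff hb)
    moreover have "(\<Sum>a\<in>L. h a) = h b + (\<Sum>a\<in>?R. h a)" using L by (simp add: sum.remove)
    ultimately show ?thesis by simp
  qed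
  define N where "N = card ?R"
  have "?R \<noteq> {}" "finite ?R" using L by auto
  then have N: "N > 0" unfolding N_def by (metis card_gt_0_iff)
  define x where "x = poly_scale (1 / of_nat N) (h c)"
  have cL: "c \<in> L" using L by blast
  note hcc = hc[OF cL]
  have x: "x \<in> star_polys C" unfolding x_def using closed(6) hcc .
  have minus: "p (q - x) \<le> 1"
  proof -
    \<comment> \<open>\<open>q - x\<close> is a convex combination of \<open>q\<close> and \<open>q - h c\<close>.\<close>
    have "q - x = poly_scale (1 - 1 / of_nat N) q + poly_scale (1 / of_nat N) (q - h c)"
      unfolding x_def by (rule poly_mapping_eqI) (simp add: lookup_add lookup_minus lookup_poly_scale algebra_simps)
    then have "p (q - x) \<le> p (poly_scale (1 - 1 / of_nat N) q) + p (poly_scale (1 / of_nat N) (q - h c))"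
      using p_add[OF closed(6)[OF q(1)] closed(6)[OF closed(4)[OF q(1) hcc]]] by metis
    also have "\<dots> = cmod (1 - 1 / of_nat N) * p q + cmod (1 / of_nat N) * p (q - h c)"
      using p_scale[OF q(1)] p_scale[OF closed(4)[OF q(1) hcc]] by simp
    also have "cmod (1 - 1 / of_nat N) = 1 - 1 / real N"
    proof -
      have "(1 :: complex) - 1 / of_nat N = of_real (1 - 1 / real N)" by simp
      then have "cmod (1 - 1 / of_nat N) = \<bar>1 - 1 / real N\<bar>" by (metis norm_of_real)
      moreover have "1 / real N \<le> 1" using N by simp
      ultimately show ?thesis by simp
    qed
    also have "cmod (1 / of_nat N) = 1 / real N" by (simp add: norm_divide)
    also have "(1 - 1 / real N) * p q + 1 / real N * p (q - h c) \<le> (1 - 1 / real N) * 1 + 1 / real N * 1"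
      using N q(6) qmh[OF cL] by (intro add_mono mult_left_mono) auto
    finally show ?thesis by simp
  qed
  have plus: "p (q + x) \<le> 1"
  proof -
    let ?R' = "?R - {c}"
    have fin: "finite ?R" using L by simp
    \<comment> \<open>\<open>q + x\<close> is the mean of \<open>q\<close> and the \<open>q - h a\<close> for \<open>a\<close> other than \<open>b\<close> and \<open>c\<close>.\<close>
    have "(\<Sum>a\<in>?R'. q - h a) = poly_scale (of_nat (card ?R')) q - (\<Sum>a\<in>?R'. h a)"
      by (simp only: sum_subtractf poly_sum_const)
    also have "(\<Sum>a\<in>?R'. h a) = (\<Sum>a\<in>?R. h a) - h c" using fin L(3) by (simp add: sum.remove)
    also have "poly_scale (of_nat (card ?R')) q - ((\<Sum>a\<in>?R. h a) - h c) \<doteq>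
        poly_scale (of_nat (card ?R')) q - (0 - h c)"
      by (intro eqv_diff sum0 eqv_refl closed(6) q hcc)
    finally have *: "(\<Sum>a\<in>?R'. q - h a) \<doteq> poly_scale (of_nat (card ?R')) q + h c" by simp
    have card: "card ?R' = N - 1" unfolding N_def using fin L(3) by simp
    have c1: "(of_nat (N - 1) :: complex) = of_nat N - 1" using N by (simp add: of_nat_diff)
    have "q + x = poly_scale (1 / of_nat N) (q + (poly_scale (of_nat (card ?R')) q + h c))"
      unfolding x_def card c1 using N
      by (intro poly_mapping_eqI) (simp add: lookup_add lookup_poly_scale field_simps)
    also have "\<dots> \<doteq> poly_scale (1 / of_nat N) (q + (\<Sum>a\<in>?R'. q - h a))"
      by (intro eqv_scale eqv_add eqv_refl q eqv_sym[OF *])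
    finally have "p (q + x) = p (poly_scale (1 / of_nat N) (q + (\<Sum>a\<in>?R'. q - h a)))" by (rule eqv_p)
    also have sc: "(\<Sum>a\<in>?R'. q - h a) \<in> star_polys C" using eqvD(1)[OF *] .
    have "p (poly_scale (1 / of_nat N) (q + (\<Sum>a\<in>?R'. q - h a))) = (1 / real N) * p (q + (\<Sum>a\<in>?R'. q - h a))"
      using p_scale[OF closed(3)[OF q(1) sc]] by (simp add: norm_divide)
    also have "\<dots> \<le> (1 / real N) * (1 + real (N - 1))"
    proof (rule mult_left_mono)
      have "p (q + (\<Sum>a\<in>?R'. q - h a)) \<le> p q + p (\<Sum>a\<in>?R'. q - h a)" by (intro p_add q sc)
      also have "p (\<Sum>a\<in>?R'. q - h a) \<le> (\<Sum>a\<in>?R'. p (q - h a))"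
        by (rule p_sum) (use q hc closed(4) in blast)
      also have "\<dots> \<le> (\<Sum>a\<in>?R'. 1)" by (rule sum_mono) (use qmh in blast)
      finally show "p (q + (\<Sum>a\<in>?R'. q - h a)) \<le> 1 + real (N - 1)" using q(6) card by simp
    qed simp
    also have "\<dots> = 1" using N by (simp add: field_simps of_nat_diff)
    finally show ?thesis .
  qed
  have "p x = 0"
  proof (rule unit_extreme[OF q(2) _ _ _ _ plus minus])
    show "poly_star q \<doteq> q" using q eqv_refl by simp
    show "q * x \<doteq> x" "x * q \<doteq> x" unfolding x_def poly_scale_mult by (intro eqv_scale qh cL)+
    show "poly_star x \<doteq> x" unfolding x_def poly_star_scale using hs[OF cL] eqv_refl closed(6)[OF hcc] by simp
  qed
  then have "p (h c) = 0" unfolding x_def p_scale[OF hcc] using N by simp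
  moreover note r = range_proj[OF c]
  have "poly_star (range_proj c * q) * (range_proj c * q) = q * (range_proj c * range_proj c) * q"
    using q(3) r(3) by (simp add: poly_star_mult mult.assoc)
  moreover have "q * (range_proj c * range_proj c) * q \<doteq> h c"
    unfolding h_def by (intro eqv_mult eqv_refl q r(2))
  ultimately have "(p (range_proj c * q))\<^sup>2 = 0"
    using p_square[OF closed(8)[OF r(1) q(1)]] eqv_p by metis
  then show ?thesis unfolding eqv_zero_iff q_def[symmetric] using closed(8) r(1) q(1) by simp
qed

lemma star_gen_orthogonal:
  assumes b: "b \<in> arr C" and c: "c \<in> arr C" and d: "deg C b = deg C c" and ne: "b \<noteq> c"
  shows "poly_star (gen b) * gen c \<doteq> 0"
proof -
  note gb = gen_closed[OF b] and gc = gen_closed[OF c]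
  show ?thesis
  proof (cases "tgt C b = tgt C c")
    case True
    have "poly_star (gen b) \<doteq> poly_star (gen b * poly_star (gen b) * gen b)"
      by (intro eqv_sym[OF eqv_star] gen_partial_isometry b)
    also have "\<dots> = poly_star (gen b) * range_proj b"
      unfolding range_proj_def by (simp add: poly_star_mult poly_star_simps mult.assoc)
    finally have 1: "poly_star (gen b) \<doteq> poly_star (gen b) * range_proj b" .
    have 2: "gen c \<doteq> range_proj c * gen c" unfolding range_proj_def by (intro eqv_sym[OF gen_partial_isometry] c)
    have "poly_star (gen b) * gen c \<doteq> poly_star (gen b) * range_proj b * (range_proj c * gen c)"
      by (intro eqv_mult 1 2)
    also have "\<dots> = poly_star (gen b) * (range_proj b * range_proj c) * gen c" by (simp add: mult.assoc)
    also have "\<dots> \<doteq> poly_star (gen b) * 0 * gen c"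
      by (intro eqv_mult eqv_refl gb gc range_proj_orthogonal) (use assms True in auto)
    finally show ?thesis by simp
  next
    case False
    have "poly_star (gen b) * gen c \<doteq> poly_star (gen b) * gen (tgt C b) * (gen (tgt C c) * gen c)"
      by (intro eqv_mult eqv_sym[OF star_gen_tgt] eqv_sym[OF gen_tgt] b c)
    also have "\<dots> = poly_star (gen b) * (gen (tgt C b) * gen (tgt C c)) * gen c" by (simp add: mult.assoc)
    also have "\<dots> \<doteq> poly_star (gen b) * 0 * gen c"
      by (intro eqv_mult eqv_refl gb gc gen_orthogonal tgt_in_ids b c False)
    finally show ?thesis by simp
  qed
qed

lemma p_gen_le_1:
  assumes "a \<in> arr C"
  shows "p (gen a) \<le> 1"
proof -
  have e: "src C a \<in> ids C" using src_in_ids assms by blast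
  have "(p (gen a))\<^sup>2 = p (gen (src C a))" using p_square[OF gen_closed(1)[OF assms]] eqv_p[OF gen_source[OF assms]] by simp
  also have "\<dots> \<le> 1" by (rule p_projection_le_1[OF gen_idem[OF e] gen_selfadjoint[OF e]])
  finally have "(p (gen a))\<^sup>2 \<le> 1\<^sup>2" by simp
  then show ?thesis by (rule power2_le_imp_le) simp
qed

end

section \<open>Operators of local maps\<close>

context finite_graph
begin

definition matrix_unit :: "'a \<Rightarrow> 'a \<Rightarrow> 'a star_poly" where
  "matrix_unit a b = gen a * poly_star (gen b)"

definition op_sum :: "('a \<times> 'a) set \<Rightarrow> 'a star_poly" where
  "op_sum P = (\<Sum>(a, b)\<in>P. matrix_unit a b)"

text \<open>A decomposition of \<open>h\<close> on \<open>U\<close> into finitely many basic maps \<open>b y \<mapsto> a y\<close> on disjoint cylinders.\<close>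

definition represents :: "('a \<times> 'a) set \<Rightarrow> 'a set set \<Rightarrow> ('a set \<Rightarrow> 'a set) \<Rightarrow> bool" where
  "represents P U h \<longleftrightarrow> finite P \<and> (\<forall>a b. (a, b) \<in> P \<longrightarrow> acts h a b \<and> cyl b \<subseteq> U) \<and>
    (\<forall>x\<in>U. \<exists>a b. (a, b) \<in> P \<and> x \<in> cyl b) \<and>
    (\<forall>a b a' b'. (a, b) \<in> P \<longrightarrow> (a', b') \<in> P \<longrightarrow> cyl b \<inter> cyl b' \<noteq> {} \<longrightarrow> a = a' \<and> b = b')"

lemma representsI:
  assumes "finite P" "\<And>a b. (a, b) \<in> P \<Longrightarrow> acts h a b \<and> cyl b \<subseteq> U"
    "\<And>x. x \<in> U \<Longrightarrow> \<exists>a b. (a, b) \<in> P \<and> x \<in> cyl b"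
    "\<And>a b a' b'. (a, b) \<in> P \<Longrightarrow> (a', b') \<in> P \<Longrightarrow> cyl b \<inter> cyl b' \<noteq> {} \<Longrightarrow> a = a' \<and> b = b'"
  shows "represents P U h"
  unfolding represents_def using assms by simp

lemma representsD:
  assumes "represents P U h"
  shows "finite P" "(a, b) \<in> P \<Longrightarrow> acts h a b" "(a, b) \<in> P \<Longrightarrow> cyl b \<subseteq> U"
    "x \<in> U \<Longrightarrow> \<exists>a b. (a, b) \<in> P \<and> x \<in> cyl b"
    "(a, b) \<in> P \<Longrightarrow> (a', b') \<in> P \<Longrightarrow> x \<in> cyl b \<Longrightarrow> x \<in> cyl b' \<Longrightarrow> a = a' \<and> b = b'"
proof -
  note r = assms[unfolded represents_def]
  show "finite P" "(a, b) \<in> P \<Longrightarrow> acts h a b" "(a, b) \<in> P \<Longrightarrow> cyl b \<subseteq> U"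
    "x \<in> U \<Longrightarrow> \<exists>a b. (a, b) \<in> P \<and> x \<in> cyl b" using r by simp_all
  assume "(a, b) \<in> P" "(a', b') \<in> P" "x \<in> cyl b" "x \<in> cyl b'"
  moreover from this have "cyl b \<inter> cyl b' \<noteq> {}" by blast
  ultimately show "a = a' \<and> b = b'" using r by simp
qed

lemma represents_cong:
  assumes "represents P U h" "\<And>x. x \<in> U \<Longrightarrow> h x = g x"
  shows "represents P U g"
proof (rule representsI)
  note P = representsD[OF assms(1)]
  show "finite P" by (rule P(1))
  show "acts g a b \<and> cyl b \<subseteq> U" if "(a, b) \<in> P" for a b
    using acts_cong[OF P(2)[OF that], of g] P(3)[OF that] assms(2) by blast
  show "\<exists>a b. (a, b) \<in> P \<and> x \<in> cyl b" if "x \<in> U" for x using P(4)[OF that] .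
  show "a = a' \<and> b = b'" if "(a, b) \<in> P" "(a', b') \<in> P" "cyl b \<inter> cyl b' \<noteq> {}" for a b a' b'
    using that P(5)[OF that(1,2)] by blast
qed

lemma represents_inverse:
  assumes "represents P U h" "\<And>x. x \<in> U \<Longrightarrow> g (h x) = x"
  shows "represents (prod.swap ` P) (h ` U) g"
proof (rule representsI)
  note P = representsD[OF assms(1)]
  show "finite (prod.swap ` P)" using P(1) by simp
  have img: "cyl a = h ` cyl b" if "(a, b) \<in> P" for a b using acts_image[OF P(2)[OF that]] by simp
  show "acts g b a \<and> cyl a \<subseteq> h ` U" if "(b, a) \<in> prod.swap ` P" for a b
  proof -
    have ab: "(a, b) \<in> P" using that by auto
    have "acts g b a" by (rule acts_inverse[OF P(2)[OF ab]]) (use assms(2) P(3)[OF ab] in blast)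
    moreover have "cyl a \<subseteq> h ` U" unfolding img[OF ab] by (rule image_mono[OF P(3)[OF ab]])
    ultimately show ?thesis ..
  qed
  show "\<exists>a b. (a, b) \<in> prod.swap ` P \<and> y \<in> cyl b" if y: "y \<in> h ` U" for y
  proof -
    obtain x where x: "x \<in> U" "y = h x" using y by blast
    obtain a b where "(a, b) \<in> P" "x \<in> cyl b" using P(4)[OF x(1)] by blast
    then have "(b, a) \<in> prod.swap ` P" "y \<in> cyl a" using img x(2) by auto
    then show ?thesis by blast
  qed
  show "b = b' \<and> a = a'" if *: "(b, a) \<in> prod.swap ` P" "(b', a') \<in> prod.swap ` P" "cyl a \<inter> cyl a' \<noteq> {}" for a b a' b'
  proof -
    have ab: "(a, b) \<in> P" "(a', b') \<in> P" using * by auto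
    obtain y where "y \<in> h ` cyl b" "y \<in> h ` cyl b'" using *(3) img[OF ab(1)] img[OF ab(2)] by auto
    then obtain x x' where x: "x \<in> cyl b" "x' \<in> cyl b'" "h x = h x'" by auto
    have "x \<in> U" "x' \<in> U" using x P(3)[OF ab(1)] P(3)[OF ab(2)] by auto
    then have "x = x'" using assms(2) x(3) by metis
    then show ?thesis using P(5)[OF ab x(1)] x(2) by simp
  qed
qed

lemma op_sum_inverse: "poly_star (op_sum P) = op_sum (prod.swap ` P)"
proof -
  have "op_sum (prod.swap ` P) = (\<Sum>x\<in>P. case prod.swap x of (a, b) \<Rightarrow> matrix_unit a b)"
    unfolding op_sum_def by (simp add: sum.reindex)
  also have "\<dots> = poly_star (op_sum P)"
    unfolding op_sum_def poly_star_sum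
    by (rule sum.cong) (auto simp: matrix_unit_def poly_star_mult poly_star_simps split: prod.split)
  finally show ?thesis by simp
qed

lemma represents_union:
  assumes "represents P U h" "represents Q V h" "U \<inter> V = {}"
  shows "represents (P \<union> Q) (U \<union> V) h" "op_sum (P \<union> Q) = op_sum P + op_sum Q"
proof -
  note P = representsD[OF assms(1)] and Q = representsD[OF assms(2)]
  show "represents (P \<union> Q) (U \<union> V) h"
  proof (rule representsI)
    show "finite (P \<union> Q)" using P(1) Q(1) by simp
    show "acts h a b \<and> cyl b \<subseteq> U \<union> V" if "(a, b) \<in> P \<union> Q" for a b
      using that P(2,3) Q(2,3) by blast
    show "\<exists>a b. (a, b) \<in> P \<union> Q \<and> x \<in> cyl b" if x: "x \<in> U \<union> V" for x
      using x P(4)[of x] Q(4)[of x] by blast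
    show "a = a' \<and> b = b'" if *: "(a, b) \<in> P \<union> Q" "(a', b') \<in> P \<union> Q" "cyl b \<inter> cyl b' \<noteq> {}" for a b a' b'
    proof -
      obtain x where x: "x \<in> cyl b" "x \<in> cyl b'" using *(3) by blast
      consider "(a, b) \<in> P" "(a', b') \<in> P" | "(a, b) \<in> Q" "(a', b') \<in> Q" |
        "(a, b) \<in> P" "(a', b') \<in> Q" | "(a, b) \<in> Q" "(a', b') \<in> P" using *(1,2) by blast
      then show ?thesis
      proof cases
        case 1 then show ?thesis using P(5) x by blast
      next
        case 2 then show ?thesis using Q(5) x by blast
      next
        case 3 then show ?thesis using P(3)[OF 3(1)] Q(3)[OF 3(2)] x assms(3) by blast
      next
        case 4 then show ?thesis using Q(3)[OF 4(1)] P(3)[OF 4(2)] x assms(3) by blast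
      qed
    qed
  qed
  have "P \<inter> Q = {}"
  proof (rule ccontr)
    assume "P \<inter> Q \<noteq> {}"
    then obtain a b where ab: "(a, b) \<in> P" "(a, b) \<in> Q" by auto
    then have "cyl b \<noteq> {}" using cyl_nonempty actsD(2)[OF P(2)] by blast
    then show False using P(3)[OF ab(1)] Q(3)[OF ab(2)] assms(3) by blast
  qed
  then show "op_sum (P \<union> Q) = op_sum P + op_sum Q"
    unfolding op_sum_def using P(1) Q(1) by (simp add: sum.union_disjoint)
qed

lemma represents_UN:
  assumes "finite I" "\<And>i. i \<in> I \<Longrightarrow> represents (P i) (U i) h"
    "\<And>i j. i \<in> I \<Longrightarrow> j \<in> I \<Longrightarrow> i \<noteq> j \<Longrightarrow> U i \<inter> U j = {}"
  shows "represents (\<Union>i\<in>I. P i) (\<Union>i\<in>I. U i) h \<and> op_sum (\<Union>i\<in>I. P i) = (\<Sum>i\<in>I. op_sum (P i))"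
  using assms
proof (induction I rule: finite_induct)
  case empty
  then show ?case by (simp add: represents_def op_sum_def)
next
  case (insert i I)
  have IH: "represents (\<Union>i\<in>I. P i) (\<Union>i\<in>I. U i) h" "op_sum (\<Union>i\<in>I. P i) = (\<Sum>i\<in>I. op_sum (P i))"
    using insert by auto
  have "U i \<inter> (\<Union>i\<in>I. U i) = {}" using insert.prems(2)[of i] insert.hyps(2) by blast
  then show ?case
    using represents_union[OF insert.prems(1)[of i] IH(1)] IH(2) insert.hyps by simp
qed

text \<open>The decomposition of \<open>h\<close> along the arrows \<open>b\<close> of degree \<open>n\<close>. It covers \<open>U\<close> if \<open>n\<close> dominates the degrees
  that occur in some decomposition.\<close>

definition level_rep :: "nat ^ 'k \<Rightarrow> 'a set set \<Rightarrow> ('a set \<Rightarrow> 'a set) \<Rightarrow> ('a \<times> 'a) set" where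
  "level_rep n U h = {(a, b). b \<in> arr C \<and> deg C b = n \<and> cyl b \<subseteq> U \<and> acts h a b}"

definition dominates :: "nat ^ 'k \<Rightarrow> ('a \<times> 'a) set \<Rightarrow> bool" where
  "dominates n P \<longleftrightarrow> (\<forall>(a, b)\<in>P. \<exists>k. n = deg C b + k)"

lemma dominates_sum: "finite P \<Longrightarrow> dominates ((\<Sum>(a, b)\<in>P. deg C b) + m) P"
  unfolding dominates_def
proof safe
  fix a b assume "finite P" "(a, b) \<in> P"
  then have "(\<Sum>(a, b)\<in>P. deg C b) + m = deg C b + ((\<Sum>(a, b)\<in>P - {(a, b)}. deg C b) + m)"
    by (simp add: sum.remove add.assoc)
  then show "\<exists>k. (\<Sum>(a, b)\<in>P. deg C b) + m = deg C b + k" by blast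
qed

end

context aperiodic_graph
begin

lemma represents_level:
  assumes "represents P U h" "dominates n P"
  shows "represents (level_rep n U h) U h"
    "(a1, b1) \<in> level_rep n U h \<Longrightarrow> \<exists>a b c. (a, b) \<in> P \<and> composable b c \<and> a1 = cmp C a c \<and> b1 = cmp C b c"
proof -
  note P = representsD[OF assms(1)]
  show decomp: "\<exists>a b c. (a, b) \<in> P \<and> composable b c \<and> a1 = cmp C a c \<and> b1 = cmp C b c"
    if *: "(a1, b1) \<in> level_rep n U h" for a1 b1
  proof -
    have b1: "b1 \<in> arr C" "deg C b1 = n" "cyl b1 \<subseteq> U" "acts h a1 b1" using * unfolding level_rep_def by auto
    obtain x where x: "x \<in> cyl b1" using cyl_nonempty[OF b1(1)] by blast
    obtain a b where ab: "(a, b) \<in> P" "x \<in> cyl b" using P(4) x b1(3) by blast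
    obtain k where "n = deg C b + k" using assms(2) ab(1) unfolding dominates_def by blast
    then obtain c where c: "composable b c" "b1 = cmp C b c" using nbhd_extension[OF ab(2) x] b1(2) by metis
    have "a1 = cmp C a c" using acts_unique[OF b1(4)] acts_ext(2)[OF P(2)[OF ab(1)] c(1)] c(2) by blast
    then show ?thesis using ab(1) c by blast
  qed
  show "represents (level_rep n U h) U h"
  proof (rule representsI)
    have "level_rep n U h \<subseteq> (\<lambda>b. (THE a. acts h a b, b)) ` {b \<in> arr C. deg C b = n}"
    proof
      fix z assume "z \<in> level_rep n U h"
      then obtain a b where z: "z = (a, b)" "b \<in> arr C" "deg C b = n" "acts h a b" unfolding level_rep_def by blast
      have "(THE a. acts h a b) = a" by (rule the_equality) (use z acts_unique in auto)
      then show "z \<in> (\<lambda>b. (THE a. acts h a b, b)) ` {b \<in> arr C. deg C b = n}" using z by auto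
    qed
    then show "finite (level_rep n U h)" using finite_level finite_subset by blast
    show "acts h a b \<and> cyl b \<subseteq> U" if "(a, b) \<in> level_rep n U h" for a b
      using that unfolding level_rep_def by blast
    show "\<exists>a b. (a, b) \<in> level_rep n U h \<and> x \<in> cyl b" if x: "x \<in> U" for x
    proof -
      obtain a b where ab: "(a, b) \<in> P" "x \<in> cyl b" using P(4)[OF x] by blast
      obtain k where k: "n = deg C b + k" using assms(2) ab(1) unfolding dominates_def by blast
      obtain b1 where b1: "b1 \<in> arr C" "deg C b1 = n" "x \<in> cyl b1" using path_in_cyl cylD(1)[OF ab(2)] by blast
      obtain c where c: "composable b c" "b1 = cmp C b c" using nbhd_extension[OF ab(2) b1(3)] b1(2) k by metis
      have "cyl b1 \<subseteq> U" using cyl_mono[OF prefix_cmp[OF c(1)]] c(2) P(3)[OF ab(1)] by blast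
      moreover have "acts h (cmp C a c) b1" using acts_ext(2)[OF P(2)[OF ab(1)] c(1)] c(2) by simp
      ultimately show ?thesis using b1 unfolding level_rep_def by blast
    qed
    show "a = a' \<and> b = b'" if *: "(a, b) \<in> level_rep n U h" "(a', b') \<in> level_rep n U h" "cyl b \<inter> cyl b' \<noteq> {}" for a b a' b'
    proof -
      have bb: "b = b'" using * cyl_disjoint_degree[of b b'] unfolding level_rep_def by auto
      have "acts h a b" "acts h a' b" using * bb unfolding level_rep_def by auto
      then show ?thesis using bb acts_unique by blast
    qed
  qed
qed

lemma bisection_represents:
  assumes "bisection U h"
  shows "\<exists>P. represents P U h"
proof -
  obtain n where n: "\<forall>b\<in>arr C. deg C b = n \<longrightarrow> cyl b \<inter> U = {} \<or> cyl b \<subseteq> U \<and> (\<exists>a. acts h a b)"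
    using bisection_level[OF assms] .
  let ?B = "{b \<in> arr C. deg C b = n} \<inter> {b. cyl b \<subseteq> U \<and> (\<exists>a. acts h a b)}"
  define f where "f b = (SOME a. acts h a b)" for b
  have f: "acts h (f b) b" if "b \<in> ?B" for b
  proof -
    have "\<exists>a. acts h a b" using that by blast
    then show ?thesis unfolding f_def by (rule someI_ex)
  qed
  have "represents ((\<lambda>b. (f b, b)) ` ?B) U h"
  proof (rule representsI)
    show "finite ((\<lambda>b. (f b, b)) ` ?B)" using finite_level by blast
    show "acts h a b \<and> cyl b \<subseteq> U" if "(a, b) \<in> (\<lambda>b. (f b, b)) ` ?B" for a b using that f by auto
    show "\<exists>a b. (a, b) \<in> (\<lambda>b. (f b, b)) ` ?B \<and> x \<in> cyl b" if x: "x \<in> U" for x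
    proof -
      obtain b where b: "b \<in> arr C" "deg C b = n" "x \<in> cyl b"
        using path_in_cyl x clopen_subset[OF bisectionD(1)[OF assms]] by blast
      then have "b \<in> ?B" using n x by blast
      then show ?thesis using b(3) by blast
    qed
    show "a = a' \<and> b = b'" if *: "(a, b) \<in> (\<lambda>b. (f b, b)) ` ?B" "(a', b') \<in> (\<lambda>b. (f b, b)) ` ?B" "cyl b \<inter> cyl b' \<noteq> {}" for a b a' b'
    proof -
      have "b = b'" using * cyl_disjoint_degree[of b b'] by auto
      then show ?thesis using * by auto
    qed
  qed
  then show ?thesis by blast
qed

text \<open>The choice of the decomposition is immaterial up to elements of seminorm zero.\<close>

definition spectral_op :: "'a set set \<Rightarrow> ('a set \<Rightarrow> 'a set) \<Rightarrow> 'a star_poly" where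
  "spectral_op U h = op_sum (SOME P. represents P U h)"

end

locale aperiodic_seminorm = aperiodic_graph C + graph_seminorm C p
  for C :: "('a, 'k::finite) kgraph" and p :: "'a star_poly \<Rightarrow> real"
begin

lemma matrix_unit_closed: "a \<in> arr C \<Longrightarrow> b \<in> arr C \<Longrightarrow> matrix_unit a b \<in> star_polys C"
  unfolding matrix_unit_def by (intro closed(8) gen_closed)

lemma op_sum_closed:
  assumes "represents P U h"
  shows "op_sum P \<in> star_polys C"
  unfolding op_sum_def
proof (rule closed_sum)
  fix x assume "x \<in> P"
  then show "(case x of (a, b) \<Rightarrow> matrix_unit a b) \<in> star_polys C"
    using matrix_unit_closed actsD(1,2)[OF representsD(2)[OF assms]] by (cases x) auto
qed

lemma composable_level: "b \<in> arr C \<Longrightarrow> {c \<in> arr C. tgt C c = src C b \<and> deg C c = n} = {c. composable b c \<and> deg C c = n}"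
  unfolding composable_def by auto

lemma matrix_unit_refine:
  assumes "acts h a b"
  shows "matrix_unit a b \<doteq> (\<Sum>c\<in>{c. composable b c \<and> deg C c = n}. matrix_unit (cmp C a c) (cmp C b c))"
proof -
  note ab = actsD[OF assms]
  note ga = gen_closed(1)[OF ab(1)] and gb = gen_closed(2)[OF ab(2)]
  let ?L = "{c. composable b c \<and> deg C c = n}"
  have "matrix_unit a b \<doteq> gen a * gen (src C a) * poly_star (gen b)"
    unfolding matrix_unit_def by (intro eqv_mult eqv_refl gb eqv_sym[OF gen_src] ab)
  also have "\<dots> \<doteq> gen a * (\<Sum>c\<in>{c \<in> arr C. tgt C c = src C b \<and> deg C c = n}. gen c * poly_star (gen c)) * poly_star (gen b)"
    unfolding ab(3) by (intro eqv_mult eqv_refl ga gb gen_level_sum src_in_ids ab)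
  also have "\<dots> = (\<Sum>c\<in>?L. (gen a * gen c) * poly_star (gen b * gen c))"
    unfolding composable_level[OF ab(2)] by (simp add: sum_distrib_left sum_distrib_right poly_star_mult mult.assoc)
  also have "\<dots> \<doteq> (\<Sum>c\<in>?L. matrix_unit (cmp C a c) (cmp C b c))"
  proof (rule eqv_sum)
    fix c assume "c \<in> ?L"
    then have bc: "composable b c" by blast
    have ac: "composable a c" using acts_ext(1)[OF assms bc] .
    show "(gen a * gen c) * poly_star (gen b * gen c) \<doteq> matrix_unit (cmp C a c) (cmp C b c)"
      unfolding matrix_unit_def by (intro eqv_mult eqv_star gen_cmp ac bc)
  qed
  finally show ?thesis .
qed

text \<open>Every \<open>s\<^sub>a s\<^sub>b\<^sup>*\<close> is the sum of \<open>s\<^sub>a\<^sub>c s\<^sub>b\<^sub>c\<^sup>*\<close> over the \<open>c\<close> of a given degree, and the pairs obtained in this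
  way are all pairs along degree \<open>n\<close>, since \<open>a\<close> is determined by \<open>b\<close> and \<open>h\<close>. Thus the operator of a
  decomposition is seen to depend on \<open>h\<close> and \<open>n\<close> only; a common \<open>n\<close> compares any two decompositions.\<close>

lemma op_sum_level:
  assumes P: "represents P U h" and dom: "dominates n P"
  shows "op_sum P \<doteq> op_sum (level_rep n U h)"
proof -
  note PD = representsD[OF P]
  define k where "k b = (SOME k. n = deg C b + k)" for b
  have k: "n = deg C b + k b" if "(a, b) \<in> P" for a b
    unfolding k_def using dom that unfolding dominates_def by (auto intro: someI_ex)
  let ?L = "\<lambda>z. {c. composable (snd z) c \<and> deg C c = k (snd z)}"
  let ?f = "\<lambda>(z, c). (cmp C (fst z) c, cmp C (snd z) c)"
  have "op_sum P \<doteq> (\<Sum>z\<in>P. \<Sum>c\<in>?L z. matrix_unit (cmp C (fst z) c) (cmp C (snd z) c))"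
    unfolding op_sum_def
  proof (rule eqv_sum)
    fix z assume "z \<in> P"
    then have "acts h (fst z) (snd z)" using PD(2) by (metis prod.collapse)
    from matrix_unit_refine[OF this, of "k (snd z)"]
    show "(case z of (a, b) \<Rightarrow> matrix_unit a b) \<doteq> (\<Sum>c\<in>?L z. matrix_unit (cmp C (fst z) c) (cmp C (snd z) c))"
      by (simp add: case_prod_unfold)
  qed
  also have "(\<Sum>z\<in>P. \<Sum>c\<in>?L z. matrix_unit (cmp C (fst z) c) (cmp C (snd z) c))
      = (\<Sum>y\<in>Sigma P ?L. case ?f y of (a, b) \<Rightarrow> matrix_unit a b)"
  proof -
    have fin: "finite (?L z)" for z by (rule finite_subset[OF _ finite_level[of "k (snd z)"]]) (auto dest: composableD)
    show ?thesis
      by (subst sum.Sigma[OF PD(1)]) (simp_all add: fin case_prod_unfold)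
  qed
  also have "\<dots> = (\<Sum>y\<in>level_rep n U h. case y of (a, b) \<Rightarrow> matrix_unit a b)"
  proof (rule sum.reindex_bij_betw)
    show "bij_betw ?f (Sigma P ?L) (level_rep n U h)"
      unfolding bij_betw_def
    proof
      show "inj_on ?f (Sigma P ?L)"
      proof (rule inj_onI)
        fix y y' assume *: "y \<in> Sigma P ?L" "y' \<in> Sigma P ?L" "?f y = ?f y'"
        obtain a b c a' b' c' where y: "y = ((a, b), c)" "y' = ((a', b'), c')" by (metis prod.collapse)
        have bc: "(a, b) \<in> P" "composable b c" "(a', b') \<in> P" "composable b' c'" "cmp C b c = cmp C b' c'"
          using * y by auto
        obtain x where x: "x \<in> cyl (cmp C b c)" using cyl_nonempty composableD(4)[OF bc(2)] by blast
        have "x \<in> cyl b" "x \<in> cyl b'"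
          using x cyl_mono[OF prefix_cmp[OF bc(2)]] cyl_mono[OF prefix_cmp[OF bc(4)]] bc(5) by auto
        then have "a = a' \<and> b = b'" using PD(5)[OF bc(1,3)] by blast
        moreover from this have "c = c'" using left_cancel bc by metis
        ultimately show "y = y'" using y by simp
      qed
      show "?f ` Sigma P ?L = level_rep n U h"
      proof
        show "?f ` Sigma P ?L \<subseteq> level_rep n U h"
        proof
          fix w assume "w \<in> ?f ` Sigma P ?L"
          then obtain a b c where w: "(a, b) \<in> P" "composable b c" "deg C c = k b" "w = (cmp C a c, cmp C b c)" by auto
          have "deg C (cmp C b c) = n" using composableD(7)[OF w(2)] w(3) k[OF w(1)] by simp
          moreover have "cyl (cmp C b c) \<subseteq> U" using cyl_mono[OF prefix_cmp[OF w(2)]] PD(3)[OF w(1)] by blast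
          ultimately show "w \<in> level_rep n U h"
            unfolding level_rep_def using w(4) composableD(4)[OF w(2)] acts_ext(2)[OF PD(2)[OF w(1)] w(2)] by simp
        qed
        show "level_rep n U h \<subseteq> ?f ` Sigma P ?L"
        proof
          fix w assume w: "w \<in> level_rep n U h"
          obtain a1 b1 where w1: "w = (a1, b1)" by (cases w)
          obtain a b c where abc: "(a, b) \<in> P" "composable b c" "a1 = cmp C a c" "b1 = cmp C b c"
            using represents_level(2)[OF P dom] w w1 by blast
          have "deg C b + deg C c = deg C b + k b"
            using w w1 abc(4) composableD(7)[OF abc(2)] k[OF abc(1)] unfolding level_rep_def by auto
          then have "deg C c = k b" by (simp only: add_left_cancel)
          then have "((a, b), c) \<in> Sigma P ?L" using abc(1,2) by simp
          then show "w \<in> ?f ` Sigma P ?L" using w1 abc(3,4) by (metis (mono_tags, lifting) case_prod_conv fst_conv image_eqI snd_conv)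
        qed
      qed
    qed
  qed
  finally show ?thesis unfolding op_sum_def .
qed

lemma op_sum_unique:
  assumes "represents P U h" "represents Q U h"
  shows "op_sum P \<doteq> op_sum Q"
proof -
  let ?n = "(\<Sum>(a, b)\<in>P. deg C b) + (\<Sum>(a, b)\<in>Q. deg C b)"
  have "dominates ?n P" using dominates_sum representsD(1)[OF assms(1)] by blast
  moreover have "dominates ?n Q" using dominates_sum[OF representsD(1)[OF assms(2)]] by (simp add: add.commute)
  ultimately show ?thesis using op_sum_level[OF assms(1)] op_sum_level[OF assms(2)] eqv_trans eqv_sym by metis
qed

lemma spectral_op_eqv:
  assumes "represents P U h"
  shows "op_sum P \<doteq> spectral_op U h"
  unfolding spectral_op_def by (rule op_sum_unique[OF assms]) (rule someI[of _ P], rule assms)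

lemma spectral_op_rep:
  assumes "bisection U h"
  obtains P where "represents P U h" "spectral_op U h = op_sum P"
  unfolding spectral_op_def using bisection_represents[OF assms] by (metis someI_ex)

lemma spectral_op_closed: "bisection U h \<Longrightarrow> spectral_op U h \<in> star_polys C"
  using spectral_op_rep op_sum_closed by metis

lemma spectral_op_cong:
  assumes "bisection U h" "\<And>x. x \<in> U \<Longrightarrow> h x = g x"
  shows "spectral_op U h \<doteq> spectral_op U g"
proof -
  obtain P where P: "represents P U h" "spectral_op U h = op_sum P" using spectral_op_rep[OF assms(1)] .
  then show ?thesis using spectral_op_eqv[OF represents_cong[OF P(1) assms(2)]] by simp
qed

lemma spectral_op_star:
  assumes "bisection U h" "\<And>x. x \<in> U \<Longrightarrow> g (h x) = x"
  shows "poly_star (spectral_op U h) \<doteq> spectral_op (h ` U) g"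
proof -
  obtain P where P: "represents P U h" "spectral_op U h = op_sum P" using spectral_op_rep[OF assms(1)] .
  then show ?thesis using spectral_op_eqv[OF represents_inverse[OF P(1) assms(2)]] op_sum_inverse by simp
qed

lemma spectral_op_empty: "spectral_op {} h \<doteq> 0"
proof -
  have "represents {} {} h" unfolding represents_def by simp
  from eqv_sym[OF spectral_op_eqv[OF this]] show ?thesis by (simp add: op_sum_def)
qed

lemma spectral_op_UN:
  assumes "finite I" "\<And>i. i \<in> I \<Longrightarrow> bisection (U i) h"
    "\<And>i j. i \<in> I \<Longrightarrow> j \<in> I \<Longrightarrow> i \<noteq> j \<Longrightarrow> U i \<inter> U j = {}"
  shows "(\<Sum>i\<in>I. spectral_op (U i) h) \<doteq> spectral_op (\<Union>i\<in>I. U i) h"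
proof -
  have "\<forall>i\<in>I. \<exists>P. represents P (U i) h \<and> spectral_op (U i) h = op_sum P"
    using spectral_op_rep[OF assms(2)] by metis
  then obtain P where P: "\<And>i. i \<in> I \<Longrightarrow> represents (P i) (U i) h" "\<And>i. i \<in> I \<Longrightarrow> spectral_op (U i) h = op_sum (P i)"
    by metis
  have *: "represents (\<Union>i\<in>I. P i) (\<Union>i\<in>I. U i) h" "op_sum (\<Union>i\<in>I. P i) = (\<Sum>i\<in>I. op_sum (P i))"
    using represents_UN[OF assms(1) P(1) assms(3)] by auto
  show ?thesis using spectral_op_eqv[OF *(1)] *(2) P(2) by simp
qed

lemma spectral_op_gen:
  assumes "a \<in> arr C"
  shows "spectral_op (cyl (src C a)) (shift a) \<doteq> gen a"
proof -
  have e: "src C a \<in> ids C" using src_in_ids assms by blast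
  have "represents {(a, src C a)} (cyl (src C a)) (shift a)"
    by (rule representsI) (use acts_shift[OF assms] in auto)
  from eqv_sym[OF spectral_op_eqv[OF this]]
  have "spectral_op (cyl (src C a)) (shift a) \<doteq> gen a * poly_star (gen (src C a))"
    by (simp add: op_sum_def matrix_unit_def)
  also have "\<dots> \<doteq> gen a * gen (src C a)" by (intro eqv_mult eqv_refl gen_closed assms gen_selfadjoint e)
  also have "\<dots> \<doteq> gen a" by (rule gen_src[OF assms])
  finally show ?thesis .
qed

lemma matrix_unit_mult:
  assumes a: "a \<in> arr C" and b: "b \<in> arr C" "src C a = src C b" and d: "d \<in> arr C"
    and c: "composable c w" "deg C c = deg C b"
  shows "b \<noteq> c \<Longrightarrow> matrix_unit a b * matrix_unit (cmp C c w) d \<doteq> 0"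
    "b = c \<Longrightarrow> matrix_unit a b * matrix_unit (cmp C c w) d \<doteq> matrix_unit (cmp C a w) d"
proof -
  note cw = composableD[OF c(1)]
  have "matrix_unit a b * matrix_unit (cmp C c w) d = gen a * poly_star (gen b) * (gen (cmp C c w) * poly_star (gen d))"
    unfolding matrix_unit_def ..
  also have "\<dots> \<doteq> gen a * poly_star (gen b) * ((gen c * gen w) * poly_star (gen d))"
    by (intro eqv_mult eqv_refl closed(8) gen_closed a b d eqv_sym[OF gen_cmp] c)
  also have "\<dots> = gen a * (poly_star (gen b) * gen c) * (gen w * poly_star (gen d))" by (simp add: mult.assoc)
  finally have *: "matrix_unit a b * matrix_unit (cmp C c w) d \<doteq>
      gen a * (poly_star (gen b) * gen c) * (gen w * poly_star (gen d))" .
  show "matrix_unit a b * matrix_unit (cmp C c w) d \<doteq> 0" if "b \<noteq> c"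
  proof -
    note *
    also have "gen a * (poly_star (gen b) * gen c) * (gen w * poly_star (gen d)) \<doteq> gen a * 0 * (gen w * poly_star (gen d))"
      by (intro eqv_mult eqv_refl closed(8) gen_closed a b d cw star_gen_orthogonal that c(2)[symmetric])
    finally show ?thesis by simp
  qed
  show "matrix_unit a b * matrix_unit (cmp C c w) d \<doteq> matrix_unit (cmp C a w) d" if bc: "b = c"
  proof -
    have aw: "composable a w" using c(1) bc a b(2) unfolding composable_def by simp
    note *
    also have "gen a * (poly_star (gen b) * gen c) * (gen w * poly_star (gen d)) \<doteq> gen a * gen (src C b) * (gen w * poly_star (gen d))"
      unfolding bc[symmetric] by (intro eqv_mult eqv_refl closed(8) gen_closed a b d cw gen_source)
    also have "\<dots> \<doteq> gen a * (gen w * poly_star (gen d))"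
      unfolding b(2)[symmetric] by (intro eqv_mult eqv_refl closed(8) gen_closed a d cw gen_src)
    also have "\<dots> = (gen a * gen w) * poly_star (gen d)" by (simp add: mult.assoc)
    also have "\<dots> \<doteq> matrix_unit (cmp C a w) d"
      unfolding matrix_unit_def by (intro eqv_mult eqv_refl gen_closed d gen_cmp aw)
    finally show ?thesis .
  qed
qed

text \<open>Decompose \<open>g\<close> along arrows \<open>b\<close> of a fixed degree \<open>N\<close>, and \<open>h\<close> along arrows so long that in all its pairs
  \<open>(c, d)\<close> the arrow \<open>c\<close> factorizes as \<open>c1 w\<close> with \<open>c1\<close> of degree \<open>N\<close>. In the product of the two sums
  \<open>s\<^sub>b\<^sup>* s\<^sub>c\<close> vanishes by orthogonality unless \<open>b = c1\<close>, when it is \<open>s\<^sub>w\<close>; this happens for just those pairs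
  for which the image \<open>c y\<close> lies in \<open>V\<close>.\<close>

lemma spectral_op_mult:
  assumes g: "bisection V g" and h: "bisection U h"
  shows "spectral_op V g * spectral_op U h \<doteq> spectral_op {x \<in> U. h x \<in> V} (g \<circ> h)"
proof -
  let ?W = "{x \<in> U. h x \<in> V}"
  obtain P0 where P0: "represents P0 V g" "spectral_op V g = op_sum P0" using spectral_op_rep[OF g] .
  obtain Q0 where Q0: "represents Q0 U h" "spectral_op U h = op_sum Q0" using spectral_op_rep[OF h] .
  \<comment> \<open>Sums of degrees serve as common upper bounds; the summand \<open>N\<close> of \<open>M\<close> makes the second factors long.\<close>
  define N where "N = (\<Sum>(a, b)\<in>P0. deg C b)"
  define M where "M = (\<Sum>(a, b)\<in>Q0. deg C b) + N"
  have domP: "dominates N P0" unfolding N_def using dominates_sum[OF representsD(1)[OF P0(1)], of 0] by simp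
  have domQ: "dominates M Q0" unfolding M_def by (rule dominates_sum[OF representsD(1)[OF Q0(1)]])
  define P where "P = level_rep N V g"
  define Q where "Q = level_rep M U h"
  have P: "represents P V g" unfolding P_def by (rule represents_level(1)[OF P0(1) domP])
  have Q: "represents Q U h" unfolding Q_def by (rule represents_level(1)[OF Q0(1) domQ])
  note PD = representsD[OF P] and QD = representsD[OF Q]
  have Pdeg: "deg C b = N" if "(a, b) \<in> P" for a b using that unfolding P_def level_rep_def by blast
  have split: "\<exists>c1 w. composable c1 w \<and> c = cmp C c1 w \<and> deg C c1 = N" if cd: "(c, d) \<in> Q" for c d
  proof -
    obtain c0 d0 v where v: "(c0, d0) \<in> Q0" "composable d0 v" "c = cmp C c0 v" "d = cmp C d0 v"
      using represents_level(2)[OF Q0(1) domQ] cd unfolding Q_def by blast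
    have "M = deg C d0 + ((\<Sum>(a, b)\<in>Q0 - {(c0, d0)}. deg C b) + N)"
      unfolding M_def using v(1) representsD(1)[OF Q0(1)] by (simp add: sum.remove add.assoc)
    moreover have "M = deg C d0 + deg C v" using cd composableD(7)[OF v(2)] v(4) unfolding Q_def level_rep_def by auto
    ultimately have dv: "deg C v = (\<Sum>(a, b)\<in>Q0 - {(c0, d0)}. deg C b) + N" by simp
    have "composable c0 v" using acts_ext(1)[OF representsD(2)[OF Q0(1) v(1)] v(2)] .
    then have "deg C c = N + (deg C c0 + (\<Sum>(a, b)\<in>Q0 - {(c0, d0)}. deg C b))"
      using composableD(7) v(3) dv by (simp add: ac_simps)
    moreover have "c \<in> arr C" using actsD(1)[OF QD(2)[OF cd]] .
    ultimately show ?thesis using factorization_exists by metis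
  qed
  let ?Q' = "{(c, d) \<in> Q. cyl c \<subseteq> V}"
  define u where "u d = (THE e. acts (g \<circ> h) e d)" for d
  have trm: "(\<Sum>(a, b)\<in>P. matrix_unit a b * matrix_unit c d) \<doteq> (if cyl c \<subseteq> V then matrix_unit (u d) d else 0) \<and>
      (cyl c \<subseteq> V \<or> cyl c \<inter> V = {}) \<and> (cyl c \<subseteq> V \<longrightarrow> acts (g \<circ> h) (u d) d)"
    if cd: "(c, d) \<in> Q" for c d
  proof -
    obtain c1 w where c1: "composable c1 w" "c = cmp C c1 w" "deg C c1 = N" using split[OF cd] by blast
    note acd = actsD[OF QD(2)[OF cd]]
    have cyl_c: "cyl c \<subseteq> cyl c1" using cyl_mono[OF prefix_cmp[OF c1(1)]] c1(2) by simp
    have zero: "matrix_unit a b * matrix_unit c d \<doteq> 0" if "(a, b) \<in> P" "b \<noteq> c1" for a b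
      using matrix_unit_mult(1)[OF actsD(1-3)[OF PD(2)[OF that(1)]] acd(2) c1(1)] c1 Pdeg that by metis
    show ?thesis
    proof (cases "\<exists>a. (a, c1) \<in> P")
      case True
      then obtain a where a: "(a, c1) \<in> P" by blast
      have sub: "cyl c \<subseteq> V" using cyl_c PD(3)[OF a] by blast
      have "acts g (cmp C a w) c" using acts_ext(2)[OF PD(2)[OF a] c1(1)] c1(2) by simp
      then have act: "acts (g \<circ> h) (cmp C a w) d" using acts_comp[OF QD(2)[OF cd]] by blast
      then have ue: "u d = cmp C a w" unfolding u_def using acts_unique by (auto intro: the_equality)
      have fin: "finite P" by (rule PD(1))
      have "(\<Sum>(a, b)\<in>P. matrix_unit a b * matrix_unit c d)
          = matrix_unit a c1 * matrix_unit c d + (\<Sum>(a, b)\<in>P - {(a, c1)}. matrix_unit a b * matrix_unit c d)"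
        using fin a by (simp add: sum.remove)
      also have "\<dots> \<doteq> matrix_unit (cmp C a w) d + 0"
      proof (intro eqv_add)
        show "matrix_unit a c1 * matrix_unit c d \<doteq> matrix_unit (cmp C a w) d"
          using matrix_unit_mult(2)[OF actsD(1-3)[OF PD(2)[OF a]] acd(2) c1(1)] c1(2) by simp
        show "(\<Sum>(a, b)\<in>P - {(a, c1)}. matrix_unit a b * matrix_unit c d) \<doteq> 0"
        proof (rule eqv_sum_zero)
          fix z assume z: "z \<in> P - {(a, c1)}"
          obtain a' b' where ab: "z = (a', b')" by (cases z)
          have ab': "(a', b') \<in> P" "(a', b') \<noteq> (a, c1)" using z ab by auto
          have "b' \<noteq> c1" using ab' acts_unique[OF PD(2)[OF ab'(1)]] PD(2)[OF a] by blast
          then show "(case z of (a, b) \<Rightarrow> matrix_unit a b * matrix_unit c d) \<doteq> 0" using zero ab'(1) ab by simp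
        qed
      qed
      finally show ?thesis using sub ue act by simp
    next
      case False
      have "cyl c \<inter> V = {}"
      proof (rule ccontr)
        assume "cyl c \<inter> V \<noteq> {}"
        then obtain x where x: "x \<in> cyl c" "x \<in> V" by blast
        obtain a b where ab: "(a, b) \<in> P" "x \<in> cyl b" using PD(4)[OF x(2)] by blast
        have "b = c1" using cyl_disjoint_degree[of b c1] Pdeg[OF ab(1)] c1(3) ab(2) x(1) cyl_c by auto
        then show False using False ab(1) by blast
      qed
      moreover have "cyl c \<noteq> {}" using cyl_nonempty acd(1) by blast
      moreover have "(\<Sum>(a, b)\<in>P. matrix_unit a b * matrix_unit c d) \<doteq> 0"
        by (rule eqv_sum_zero) (use zero False in auto)
      ultimately show ?thesis by auto
    qed
  qed
  have uD: "acts (g \<circ> h) (u d) d" if "(c, d) \<in> Q" "cyl c \<subseteq> V" for c d using trm that by blast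
  let ?R = "(\<lambda>(c, d). (u d, d)) ` ?Q'"
  have finQ: "finite Q" by (rule QD(1))
  have R: "represents ?R ?W (g \<circ> h)"
  proof (rule representsI)
    show "finite ?R" using finQ by (auto intro: rev_finite_subset)
    fix e d assume "(e, d) \<in> ?R"
    then obtain c where c: "(c, d) \<in> Q" "cyl c \<subseteq> V" "e = u d" by auto
    have "cyl d \<subseteq> ?W"
    proof
      fix x assume x: "x \<in> cyl d"
      then have "h x \<in> cyl c" using acts_image[OF QD(2)[OF c(1)]] by blast
      then show "x \<in> ?W" using x c(2) QD(3)[OF c(1)] by blast
    qed
    then show "acts (g \<circ> h) e d \<and> cyl d \<subseteq> ?W" using uD c by blast
  next
    fix x assume x: "x \<in> ?W"
    then obtain c d where cd: "(c, d) \<in> Q" "x \<in> cyl d" using QD(4) by blast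
    then have "h x \<in> cyl c" using acts_image[OF QD(2)[OF cd(1)]] by blast
    then have "cyl c \<subseteq> V" using trm[OF cd(1)] x by blast
    then have "(u d, d) \<in> ?R" using cd(1) by (auto intro!: image_eqI[of _ _ "(c, d)"])
    then show "\<exists>a b. (a, b) \<in> ?R \<and> x \<in> cyl b" using cd(2) by blast
  next
    fix e d e' d' assume *: "(e, d) \<in> ?R" "(e', d') \<in> ?R" "cyl d \<inter> cyl d' \<noteq> {}"
    obtain c where c: "(c, d) \<in> Q" "e = u d" using *(1) by auto
    obtain c' where c': "(c', d') \<in> Q" "e' = u d'" using *(2) by auto
    obtain x where "x \<in> cyl d" "x \<in> cyl d'" using *(3) by blast
    then have "c = c' \<and> d = d'" using QD(5)[OF c(1) c'(1)] by blast
    then show "e = e' \<and> d = d'" using c c' by simp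
  qed
  have "spectral_op V g * spectral_op U h \<doteq> op_sum P * op_sum Q"
    unfolding P0(2) Q0(2) by (intro eqv_mult op_sum_unique[OF P0(1) P] op_sum_unique[OF Q0(1) Q])
  also have "op_sum P * op_sum Q = (\<Sum>(c, d)\<in>Q. \<Sum>(a, b)\<in>P. matrix_unit a b * matrix_unit c d)"
    unfolding op_sum_def by (simp add: sum_product case_prod_unfold sum.swap[of _ P])
  also have "\<dots> \<doteq> (\<Sum>(c, d)\<in>Q. if cyl c \<subseteq> V then matrix_unit (u d) d else 0)"
    by (rule eqv_sum) (use trm in \<open>auto simp: case_prod_unfold\<close>)
  also have "\<dots> = (\<Sum>(c, d)\<in>?Q'. matrix_unit (u d) d)"
  proof -
    have "(\<Sum>z\<in>Q. if cyl (fst z) \<subseteq> V then matrix_unit (u (snd z)) (snd z) else 0) = (\<Sum>z\<in>Q \<inter> {z. cyl (fst z) \<subseteq> V}. matrix_unit (u (snd z)) (snd z))"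
      using finQ by (simp add: sum.inter_restrict)
    moreover have "?Q' = Q \<inter> {z. cyl (fst z) \<subseteq> V}" by auto
    ultimately show ?thesis by (simp add: case_prod_unfold)
  qed
  also have "\<dots> = op_sum ?R"
  proof -
    have "inj_on (\<lambda>(c, d). (u d, d)) ?Q'"
    proof (rule inj_onI)
      fix z z' assume *: "z \<in> ?Q'" "z' \<in> ?Q'" "(\<lambda>(c, d). (u d, d)) z = (\<lambda>(c, d). (u d, d)) z'"
      obtain c d c' d' where z: "z = (c, d)" "z' = (c', d')" by (metis prod.collapse)
      then have "(c, d) \<in> Q" "(c', d) \<in> Q" "d = d'" using * by auto
      moreover from this have "c = c'" using acts_unique[OF QD(2) QD(2)] by blast
      ultimately show "z = z'" using z by simp
    qed
    then show ?thesis unfolding op_sum_def by (simp add: sum.reindex case_prod_unfold comp_def)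
  qed
  also have "op_sum ?R \<doteq> spectral_op ?W (g \<circ> h)" by (rule spectral_op_eqv[OF R])
  finally show ?thesis .
qed

end

section \<open>The universal norm and the homomorphism of a conjugacy\<close>

definition word_hom :: "('a \<Rightarrow> 'b star_poly) \<Rightarrow> 'a star_word \<Rightarrow> 'b star_poly" where
  "word_hom t w = prod_list (map (\<lambda>(a, b). if b then poly_star (t a) else t a) (letters w))"

text \<open>The *-homomorphism of free *-algebras that extends \<open>t\<close>.\<close>

definition free_hom :: "('a \<Rightarrow> 'b star_poly) \<Rightarrow> 'a star_poly \<Rightarrow> 'b star_poly" where
  "free_hom t f = (\<Sum>w\<in>pkeys f. poly_scale (plookup f w) (word_hom t w))"

lemma poly_star_one: "poly_star 1 = 1"
  using poly_star_simps(6)[of 0 1] word_star_simps(3) by (metis complex_cnj_one single_one)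

lemma word_hom_simps:
  "word_hom t (u + v) = word_hom t u * word_hom t v" "word_hom t 0 = 1"
  by (simp_all add: word_hom_def star_word_add)

lemma word_hom_star: "word_hom t (word_star w) = poly_star (word_hom t w)"
proof -
  have "prod_list (map (\<lambda>(a, b). if b then poly_star (t a) else t a) (rev (map (\<lambda>(a, b). (a, \<not> b)) ls)))
      = poly_star (prod_list (map (\<lambda>(a, b). if b then poly_star (t a) else t a) ls))" for ls
    by (induction ls) (auto simp: poly_star_one poly_star_mult poly_star_simps)
  then show ?thesis unfolding word_hom_def word_star_def by simp
qed

lemma free_hom_superset:
  assumes "finite A" "pkeys f \<subseteq> A"
  shows "free_hom t f = (\<Sum>w\<in>A. poly_scale (plookup f w) (word_hom t w))"
  unfolding free_hom_def
  by (rule sum.mono_neutral_left) (use assms in \<open>auto simp: in_keys_iff poly_scale_simps\<close>)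

lemma free_hom_zero: "free_hom t 0 = 0"
  by (simp add: free_hom_def)

lemma free_hom_single: "free_hom t (psingle w c) = poly_scale c (word_hom t w)"
  by (simp add: free_hom_superset[of "{w}"])

lemma free_hom_add: "free_hom t (f + g) = free_hom t f + free_hom t g"
proof -
  let ?A = "pkeys f \<union> pkeys g"
  have "free_hom t (f + g) = (\<Sum>w\<in>?A. poly_scale (plookup (f + g) w) (word_hom t w))"
    by (rule free_hom_superset[OF _ keys_add]) simp
  also have "\<dots> = (\<Sum>w\<in>?A. poly_scale (plookup f w) (word_hom t w)) + (\<Sum>w\<in>?A. poly_scale (plookup g w) (word_hom t w))"
    by (simp add: lookup_add poly_scale_simps sum.distrib)
  also have "\<dots> = free_hom t f + free_hom t g"
    by (simp add: free_hom_superset[of ?A])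
  finally show ?thesis .
qed

lemma free_hom_scale: "free_hom t (poly_scale c f) = poly_scale c (free_hom t f)"
proof (induction f rule: poly_induct)
  case (single w d)
  have "poly_scale c (psingle w d) = psingle w (c * d)" by (simp add: poly_scale_def mult_single)
  then show ?case by (simp add: free_hom_single poly_scale_simps)
qed (simp_all add: free_hom_zero free_hom_add poly_scale_simps)

lemma free_hom_diff: "free_hom t (f - g) = free_hom t f - free_hom t g"
  using free_hom_add[of t "f - g" g] by simp

lemma free_hom_sum: "free_hom t (\<Sum>i\<in>I. f i) = (\<Sum>i\<in>I. free_hom t (f i))"
  by (induction I rule: infinite_finite_induct) (simp_all add: free_hom_zero free_hom_add)

lemma free_hom_mult: "free_hom t (f * g) = free_hom t f * free_hom t g"
proof (induction f rule: poly_induct)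
  case (single u a)
  show ?case
  proof (induction g rule: poly_induct)
    case (single v b)
    show ?case
      by (simp add: mult_single free_hom_single word_hom_simps poly_scale_mult poly_scale_simps mult.commute)
  qed (simp_all add: free_hom_zero free_hom_add algebra_simps)
qed (simp_all add: free_hom_zero free_hom_add algebra_simps)

lemma free_hom_star: "free_hom t (poly_star f) = poly_star (free_hom t f)"
  by (induction f rule: poly_induct)
    (simp_all add: free_hom_zero free_hom_add poly_star_simps free_hom_single word_hom_star poly_star_scale)

lemma free_hom_gen: "free_hom t (gen a) = t a"
  by (simp add: gen_def free_hom_single word_hom_def poly_scale_simps)

lemma free_hom_closed:
  assumes "\<And>a. a \<in> arr C \<Longrightarrow> t a \<in> star_polys C'" "f \<in> star_polys C"
  shows "free_hom t f \<in> star_polys C'"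
  using assms(2)
  by (induction f rule: star_polys_induct)
    (simp_all add: free_hom_gen free_hom_star free_hom_mult free_hom_add free_hom_scale free_hom_zero
      assms(1) star_polys_closed)

context finite_graph
begin

lemma graph_seminorm_iff:
  "graph_seminorm C p \<longleftrightarrow> p \<in> {p. cstar_seminorm C p \<and> (\<forall>r\<in>graph_relators C. p r = 0)}"
  unfolding graph_seminorm_def graph_seminorm_axioms_def star_seminorm_def
  using finite_graph_axioms by auto

lemma graph_seminorm_zero: "graph_seminorm C (\<lambda>x. 0)"
  unfolding graph_seminorm_iff cstar_seminorm_def by simp

text \<open>The supremum in the definition of the universal norm is finite, as generators have norm at most 1.\<close>

lemma graph_seminorm_bounded:
  assumes "x \<in> star_polys C"
  shows "\<exists>M. \<forall>p. graph_seminorm C p \<longrightarrow> p x \<le> M"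
  using assms
proof (induction x rule: star_polys_induct)
  case (gen a)
  then have "\<forall>p. graph_seminorm C p \<longrightarrow> p (gen a) \<le> 1" using graph_seminorm.p_gen_le_1 by metis
  then show ?case by blast
next
  case (star a)
  have "p (poly_star (gen a)) \<le> 1" if "graph_seminorm C p" for p
  proof -
    interpret graph_seminorm C p by (rule that)
    show ?thesis using p_gen_le_1[OF star] p_star[OF gen_closed(1)[OF star]] by simp
  qed
  then show ?case by blast
next
  case (mult f g)
  then obtain M N where M: "\<And>p. graph_seminorm C p \<Longrightarrow> p f \<le> M" "\<And>p. graph_seminorm C p \<Longrightarrow> p g \<le> N" by blast
  have "p (f * g) \<le> \<bar>M\<bar> * \<bar>N\<bar>" if "graph_seminorm C p" for p
  proof -
    interpret graph_seminorm C p by (rule that)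
    have "p (f * g) \<le> p f * p g" using p_mult mult by blast
    also have "\<dots> \<le> \<bar>M\<bar> * \<bar>N\<bar>"
      using M[OF that] p_nonneg[of f] p_nonneg[of g] mult by (intro mult_mono) auto
    finally show ?thesis .
  qed
  then show ?case by blast
next
  case (add f g)
  then obtain M N where M: "\<And>p. graph_seminorm C p \<Longrightarrow> p f \<le> M" "\<And>p. graph_seminorm C p \<Longrightarrow> p g \<le> N" by blast
  have "p (f + g) \<le> M + N" if "graph_seminorm C p" for p
  proof -
    interpret graph_seminorm C p by (rule that)
    show ?thesis using p_add[of f g] add M[OF that] by auto
  qed
  then show ?case by blast
next
  case (scale c f)
  then obtain M where M: "\<And>p. graph_seminorm C p \<Longrightarrow> p f \<le> M" by blast
  have "p (poly_scale c f) \<le> cmod c * M" if "graph_seminorm C p" for p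
  proof -
    interpret graph_seminorm C p by (rule that)
    show ?thesis using p_scale[OF scale(1)] M[OF that] by (simp add: mult_left_mono)
  qed
  then show ?case by blast
next
  case zero
  have "p 0 \<le> 0" if "graph_seminorm C p" for p
  proof -
    interpret graph_seminorm C p by (rule that)
    show ?thesis using p_zero by simp
  qed
  then show ?case by blast
qed

lemma univ_norm_upper:
  assumes "x \<in> star_polys C" "graph_seminorm C p"
  shows "p x \<le> univ_norm C x"
  unfolding univ_norm_def
proof (rule cSUP_upper)
  show "p \<in> {p. cstar_seminorm C p \<and> (\<forall>r\<in>graph_relators C. p r = 0)}"
    using assms(2) graph_seminorm_iff by simp
  obtain M where "\<forall>p. graph_seminorm C p \<longrightarrow> p x \<le> M" using graph_seminorm_bounded[OF assms(1)] by blast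
  then show "bdd_above ((\<lambda>p. p x) ` {p. cstar_seminorm C p \<and> (\<forall>r\<in>graph_relators C. p r = 0)})"
    unfolding bdd_above_def using graph_seminorm_iff by auto
qed

lemma univ_norm_least:
  assumes "\<And>p. graph_seminorm C p \<Longrightarrow> p x \<le> M"
  shows "univ_norm C x \<le> M"
  unfolding univ_norm_def
proof (rule cSUP_least)
  show "{p. cstar_seminorm C p \<and> (\<forall>r\<in>graph_relators C. p r = 0)} \<noteq> {}"
    using graph_seminorm_zero graph_seminorm_iff by blast
qed (use assms graph_seminorm_iff in blast)

lemma relators_closed:
  assumes "r \<in> graph_relators C"
  shows "r \<in> star_polys C"
proof -
  note cl = star_polys_closed[where C = C]
  have e: "e \<in> arr C" if "e \<in> ids C" for e using that ids_subset by blast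
  have s: "(\<Sum>a\<in>{a \<in> ray C e. deg C a = n}. gen a * poly_star (gen a)) \<in> star_polys C" if "e \<in> ids C" for e n
  proof (rule star_polys_sum)
    fix a assume "a \<in> {a \<in> ray C e. deg C a = n}"
    then have "a \<in> arr C" using ray_prefix_iff[OF e[OF that]] prefixD(2) by blast
    then show "gen a * poly_star (gen a) \<in> star_polys C" by (intro cl)
  qed
  show ?thesis
    using assms unfolding graph_relators_def
    by (elim UnE CollectE exE conjE) (auto intro!: cl s cmp_closed dest: e src_in_ids)
qed

text \<open>The $C^*$-identity survives the supremum because squaring is monotone.\<close>

theorem univ_norm_seminorm: "graph_seminorm C (univ_norm C)"
proof -
  let ?N = "univ_norm C"
  note up = univ_norm_upper and least = univ_norm_least
  note cl = star_polys_closed[where C = C]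
  have nonneg: "0 \<le> ?N x" if "x \<in> star_polys C" for x using up[OF that graph_seminorm_zero] .
  have square: "?N (poly_star x * x) = (?N x)\<^sup>2" if x: "x \<in> star_polys C" for x
  proof (rule antisym)
    show "?N (poly_star x * x) \<le> (?N x)\<^sup>2"
    proof (rule least)
      fix p assume p: "graph_seminorm C p"
      interpret graph_seminorm C p by fact
      show "p (poly_star x * x) \<le> (?N x)\<^sup>2"
        unfolding p_square[OF x] by (rule power_mono[OF up[OF x p] p_nonneg[OF x]])
    qed
    have "?N x \<le> sqrt (?N (poly_star x * x))"
    proof (rule least)
      fix p assume p: "graph_seminorm C p"
      interpret graph_seminorm C p by fact
      have "(p x)\<^sup>2 \<le> ?N (poly_star x * x)" unfolding p_square[OF x, symmetric] by (intro up p cl x)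
      then show "p x \<le> sqrt (?N (poly_star x * x))" by (rule real_le_rsqrt)
    qed
    then have "(?N x)\<^sup>2 \<le> (sqrt (?N (poly_star x * x)))\<^sup>2" by (rule power_mono[OF _ nonneg[OF x]])
    then show "(?N x)\<^sup>2 \<le> ?N (poly_star x * x)" using nonneg[OF cl(8)[OF cl(7)[OF x] x]] by simp
  qed
  have scale_le: "?N (poly_scale c x) \<le> cmod c * ?N x" if x: "x \<in> star_polys C" for c x
  proof (rule least)
    fix p assume p: "graph_seminorm C p"
    interpret graph_seminorm C p by fact
    show "p (poly_scale c x) \<le> cmod c * ?N x"
      unfolding p_scale[OF x] by (rule mult_left_mono[OF up[OF x p]]) simp
  qed
  have scale: "?N (poly_scale c x) = cmod c * ?N x" if x: "x \<in> star_polys C" for c x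
  proof (rule antisym[OF scale_le[OF x]], cases "c = 0")
    case True
    then show "cmod c * ?N x \<le> ?N (poly_scale c x)" using nonneg[OF cl(6)[OF x]] by simp
  next
    case False
    have "?N (poly_scale (1 / c) (poly_scale c x)) \<le> cmod (1 / c) * ?N (poly_scale c x)" by (rule scale_le[OF cl(6)[OF x]])
    then show "cmod c * ?N x \<le> ?N (poly_scale c x)" using False by (simp add: poly_scale_simps norm_divide field_simps)
  qed
  have add: "?N (x + y) \<le> ?N x + ?N y" if x: "x \<in> star_polys C" and y: "y \<in> star_polys C" for x y
  proof (rule least)
    fix p assume p: "graph_seminorm C p"
    interpret graph_seminorm C p by fact
    show "p (x + y) \<le> ?N x + ?N y" using p_add[OF x y] up[OF x p] up[OF y p] by simp
  qed
  have mult: "?N (x * y) \<le> ?N x * ?N y" if x: "x \<in> star_polys C" and y: "y \<in> star_polys C" for x y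
  proof (rule least)
    fix p assume p: "graph_seminorm C p"
    interpret graph_seminorm C p by fact
    have "p x * p y \<le> ?N x * ?N y"
      by (rule mult_mono[OF up[OF x p] up[OF y p] nonneg[OF x] p_nonneg[OF y]])
    then show "p (x * y) \<le> ?N x * ?N y" using p_mult[OF x y] by simp
  qed
  have rel: "?N r = 0" if r: "r \<in> graph_relators C" for r
  proof (rule antisym[OF _ nonneg[OF relators_closed[OF r]]], rule least)
    fix p assume p: "graph_seminorm C p"
    interpret graph_seminorm C p by fact
    show "p r \<le> 0" using relators[OF r] by simp
  qed
  have "cstar_seminorm C ?N" unfolding cstar_seminorm_def using nonneg square scale add mult by blast
  then show ?thesis unfolding graph_seminorm_iff using rel by blast
qed

lemma cyl_ids_cover: "(\<Union>e\<in>ids C. cyl e) = paths"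
proof
  show "(\<Union>e\<in>ids C. cyl e) \<subseteq> paths" using cyl_subset by (rule UN_least)
  show "paths \<subseteq> (\<Union>e\<in>ids C. cyl e)"
  proof
    fix x assume "x \<in> paths"
    then obtain e where "e \<in> arr C" "deg C e = 0" "x \<in> cyl e" using path_in_cyl by blast
    then show "x \<in> (\<Union>e\<in>ids C. cyl e)" using degree_zero_id(2) by blast
  qed
qed

end

locale path_conj = S: aperiodic_graph C + T: aperiodic_graph C'
  for C :: "('a, 'k::finite) kgraph" and C' :: "('b, 'l::finite) kgraph" +
  fixes \<phi> :: "'a set \<Rightarrow> 'b set" and \<psi> :: "'b set \<Rightarrow> 'a set"
  assumes conj: "path_conjugacy C C' \<phi> \<psi>" and conj_inv: "path_conjugacy C' C \<psi> \<phi>"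
begin

sublocale T: aperiodic_seminorm C' "univ_norm C'"
  by (intro aperiodic_seminorm.intro T.aperiodic_graph_axioms T.univ_norm_seminorm)

lemma swapped: "path_conj C' C \<psi> \<phi>"
  by (intro path_conj.intro path_conj_axioms.intro T.aperiodic_graph_axioms S.aperiodic_graph_axioms conj conj_inv)

lemma \<phi>: "x \<in> S.paths \<Longrightarrow> \<phi> x \<in> T.paths" "x \<in> S.paths \<Longrightarrow> \<psi> (\<phi> x) = x"
  "y \<in> T.paths \<Longrightarrow> \<psi> y \<in> S.paths" "y \<in> T.paths \<Longrightarrow> \<phi> (\<psi> y) = y"
  "S.bisection U h \<Longrightarrow> T.bisection (\<phi> ` U) (\<phi> \<circ> h \<circ> \<psi>)"
  using conj conj_inv unfolding path_conjugacy_def by auto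

definition transported :: "'a set set \<Rightarrow> ('a set \<Rightarrow> 'a set) \<Rightarrow> 'b star_poly" where
  "transported U h = T.spectral_op (\<phi> ` U) (\<phi> \<circ> h \<circ> \<psi>)"

lemma bisection_paths:
  assumes "S.bisection U h"
  shows "U \<subseteq> S.paths" "x \<in> U \<Longrightarrow> h x \<in> S.paths"
  using S.clopen_subset[OF S.bisectionD(1)[OF assms]] S.clopen_subset[OF S.bisection_clopen_image[OF assms]] by auto

lemma transported_closed: "S.bisection U h \<Longrightarrow> transported U h \<in> star_polys C'"
  unfolding transported_def by (rule T.spectral_op_closed[OF \<phi>(5)])

lemma transported_cong:
  assumes "S.bisection U h" "\<And>x. x \<in> U \<Longrightarrow> h x = g x"
  shows "T.eqv (transported U h) (transported U g)"
  unfolding transported_def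
  by (rule T.spectral_op_cong[OF \<phi>(5)[OF assms(1)]]) (use assms(2) bisection_paths(1)[OF assms(1)] \<phi>(2) in auto)

lemma transported_mult:
  assumes g: "S.bisection V g" and h: "S.bisection U h"
  shows "T.eqv (transported V g * transported U h) (transported {x \<in> U. h x \<in> V} (g \<circ> h))"
proof -
  note V = bisection_paths[OF g] and U = bisection_paths[OF h]
  have set_eq: "{y \<in> \<phi> ` U. (\<phi> \<circ> h \<circ> \<psi>) y \<in> \<phi> ` V} = \<phi> ` {x \<in> U. h x \<in> V}"
  proof
    show "{y \<in> \<phi> ` U. (\<phi> \<circ> h \<circ> \<psi>) y \<in> \<phi> ` V} \<subseteq> \<phi> ` {x \<in> U. h x \<in> V}"
    proof
      fix y assume y: "y \<in> {y \<in> \<phi> ` U. (\<phi> \<circ> h \<circ> \<psi>) y \<in> \<phi> ` V}"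
      then obtain x where x: "x \<in> U" "y = \<phi> x" by blast
      then have "\<phi> (h x) \<in> \<phi> ` V" using y \<phi>(2) U(1) by auto
      then obtain v where v: "v \<in> V" "\<phi> (h x) = \<phi> v" by blast
      then have "h x = v" using \<phi>(2) U(2)[OF x(1)] V(1) by (metis subsetD)
      then show "y \<in> \<phi> ` {x \<in> U. h x \<in> V}" using x v(1) by blast
    qed
    show "\<phi> ` {x \<in> U. h x \<in> V} \<subseteq> {y \<in> \<phi> ` U. (\<phi> \<circ> h \<circ> \<psi>) y \<in> \<phi> ` V}"
      using \<phi>(2) U(1) by auto
  qed
  have "T.eqv (transported V g * transported U h)
      (T.spectral_op {y \<in> \<phi> ` U. (\<phi> \<circ> h \<circ> \<psi>) y \<in> \<phi> ` V} ((\<phi> \<circ> g \<circ> \<psi>) \<circ> (\<phi> \<circ> h \<circ> \<psi>)))"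
    unfolding transported_def by (rule T.spectral_op_mult[OF \<phi>(5)[OF g] \<phi>(5)[OF h]])
  also have "T.eqv (T.spectral_op {y \<in> \<phi> ` U. (\<phi> \<circ> h \<circ> \<psi>) y \<in> \<phi> ` V} ((\<phi> \<circ> g \<circ> \<psi>) \<circ> (\<phi> \<circ> h \<circ> \<psi>)))
      (transported {x \<in> U. h x \<in> V} (g \<circ> h))"
    unfolding transported_def set_eq[symmetric]
  proof (rule T.spectral_op_cong)
    show "T.bisection {y \<in> \<phi> ` U. (\<phi> \<circ> h \<circ> \<psi>) y \<in> \<phi> ` V} ((\<phi> \<circ> g \<circ> \<psi>) \<circ> (\<phi> \<circ> h \<circ> \<psi>))"
      by (rule T.bisection_comp[OF \<phi>(5)[OF h] \<phi>(5)[OF g]])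
    fix y assume "y \<in> {y \<in> \<phi> ` U. (\<phi> \<circ> h \<circ> \<psi>) y \<in> \<phi> ` V}"
    then obtain x where "x \<in> U" "y = \<phi> x" by blast
    then show "((\<phi> \<circ> g \<circ> \<psi>) \<circ> (\<phi> \<circ> h \<circ> \<psi>)) y = (\<phi> \<circ> (g \<circ> h) \<circ> \<psi>) y"
      using \<phi>(2) U by (simp add: subset_iff)
  qed
  finally show ?thesis .
qed

lemma transported_star:
  assumes h: "S.bisection U h" and inv: "\<And>x. x \<in> U \<Longrightarrow> g (h x) = x"
  shows "T.eqv (poly_star (transported U h)) (transported (h ` U) g)"
proof -
  note U = bisection_paths[OF h]
  have "(\<lambda>x. \<phi> (h (\<psi> (\<phi> x)))) ` U = (\<lambda>x. \<phi> (h x)) ` U"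
    by (rule image_cong) (use \<phi>(2) U(1) in auto)
  then have "(\<phi> \<circ> h \<circ> \<psi>) ` \<phi> ` U = \<phi> ` h ` U" by (simp add: image_image)
  moreover have "T.eqv (poly_star (transported U h)) (T.spectral_op ((\<phi> \<circ> h \<circ> \<psi>) ` \<phi> ` U) (\<phi> \<circ> g \<circ> \<psi>))"
    unfolding transported_def
  proof (rule T.spectral_op_star[OF \<phi>(5)[OF h]])
    fix y assume "y \<in> \<phi> ` U"
    then obtain x where "x \<in> U" "y = \<phi> x" by blast
    then show "(\<phi> \<circ> g \<circ> \<psi>) ((\<phi> \<circ> h \<circ> \<psi>) y) = y" using \<phi>(2) U inv by (simp add: subset_iff)
  qed
  ultimately show ?thesis unfolding transported_def by simp
qed

lemma transported_UN:
  assumes "finite I" "\<And>i. i \<in> I \<Longrightarrow> S.bisection (U i) h"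
    "\<And>i j. i \<in> I \<Longrightarrow> j \<in> I \<Longrightarrow> i \<noteq> j \<Longrightarrow> U i \<inter> U j = {}"
  shows "T.eqv (\<Sum>i\<in>I. transported (U i) h) (transported (\<Union>i\<in>I. U i) h)"
proof -
  have "T.eqv (\<Sum>i\<in>I. transported (U i) h) (T.spectral_op (\<Union>i\<in>I. \<phi> ` U i) (\<phi> \<circ> h \<circ> \<psi>))"
    unfolding transported_def
  proof (rule T.spectral_op_UN[OF assms(1) \<phi>(5)[OF assms(2)]])
    fix i j assume ij: "i \<in> I" "j \<in> I" "i \<noteq> j"
    show "\<phi> ` U i \<inter> \<phi> ` U j = {}"
    proof (rule ccontr)
      assume "\<phi> ` U i \<inter> \<phi> ` U j \<noteq> {}"
      then obtain x x' where x: "x \<in> U i" "x' \<in> U j" "\<phi> x = \<phi> x'" by blast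
      then have "x = x'" using \<phi>(2) bisection_paths(1)[OF assms(2)] ij by (metis subsetD)
      then show False using assms(3)[OF ij] x by blast
    qed
  qed
  then show ?thesis unfolding transported_def by (simp add: image_UN)
qed

definition clopen_proj :: "'a set set \<Rightarrow> 'b star_poly" where
  "clopen_proj U = transported U (\<lambda>x. x)"

definition image_gen :: "'a \<Rightarrow> 'b star_poly" where
  "image_gen a = transported (S.cyl (src C a)) (S.shift a)"

lemma image_gen_closed: "a \<in> arr C \<Longrightarrow> image_gen a \<in> star_polys C'"
  unfolding image_gen_def by (rule transported_closed[OF S.bisection_shift])

lemma clopen_proj_mult:
  assumes "S.clopen U" "S.bisection V h" "h ` V \<subseteq> U"
  shows "T.eqv (clopen_proj U * transported V h) (transported V h)"
proof -
  have "{x \<in> V. h x \<in> U} = V" "(\<lambda>x. x) \<circ> h = h" using assms(3) by auto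
  then show ?thesis
    using transported_mult[OF S.bisection_id[OF assms(1)] assms(2)] unfolding clopen_proj_def by simp
qed

lemma unshift_shift:
  assumes "a \<in> arr C" "y \<in> S.cyl (src C a)"
  shows "inv_into (S.cyl (src C a)) (S.shift a) (S.shift a y) = y"
  by (rule inv_into_f_f[OF S.bisectionD(2)[OF S.bisection_shift[OF assms(1)]] assms(2)])

lemma image_gen_adjoint:
  assumes a: "a \<in> arr C"
  shows "S.bisection (S.cyl a) (inv_into (S.cyl (src C a)) (S.shift a))"
    "T.eqv (poly_star (image_gen a)) (transported (S.cyl a) (inv_into (S.cyl (src C a)) (S.shift a)))"
proof -
  have img: "S.shift a ` S.cyl (src C a) = S.cyl a" using S.cyl_eq_shift[OF a] by simp
  show "S.bisection (S.cyl a) (inv_into (S.cyl (src C a)) (S.shift a))"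
    using S.bisection_inverse[OF S.bisection_shift[OF a]] img by simp
  show "T.eqv (poly_star (image_gen a)) (transported (S.cyl a) (inv_into (S.cyl (src C a)) (S.shift a)))"
    using transported_star[OF S.bisection_shift[OF a] unshift_shift[OF a]] img unfolding image_gen_def by simp
qed

lemma image_gen_adjoint_mult:
  assumes a: "a \<in> arr C" and b: "b \<in> arr C" "src C a = src C b"
  shows "S.bisection (S.cyl b) (S.shift a \<circ> inv_into (S.cyl (src C b)) (S.shift b))"
    "T.eqv (image_gen a * poly_star (image_gen b))
      (transported (S.cyl b) (S.shift a \<circ> inv_into (S.cyl (src C b)) (S.shift b)))"
proof -
  let ?u = "inv_into (S.cyl (src C b)) (S.shift b)"
  note adj = image_gen_adjoint[OF b(1)]
  have "?u x \<in> S.cyl (src C a)" if x: "x \<in> S.cyl b" for x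
  proof -
    obtain y where y: "y \<in> S.cyl (src C b)" "x = S.shift b y" using S.cyl_shift[OF x] .
    then show ?thesis using unshift_shift[OF b(1) y(1)] b(2) by simp
  qed
  then have W: "{x \<in> S.cyl b. ?u x \<in> S.cyl (src C a)} = S.cyl b" by blast
  show "S.bisection (S.cyl b) (S.shift a \<circ> ?u)"
    using S.bisection_comp[OF adj(1) S.bisection_shift[OF a]] W by simp
  have "T.eqv (image_gen a * poly_star (image_gen b)) (image_gen a * transported (S.cyl b) ?u)"
    by (intro T.eqv_mult T.eqv_refl image_gen_closed a adj(2))
  also have "T.eqv (image_gen a * transported (S.cyl b) ?u) (transported (S.cyl b) (S.shift a \<circ> ?u))"
    using transported_mult[OF S.bisection_shift[OF a] adj(1)] W unfolding image_gen_def by simp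
  finally show "T.eqv (image_gen a * poly_star (image_gen b)) (transported (S.cyl b) (S.shift a \<circ> ?u))" .
qed

lemma image_gen_range:
  assumes a: "a \<in> arr C"
  shows "T.eqv (image_gen a * poly_star (image_gen a)) (clopen_proj (S.cyl a))"
proof -
  note m = image_gen_adjoint_mult[OF a a refl]
  have "(S.shift a \<circ> inv_into (S.cyl (src C a)) (S.shift a)) x = x" if x: "x \<in> S.cyl a" for x
  proof -
    obtain y where y: "y \<in> S.cyl (src C a)" "x = S.shift a y" using S.cyl_shift[OF x] .
    then show ?thesis using unshift_shift[OF a y(1)] by simp
  qed
  then show ?thesis unfolding clopen_proj_def by (intro T.eqv_trans[OF m(2) transported_cong[OF m(1)]])
qed

lemma image_gen_source:
  assumes a: "a \<in> arr C"
  shows "T.eqv (poly_star (image_gen a) * image_gen a) (clopen_proj (S.cyl (src C a)))"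
proof -
  let ?u = "inv_into (S.cyl (src C a)) (S.shift a)"
  note adj = image_gen_adjoint[OF a]
  have W: "{x \<in> S.cyl (src C a). S.shift a x \<in> S.cyl a} = S.cyl (src C a)" using S.shift_in_cyl a by blast
  have "T.eqv (poly_star (image_gen a) * image_gen a) (transported (S.cyl a) ?u * image_gen a)"
    by (intro T.eqv_mult T.eqv_refl image_gen_closed a adj(2))
  also have "T.eqv (transported (S.cyl a) ?u * image_gen a) (transported (S.cyl (src C a)) (?u \<circ> S.shift a))"
    using transported_mult[OF adj(1) S.bisection_shift[OF a]] W unfolding image_gen_def by simp
  also have "T.eqv (transported (S.cyl (src C a)) (?u \<circ> S.shift a)) (clopen_proj (S.cyl (src C a)))"
    unfolding clopen_proj_def
  proof (rule transported_cong)
    show "S.bisection (S.cyl (src C a)) (?u \<circ> S.shift a)"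
      using S.bisection_comp[OF S.bisection_shift[OF a] adj(1)] W by simp
  qed (use unshift_shift[OF a] in simp)
  finally show ?thesis .
qed

lemma image_gen_id:
  assumes "e \<in> ids C"
  shows "T.eqv (image_gen e) (clopen_proj (S.cyl e))"
proof -
  have e: "e \<in> arr C" "src C e = e" using assms S.ids_subset S.src_id by auto
  show ?thesis
    unfolding image_gen_def clopen_proj_def e(2)
    by (rule transported_cong) (use S.bisection_shift[OF e(1)] e(2) S.shift_id[OF assms] in auto)
qed

lemma clopen_proj_inter:
  assumes "S.clopen U" "S.clopen V"
  shows "T.eqv (clopen_proj U * clopen_proj V) (clopen_proj (U \<inter> V))"
proof -
  have "{x \<in> V. x \<in> U} = U \<inter> V" by auto
  then show ?thesis
    using transported_mult[OF S.bisection_id[OF assms(1)] S.bisection_id[OF assms(2)]]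
    unfolding clopen_proj_def by (simp add: comp_def)
qed

lemma clopen_proj_star: "S.clopen U \<Longrightarrow> T.eqv (poly_star (clopen_proj U)) (clopen_proj U)"
  using transported_star[OF S.bisection_id, of U "\<lambda>x. x"] unfolding clopen_proj_def by simp

lemma clopen_proj_UN:
  assumes "finite I" "\<And>i. i \<in> I \<Longrightarrow> S.clopen (U i)" "\<And>i j. i \<in> I \<Longrightarrow> j \<in> I \<Longrightarrow> i \<noteq> j \<Longrightarrow> U i \<inter> U j = {}"
  shows "T.eqv (\<Sum>i\<in>I. clopen_proj (U i)) (clopen_proj (\<Union>i\<in>I. U i))"
  unfolding clopen_proj_def by (rule transported_UN[OF assms(1) S.bisection_id[OF assms(2)] assms(3)])

abbreviation hom :: "'a star_poly \<Rightarrow> 'b star_poly" where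
  "hom \<equiv> free_hom image_gen"

lemma hom_closed: "x \<in> star_polys C \<Longrightarrow> hom x \<in> star_polys C'"
  by (rule free_hom_closed[OF image_gen_closed])

text \<open>Each relation is an identity between bisections: the generators are the maps \<open>y \<mapsto> a y\<close>, products are
  compositions, adjoints are inverses, and the last family of relations says that the cylinder of a
  vertex is the disjoint union of the cylinders of its arrows of degree \<open>n\<close>.\<close>

lemma hom_relators:
  assumes "r \<in> graph_relators C"
  shows "T.eqv (hom r) 0"
proof -
  note cl = image_gen_closed
  have ida: "e \<in> arr C" if "e \<in> ids C" for e using that S.ids_subset by blast
  have diff0: "T.eqv (x - y) 0" if "T.eqv x y" for x y
    using T.eqv_diff[OF that T.eqv_refl[OF T.eqvD(2)[OF that]]] by simp
  note fh = free_hom_diff free_hom_mult free_hom_star free_hom_gen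
  consider (1) a where "a \<in> arr C" "r = gen a * poly_star (gen a) * gen a - gen a"
    | (2) e where "e \<in> ids C" "r = gen e * gen e - gen e"
    | (3) e where "e \<in> ids C" "r = poly_star (gen e) - gen e"
    | (4) e f where "e \<in> ids C" "f \<in> ids C" "e \<noteq> f" "r = gen e * gen f"
    | (5) a b where "a \<in> arr C" "b \<in> arr C" "src C a = tgt C b" "r = gen a * gen b - gen (cmp C a b)"
    | (6) a where "a \<in> arr C" "r = poly_star (gen a) * gen a - gen (src C a)"
    | (7) e n where "e \<in> ids C" "r = gen e - (\<Sum>a\<in>{a \<in> ray C e. deg C a = n}. gen a * poly_star (gen a))"
    using assms unfolding graph_relators_def
    by (elim UnE CollectE exE conjE)
      ((rule that(1), assumption, assumption) | (rule that(2), assumption, assumption) |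
        (rule that(3), assumption, assumption) | (rule that(4), assumption, assumption, assumption, assumption) |
        (rule that(5), assumption, assumption, assumption, assumption) |
        (rule that(6), assumption, assumption) | (rule that(7), assumption, assumption))+
  then show ?thesis
  proof cases
    case 1
    have "T.eqv (image_gen a * poly_star (image_gen a) * image_gen a) (clopen_proj (S.cyl a) * image_gen a)"
      by (intro T.eqv_mult T.eqv_refl cl 1 image_gen_range)
    also have "T.eqv (clopen_proj (S.cyl a) * image_gen a) (image_gen a)"
      unfolding image_gen_def
      by (rule clopen_proj_mult[OF S.clopen_cyl S.bisection_shift]) (use S.cyl_eq_shift 1 in auto)
    finally show ?thesis using diff0 unfolding 1(2) fh by blast
  next
    case 2
    note e = image_gen_id[OF 2(1)]
    have "T.eqv (image_gen e * image_gen e) (clopen_proj (S.cyl e) * clopen_proj (S.cyl e))"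
      by (intro T.eqv_mult e)
    also have "T.eqv (clopen_proj (S.cyl e) * clopen_proj (S.cyl e)) (clopen_proj (S.cyl e))"
      using clopen_proj_inter[OF S.clopen_cyl S.clopen_cyl, of e e] by simp
    also have "T.eqv (clopen_proj (S.cyl e)) (image_gen e)" by (rule T.eqv_sym[OF e])
    finally show ?thesis using diff0 unfolding 2(2) fh by blast
  next
    case 3
    note e = image_gen_id[OF 3(1)]
    have "T.eqv (poly_star (image_gen e)) (poly_star (clopen_proj (S.cyl e)))" by (rule T.eqv_star[OF e])
    also have "T.eqv (poly_star (clopen_proj (S.cyl e))) (clopen_proj (S.cyl e))" by (rule clopen_proj_star[OF S.clopen_cyl])
    also have "T.eqv (clopen_proj (S.cyl e)) (image_gen e)" by (rule T.eqv_sym[OF e])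
    finally show ?thesis using diff0 unfolding 3(2) fh by blast
  next
    case 4
    have "S.cyl e \<inter> S.cyl f = {}" by (rule S.cyl_disjoint_degree) (use 4 S.deg_id in auto)
    moreover have "T.eqv (clopen_proj {}) 0"
      unfolding clopen_proj_def transported_def using T.spectral_op_empty by simp
    moreover have "T.eqv (image_gen e * image_gen f) (clopen_proj (S.cyl e) * clopen_proj (S.cyl f))"
      by (intro T.eqv_mult image_gen_id 4)
    ultimately have "T.eqv (image_gen e * image_gen f) 0"
      using clopen_proj_inter[OF S.clopen_cyl S.clopen_cyl, of e f] T.eqv_trans by metis
    then show ?thesis unfolding 4(4) fh .
  next
    case 5
    have comp: "S.composable a b" unfolding S.composable_def using 5 by simp
    note ab = S.composableD[OF comp]
    have W: "{x \<in> S.cyl (src C b). S.shift b x \<in> S.cyl (src C a)} = S.cyl (src C b)"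
      using S.shift_cmp(1)[OF comp] by blast
    have "T.eqv (image_gen a * image_gen b) (transported (S.cyl (src C b)) (S.shift a \<circ> S.shift b))"
      unfolding image_gen_def using transported_mult[OF S.bisection_shift[OF ab(1)] S.bisection_shift[OF ab(2)]] W by simp
    also have "T.eqv (transported (S.cyl (src C b)) (S.shift a \<circ> S.shift b)) (image_gen (cmp C a b))"
      unfolding image_gen_def ab(5)
      by (rule transported_cong)
        (use S.bisection_comp[OF S.bisection_shift[OF ab(2)] S.bisection_shift[OF ab(1)]] W
          S.shift_cmp(2)[OF comp] in auto)
    finally show ?thesis using diff0 unfolding 5(4) fh by blast
  next
    case 6
    have "T.eqv (poly_star (image_gen a) * image_gen a) (clopen_proj (S.cyl (src C a)))" by (rule image_gen_source[OF 6(1)])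
    also have "T.eqv (clopen_proj (S.cyl (src C a))) (image_gen (src C a))"
      by (intro T.eqv_sym[OF image_gen_id] S.src_in_ids 6)
    finally show ?thesis using diff0 unfolding 6(2) fh by blast
  next
    case 7
    let ?L = "{a \<in> ray C e. deg C a = n}"
    have ra: "a \<in> ray C e \<longleftrightarrow> S.prefix e a" for a by (rule S.ray_prefix_iff[OF ida[OF 7(1)]])
    have La: "a \<in> arr C" "S.prefix e a" "deg C a = n" if "a \<in> ?L" for a
      using that ra S.prefixD(2) by auto
    have fin: "finite ?L" using S.row_finite 7(1) unfolding row_finite_def by blast
    have U: "(\<Union>a\<in>?L. S.cyl a) = S.cyl e"
    proof
      show "(\<Union>a\<in>?L. S.cyl a) \<subseteq> S.cyl e" using S.cyl_mono La(2) by blast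
      show "S.cyl e \<subseteq> (\<Union>a\<in>?L. S.cyl a)"
      proof
        fix x assume x: "x \<in> S.cyl e"
        obtain a where a: "a \<in> arr C" "deg C a = n" "x \<in> S.cyl a" using S.path_in_cyl[OF S.cylD(1)[OF x]] by blast
        obtain w where "S.composable e w" "a = cmp C e w"
          by (rule S.nbhd_extension[OF x a(3), of n]) (use a S.deg_id[OF 7(1)] in auto)
        then have "a \<in> ?L" using ra S.prefix_cmp a(2) by blast
        then show "x \<in> (\<Union>a\<in>?L. S.cyl a)" using a(3) by blast
      qed
    qed
    have disj: "S.cyl a \<inter> S.cyl b = {}" if "a \<in> ?L" "b \<in> ?L" "a \<noteq> b" for a b
      by (rule S.cyl_disjoint_degree) (use that in auto)
    have "T.eqv (image_gen e) (clopen_proj (S.cyl e))" by (rule image_gen_id[OF 7(1)])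
    also have "T.eqv (clopen_proj (S.cyl e)) (\<Sum>a\<in>?L. clopen_proj (S.cyl a))"
      unfolding U[symmetric]
      by (rule T.eqv_sym[OF clopen_proj_UN[OF fin S.clopen_cyl disj]])
    also have "T.eqv (\<Sum>a\<in>?L. clopen_proj (S.cyl a)) (\<Sum>a\<in>?L. image_gen a * poly_star (image_gen a))"
      by (rule T.eqv_sum[OF T.eqv_sym[OF image_gen_range[OF La(1)]]])
    finally show ?thesis using diff0 unfolding 7(2) fh free_hom_sum by blast
  qed
qed

text \<open>The pullback of the universal norm is one of the seminorms of which the universal norm of \<open>C\<close> is the
  supremum. So the homomorphism is contractive.\<close>

lemma pullback_seminorm: "graph_seminorm C (\<lambda>x. univ_norm C' (hom x))"
  unfolding S.graph_seminorm_iff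
proof (intro CollectI conjI ballI)
  show "cstar_seminorm C (\<lambda>x. univ_norm C' (hom x))"
    unfolding cstar_seminorm_def
  proof (intro conjI ballI allI)
    fix x assume "x \<in> star_polys C"
    note hx = hom_closed[OF this]
    show "0 \<le> univ_norm C' (hom x)" by (rule T.p_nonneg[OF hx])
    show "univ_norm C' (hom (poly_star x * x)) = (univ_norm C' (hom x))\<^sup>2"
      unfolding free_hom_mult free_hom_star by (rule T.p_square[OF hx])
    show "univ_norm C' (hom (poly_scale c x)) = cmod c * univ_norm C' (hom x)" for c
      unfolding free_hom_scale by (rule T.p_scale[OF hx])
    fix y assume "y \<in> star_polys C"
    note hy = hom_closed[OF this]
    show "univ_norm C' (hom (x + y)) \<le> univ_norm C' (hom x) + univ_norm C' (hom y)"
      unfolding free_hom_add by (rule T.p_add[OF hx hy])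
    show "univ_norm C' (hom (x * y)) \<le> univ_norm C' (hom x) * univ_norm C' (hom y)"
      unfolding free_hom_mult by (rule T.p_mult[OF hx hy])
  qed
  show "univ_norm C' (hom r) = 0" if "r \<in> graph_relators C" for r
    using hom_relators[OF that] T.eqv_zero_iff by blast
qed

lemma hom_contractive: "x \<in> star_polys C \<Longrightarrow> univ_norm C' (hom x) \<le> univ_norm C x"
  by (rule S.univ_norm_upper[OF _ pullback_seminorm])

text \<open>Both units are the operator of the identity map of the whole path space.\<close>

lemma hom_unit: "T.eqv (hom (\<Sum>e\<in>ids C. gen e)) (\<Sum>e\<in>ids C'. gen e)"
proof -
  have cover: "(\<Union>e\<in>ids C. S.cyl e) = S.paths" by (rule S.cyl_ids_cover)
  have cover': "(\<Union>e\<in>ids C'. T.cyl e) = T.paths" by (rule T.cyl_ids_cover)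
  have disj: "S.cyl e \<inter> S.cyl f = {}" if "e \<in> ids C" "f \<in> ids C" "e \<noteq> f" for e f
    using S.cyl_disjoint_degree S.deg_id that by simp
  have disj': "T.cyl e \<inter> T.cyl f = {}" if "e \<in> ids C'" "f \<in> ids C'" "e \<noteq> f" for e f
    using T.cyl_disjoint_degree T.deg_id that by simp
  have "T.eqv (hom (\<Sum>e\<in>ids C. gen e)) (\<Sum>e\<in>ids C. clopen_proj (S.cyl e))"
    unfolding free_hom_sum free_hom_gen by (intro T.eqv_sum image_gen_id)
  also have "T.eqv (\<Sum>e\<in>ids C. clopen_proj (S.cyl e)) (clopen_proj S.paths)"
    unfolding cover[symmetric] by (rule clopen_proj_UN[OF S.finite_ids S.clopen_cyl disj])
  also have "T.eqv (clopen_proj S.paths) (T.spectral_op T.paths (\<lambda>x. x))"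
  proof -
    have img: "\<phi> ` S.paths = T.paths"
    proof
      show "\<phi> ` S.paths \<subseteq> T.paths" using \<phi>(1) by (rule image_subsetI)
      show "T.paths \<subseteq> \<phi> ` S.paths"
      proof
        fix y assume "y \<in> T.paths"
        then show "y \<in> \<phi> ` S.paths" using \<phi>(3,4) by (intro image_eqI[of y \<phi> "\<psi> y"]) auto
      qed
    qed
    have "T.bisection (\<phi> ` S.paths) (\<phi> \<circ> (\<lambda>x. x) \<circ> \<psi>)" by (rule \<phi>(5)[OF S.bisection_id[OF S.clopen_paths]])
    then show ?thesis
      unfolding clopen_proj_def transported_def img by (rule T.spectral_op_cong) (use \<phi>(4) in simp)
  qed
  also have "T.eqv (T.spectral_op T.paths (\<lambda>x. x)) (\<Sum>e\<in>ids C'. T.spectral_op (T.cyl e) (\<lambda>x. x))"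
    unfolding cover'[symmetric]
    by (rule T.eqv_sym[OF T.spectral_op_UN[OF T.finite_ids T.bisection_id[OF T.clopen_cyl] disj']])
  also have "T.eqv (\<Sum>e\<in>ids C'. T.spectral_op (T.cyl e) (\<lambda>x. x)) (\<Sum>e\<in>ids C'. gen e)"
  proof (rule T.eqv_sum)
    fix e assume e: "e \<in> ids C'"
    have ea: "e \<in> arr C'" "src C' e = e" using e T.ids_subset T.src_id by auto
    have "T.eqv (T.spectral_op (T.cyl e) (\<lambda>x. x)) (T.spectral_op (T.cyl e) (T.shift e))"
      by (rule T.spectral_op_cong[OF T.bisection_id[OF T.clopen_cyl]]) (use T.shift_id[OF e] in simp)
    also have "T.eqv (T.spectral_op (T.cyl e) (T.shift e)) (gen e)" using T.spectral_op_gen[OF ea(1)] ea(2) by simp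
    finally show "T.eqv (T.spectral_op (T.cyl e) (\<lambda>x. x)) (gen e)" .
  qed
  finally show ?thesis .
qed

end

section \<open>Invariance of K-theory\<close>

text \<open>The condition \<open>closed\<close> concerns products that leave the carrier: \<open>r\<close> then yields an empty set for
  them, and \<open>r'\<close> has to do the same.\<close>

lemma quot_monoid_iso:
  assumes bij: "bij_betw h (carrier M) (carrier M')"
    and sub: "r \<subseteq> carrier M \<times> carrier M" "r' \<subseteq> carrier M' \<times> carrier M'"
    and rel: "\<And>x y. x \<in> carrier M \<Longrightarrow> y \<in> carrier M \<Longrightarrow> (h x, h y) \<in> r' \<longleftrightarrow> (x, y) \<in> r"
    and mult: "\<And>x y. x \<in> carrier M \<Longrightarrow> y \<in> carrier M \<Longrightarrow> h (x \<otimes>\<^bsub>M\<^esub> y) = h x \<otimes>\<^bsub>M'\<^esub> h y"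
    and closed: "\<And>x y. x \<in> carrier M \<Longrightarrow> y \<in> carrier M \<Longrightarrow>
      h x \<otimes>\<^bsub>M'\<^esub> h y \<in> carrier M' \<longleftrightarrow> x \<otimes>\<^bsub>M\<^esub> y \<in> carrier M"
  shows "quot_monoid M r \<cong> quot_monoid M' r'"
proof -
  have hin: "h x \<in> carrier M'" if "x \<in> carrier M" for x using bij that bij_betwE by blast
  have surj: "\<exists>x\<in>carrier M. y = h x" if "y \<in> carrier M'" for y using bij that unfolding bij_betw_def by blast
  have inj: "inj_on h (carrier M)" using bij unfolding bij_betw_def by blast
  have cls: "h ` (r `` {x}) = r' `` {h x}" if x: "x \<in> carrier M" for x
  proof
    show "h ` (r `` {x}) \<subseteq> r' `` {h x}" using rel x sub(1) by auto
    show "r' `` {h x} \<subseteq> h ` (r `` {x})"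
    proof
      fix y assume y: "y \<in> r' `` {h x}"
      then obtain z where z: "z \<in> carrier M" "y = h z" using surj sub(2) by blast
      then have "(x, z) \<in> r" using y rel x by simp
      then show "y \<in> h ` (r `` {x})" using z by blast
    qed
  qed
  let ?F = "\<lambda>X. h ` X"
  have "bij_betw ?F (carrier M // r) (carrier M' // r')"
    unfolding bij_betw_def
  proof
    have sub_cls: "X \<subseteq> carrier M" if "X \<in> carrier M // r" for X
      using that sub(1) unfolding quotient_def by blast
    show "inj_on ?F (carrier M // r)"
      by (rule inj_onI) (use inj sub_cls in \<open>metis inj_on_image_eq_iff\<close>)
    show "?F ` (carrier M // r) = carrier M' // r'"
    proof
      show "?F ` (carrier M // r) \<subseteq> carrier M' // r'"
      proof
        fix Y assume "Y \<in> ?F ` (carrier M // r)"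
        then obtain x where "x \<in> carrier M" "Y = h ` (r `` {x})" unfolding quotient_def by blast
        then show "Y \<in> carrier M' // r'" using cls hin unfolding quotient_def by blast
      qed
      show "carrier M' // r' \<subseteq> ?F ` (carrier M // r)"
      proof
        fix Y assume "Y \<in> carrier M' // r'"
        then obtain x where "x \<in> carrier M" "Y = r' `` {h x}" using surj unfolding quotient_def by blast
        then show "Y \<in> ?F ` (carrier M // r)" using cls unfolding quotient_def by blast
      qed
    qed
  qed
  moreover have "?F ((\<Union>x\<in>X. \<Union>y\<in>Y. r `` {x \<otimes>\<^bsub>M\<^esub> y})) = (\<Union>x\<in>?F X. \<Union>y\<in>?F Y. r' `` {x \<otimes>\<^bsub>M'\<^esub> y})"
    if XY: "X \<in> carrier M // r" "Y \<in> carrier M // r" for X Y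
  proof -
    have sub_cls: "X \<subseteq> carrier M" "Y \<subseteq> carrier M" using XY sub(1) unfolding quotient_def by auto
    have "?F (r `` {x \<otimes>\<^bsub>M\<^esub> y}) = r' `` {h x \<otimes>\<^bsub>M'\<^esub> h y}" if xy: "x \<in> X" "y \<in> Y" for x y
    proof -
      have c: "x \<in> carrier M" "y \<in> carrier M" using xy sub_cls by auto
      show ?thesis
      proof (cases "x \<otimes>\<^bsub>M\<^esub> y \<in> carrier M")
        case True
        then show ?thesis using cls[OF True] mult[OF c] by simp
      next
        case False
        then have "r `` {x \<otimes>\<^bsub>M\<^esub> y} = {}" "r' `` {h x \<otimes>\<^bsub>M'\<^esub> h y} = {}"
          using sub closed[OF c] by auto
        then show ?thesis by simp
      qed
    qed
    then show ?thesis by (simp add: image_UN)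
  qed
  ultimately have "?F \<in> iso (quot_monoid M r) (quot_monoid M' r')"
    unfolding iso_def hom_def quot_monoid_def bij_betw_def by (auto simp: image_subset_iff)
  then show ?thesis unfolding is_iso_def by blast
qed

text \<open>The structure from which \<open>K\<^sub>0\<close> and \<open>K\<^sub>1\<close> are built: *-ring, unit and norm.\<close>

locale cstar_alg_iso =
  fixes A :: "('x, 'm) cstar_alg_scheme" and A' :: "('y, 'n) cstar_alg_scheme" and F :: "'x \<Rightarrow> 'y"
  assumes group: "abelian_group A" "abelian_group A'"
    and bij: "bij_betw F (carrier A) (carrier A')"
    and F_add: "x \<in> carrier A \<Longrightarrow> y \<in> carrier A \<Longrightarrow> F (x \<oplus>\<^bsub>A\<^esub> y) = F x \<oplus>\<^bsub>A'\<^esub> F y"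
    and F_mult: "x \<in> carrier A \<Longrightarrow> y \<in> carrier A \<Longrightarrow> F (x \<otimes>\<^bsub>A\<^esub> y) = F x \<otimes>\<^bsub>A'\<^esub> F y"
    and F_star: "x \<in> carrier A \<Longrightarrow> F (star A x) = star A' (F x)"
    and F_norm: "x \<in> carrier A \<Longrightarrow> cnorm A' (F x) = cnorm A x"
    and F_one: "F \<one>\<^bsub>A\<^esub> = \<one>\<^bsub>A'\<^esub>"
    and one_closed: "\<one>\<^bsub>A\<^esub> \<in> carrier A"
    and mult_closed: "x \<in> carrier A \<Longrightarrow> y \<in> carrier A \<Longrightarrow> x \<otimes>\<^bsub>A\<^esub> y \<in> carrier A"
    and star_closed: "x \<in> carrier A \<Longrightarrow> star A x \<in> carrier A"
begin

sublocale A: abelian_group A by (rule group)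
sublocale A': abelian_group A' by (rule group)

lemma F_in: "x \<in> carrier A \<Longrightarrow> F x \<in> carrier A'"
  using bij bij_betwE by blast

lemma F_zero: "F \<zero>\<^bsub>A\<^esub> = \<zero>\<^bsub>A'\<^esub>"
proof -
  have "F \<zero>\<^bsub>A\<^esub> \<oplus>\<^bsub>A'\<^esub> F \<zero>\<^bsub>A\<^esub> = F \<zero>\<^bsub>A\<^esub>" using F_add[of "\<zero>\<^bsub>A\<^esub>" "\<zero>\<^bsub>A\<^esub>"] by simp
  then show ?thesis using F_in[OF A.zero_closed] A'.add.r_cancel_one' by metis
qed

lemma F_minus:
  assumes "x \<in> carrier A" "y \<in> carrier A"
  shows "F (x \<ominus>\<^bsub>A\<^esub> y) = F x \<ominus>\<^bsub>A'\<^esub> F y"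
proof -
  have "F (\<ominus>\<^bsub>A\<^esub> y) \<oplus>\<^bsub>A'\<^esub> F y = \<zero>\<^bsub>A'\<^esub>"
    using F_add[of "\<ominus>\<^bsub>A\<^esub> y" y] assms F_zero by (simp add: A.l_neg)
  then have "\<ominus>\<^bsub>A'\<^esub> F y = F (\<ominus>\<^bsub>A\<^esub> y)" using A'.minus_equality F_in assms by simp
  then show ?thesis unfolding a_minus_def using F_add assms by simp
qed

abbreviation F_inv :: "'y \<Rightarrow> 'x" where
  "F_inv \<equiv> inv_into (carrier A) F"

lemma F_inv: "x \<in> carrier A \<Longrightarrow> F_inv (F x) = x" "y \<in> carrier A' \<Longrightarrow> F (F_inv y) = y"
  "y \<in> carrier A' \<Longrightarrow> F_inv y \<in> carrier A"
  using bij by (auto simp: bij_betw_inv_into_left bij_betw_inv_into_right bij_betw_def inv_into_into)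

lemma inverse_iso: "cstar_alg_iso A' A F_inv"
proof
  show "bij_betw F_inv (carrier A') (carrier A)" by (rule bij_betw_inv_into[OF bij])
  show "F_inv \<one>\<^bsub>A'\<^esub> = \<one>\<^bsub>A\<^esub>" using F_inv(1)[OF one_closed] F_one by simp
  show "\<one>\<^bsub>A'\<^esub> \<in> carrier A'" using F_in[OF one_closed] F_one by simp
  fix x assume x: "x \<in> carrier A'"
  note ix = F_inv(2,3)[OF x]
  show "F_inv (star A' x) = star A (F_inv x)"
    using F_inv(1)[OF star_closed[OF ix(2)]] F_star[OF ix(2)] ix(1) by simp
  show "star A' x \<in> carrier A'" using F_in[OF star_closed[OF ix(2)]] F_star[OF ix(2)] ix(1) by simp
  show "cnorm A (F_inv x) = cnorm A' x" using F_norm[OF ix(2)] ix(1) by simp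
  fix y assume y: "y \<in> carrier A'"
  note iy = F_inv(2,3)[OF y]
  show "F_inv (x \<oplus>\<^bsub>A'\<^esub> y) = F_inv x \<oplus>\<^bsub>A\<^esub> F_inv y"
    using F_inv(1)[OF A.a_closed[OF ix(2) iy(2)]] F_add[OF ix(2) iy(2)] ix(1) iy(1) by simp
  show "F_inv (x \<otimes>\<^bsub>A'\<^esub> y) = F_inv x \<otimes>\<^bsub>A\<^esub> F_inv y"
    using F_inv(1)[OF mult_closed[OF ix(2) iy(2)]] F_mult[OF ix(2) iy(2)] ix(1) iy(1) by simp
  show "x \<otimes>\<^bsub>A'\<^esub> y \<in> carrier A'"
    using F_in[OF mult_closed[OF ix(2) iy(2)]] F_mult[OF ix(2) iy(2)] ix(1) iy(1) by simp
qed

text \<open>A condition on all entries in place of a format \<open>m \<times> n\<close>: it is stable under products and block sums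
  regardless of the sizes. The format is transported separately in \<open>map_mtx_carrier\<close>.\<close>

definition entries_in :: "'x mtx \<Rightarrow> bool" where
  "entries_in M \<longleftrightarrow> (\<forall>i j. M i j \<in> carrier A)"

definition map_mtx :: "'x mtx \<Rightarrow> 'y mtx" where
  "map_mtx M = (\<lambda>i j. F (M i j))"

definition map_sized :: "nat \<times> 'x mtx \<Rightarrow> nat \<times> 'y mtx" where
  "map_sized = (\<lambda>(n, M). (n, map_mtx M))"

lemma mtx_carrier_entries: "M \<in> mtx_carrier A m n \<Longrightarrow> entries_in M"
  unfolding mtx_carrier_def entries_in_def by (metis (mono_tags, lifting) A.zero_closed mem_Collect_eq)

lemma map_mtx_inj: "entries_in M \<Longrightarrow> entries_in N \<Longrightarrow> map_mtx M = map_mtx N \<longleftrightarrow> M = N"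
  unfolding map_mtx_def entries_in_def fun_eq_iff using F_inv(1) by metis

lemma map_mtx_carrier:
  assumes "entries_in M"
  shows "map_mtx M \<in> mtx_carrier A' m n \<longleftrightarrow> M \<in> mtx_carrier A m n"
proof -
  have "F (M i j) = \<zero>\<^bsub>A'\<^esub> \<longleftrightarrow> M i j = \<zero>\<^bsub>A\<^esub>" for i j
    using F_zero F_inv(1) A.zero_closed assms unfolding entries_in_def by metis
  then show ?thesis using assms F_in unfolding mtx_carrier_def map_mtx_def entries_in_def by simp
qed

lemma F_finsum:
  assumes "finite K" "\<And>k. k \<in> K \<Longrightarrow> g k \<in> carrier A"
  shows "F (\<Oplus>\<^bsub>A\<^esub>k\<in>K. g k) = (\<Oplus>\<^bsub>A'\<^esub>k\<in>K. F (g k))"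
  using assms
proof (induction K rule: finite_induct)
  case (insert k K)
  have g: "g \<in> K \<rightarrow> carrier A" "g k \<in> carrier A" using insert.prems by auto
  have Fg: "(\<lambda>k. F (g k)) \<in> K \<rightarrow> carrier A'" "F (g k) \<in> carrier A'" using g F_in by auto
  have "F (\<Oplus>\<^bsub>A\<^esub>k\<in>insert k K. g k) = F (g k) \<oplus>\<^bsub>A'\<^esub> F (\<Oplus>\<^bsub>A\<^esub>k\<in>K. g k)"
    using A.finsum_insert[OF insert.hyps g] F_add[OF g(2) A.finsum_closed[OF g(1)]] by simp
  then show ?case using A'.finsum_insert[OF insert.hyps Fg] insert by simp
qed (simp add: F_zero)

lemma mtx_mult_entries: "entries_in M \<Longrightarrow> entries_in N \<Longrightarrow> entries_in (mtx_mult A n M N)"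
  unfolding entries_in_def mtx_mult_def by (auto intro!: A.finsum_closed mult_closed)

lemma mtx_star_entries: "entries_in M \<Longrightarrow> entries_in (mtx_star A M)"
  unfolding entries_in_def mtx_star_def by (auto intro: star_closed)

lemma mtx_one_entries: "entries_in (mtx_one A n)"
  unfolding entries_in_def mtx_one_def using one_closed by simp

lemma map_mtx_mult:
  "entries_in M \<Longrightarrow> entries_in N \<Longrightarrow> map_mtx (mtx_mult A n M N) = mtx_mult A' n (map_mtx M) (map_mtx N)"
  unfolding entries_in_def mtx_mult_def map_mtx_def
  by (intro ext) (simp add: F_finsum mult_closed F_mult)

lemma map_mtx_star: "entries_in M \<Longrightarrow> map_mtx (mtx_star A M) = mtx_star A' (map_mtx M)"
  unfolding entries_in_def mtx_star_def map_mtx_def by (simp add: F_star)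

lemma map_mtx_one: "map_mtx (mtx_one A n) = mtx_one A' n"
  unfolding mtx_one_def map_mtx_def by (auto simp: fun_eq_iff F_one F_zero)

lemma map_sized_block_sum: "map_sized (block_sum A p q) = block_sum A' (map_sized p) (map_sized q)"
  by (cases p; cases q) (auto simp: map_sized_def map_mtx_def fun_eq_iff F_zero)

lemma block_sum_entries: "entries_in (snd p) \<Longrightarrow> entries_in (snd q) \<Longrightarrow> entries_in (snd (block_sum A p q))"
  by (cases p; cases q) (auto simp: entries_in_def)

lemma map_sized_projections:
  assumes "entries_in (snd p)"
  shows "map_sized p \<in> mtx_projections A' \<longleftrightarrow> p \<in> mtx_projections A"
proof -
  obtain n M where p: "p = (n, M)" by (cases p)
  have M: "entries_in M" using assms p by simp
  show ?thesis
    unfolding p map_sized_def mtx_projections_def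
    using map_mtx_carrier[OF M] map_mtx_mult[OF M M, symmetric] map_mtx_star[OF M, symmetric]
      map_mtx_inj[OF mtx_mult_entries[OF M M] M] map_mtx_inj[OF mtx_star_entries[OF M] M] by simp
qed

lemma map_sized_unitaries:
  assumes "entries_in (snd p)"
  shows "map_sized p \<in> mtx_unitaries A' \<longleftrightarrow> p \<in> mtx_unitaries A"
proof -
  obtain n M where p: "p = (n, M)" by (cases p)
  have M: "entries_in M" using assms p by simp
  note S = mtx_star_entries[OF M]
  show ?thesis
    unfolding p map_sized_def mtx_unitaries_def
    using map_mtx_carrier[OF M] map_mtx_mult[OF S M, symmetric] map_mtx_mult[OF M S, symmetric] map_mtx_star[OF M, symmetric]
      map_mtx_one[symmetric] map_mtx_inj[OF mtx_mult_entries[OF S M] mtx_one_entries]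
      map_mtx_inj[OF mtx_mult_entries[OF M S] mtx_one_entries] by simp
qed

lemma projections_entries: "p \<in> mtx_projections A \<Longrightarrow> entries_in (snd p)"
  unfolding mtx_projections_def using mtx_carrier_entries by auto

lemma unitaries_entries: "p \<in> mtx_unitaries A \<Longrightarrow> entries_in (snd p)"
  unfolding mtx_unitaries_def using mtx_carrier_entries by auto

lemma map_sized_inj: "entries_in (snd p) \<Longrightarrow> entries_in (snd q) \<Longrightarrow> map_sized p = map_sized q \<Longrightarrow> p = q"
  using map_mtx_inj by (cases p; cases q) (auto simp: map_sized_def)

lemma map_mtx_preimage:
  assumes "\<forall>i j. N i j \<in> carrier A'"
  obtains M where "entries_in M" "map_mtx M = N"
  using that[of "\<lambda>i j. F_inv (N i j)"] assms F_inv unfolding entries_in_def map_mtx_def by simp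

lemma map_sized_preimage:
  assumes "\<forall>i j. snd q i j \<in> carrier A'"
  obtains p where "entries_in (snd p)" "map_sized p = q"
proof -
  obtain M where "entries_in M" "map_mtx M = snd q" using map_mtx_preimage assms by blast
  then show ?thesis using that[of "(fst q, M)"] by (simp add: map_sized_def)
qed

lemma target_entries: "N \<in> mtx_carrier A' m n \<Longrightarrow> \<forall>i j. N i j \<in> carrier A'"
  unfolding mtx_carrier_def by (metis (mono_tags, lifting) A'.zero_closed mem_Collect_eq)

lemma projections_preimage:
  assumes "q \<in> mtx_projections A'"
  obtains p where "p \<in> mtx_projections A" "map_sized p = q"
proof -
  have "\<forall>i j. snd q i j \<in> carrier A'" using assms target_entries unfolding mtx_projections_def by auto
  then obtain p where "entries_in (snd p)" "map_sized p = q" using map_sized_preimage by blast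
  then show ?thesis using that map_sized_projections assms by metis
qed

lemma unitaries_preimage:
  assumes "q \<in> mtx_unitaries A'"
  obtains p where "p \<in> mtx_unitaries A" "map_sized p = q"
proof -
  have "\<forall>i j. snd q i j \<in> carrier A'" using assms target_entries unfolding mtx_unitaries_def by auto
  then obtain p where "entries_in (snd p)" "map_sized p = q" using map_sized_preimage by blast
  then show ?thesis using that map_sized_unitaries assms by metis
qed

lemma map_sized_mvn:
  assumes p: "entries_in (snd p)" and q: "entries_in (snd q)"
  shows "mvn_equiv A' (map_sized p) (map_sized q) \<longleftrightarrow> mvn_equiv A p q"
proof -
  obtain m M n N where pq: "p = (m, M)" "q = (n, N)" by (cases p; cases q) auto
  have MN: "entries_in M" "entries_in N" using p q pq by auto
  have eq: "(mtx_mult A' n (mtx_star A' (map_mtx v)) (map_mtx v) = map_mtx M \<and>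
      mtx_mult A' m (map_mtx v) (mtx_star A' (map_mtx v)) = map_mtx N) \<longleftrightarrow>
      (mtx_mult A n (mtx_star A v) v = M \<and> mtx_mult A m v (mtx_star A v) = N)" if v: "entries_in v" for v
  proof -
    note s = mtx_star_entries[OF v]
    show ?thesis
      using map_mtx_star[OF v, symmetric] map_mtx_mult[OF s v, symmetric] map_mtx_mult[OF v s, symmetric]
        map_mtx_inj[OF mtx_mult_entries[OF s v] MN(1)] map_mtx_inj[OF mtx_mult_entries[OF v s] MN(2)] by simp
  qed
  show ?thesis
    unfolding pq map_sized_def prod.case mvn_equiv.simps
  proof
    assume "\<exists>w\<in>mtx_carrier A' n m. mtx_mult A' n (mtx_star A' w) w = map_mtx M \<and> mtx_mult A' m w (mtx_star A' w) = map_mtx N"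
    then obtain w where w: "w \<in> mtx_carrier A' n m" "mtx_mult A' n (mtx_star A' w) w = map_mtx M"
      "mtx_mult A' m w (mtx_star A' w) = map_mtx N" by blast
    obtain v where v: "entries_in v" "map_mtx v = w" using map_mtx_preimage[OF target_entries[OF w(1)]] .
    then show "\<exists>v\<in>mtx_carrier A n m. mtx_mult A n (mtx_star A v) v = M \<and> mtx_mult A m v (mtx_star A v) = N"
      using eq[OF v(1)] map_mtx_carrier[OF v(1)] w by blast
  next
    assume "\<exists>v\<in>mtx_carrier A n m. mtx_mult A n (mtx_star A v) v = M \<and> mtx_mult A m v (mtx_star A v) = N"
    then obtain v where v: "v \<in> mtx_carrier A n m" "mtx_mult A n (mtx_star A v) v = M \<and> mtx_mult A m v (mtx_star A v) = N" by blast
    have "entries_in v" using mtx_carrier_entries v(1) .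
    then show "\<exists>w\<in>mtx_carrier A' n m. mtx_mult A' n (mtx_star A' w) w = map_mtx M \<and> mtx_mult A' m w (mtx_star A' w) = map_mtx N"
      using eq map_mtx_carrier v by blast
  qed
qed

theorem K0_iso: "K0 A \<cong> K0 A'"
  unfolding K0_def
proof (rule quot_monoid_iso)
  let ?h = "map_prod map_sized map_sized"
  note pe = projections_entries and be = block_sum_entries
  show "bij_betw ?h (carrier (K0_pairs A)) (carrier (K0_pairs A'))"
  proof -
    have "bij_betw map_sized (mtx_projections A) (mtx_projections A')"
      unfolding bij_betw_def
    proof
      show "inj_on map_sized (mtx_projections A)" by (rule inj_onI) (use map_sized_inj pe in blast)
      show "map_sized ` mtx_projections A = mtx_projections A'"
      proof
        show "map_sized ` mtx_projections A \<subseteq> mtx_projections A'" using map_sized_projections pe by blast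
        show "mtx_projections A' \<subseteq> map_sized ` mtx_projections A" using projections_preimage by blast
      qed
    qed
    then show ?thesis unfolding K0_pairs_def using bij_betw_map_prod by (metis partial_object.select_convs(1))
  qed
  show "K0_rel A \<subseteq> carrier (K0_pairs A) \<times> carrier (K0_pairs A)"
    "K0_rel A' \<subseteq> carrier (K0_pairs A') \<times> carrier (K0_pairs A')"
    unfolding K0_rel_def K0_pairs_def by auto
  fix x y assume xy: "x \<in> carrier (K0_pairs A)" "y \<in> carrier (K0_pairs A)"
  obtain p q p' q' where x: "x = (p, q)" and y: "y = (p', q')" by (cases x; cases y)
  have P: "p \<in> mtx_projections A" "q \<in> mtx_projections A" "p' \<in> mtx_projections A" "q' \<in> mtx_projections A"
    using xy x y unfolding K0_pairs_def by auto
  note E = pe[OF P(1)] pe[OF P(2)] pe[OF P(3)] pe[OF P(4)]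
  have P': "map_sized p \<in> mtx_projections A'" "map_sized q \<in> mtx_projections A'"
    "map_sized p' \<in> mtx_projections A'" "map_sized q' \<in> mtx_projections A'"
    using P E map_sized_projections by auto
  have mvn: "mvn_equiv A' (block_sum A' (block_sum A' (map_sized p) (map_sized q')) (map_sized r))
        (block_sum A' (block_sum A' (map_sized p') (map_sized q)) (map_sized r)) \<longleftrightarrow>
      mvn_equiv A (block_sum A (block_sum A p q') r) (block_sum A (block_sum A p' q) r)"
    if "r \<in> mtx_projections A" for r
    unfolding map_sized_block_sum[symmetric] by (intro map_sized_mvn be E pe that)
  have "(\<exists>r\<in>mtx_projections A'. mvn_equiv A' (block_sum A' (block_sum A' (map_sized p) (map_sized q')) r)
        (block_sum A' (block_sum A' (map_sized p') (map_sized q)) r)) \<longleftrightarrow>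
      (\<exists>r\<in>mtx_projections A. mvn_equiv A (block_sum A (block_sum A p q') r) (block_sum A (block_sum A p' q) r))"
    using mvn projections_preimage map_sized_projections pe by metis
  then show "(?h x, ?h y) \<in> K0_rel A' \<longleftrightarrow> (x, y) \<in> K0_rel A"
    unfolding x y K0_rel_def using P P' by simp
  show "?h (x \<otimes>\<^bsub>K0_pairs A\<^esub> y) = ?h x \<otimes>\<^bsub>K0_pairs A'\<^esub> ?h y"
    unfolding x y K0_pairs_def by (simp add: map_sized_block_sum)
  show "?h x \<otimes>\<^bsub>K0_pairs A'\<^esub> ?h y \<in> carrier (K0_pairs A') \<longleftrightarrow> x \<otimes>\<^bsub>K0_pairs A\<^esub> y \<in> carrier (K0_pairs A)"
    unfolding x y K0_pairs_def
    using map_sized_projections[OF be[OF E(1,3)]] map_sized_projections[OF be[OF E(2,4)]]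
    by (simp add: map_sized_block_sum)
qed

lemma map_sized_homotopic:
  assumes "unitary_homotopic A p q"
  shows "unitary_homotopic A' (map_sized p) (map_sized q)"
proof -
  obtain n \<gamma> where \<gamma>: "\<And>t. t \<in> {0..1} \<Longrightarrow> (n, \<gamma> t) \<in> mtx_unitaries A" "mtx_path_continuous A \<gamma>"
    "p = (n, \<gamma> 0)" "q = (n, \<gamma> 1)"
    using assms unfolding unitary_homotopic_def by blast
  have E: "entries_in (\<gamma> t)" if "t \<in> {0..1}" for t using unitaries_entries[OF \<gamma>(1)[OF that]] by simp
  have "(n, map_mtx (\<gamma> t)) \<in> mtx_unitaries A'" if "t \<in> {0..1}" for t
    using map_sized_unitaries[of "(n, \<gamma> t)"] \<gamma>(1)[OF that] E[OF that] by (simp add: map_sized_def)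
  moreover have "mtx_path_continuous A' (\<lambda>t. map_mtx (\<gamma> t))"
    unfolding mtx_path_continuous_def
  proof (intro allI ballI)
    fix i j t assume t: "t \<in> {0..1::real}"
    have lim: "((\<lambda>s. cnorm A (\<gamma> s i j \<ominus>\<^bsub>A\<^esub> \<gamma> t i j)) \<longlongrightarrow> 0) (at t within {0..1})"
      using \<gamma>(2) t unfolding mtx_path_continuous_def by blast
    have eq: "cnorm A' (map_mtx (\<gamma> s) i j \<ominus>\<^bsub>A'\<^esub> map_mtx (\<gamma> t) i j) = cnorm A (\<gamma> s i j \<ominus>\<^bsub>A\<^esub> \<gamma> t i j)"
      if "s \<in> {0..1}" for s
    proof -
      have c: "\<gamma> s i j \<in> carrier A" "\<gamma> t i j \<in> carrier A" using E[OF that] E[OF t] unfolding entries_in_def by auto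
      then show ?thesis unfolding map_mtx_def using F_minus[OF c] F_norm[of "\<gamma> s i j \<ominus>\<^bsub>A\<^esub> \<gamma> t i j"] by simp
    qed
    have "\<forall>\<^sub>F s in at t within {0..1}. cnorm A (\<gamma> s i j \<ominus>\<^bsub>A\<^esub> \<gamma> t i j) =
        cnorm A' (map_mtx (\<gamma> s) i j \<ominus>\<^bsub>A'\<^esub> map_mtx (\<gamma> t) i j)"
      unfolding eventually_at_topological using eq by (intro exI[of _ UNIV]) auto
    then show "((\<lambda>s. cnorm A' (map_mtx (\<gamma> s) i j \<ominus>\<^bsub>A'\<^esub> map_mtx (\<gamma> t) i j)) \<longlongrightarrow> 0) (at t within {0..1})"
      by (rule Lim_transform_eventually[OF lim])
  qed
  ultimately show ?thesis
    unfolding unitary_homotopic_def \<gamma>(3,4) map_sized_def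
    by (intro exI[of _ n] exI[of _ "\<lambda>t. map_mtx (\<gamma> t)"]) simp
qed

end

context cstar_alg_iso
begin

lemma map_sized_inverse:
  assumes "entries_in (snd p)"
  shows "cstar_alg_iso.map_sized F_inv (map_sized p) = p"
proof -
  interpret I: cstar_alg_iso A' A F_inv by (rule inverse_iso)
  show ?thesis
    using assms F_inv(1) unfolding I.map_sized_def map_sized_def I.map_mtx_def map_mtx_def entries_in_def
    by (cases p) simp
qed

lemma map_sized_homotopic_iff:
  assumes "entries_in (snd p)" "entries_in (snd q)"
  shows "unitary_homotopic A' (map_sized p) (map_sized q) \<longleftrightarrow> unitary_homotopic A p q"
proof
  interpret I: cstar_alg_iso A' A F_inv by (rule inverse_iso)
  assume "unitary_homotopic A' (map_sized p) (map_sized q)"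
  then have "unitary_homotopic A (I.map_sized (map_sized p)) (I.map_sized (map_sized q))"
    by (rule I.map_sized_homotopic)
  then show "unitary_homotopic A p q" using map_sized_inverse assms by simp
qed (rule map_sized_homotopic)

theorem K1_iso: "K1 A \<cong> K1 A'"
  unfolding K1_def
proof (rule quot_monoid_iso)
  note ue = unitaries_entries and be = block_sum_entries
  show "bij_betw map_sized (carrier (unitary_monoid A)) (carrier (unitary_monoid A'))"
    unfolding bij_betw_def unitary_monoid_def partial_object.select_convs
  proof
    show "inj_on map_sized (mtx_unitaries A)" by (rule inj_onI) (use map_sized_inj ue in blast)
    show "map_sized ` mtx_unitaries A = mtx_unitaries A'"
    proof
      show "map_sized ` mtx_unitaries A \<subseteq> mtx_unitaries A'" using map_sized_unitaries ue by blast
      show "mtx_unitaries A' \<subseteq> map_sized ` mtx_unitaries A" using unitaries_preimage by blast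
    qed
  qed
  show "K1_rel A \<subseteq> carrier (unitary_monoid A) \<times> carrier (unitary_monoid A)"
    "K1_rel A' \<subseteq> carrier (unitary_monoid A') \<times> carrier (unitary_monoid A')"
    unfolding K1_rel_def unitary_monoid_def by auto
  fix u v assume "u \<in> carrier (unitary_monoid A)" "v \<in> carrier (unitary_monoid A)"
  then have uv: "u \<in> mtx_unitaries A" "v \<in> mtx_unitaries A" unfolding unitary_monoid_def by auto
  note E = ue[OF uv(1)] ue[OF uv(2)]
  have uv': "map_sized u \<in> mtx_unitaries A'" "map_sized v \<in> mtx_unitaries A'"
    using uv E map_sized_unitaries by auto
  have "unitary_homotopic A' (block_sum A' (map_sized u) (k, mtx_one A' k)) (block_sum A' (map_sized v) (l, mtx_one A' l)) \<longleftrightarrow>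
      unitary_homotopic A (block_sum A u (k, mtx_one A k)) (block_sum A v (l, mtx_one A l))" for k l
  proof -
    have one: "(k, mtx_one A' k) = map_sized (k, mtx_one A k)" for k unfolding map_sized_def by (simp add: map_mtx_one)
    have oe: "entries_in (snd (k, mtx_one A k))" for k using mtx_one_entries by simp
    show ?thesis
      unfolding one map_sized_block_sum[symmetric] by (rule map_sized_homotopic_iff[OF be[OF E(1) oe] be[OF E(2) oe]])
  qed
  then show "(map_sized u, map_sized v) \<in> K1_rel A' \<longleftrightarrow> (u, v) \<in> K1_rel A"
    unfolding K1_rel_def using uv uv' by simp
  show "map_sized (u \<otimes>\<^bsub>unitary_monoid A\<^esub> v) = map_sized u \<otimes>\<^bsub>unitary_monoid A'\<^esub> map_sized v"
    unfolding unitary_monoid_def by (simp add: map_sized_block_sum)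
  show "map_sized u \<otimes>\<^bsub>unitary_monoid A'\<^esub> map_sized v \<in> carrier (unitary_monoid A') \<longleftrightarrow>
      u \<otimes>\<^bsub>unitary_monoid A\<^esub> v \<in> carrier (unitary_monoid A)"
    unfolding unitary_monoid_def using map_sized_unitaries[OF be[OF E]] by (simp add: map_sized_block_sum)
qed

end

section \<open>The isomorphism of graph algebras\<close>

lemma graph_seminorm_star:
  assumes "finite_graph C"
  shows "star_seminorm C (univ_norm C)"
  using finite_graph.univ_norm_seminorm[OF assms] unfolding graph_seminorm_def by blast

text \<open>A *-homomorphism of the dense *-subalgebras that is isometric and, up to elements of norm zero,
  surjective and unital. It extends to an isomorphism of the completions.\<close>

definition universal_iso ::
  "('a, 'k::finite) kgraph \<Rightarrow> ('b, 'l::finite) kgraph \<Rightarrow> ('a star_poly \<Rightarrow> 'b star_poly) \<Rightarrow> bool" where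
  "universal_iso C C' F \<longleftrightarrow>
    (\<forall>x y. F (x + y) = F x + F y \<and> F (x * y) = F x * F y) \<and> (\<forall>x. F (poly_star x) = poly_star (F x)) \<and>
    (\<forall>x\<in>star_polys C. F x \<in> star_polys C' \<and> univ_norm C' (F x) = univ_norm C x) \<and>
    (\<forall>y\<in>star_polys C'. \<exists>x\<in>star_polys C. univ_norm C' (F x - y) = 0) \<and>
    univ_norm C' (F (\<Sum>e\<in>ids C. gen e) - (\<Sum>e\<in>ids C'. gen e)) = 0"

context path_conj
begin

text \<open>The operator of \<open>h\<close> is sent to that of \<open>\<phi> \<circ> h \<circ> \<psi>\<close>. Decomposing the latter and applying the
  homomorphism of \<open>\<psi>\<close> to the pieces yields the operators of pieces of \<open>\<psi> \<circ> (\<phi> \<circ> h \<circ> \<psi>) \<circ> \<phi> = h\<close>.\<close>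

lemma hom_spectral_inverse:
  assumes "S.bisection U h"
  shows "star_seminorm.eqv C (univ_norm C) (free_hom (path_conj.image_gen C' C \<psi> \<phi>) (transported U h)) (S.spectral_op U h)"
proof -
  interpret R: path_conj C' C \<psi> \<phi> by (rule swapped)
  let ?k = "\<phi> \<circ> h \<circ> \<psi>"
  obtain P where P: "T.represents P (\<phi> ` U) ?k" "transported U h = T.op_sum P"
    unfolding transported_def using T.spectral_op_rep[OF \<phi>(5)[OF assms]] .
  note PD = T.representsD[OF P(1)]
  have bP: "T.bisection (T.cyl b) ?k" if "(a, b) \<in> P" for a b using T.bisection_acts[OF PD(2)[OF that]] .
  have unit: "R.T.eqv (R.image_gen a * poly_star (R.image_gen b)) (R.transported (T.cyl b) ?k)" if ab: "(a, b) \<in> P" for a b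
  proof -
    note act = T.actsD[OF PD(2)[OF ab]]
    note m = R.image_gen_adjoint_mult[OF act(1-3)]
    have "R.T.eqv (R.transported (T.cyl b) (T.shift a \<circ> inv_into (T.cyl (src C' b)) (T.shift b))) (R.transported (T.cyl b) ?k)"
    proof (rule R.transported_cong[OF m(1)])
      fix x assume x: "x \<in> T.cyl b"
      obtain y where y: "y \<in> T.cyl (src C' b)" "x = T.shift b y" using T.cyl_shift[OF x] .
      show "(T.shift a \<circ> inv_into (T.cyl (src C' b)) (T.shift b)) x = ?k x"
        using R.unshift_shift[OF act(2) y(1)] act(4)[OF y(1)] y(2) by simp
    qed
    then show ?thesis by (rule R.T.eqv_trans[OF m(2)])
  qed
  have "R.hom (transported U h) = (\<Sum>(a, b)\<in>P. R.image_gen a * poly_star (R.image_gen b))"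
    unfolding P(2) T.op_sum_def T.matrix_unit_def
    by (simp add: free_hom_sum case_prod_unfold free_hom_mult free_hom_star free_hom_gen)
  also have "R.T.eqv (\<Sum>(a, b)\<in>P. R.image_gen a * poly_star (R.image_gen b)) (\<Sum>z\<in>P. R.transported (T.cyl (snd z)) ?k)"
  proof (rule R.T.eqv_sum)
    fix z assume "z \<in> P"
    then show "R.T.eqv (case z of (a, b) \<Rightarrow> R.image_gen a * poly_star (R.image_gen b)) (R.transported (T.cyl (snd z)) ?k)"
      using unit by (cases z) simp
  qed
  also have "R.T.eqv (\<Sum>z\<in>P. R.transported (T.cyl (snd z)) ?k) (R.transported (\<Union>z\<in>P. T.cyl (snd z)) ?k)"
  proof (rule R.transported_UN[OF PD(1)])
    show "T.bisection (T.cyl (snd z)) ?k" if "z \<in> P" for z using bP[of "fst z" "snd z"] that by simp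
    show "T.cyl (snd z) \<inter> T.cyl (snd w) = {}" if zw: "z \<in> P" "w \<in> P" "z \<noteq> w" for z w
      using PD(5)[of "fst z" "snd z" "fst w" "snd w"] zw by (auto simp: prod_eq_iff)
  qed
  also have "(\<Union>z\<in>P. T.cyl (snd z)) = \<phi> ` U"
  proof
    show "(\<Union>z\<in>P. T.cyl (snd z)) \<subseteq> \<phi> ` U" by (rule UN_least) (rule PD(3)[of "fst z" "snd z" for z], simp)
    show "\<phi> ` U \<subseteq> (\<Union>z\<in>P. T.cyl (snd z))"
    proof
      fix x assume "x \<in> \<phi> ` U"
      then obtain a b where "(a, b) \<in> P" "x \<in> T.cyl b" using PD(4) by blast
      then show "x \<in> (\<Union>z\<in>P. T.cyl (snd z))" by (intro UN_I[of "(a, b)"]) simp_all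
    qed
  qed
  also have "R.T.eqv (R.transported (\<phi> ` U) ?k) (S.spectral_op U h)"
  proof -
    note U = bisection_paths[OF assms]
    have "\<psi> ` \<phi> ` U = (\<lambda>x. x) ` U" unfolding image_image by (rule image_cong) (use \<phi>(2) U(1) in auto)
    then have img: "\<psi> ` \<phi> ` U = U" by simp
    have "S.bisection (\<psi> ` \<phi> ` U) (\<psi> \<circ> ?k \<circ> \<phi>)" by (rule R.\<phi>(5)[OF \<phi>(5)[OF assms]])
    then have "S.bisection U (\<psi> \<circ> ?k \<circ> \<phi>)" by (simp only: img)
    then have "R.T.eqv (S.spectral_op U (\<psi> \<circ> ?k \<circ> \<phi>)) (S.spectral_op U h)"
      by (rule R.T.spectral_op_cong) (use \<phi>(2) U in auto)
    then show ?thesis unfolding R.transported_def img .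
  qed
  finally show ?thesis .
qed

lemma hom_inverse:
  assumes "x \<in> star_polys C"
  shows "star_seminorm.eqv C (univ_norm C) (free_hom (path_conj.image_gen C' C \<psi> \<phi>) (hom x)) x"
proof -
  interpret R: path_conj C' C \<psi> \<phi> by (rule swapped)
  have on_gen: "R.T.eqv (R.hom (hom (gen a))) (gen a)" if a: "a \<in> arr C" for a
    unfolding free_hom_gen image_gen_def
    by (rule R.T.eqv_trans[OF hom_spectral_inverse[OF S.bisection_shift[OF a]] R.T.spectral_op_gen[OF a]])
  show ?thesis
    using assms
  proof (induction x rule: star_polys_induct)
    case (gen a)
    then show ?case by (rule on_gen)
  next
    case (star a)
    then show ?case unfolding free_hom_star by (rule R.T.eqv_star[OF on_gen])
  next
    case (mult f g)
    show ?case unfolding free_hom_mult by (rule R.T.eqv_mult[OF mult(3,4)])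
  next
    case (add f g)
    show ?case unfolding free_hom_add by (rule R.T.eqv_add[OF add(3,4)])
  next
    case (scale c f)
    show ?case unfolding free_hom_scale by (rule R.T.eqv_scale[OF scale(2)])
  next
    case zero
    show ?case unfolding free_hom_zero by (rule R.T.eqv_refl[OF R.T.closed(1)])
  qed
qed

text \<open>The homomorphisms of \<open>\<phi>\<close> and \<open>\<psi>\<close> are contractive and inverse to each other up to norm zero.\<close>

theorem hom_universal_iso: "universal_iso C C' hom"
  unfolding universal_iso_def
proof (intro conjI allI ballI)
  interpret R: path_conj C' C \<psi> \<phi> by (rule swapped)
  show "hom (x + y) = hom x + hom y" "hom (x * y) = hom x * hom y" "hom (poly_star x) = poly_star (hom x)" for x y
    by (simp_all add: free_hom_add free_hom_mult free_hom_star)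
  show "hom x \<in> star_polys C'" if "x \<in> star_polys C" for x using hom_closed[OF that] .
  show "univ_norm C' (hom x) = univ_norm C x" if x: "x \<in> star_polys C" for x
  proof (rule antisym[OF hom_contractive[OF x]])
    have "univ_norm C x = univ_norm C (R.hom (hom x))" using R.T.eqv_p[OF hom_inverse[OF x]] by simp
    also have "\<dots> \<le> univ_norm C' (hom x)" by (rule R.hom_contractive[OF hom_closed[OF x]])
    finally show "univ_norm C x \<le> univ_norm C' (hom x)" .
  qed
  show "\<exists>x\<in>star_polys C. univ_norm C' (hom x - y) = 0" if y: "y \<in> star_polys C'" for y
  proof
    show "R.hom y \<in> star_polys C" by (rule R.hom_closed[OF y])
    show "univ_norm C' (hom (R.hom y) - y) = 0" using R.hom_inverse[OF y] unfolding T.eqv_def by blast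
  qed
  show "univ_norm C' (hom (\<Sum>e\<in>ids C. gen e) - (\<Sum>e\<in>ids C'. gen e)) = 0"
    using hom_unit unfolding T.eqv_def by blast
qed

end

locale universal_algebra = finite_graph C + star_seminorm C "univ_norm C" for C :: "('a, 'k::finite) kgraph"
begin

abbreviation norm_u :: "'a star_poly \<Rightarrow> real" where
  "norm_u \<equiv> univ_norm C"

lemma cauchyD:
  assumes "f \<in> cauchy_seqs C"
  shows "f n \<in> star_polys C" "0 < \<epsilon> \<Longrightarrow> \<exists>N. \<forall>m\<ge>N. \<forall>n\<ge>N. norm_u (f m - f n) < \<epsilon>"
  using assms unfolding cauchy_seqs_def by auto

lemma cauchyI:
  assumes "\<And>n. f n \<in> star_polys C" "\<And>\<epsilon>. 0 < \<epsilon> \<Longrightarrow> \<exists>N. \<forall>m\<ge>N. \<forall>n\<ge>N. norm_u (f m - f n) < \<epsilon>"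
  shows "f \<in> cauchy_seqs C"
  using assms unfolding cauchy_seqs_def by auto

lemma cauchy_const: "x \<in> star_polys C \<Longrightarrow> (\<lambda>n. x) \<in> cauchy_seqs C"
  by (rule cauchyI) (simp_all add: p_zero)

lemma cauchy_norm_convergent:
  assumes "f \<in> cauchy_seqs C"
  shows "convergent (\<lambda>n. norm_u (f n))"
proof -
  note f = cauchyD[OF assms]
  have "Cauchy (\<lambda>n. norm_u (f n))"
  proof (rule CauchyI)
    fix \<epsilon> :: real assume "0 < \<epsilon>"
    then obtain N where N: "\<forall>m\<ge>N. \<forall>n\<ge>N. norm_u (f m - f n) < \<epsilon>" using f(2) by blast
    have le: "norm_u (f m) \<le> norm_u (f m - f n) + norm_u (f n)" for m n
      using p_add[of "f m - f n" "f n"] f(1) closed(4) by simp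
    have "\<bar>norm_u (f m) - norm_u (f n)\<bar> < \<epsilon>" if "m \<ge> N" "n \<ge> N" for m n
    proof -
      have "norm_u (f m - f n) < \<epsilon>" "norm_u (f n - f m) < \<epsilon>" using N that by auto
      then show ?thesis using le[of m n] le[of n m] by linarith
    qed
    then show "\<exists>M. \<forall>m\<ge>M. \<forall>n\<ge>M. norm (norm_u (f m) - norm_u (f n)) < \<epsilon>" by auto
  qed
  then show ?thesis by (rule Cauchy_convergent)
qed

lemma cauchy_bounded:
  assumes "f \<in> cauchy_seqs C"
  obtains M where "0 < M" "\<And>n. norm_u (f n) \<le> M"
proof -
  have "Bseq (\<lambda>n. norm_u (f n))" using cauchy_norm_convergent[OF assms] by (rule convergent_imp_Bseq)
  then obtain M where "0 < M" "\<And>n. norm (norm_u (f n)) \<le> M" unfolding Bseq_def by blast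
  then show ?thesis using that[of M] by (metis abs_le_D1 real_norm_def)
qed

lemma cauchy_add:
  assumes "f \<in> cauchy_seqs C" "g \<in> cauchy_seqs C"
  shows "(\<lambda>n. f n + g n) \<in> cauchy_seqs C"
proof (rule cauchyI)
  note f = cauchyD[OF assms(1)] and g = cauchyD[OF assms(2)]
  show "f n + g n \<in> star_polys C" for n by (intro closed f g)
  fix \<epsilon> :: real assume "0 < \<epsilon>"
  then have e: "0 < \<epsilon> / 2" by simp
  obtain N1 where N1: "\<forall>m\<ge>N1. \<forall>n\<ge>N1. norm_u (f m - f n) < \<epsilon> / 2" using f(2)[OF e] by blast
  obtain N2 where N2: "\<forall>m\<ge>N2. \<forall>n\<ge>N2. norm_u (g m - g n) < \<epsilon> / 2" using g(2)[OF e] by blast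
  have "norm_u ((f m + g m) - (f n + g n)) < \<epsilon>" if "m \<ge> max N1 N2" "n \<ge> max N1 N2" for m n
  proof -
    have "norm_u ((f m - f n) + (g m - g n)) \<le> norm_u (f m - f n) + norm_u (g m - g n)"
      by (intro p_add closed f g)
    moreover have "norm_u (f m - f n) < \<epsilon> / 2" "norm_u (g m - g n) < \<epsilon> / 2" using N1 N2 that by auto
    moreover have eq: "(f m + g m) - (f n + g n) = (f m - f n) + (g m - g n)" by (simp add: algebra_simps)
    ultimately show ?thesis unfolding eq by linarith
  qed
  then show "\<exists>N. \<forall>m\<ge>N. \<forall>n\<ge>N. norm_u ((f m + g m) - (f n + g n)) < \<epsilon>" by blast
qed

lemma cauchy_star:
  assumes "f \<in> cauchy_seqs C"
  shows "(\<lambda>n. poly_star (f n)) \<in> cauchy_seqs C"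
proof (rule cauchyI)
  note f = cauchyD[OF assms]
  show "poly_star (f n) \<in> star_polys C" for n by (intro closed f)
  have "norm_u (poly_star (f m) - poly_star (f n)) = norm_u (f m - f n)" for m n
    using p_star[OF closed(4)[OF f(1) f(1)], of m n] by (simp add: poly_star_simps)
  then show "\<exists>N. \<forall>m\<ge>N. \<forall>n\<ge>N. norm_u (poly_star (f m) - poly_star (f n)) < \<epsilon>" if "0 < \<epsilon>" for \<epsilon>
    using f(2)[OF that] by simp
qed

lemma cauchy_uminus:
  assumes "f \<in> cauchy_seqs C"
  shows "(\<lambda>n. - f n) \<in> cauchy_seqs C"
proof (rule cauchyI)
  note f = cauchyD[OF assms]
  show "- f n \<in> star_polys C" for n by (intro closed f)
  have "norm_u (- f m - - f n) = norm_u (f m - f n)" for m n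
    using p_diff_commute[OF f(1) f(1), of n m] by simp
  then show "\<exists>N. \<forall>m\<ge>N. \<forall>n\<ge>N. norm_u (- f m - - f n) < \<epsilon>" if "0 < \<epsilon>" for \<epsilon>
    using f(2)[OF that] by simp
qed

text \<open>\<open>x y - x' y' = (x - x') y + x' (y - y')\<close>.\<close>

lemma mult_diff_bound:
  assumes "x \<in> star_polys C" "y \<in> star_polys C" "x' \<in> star_polys C" "y' \<in> star_polys C"
    and "norm_u y \<le> M" "norm_u x' \<le> M'"
  shows "norm_u (x * y - x' * y') \<le> norm_u (x - x') * M + M' * norm_u (y - y')"
proof -
  have "x * y - x' * y' = (x - x') * y + x' * (y - y')" by (simp add: algebra_simps)
  then have "norm_u (x * y - x' * y') \<le> norm_u ((x - x') * y) + norm_u (x' * (y - y'))"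
    using p_add[OF closed(8)[OF closed(4)[OF assms(1,3)] assms(2)] closed(8)[OF assms(3) closed(4)[OF assms(2,4)]]] by simp
  also have "\<dots> \<le> norm_u (x - x') * norm_u y + norm_u x' * norm_u (y - y')"
    by (intro add_mono p_mult closed assms)
  also have "\<dots> \<le> norm_u (x - x') * M + M' * norm_u (y - y')"
    by (intro add_mono mult_left_mono mult_right_mono assms p_nonneg closed)
  finally show ?thesis .
qed

lemma cauchy_mult:
  assumes "f \<in> cauchy_seqs C" "g \<in> cauchy_seqs C"
  shows "(\<lambda>n. f n * g n) \<in> cauchy_seqs C"
proof (rule cauchyI)
  note f = cauchyD[OF assms(1)] and g = cauchyD[OF assms(2)]
  show "f n * g n \<in> star_polys C" for n by (intro closed f g)
  obtain M where M: "0 < M" "\<And>n. norm_u (f n) \<le> M" using cauchy_bounded[OF assms(1)] by metis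
  obtain M' where M': "0 < M'" "\<And>n. norm_u (g n) \<le> M'" using cauchy_bounded[OF assms(2)] by metis
  fix \<epsilon> :: real assume "0 < \<epsilon>"
  then have e: "0 < \<epsilon> / (2 * M')" "0 < \<epsilon> / (2 * M)" using M M' by auto
  obtain N1 where N1: "\<forall>m\<ge>N1. \<forall>n\<ge>N1. norm_u (f m - f n) < \<epsilon> / (2 * M')" using f(2)[OF e(1)] by blast
  obtain N2 where N2: "\<forall>m\<ge>N2. \<forall>n\<ge>N2. norm_u (g m - g n) < \<epsilon> / (2 * M)" using g(2)[OF e(2)] by blast
  have "norm_u (f m * g m - f n * g n) < \<epsilon>" if mn: "m \<ge> max N1 N2" "n \<ge> max N1 N2" for m n
  proof -
    have "norm_u (f m * g m - f n * g n) \<le> norm_u (f m - f n) * M' + M * norm_u (g m - g n)"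
      by (rule mult_diff_bound) (use f g M M' in auto)
    moreover have "norm_u (f m - f n) < \<epsilon> / (2 * M')" "norm_u (g m - g n) < \<epsilon> / (2 * M)" using N1 N2 mn by auto
    then have "norm_u (f m - f n) * M' < \<epsilon> / 2" "M * norm_u (g m - g n) < \<epsilon> / 2"
      using M(1) M'(1) by (simp_all add: field_simps)
    ultimately show ?thesis by simp
  qed
  then show "\<exists>N. \<forall>m\<ge>N. \<forall>n\<ge>N. norm_u (f m * g m - f n * g n) < \<epsilon>" by blast
qed

lemma null_iff: "(f, g) \<in> null_rel C \<longleftrightarrow> f \<in> cauchy_seqs C \<and> g \<in> cauchy_seqs C \<and> (\<lambda>n. norm_u (f n - g n)) \<longlonglongrightarrow> 0"
  unfolding null_rel_def by simp

lemma null_dominated: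
  assumes "f \<in> cauchy_seqs C" "g \<in> cauchy_seqs C" "\<And>n. norm_u (f n - g n) \<le> h n" "h \<longlonglongrightarrow> 0"
  shows "(f, g) \<in> null_rel C"
  unfolding null_iff
proof (intro conjI assms(1,2))
  have "0 \<le> norm_u (f n - g n)" for n by (intro p_nonneg closed cauchyD assms)
  then show "(\<lambda>n. norm_u (f n - g n)) \<longlonglongrightarrow> 0"
    by (intro tendsto_sandwich[OF _ _ tendsto_const assms(4)] always_eventually allI assms(3))
qed

lemma null_eqv: "(\<And>n. eqv (f n) (g n)) \<Longrightarrow> f \<in> cauchy_seqs C \<Longrightarrow> g \<in> cauchy_seqs C \<Longrightarrow> (f, g) \<in> null_rel C"
  unfolding null_iff eqv_def by simp

lemma null_equiv: "equiv (cauchy_seqs C) (null_rel C)"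
proof (rule equivI)
  show "null_rel C \<subseteq> cauchy_seqs C \<times> cauchy_seqs C" unfolding null_rel_def by blast
  show "refl_on (cauchy_seqs C) (null_rel C)"
    unfolding refl_on_def using null_eqv eqv_refl cauchyD(1) by blast
  show "sym (null_rel C)"
  proof (rule symI)
    fix f g assume *: "(f, g) \<in> null_rel C"
    then have "norm_u (g n - f n) = norm_u (f n - g n)" for n
      using p_diff_commute cauchyD(1) unfolding null_iff by metis
    then show "(g, f) \<in> null_rel C" using * unfolding null_iff by simp
  qed
  show "trans (null_rel C)"
  proof (rule transI)
    fix f g h assume 1: "(f, g) \<in> null_rel C" and 2: "(g, h) \<in> null_rel C"
    have c: "f \<in> cauchy_seqs C" "g \<in> cauchy_seqs C" "h \<in> cauchy_seqs C" using 1 2 unfolding null_iff by auto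
    have le: "norm_u (f n - h n) \<le> norm_u (f n - g n) + norm_u (g n - h n)" for n
      using p_add[of "f n - g n" "g n - h n"] closed(4) c[THEN cauchyD(1)] by simp
    have "(\<lambda>n. norm_u (f n - g n) + norm_u (g n - h n)) \<longlonglongrightarrow> 0 + 0"
      using 1 2 unfolding null_iff by (intro tendsto_add) auto
    then show "(f, h) \<in> null_rel C" using null_dominated[OF c(1,3) le] by simp
  qed
qed

definition cls :: "(nat \<Rightarrow> 'a star_poly) \<Rightarrow> (nat \<Rightarrow> 'a star_poly) set" where
  "cls f = null_rel C `` {f}"

lemma cls_eq_iff: "f \<in> cauchy_seqs C \<Longrightarrow> g \<in> cauchy_seqs C \<Longrightarrow> cls f = cls g \<longleftrightarrow> (f, g) \<in> null_rel C"
  unfolding cls_def using eq_equiv_class_iff[OF null_equiv] .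

lemma mem_cls: "g \<in> cls f \<longleftrightarrow> (f, g) \<in> null_rel C"
  unfolding cls_def by simp

lemma cls_self: "f \<in> cauchy_seqs C \<Longrightarrow> f \<in> cls f"
  unfolding cls_def using equiv_class_self[OF null_equiv] .

lemma carrier_cls: "X \<in> carrier (graph_algebra C) \<longleftrightarrow> (\<exists>f\<in>cauchy_seqs C. X = cls f)"
  unfolding graph_algebra_def cls_def quotient_def by simp

lemma cls_in: "f \<in> cauchy_seqs C \<Longrightarrow> cls f \<in> carrier (graph_algebra C)"
  unfolding carrier_cls by blast

lemma null_add:
  assumes "(f, f') \<in> null_rel C" "(g, g') \<in> null_rel C"
  shows "((\<lambda>n. f n + g n), (\<lambda>n. f' n + g' n)) \<in> null_rel C"
proof -
  have c: "f \<in> cauchy_seqs C" "f' \<in> cauchy_seqs C" "g \<in> cauchy_seqs C" "g' \<in> cauchy_seqs C"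
    using assms unfolding null_iff by auto
  have eq: "(f n + g n) - (f' n + g' n) = (f n - f' n) + (g n - g' n)" for n by (simp add: algebra_simps)
  have le: "norm_u ((f n + g n) - (f' n + g' n)) \<le> norm_u (f n - f' n) + norm_u (g n - g' n)" for n
    unfolding eq by (intro p_add closed cauchyD c)
  have "(\<lambda>n. norm_u (f n - f' n) + norm_u (g n - g' n)) \<longlonglongrightarrow> 0 + 0"
    using assms unfolding null_iff by (intro tendsto_add) auto
  then show ?thesis using null_dominated[OF cauchy_add[OF c(1,3)] cauchy_add[OF c(2,4)] le] by simp
qed

lemma null_mult:
  assumes "(f, f') \<in> null_rel C" "(g, g') \<in> null_rel C"
  shows "((\<lambda>n. f n * g n), (\<lambda>n. f' n * g' n)) \<in> null_rel C"
proof -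
  have c: "f \<in> cauchy_seqs C" "f' \<in> cauchy_seqs C" "g \<in> cauchy_seqs C" "g' \<in> cauchy_seqs C"
    using assms unfolding null_iff by auto
  obtain M where M: "0 < M" "\<And>n. norm_u (g n) \<le> M" using cauchy_bounded[OF c(3)] by metis
  obtain M' where M': "0 < M'" "\<And>n. norm_u (f' n) \<le> M'" using cauchy_bounded[OF c(2)] by metis
  have le: "norm_u (f n * g n - f' n * g' n) \<le> norm_u (f n - f' n) * M + M' * norm_u (g n - g' n)" for n
    by (intro mult_diff_bound cauchyD c M M')
  have "(\<lambda>n. norm_u (f n - f' n) * M + M' * norm_u (g n - g' n)) \<longlonglongrightarrow> 0 * M + M' * 0"
    using assms unfolding null_iff by (intro tendsto_add tendsto_mult tendsto_const) auto
  then show ?thesis using null_dominated[OF cauchy_mult[OF c(1,3)] cauchy_mult[OF c(2,4)] le] by simp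
qed

lemma null_star:
  assumes "(f, f') \<in> null_rel C"
  shows "((\<lambda>n. poly_star (f n)), (\<lambda>n. poly_star (f' n))) \<in> null_rel C"
proof -
  have c: "f \<in> cauchy_seqs C" "f' \<in> cauchy_seqs C" using assms unfolding null_iff by auto
  have "norm_u (poly_star (f n) - poly_star (f' n)) = norm_u (f n - f' n)" for n
    using p_star[OF closed(4)[OF cauchyD(1)[OF c(1)] cauchyD(1)[OF c(2)]], of n n] by (simp add: poly_star_simps)
  then show ?thesis using assms cauchy_star c unfolding null_iff by simp
qed

text \<open>The operations of \<open>graph_algebra\<close> are unions over representatives; if all of these give the same
  class, it is the union.\<close>

lemma cls_constant:
  assumes "f \<in> cauchy_seqs C" "\<And>f'. f' \<in> cls f \<Longrightarrow> K f' = c"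
  shows "(\<Union>f'\<in>cls f. K f') = c"
  using cls_self[OF assms(1)] assms(2) by auto

lemma cls_ops:
  assumes f: "f \<in> cauchy_seqs C" and g: "g \<in> cauchy_seqs C"
  shows "cls f \<oplus>\<^bsub>graph_algebra C\<^esub> cls g = cls (\<lambda>n. f n + g n)"
    "cls f \<otimes>\<^bsub>graph_algebra C\<^esub> cls g = cls (\<lambda>n. f n * g n)"
    "star (graph_algebra C) (cls f) = cls (\<lambda>n. poly_star (f n))"
proof -
  have add: "cls (\<lambda>n. f' n + g' n) = cls (\<lambda>n. f n + g n)"
    and mult: "cls (\<lambda>n. f' n * g' n) = cls (\<lambda>n. f n * g n)"
    if "f' \<in> cls f" "g' \<in> cls g" for f' g'
    using equiv_class_eq[OF null_equiv null_add] equiv_class_eq[OF null_equiv null_mult] that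
    unfolding mem_cls cls_def by auto
  have star: "cls (\<lambda>n. poly_star (f' n)) = cls (\<lambda>n. poly_star (f n))" if "f' \<in> cls f" for f'
    using equiv_class_eq[OF null_equiv null_star] that unfolding mem_cls cls_def by auto
  show "cls f \<oplus>\<^bsub>graph_algebra C\<^esub> cls g = cls (\<lambda>n. f n + g n)"
    unfolding graph_algebra_def ring_record_simps cls_def[symmetric]
    by (intro cls_constant f g add)
  show "cls f \<otimes>\<^bsub>graph_algebra C\<^esub> cls g = cls (\<lambda>n. f n * g n)"
    unfolding graph_algebra_def monoid.simps cls_def[symmetric]
    by (intro cls_constant f g mult)
  show "star (graph_algebra C) (cls f) = cls (\<lambda>n. poly_star (f n))"
    unfolding graph_algebra_def cstar_alg.simps cls_def[symmetric]
    by (intro cls_constant f star)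
qed

lemma unit_closed: "(\<Sum>e\<in>ids C. gen e) \<in> star_polys C"
  by (rule closed_sum) (use closed(2) ids_subset in blast)

lemma cls_consts:
  "\<zero>\<^bsub>graph_algebra C\<^esub> = cls (\<lambda>n. 0)" "\<one>\<^bsub>graph_algebra C\<^esub> = cls (\<lambda>n. \<Sum>e\<in>ids C. gen e)"
  unfolding graph_algebra_def cls_def by simp_all

lemma graph_algebra_group: "abelian_group (graph_algebra C)"
proof (rule abelian_groupI)
  note z = cauchy_const[OF closed(1)]
  show "\<zero>\<^bsub>graph_algebra C\<^esub> \<in> carrier (graph_algebra C)" unfolding cls_consts by (rule cls_in[OF z])
  fix X assume "X \<in> carrier (graph_algebra C)"
  then obtain f where f: "f \<in> cauchy_seqs C" "X = cls f" unfolding carrier_cls by blast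
  show "\<zero>\<^bsub>graph_algebra C\<^esub> \<oplus>\<^bsub>graph_algebra C\<^esub> X = X" unfolding f cls_consts cls_ops[OF z f(1)] by simp
  show "\<exists>Y\<in>carrier (graph_algebra C). Y \<oplus>\<^bsub>graph_algebra C\<^esub> X = \<zero>\<^bsub>graph_algebra C\<^esub>"
    unfolding f cls_consts
    by (rule bexI[OF _ cls_in[OF cauchy_uminus[OF f(1)]]]) (simp add: cls_ops[OF cauchy_uminus[OF f(1)] f(1)])
  fix Y assume "Y \<in> carrier (graph_algebra C)"
  then obtain g where g: "g \<in> cauchy_seqs C" "Y = cls g" unfolding carrier_cls by blast
  show "X \<oplus>\<^bsub>graph_algebra C\<^esub> Y \<in> carrier (graph_algebra C)"
    unfolding f g cls_ops[OF f(1) g(1)] by (rule cls_in[OF cauchy_add[OF f(1) g(1)]])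
  show "X \<oplus>\<^bsub>graph_algebra C\<^esub> Y = Y \<oplus>\<^bsub>graph_algebra C\<^esub> X"
    unfolding f g cls_ops[OF f(1) g(1)] cls_ops[OF g(1) f(1)] by (simp add: add.commute)
  fix Z assume "Z \<in> carrier (graph_algebra C)"
  then obtain h where h: "h \<in> cauchy_seqs C" "Z = cls h" unfolding carrier_cls by blast
  show "(X \<oplus>\<^bsub>graph_algebra C\<^esub> Y) \<oplus>\<^bsub>graph_algebra C\<^esub> Z = X \<oplus>\<^bsub>graph_algebra C\<^esub> (Y \<oplus>\<^bsub>graph_algebra C\<^esub> Z)"
    unfolding f g h
    by (simp add: cls_ops f(1) g(1) h(1) cauchy_add add.assoc)
qed

lemma cnorm_cls:
  assumes "f \<in> cauchy_seqs C"
  shows "cnorm (graph_algebra C) (cls f) = lim (\<lambda>n. norm_u (f n))"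
proof -
  define g where "g = (SOME g. g \<in> cls f)"
  have "g \<in> cls f" unfolding g_def by (rule someI[where P = "\<lambda>g. g \<in> cls f", OF cls_self[OF assms]])
  then have fg: "g \<in> cauchy_seqs C" "(\<lambda>n. norm_u (f n - g n)) \<longlonglongrightarrow> 0" unfolding mem_cls null_iff by auto
  have "(\<lambda>n. norm_u (f n) - norm_u (g n)) \<longlonglongrightarrow> 0"
  proof (rule Lim_null_comparison[OF always_eventually fg(2)], rule allI)
    fix n
    note c = cauchyD(1)[OF assms, of n] cauchyD(1)[OF fg(1), of n]
    show "norm (norm_u (f n) - norm_u (g n)) \<le> norm_u (f n - g n)"
      using p_add[OF closed(4)[OF c] c(2)] p_add[OF closed(4)[OF c(2,1)] c(1)] p_diff_commute[OF c] by simp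
  qed
  moreover have "(\<lambda>n. norm_u (f n)) \<longlonglongrightarrow> lim (\<lambda>n. norm_u (f n))"
    using cauchy_norm_convergent[OF assms] by (simp add: convergent_LIMSEQ_iff)
  ultimately have "(\<lambda>n. norm_u (f n) - (norm_u (f n) - norm_u (g n))) \<longlonglongrightarrow> lim (\<lambda>n. norm_u (f n)) - 0"
    by (intro tendsto_diff)
  then have "lim (\<lambda>n. norm_u (g n)) = lim (\<lambda>n. norm_u (f n))" using limI by simp
  then show ?thesis unfolding graph_algebra_def g_def by simp
qed

end

lemma universal_algebraI:
  assumes "finite_graph C"
  shows "universal_algebra C"
  unfolding universal_algebra_def using assms graph_seminorm_star by blast

text \<open>The map is computed on representatives. It is surjective because the terms of a Cauchy sequence can
  be lifted one by one up to norm zero, and the lifts form a Cauchy sequence as the map is isometric.\<close>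

lemma universal_iso_star_alg_iso:
  assumes "finite_graph C" "finite_graph C'" and iso: "universal_iso C C' F"
  shows "cstar_alg_iso (graph_algebra C) (graph_algebra C')
    (\<lambda>X. \<Union>f\<in>X. null_rel C' `` {\<lambda>n. F (f n)})"
proof -
  interpret S: universal_algebra C by (rule universal_algebraI) fact
  interpret T: universal_algebra C' by (rule universal_algebraI) fact
  have F: "F (x + y) = F x + F y" "F (x * y) = F x * F y" "F (poly_star x) = poly_star (F x)" for x y
    using iso unfolding universal_iso_def by auto
  have F_sp: "F x \<in> star_polys C'" "univ_norm C' (F x) = univ_norm C x" if "x \<in> star_polys C" for x
    using iso that unfolding universal_iso_def by auto
  have F_surj: "\<exists>x\<in>star_polys C. univ_norm C' (F x - y) = 0" if "y \<in> star_polys C'" for y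
    using iso that unfolding universal_iso_def by auto
  have F_diff: "F (x - y) = F x - F y" for x y using F(1)[of "x - y" y] by simp
  have F_dist: "univ_norm C' (F x - F y) = univ_norm C (x - y)" if "x \<in> star_polys C" "y \<in> star_polys C" for x y
    unfolding F_diff[symmetric] by (rule F_sp(2)[OF S.closed(4)[OF that]])
  have cauchy: "(\<lambda>n. F (f n)) \<in> cauchy_seqs C'" if f: "f \<in> cauchy_seqs C" for f
    by (rule T.cauchyI) (use F_sp(1) F_dist S.cauchyD[OF f] in simp_all)
  have null: "((\<lambda>n. F (f n)), (\<lambda>n. F (g n))) \<in> null_rel C' \<longleftrightarrow> (f, g) \<in> null_rel C"
    if "f \<in> cauchy_seqs C" "g \<in> cauchy_seqs C" for f g
    unfolding S.null_iff T.null_iff using cauchy that F_dist S.cauchyD(1) by simp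
  define H where "H = (\<lambda>X. \<Union>f\<in>X. null_rel C' `` {\<lambda>n. F (f n)})"
  have H: "H (S.cls f) = T.cls (\<lambda>n. F (f n))" if f: "f \<in> cauchy_seqs C" for f
    unfolding H_def
  proof (rule S.cls_constant[OF f])
    fix g assume "g \<in> S.cls f"
    then have fg: "(f, g) \<in> null_rel C" "g \<in> cauchy_seqs C" unfolding S.mem_cls S.null_iff by auto
    then have "T.cls (\<lambda>n. F (f n)) = T.cls (\<lambda>n. F (g n))" using T.cls_eq_iff cauchy f null by blast
    then show "null_rel C' `` {\<lambda>n. F (g n)} = T.cls (\<lambda>n. F (f n))" unfolding T.cls_def by simp
  qed
  note ci = S.carrier_cls
  show ?thesis
    unfolding H_def[symmetric]
  proof (rule cstar_alg_iso.intro)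
    show "abelian_group (graph_algebra C)" "abelian_group (graph_algebra C')"
      by (rule S.graph_algebra_group, rule T.graph_algebra_group)
    show "bij_betw H (carrier (graph_algebra C)) (carrier (graph_algebra C'))"
      unfolding bij_betw_def
    proof
      show "inj_on H (carrier (graph_algebra C))"
      proof (rule inj_onI)
        fix X Y assume "X \<in> carrier (graph_algebra C)" "Y \<in> carrier (graph_algebra C)" "H X = H Y"
        then obtain f g where "f \<in> cauchy_seqs C" "X = S.cls f" "g \<in> cauchy_seqs C" "Y = S.cls g" "H X = H Y"
          unfolding ci by blast
        then show "X = Y" using H null T.cls_eq_iff cauchy S.cls_eq_iff by metis
      qed
      show "H ` carrier (graph_algebra C) = carrier (graph_algebra C')"
      proof
        show "H ` carrier (graph_algebra C) \<subseteq> carrier (graph_algebra C')"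
          using H cauchy T.cls_in by (auto simp: ci)
        show "carrier (graph_algebra C') \<subseteq> H ` carrier (graph_algebra C)"
        proof
          fix Y assume "Y \<in> carrier (graph_algebra C')"
          then obtain g where g: "g \<in> cauchy_seqs C'" "Y = T.cls g" unfolding T.carrier_cls by blast
          obtain f where f: "\<And>n. f n \<in> star_polys C" "\<And>n. univ_norm C' (F (f n) - g n) = 0"
            using F_surj[OF T.cauchyD(1)[OF g(1)]] by metis
          have eq: "T.eqv (F (f n)) (g n)" for n
            unfolding T.eqv_def using F_sp(1) f T.cauchyD(1)[OF g(1)] by blast
          have d: "univ_norm C (f m - f n) = univ_norm C' (g m - g n)" for m n
            using F_dist[OF f(1) f(1)] T.eqv_p[OF T.eqv_diff[OF eq eq]] by metis
          have fc: "f \<in> cauchy_seqs C" by (rule S.cauchyI) (use f(1) d T.cauchyD(2)[OF g(1)] in simp_all)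
          have "((\<lambda>n. F (f n)), g) \<in> null_rel C'" by (rule T.null_eqv[OF eq cauchy[OF fc] g(1)])
          then have "H (S.cls f) = Y" using H[OF fc] T.cls_eq_iff cauchy[OF fc] g by simp
          then show "Y \<in> H ` carrier (graph_algebra C)" using S.cls_in[OF fc] by blast
        qed
      qed
    qed
    note one = S.cauchy_const[OF S.unit_closed]
    show "\<one>\<^bsub>graph_algebra C\<^esub> \<in> carrier (graph_algebra C)" unfolding S.cls_consts by (rule S.cls_in[OF one])
    have "((\<lambda>n. F (\<Sum>e\<in>ids C. gen e)), (\<lambda>n. \<Sum>e\<in>ids C'. gen e)) \<in> null_rel C'"
      unfolding T.null_iff using cauchy[OF one] T.cauchy_const[OF T.unit_closed] iso unfolding universal_iso_def by simp
    then show "H \<one>\<^bsub>graph_algebra C\<^esub> = \<one>\<^bsub>graph_algebra C'\<^esub>"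
      unfolding S.cls_consts T.cls_consts H[OF one]
      using T.cls_eq_iff cauchy[OF one] T.cauchy_const[OF T.unit_closed] by simp
    fix X assume "X \<in> carrier (graph_algebra C)"
    then obtain f where f: "f \<in> cauchy_seqs C" "X = S.cls f" unfolding ci by blast
    note fc = cauchy[OF f(1)]
    show "H (star (graph_algebra C) X) = star (graph_algebra C') (H X)"
      unfolding f(2) S.cls_ops(3)[OF f(1) f(1)] H[OF f(1)] T.cls_ops(3)[OF fc fc] H[OF S.cauchy_star[OF f(1)]] F ..
    show "star (graph_algebra C) X \<in> carrier (graph_algebra C)"
      unfolding f(2) S.cls_ops(3)[OF f(1) f(1)] by (rule S.cls_in[OF S.cauchy_star[OF f(1)]])
    show "cnorm (graph_algebra C') (H X) = cnorm (graph_algebra C) X"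
      unfolding f(2) H[OF f(1)] S.cnorm_cls[OF f(1)] T.cnorm_cls[OF fc] F_sp(2)[OF S.cauchyD(1)[OF f(1)]] ..
    fix Y assume "Y \<in> carrier (graph_algebra C)"
    then obtain g where g: "g \<in> cauchy_seqs C" "Y = S.cls g" unfolding ci by blast
    note gc = cauchy[OF g(1)]
    show "H (X \<oplus>\<^bsub>graph_algebra C\<^esub> Y) = H X \<oplus>\<^bsub>graph_algebra C'\<^esub> H Y"
      unfolding f(2) g(2) S.cls_ops(1)[OF f(1) g(1)] H[OF f(1)] H[OF g(1)] T.cls_ops(1)[OF fc gc]
        H[OF S.cauchy_add[OF f(1) g(1)]] F ..
    show "H (X \<otimes>\<^bsub>graph_algebra C\<^esub> Y) = H X \<otimes>\<^bsub>graph_algebra C'\<^esub> H Y"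
      unfolding f(2) g(2) S.cls_ops(2)[OF f(1) g(1)] H[OF f(1)] H[OF g(1)] T.cls_ops(2)[OF fc gc]
        H[OF S.cauchy_mult[OF f(1) g(1)]] F ..
    show "X \<otimes>\<^bsub>graph_algebra C\<^esub> Y \<in> carrier (graph_algebra C)"
      unfolding f(2) g(2) S.cls_ops(2)[OF f(1) g(1)] by (rule S.cls_in[OF S.cauchy_mult[OF f(1) g(1)]])
  qed
qed

section \<open>The isomorphism of K-theory\<close>

lemma iso_symmetric:
  assumes "M \<cong> N" and closed: "\<And>x y. x \<in> carrier M \<Longrightarrow> y \<in> carrier M \<Longrightarrow> x \<otimes>\<^bsub>M\<^esub> y \<in> carrier M"
  shows "N \<cong> M"
proof -
  obtain h where h: "h \<in> hom M N" "bij_betw h (carrier M) (carrier N)"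
    using assms(1) unfolding is_iso_def iso_def by blast
  let ?g = "inv_into (carrier M) h"
  have g: "bij_betw ?g (carrier N) (carrier M)" by (rule bij_betw_inv_into[OF h(2)])
  have "?g (x \<otimes>\<^bsub>N\<^esub> y) = ?g x \<otimes>\<^bsub>M\<^esub> ?g y" if xy: "x \<in> carrier N" "y \<in> carrier N" for x y
  proof -
    have in_M: "?g x \<in> carrier M" "?g y \<in> carrier M" using bij_betwE[OF g] xy by auto
    have "h (?g x \<otimes>\<^bsub>M\<^esub> ?g y) = x \<otimes>\<^bsub>N\<^esub> y"
      unfolding hom_mult[OF h(1) in_M] using bij_betw_inv_into_right[OF h(2)] xy by simp
    then show ?thesis using bij_betw_inv_into_left[OF h(2) closed[OF in_M]] by simp
  qed
  then have "?g \<in> iso N M" using g bij_betwE[OF g] unfolding iso_def hom_def by auto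
  then show ?thesis unfolding is_iso_def by blast
qed

lemma minimal_graphI:
  assumes "higher_rank_graph C" "row_finite C" "aperiodic C" "cofinal_cat C"
    and "finite (ids C)" "no_sources C" "infinite (carrier (B_monoid C))"
  shows "minimal_graph C"
proof -
  interpret higher_rank_graph C by fact
  interpret aperiodic_graph C by unfold_locales fact+
  show ?thesis by unfold_locales (fact assms(4), rule infinite_B_infinite_paths[OF assms(7)])
qed

theorem corollary9p1:
  fixes C :: "('a, 'k::finite) kgraph" and C' :: "('b, 'l::finite) kgraph"
  assumes "higher_rank_graph C" "row_finite C" "aperiodic C" "cofinal_cat C"
    and "finite (ids C)" "no_sources C"
    and "countable (carrier (B_monoid C))" "infinite (carrier (B_monoid C))"
    and "higher_rank_graph C'" "row_finite C'" "aperiodic C'" "cofinal_cat C'"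
    and "finite (ids C')" "no_sources C'"
    and "countable (carrier (B_monoid C'))" "infinite (carrier (B_monoid C'))"
    and "G_group C \<cong> G_group C'"
  shows "K0 (graph_algebra C) \<cong> K0 (graph_algebra C') \<and>
         K1 (graph_algebra C) \<cong> K1 (graph_algebra C')"
proof -
  interpret S: minimal_graph C by (rule minimal_graphI) fact+
  interpret T: minimal_graph C' by (rule minimal_graphI) fact+
  have nonempty: "S.paths \<noteq> {}" "T.paths \<noteq> {}" using S.infinite_paths T.infinite_paths by auto
  have "G_group C' \<cong> T.full_group_monoid"
    by (rule iso_symmetric[OF T.G_group_iso[OF nonempty(2)]])
      (simp add: T.full_group_monoid_def T.full_group_comp)
  then have "S.full_group_monoid \<cong> T.full_group_monoid"
    by (rule iso_trans[OF iso_trans[OF S.G_group_iso[OF nonempty(1)] assms(17)]])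
  then obtain \<phi> \<psi> where "path_conjugacy C C' \<phi> \<psi>" "path_conjugacy C' C \<psi> \<phi>"
    by (rule group_iso_path_conjugacy[OF S.minimal_graph_axioms T.minimal_graph_axioms])
  then interpret path_conj C C' \<phi> \<psi>
    by (intro path_conj.intro path_conj_axioms.intro S.aperiodic_graph_axioms T.aperiodic_graph_axioms)
  interpret cstar_alg_iso "graph_algebra C" "graph_algebra C'" "\<lambda>X. \<Union>f\<in>X. null_rel C' `` {\<lambda>n. hom (f n)}"
    by (rule universal_iso_star_alg_iso[OF S.finite_graph_axioms T.finite_graph_axioms hom_universal_iso])
  show ?thesis using K0_iso K1_iso by blast
qed

end
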